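(* Let $n\geq 2$, $0\leq\alpha<n$, and let $m>0$ be an even integer less than $n$. Put $\beta_{\alpha,n,m}=\left(1-\frac{\alpha}{n}\right)\beta_{0}(n,m)$. Then for all $0\leq\beta\leq\beta_{\alpha,n,m}$, $$\sup_{u\in W^{m,\frac{n}{m}}(\mathbb{R}^{n}),\ \left\|(-\Delta+I)^{\frac{m}{2}}u\right\|_{\frac{n}{m}}\leq1}\ \int_{\mathbb{R}^{n}}\frac{\phi\left(\beta|u|^{\frac{n}{n-m}}\right)}{|x|^{\alpha}}\,dx<\infty,$$ where $\phi(t)=e^{t}-\sum_{j=0}^{j_{\frac{n}{m}}-2}\frac{t^{j}}{j!}$. Moreover, when $\beta>\beta_{\alpha,n,m}$, the supremum is infinite.
   Context: $\|\cdot\|_{p}$ denotes the $L^p(\mathbb{R}^n)$-norm, $\Delta$ the Laplacian and $I$ the identity operator. $j_{\frac nm}=\min\{j\in\mathbb{N}: j\geq \frac nm\}$. With $\omega_{n-1}=\frac{2\pi^{n/2}}{\Gamma(n/2)}$ the surface area of the unit sphere in $\mathbb{R}^n$, $$\beta_{0}(n,m)=\frac{n}{\omega_{n-1}}\left[\frac{\pi^{n/2}2^{m}\Gamma\left(\frac{m}{2}\right)}{\Gamma\left(\frac{n-m}{2}\right)}\right]^{\frac{n}{n-m}}.$$ *)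

theory Defs
  imports "HOL-Analysis.Analysis"
begin

section \<open>Smooth test functions and weak derivatives\<close>

definition partial_deriv :: "'a::euclidean_space \<Rightarrow> ('a \<Rightarrow> real) \<Rightarrow> 'a \<Rightarrow> real" where
  "partial_deriv b f x = frechet_derivative f (at x) b"

text \<open>A multi-index is represented by a list of basis vectors, in which each vector occurs as
  often as one differentiates in its direction; its order is the length of the list. Only lists
  over Basis are used. For smooth functions the order of the entries is irrelevant.\<close>

primrec iter_partial :: "'a::euclidean_space list \<Rightarrow> ('a \<Rightarrow> real) \<Rightarrow> 'a \<Rightarrow> real" where
  "iter_partial [] f = f"
| "iter_partial (b # bs) f = partial_deriv b (iter_partial bs f)"

primrec Ck :: "nat \<Rightarrow> ('a::euclidean_space \<Rightarrow> real) \<Rightarrow> bool" where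
  "Ck 0 f \<longleftrightarrow> continuous_on UNIV f"
| "Ck (Suc k) f \<longleftrightarrow> f differentiable_on UNIV \<and> (\<forall>b\<in>Basis. Ck k (partial_deriv b f))"

definition test_functions :: "('a::euclidean_space \<Rightarrow> real) set" where
  "test_functions = {\<psi>. (\<forall>k. Ck k \<psi>) \<and> compact (closure {x. \<psi> x \<noteq> 0})}"

definition locally_integrable :: "('a::euclidean_space \<Rightarrow> real) \<Rightarrow> bool" where
  "locally_integrable f \<longleftrightarrow> (\<forall>K. compact K \<longrightarrow> set_integrable lebesgue K f)"

definition has_weak_deriv ::
  "'a::euclidean_space list \<Rightarrow> ('a \<Rightarrow> real) \<Rightarrow> ('a \<Rightarrow> real) \<Rightarrow> bool" where
  "has_weak_deriv bs u v \<longleftrightarrow>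
     locally_integrable u \<and> locally_integrable v \<and>
     (\<forall>\<psi>\<in>test_functions.
        (\<integral>x. u x * iter_partial bs \<psi> x \<partial>lebesgue)
          = (-1) ^ length bs * (\<integral>x. v x * \<psi> x \<partial>lebesgue))"

text \<open>Weak derivatives are determined almost everywhere, so the choice below only
  selects a representative.\<close>

definition weak_deriv :: "'a::euclidean_space list \<Rightarrow> ('a \<Rightarrow> real) \<Rightarrow> 'a \<Rightarrow> real" where
  "weak_deriv bs u = (SOME v. has_weak_deriv bs u v)"

definition weak_laplacian :: "('a::euclidean_space \<Rightarrow> real) \<Rightarrow> 'a \<Rightarrow> real" where
  "weak_laplacian u x = (\<Sum>b\<in>Basis. weak_deriv [b, b] u x)"

definition neg_laplacian_plus_id :: "('a::euclidean_space \<Rightarrow> real) \<Rightarrow> 'a \<Rightarrow> real" where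
  "neg_laplacian_plus_id u x = - weak_laplacian u x + u x"


section \<open>Lebesgue and Sobolev spaces\<close>

text \<open>Elements are functions, not classes modulo almost everywhere equality.\<close>

definition Lp_space :: "real \<Rightarrow> ('a::euclidean_space \<Rightarrow> real) set" where
  "Lp_space p = {f \<in> borel_measurable lebesgue. integrable lebesgue (\<lambda>x. \<bar>f x\<bar> powr p)}"

text \<open>Only meaningful on \<open>Lp_space p\<close>: outside it the integral defaults to 0.\<close>

definition Lp_norm :: "real \<Rightarrow> ('a::euclidean_space \<Rightarrow> real) \<Rightarrow> real" where
  "Lp_norm p f = (\<integral>x. \<bar>f x\<bar> powr p \<partial>lebesgue) powr (1 / p)"

definition sobolev_space :: "nat \<Rightarrow> real \<Rightarrow> ('a::euclidean_space \<Rightarrow> real) set" where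
  "sobolev_space m p =
     {u \<in> Lp_space p. \<forall>bs. set bs \<subseteq> Basis \<and> length bs \<le> m \<longrightarrow>
                        (\<exists>v\<in>Lp_space p. has_weak_deriv bs u v)}"


section \<open>Constants and the truncated exponential\<close>

definition sphere_area :: "nat \<Rightarrow> real" where
  "sphere_area n = 2 * pi powr (real n / 2) / Gamma (real n / 2)"

definition beta0 :: "nat \<Rightarrow> nat \<Rightarrow> real" where
  "beta0 n m = real n / sphere_area n *
     (pi powr (real n / 2) * 2 ^ m * Gamma (real m / 2) / Gamma ((real n - real m) / 2))
       powr (real n / (real n - real m))"

definition beta_sing :: "real \<Rightarrow> nat \<Rightarrow> nat \<Rightarrow> real" where
  "beta_sing \<alpha> n m = (1 - \<alpha> / real n) * beta0 n m"

definition j_idx :: "nat \<Rightarrow> nat \<Rightarrow> nat" where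
  "j_idx n m = (LEAST j. real j \<ge> real n / real m)"

text \<open>For \<open>0 < m < n\<close> one has \<open>j_idx n m \<ge> 2\<close>, so the subtraction does not truncate.\<close>

definition trunc_exp :: "nat \<Rightarrow> nat \<Rightarrow> real \<Rightarrow> real" where
  "trunc_exp n m t = exp t - (\<Sum>j = 0..j_idx n m - 2. t ^ j / fact j)"


section \<open>The singular Adams functional\<close>

definition admissible :: "nat \<Rightarrow> (real ^ 'n \<Rightarrow> real) set" where
  "admissible m =
     {u \<in> sobolev_space m (real CARD('n) / real m).
        Lp_norm (real CARD('n) / real m) ((neg_laplacian_plus_id ^^ (m div 2)) u) \<le> 1}"

definition adams_integral :: "real \<Rightarrow> nat \<Rightarrow> real \<Rightarrow> (real ^ 'n \<Rightarrow> real) \<Rightarrow> ennreal" where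
  "adams_integral \<alpha> m \<beta> u =
     (\<integral>\<^sup>+ x. ennreal
        (trunc_exp CARD('n) m
           (\<beta> * \<bar>u x\<bar> powr (real CARD('n) / (real CARD('n) - real m)))
         / norm x powr \<alpha>) \<partial>lebesgue)"

end

theory Submission
  imports Defs "HOL-Probability.Probability" "HOL-Computational_Algebra.Polynomial"
begin

text \<open>Upper bound. An admissible \<open>u\<close> is the Bessel potential of
  \<open>f = (I - \<Delta>)\<^bsup>m/2\<^esup> u\<close>, and the Bessel kernel, a superposition of heat kernels, lies below the Riesz
  kernel and has integral 1. For such potentials let \<open>N s\<close> be the measure of the set where
  \<open>\<beta>\<^sub>0 \<bar>u\<bar> powr q > s\<close>. Pairing \<open>f\<close> with the average of the kernel over this set and
  applying Hoelder's inequality bounds \<open>N s\<close> by a constant multiple of \<open>exp (- s)\<close>, which is not quite enough.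
  But near-equality at one level leaves little of the norm of \<open>f\<close> for much higher levels, so the levels \<open>s\<close>
  with \<open>N s \<ge> exp (- s - L)\<close> form a set of length \<open>O(L)\<close>. Hence
  \<open>exp (\<kappa> s) N s powr \<kappa>\<close> is integrable for every \<open>\<kappa> > 0\<close>. The singular weight is absorbed by
  \<open>\<integral> norm x powr (- \<alpha>) \<le> C * (measure E) powr (1 - \<alpha>/n)\<close> over a set \<open>E\<close>.

  Sharpness. Bessel potentials of truncations of \<open>norm y powr (- m)\<close> to an annulus, smoothed by the
  heat flow, are admissible and make the functional arbitrarily large.\<close>

section \<open>Elementary inequalities and radial integrals\<close>

text \<open>The critical constant comes from one integral: over the annulus from radius \<rho> to 1,
  the Riesz kernel to the power q integrates to a multiple of ln (1 / \<rho>), and a set of measure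
  exp (- t) has radius about exp (- t / n). So the q-th power of an averaged kernel integrates to at
  most t / b0 plus a bounded error. Constants may be lost everywhere, the factor of t nowhere; this
  forces tangent expansions of (a + b) powr q in place of the triangle inequality.

  The Bessel representation is obtained without the Fourier transform. Applying I - Laplacian to a
  gamma-weighted superposition of heat kernels lowers the index of the weight by one, by the heat
  equation and integration by parts in time. Used by duality this represents every admissible
  function; used directly it evaluates the operator on the extremals. Heat kernels suit this because
  all their derivatives are products of one-variable functions dominated by heat kernels. Since the
  operator is defined by an arbitrary choice of weak derivatives, its iterates are followed only up
  to null sets.\<close>

lemma powr_le_tangent:
  fixes x a :: real
  assumes "0 \<le> x" "0 \<le> a" "a \<le> 1"
  shows "x powr a \<le> 1 + a * (x - 1)"
proof (cases "x = 0")
  case False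
  then show ?thesis
    using Youngs_inequality_0[of a "1 - a" x 1] assms by (simp add: algebra_simps)
qed (use assms in auto)

text \<open>Concavity: the tangent at 1 + \<delta> is evaluated at the end points 1 and 2, and the
  two inequalities are averaged with weights 1 - \<delta> and \<delta>.\<close>

lemma powr_ge_chord:
  fixes a \<delta> :: real
  assumes "0 \<le> \<delta>" "\<delta> \<le> 1" "0 \<le> a" "a \<le> 1"
  shows "1 + \<delta> * (2 powr a - 1) \<le> (1 + \<delta>) powr a"
proof -
  define y where "y = 1 + \<delta>"
  have y: "y > 0" using assms by (simp add: y_def)
  have t: "c powr a \<le> y powr a * (1 + a * (c / y - 1))" if "c \<ge> 0" for c
  proof -
    have "c powr a = y powr a * (c / y) powr a"
      using y that by (simp add: powr_divide)
    also have "\<dots> \<le> y powr a * (1 + a * (c / y - 1))"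
      using y that assms by (intro mult_left_mono powr_le_tangent) auto
    finally show ?thesis .
  qed
  have "(1 - \<delta>) * 1 powr a + \<delta> * 2 powr a \<le>
      (1 - \<delta>) * (y powr a * (1 + a * (1 / y - 1))) + \<delta> * (y powr a * (1 + a * (2 / y - 1)))"
    using assms by (intro add_mono mult_left_mono t) auto
  also have "\<dots> = y powr a * (1 + a * ((1 + \<delta>) / y - 1))"
    using y by (simp add: field_simps)
  also have "\<dots> = y powr a" using y by (simp add: y_def)
  finally show ?thesis by (simp add: y_def algebra_simps)
qed

text \<open>The levels \<open>w1\<close>, \<open>w2\<close> and the logarithms \<open>t1\<close>, \<open>t2\<close> of the reciprocal measures of the superlevel sets are
  tied together by the share \<open>\<theta>\<close> of the norm of \<open>f\<close> in the exceptional set.\<close>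

lemma adams_numeric:
  fixes p q C :: real
  assumes p: "p > 1" and q: "q > 1" and pq: "1/p + 1/q = 1" and C: "C \<ge> 1"
  obtains K where "K \<ge> 1"
    "\<And>L w1 w2 t1 t2 \<theta>. C \<le> L \<Longrightarrow> 0 \<le> \<theta> \<Longrightarrow> \<theta> \<le> 1 \<Longrightarrow> 0 < w1 \<Longrightarrow> w1 \<le> w2 \<Longrightarrow>
      0 \<le> t1 \<Longrightarrow> t1 \<le> t2 \<Longrightarrow> t1 \<le> w1 + L \<Longrightarrow> t2 \<le> w2 + L \<Longrightarrow> w1 \<le> t1 + C \<Longrightarrow>
      w1 powr (1/q) \<le> (1 - \<theta> powr p) powr (1/p) * (t1 + C) powr (1/q) + \<theta> * C powr (1/q) \<Longrightarrow>
      w2 powr (1/q) \<le> (t1 + C) powr (1/q) + \<theta> * (C * (t2 - t1 + 1)) powr (1/q) \<Longrightarrow>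
      w1 \<le> K * L \<or> w2 - w1 \<le> K * L"
proof -
  \<comment> \<open>\<open>Z\<close> solves z powr p / p = 3 * z, so z powr p / p <= 2 + z is
    impossible beyond it. This will bound \<theta> by a multiple of (L / w1) powr (1/p).\<close>
  define Z where "Z = (3 * p) powr (1 / (p - 1))"
  have Zp: "Z powr (p - 1) = 3 * p" using p by (simp add: Z_def powr_powr)
  have Z1: "Z \<ge> 1" unfolding Z_def using p by (intro ge_one_powr_ge_zero) auto
  have lim: "((\<lambda>K. 2 / K + 4 * Z * C * K powr (- 1/p)) \<longlongrightarrow> 2 * 0 + 4 * Z * C * 0) at_top"
  proof -
    have "((\<lambda>K::real. K powr (- 1/p)) \<longlongrightarrow> 0) at_top"
      using p by (intro tendsto_neg_powr filterlim_ident) auto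
    moreover have "((\<lambda>K::real. 2 / K) \<longlongrightarrow> 2 * 0) at_top"
      by (auto intro!: tendsto_divide_0 filterlim_ident filterlim_at_top_imp_at_infinity)
    ultimately show ?thesis by (intro tendsto_intros) auto
  qed
  \<comment> \<open>\<open>K\<close> is taken so large that the error terms of both final cases lose
    against 2 powr (1/q) - 1, the slope of the chord of x powr (1/q) from 1 to 2.\<close>
  have "(2::real) powr (1/q) > 1"
    using q by (intro gr_one_powr) auto
  then have "eventually (\<lambda>K. 2 / K + 4 * Z * C * K powr (- 1/p) < 2 powr (1/q) - 1) at_top"
    by (intro order_tendstoD(2)[OF lim]) auto
  then have "eventually (\<lambda>K. 2 / K + 4 * Z * C * K powr (- 1/p) < 2 powr (1/q) - 1 \<and> K \<ge> 3) at_top"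
    by (intro eventually_conj eventually_ge_at_top)
  then obtain K where K: "2 / K + 4 * Z * C * K powr (- 1/p) < 2 powr (1/q) - 1" "K \<ge> 3"
    by (auto simp: eventually_at_top_linorder)
  show thesis
  proof (rule that)
    show "K \<ge> 1" using K by simp
    fix L w1 w2 t1 t2 \<theta> :: real
    assume L: "C \<le> L" and th: "0 \<le> \<theta>" "\<theta> \<le> 1" and w: "0 < w1" "w1 \<le> w2"
      and t: "0 \<le> t1" "t1 \<le> t2" "t1 \<le> w1 + L" "t2 \<le> w2 + L" "w1 \<le> t1 + C"
      and i1: "w1 powr (1/q) \<le> (1 - \<theta> powr p) powr (1/p) * (t1 + C) powr (1/q) + \<theta> * C powr (1/q)"
      and i2: "w2 powr (1/q) \<le> (t1 + C) powr (1/q) + \<theta> * (C * (t2 - t1 + 1)) powr (1/q)"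
    show "w1 \<le> K * L \<or> w2 - w1 \<le> K * L"
    proof (rule ccontr)
      assume "\<not> ?thesis"
      then have n: "w1 > K * L" "w2 - w1 > K * L" by auto
      \<comment> \<open>Everything is measured in units of \<open>w1\<close>: \<open>l\<close> is
        the relative error and \<open>d\<close> the relative gap of the levels. The negated claim
        says l < 1 / K and d > K * l.\<close>
      define l where "l = L / w1"
      define W where "W = w1 powr (1/q)"
      define d where "d = (w2 - w1) / w1"
      have W: "W > 0" using w by (simp add: W_def)
      have L1: "L \<ge> 1" using L C by simp
      have l0: "l > 0" using L1 w by (simp add: l_def)
      have lK: "l < 1 / K" using n w K by (simp add: l_def field_simps)
      have q1: "0 \<le> 1/q" "1/q \<le> 1" and p1: "0 \<le> 1/p" "1/p \<le> 1" using p q by auto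
      have wl: "w1 * l = L" using w by (simp add: l_def)
      have X: "(t1 + C) powr (1/q) \<le> W * (1 + 2 * l)"
      proof -
        have "w1 * (1 + 2 * l) = w1 + 2 * L" using wl by (simp add: algebra_simps)
        then have "(t1 + C) powr (1/q) \<le> (w1 * (1 + 2 * l)) powr (1/q)"
          using t L C q1 by (intro powr_mono2) auto
        also have "\<dots> = W * (1 + 2 * l) powr (1/q)"
          using w l0 by (simp add: W_def powr_mult)
        also have "\<dots> \<le> W * (1 + 1/q * ((1 + 2 * l) - 1))"
          using W l0 q1 by (intro mult_left_mono powr_le_tangent) auto
        also have "\<dots> \<le> W * (1 + 1 * ((1 + 2 * l) - 1))"
          using W l0 q1 by (intro mult_left_mono add_mono mult_right_mono) auto
        finally show ?thesis by simp
      qed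
      have Cl: "C powr (1/q) \<le> W * l powr (1/q)"
      proof -
        have "C powr (1/q) \<le> (w1 * l) powr (1/q)"
          using L C q1 wl by (intro powr_mono2) auto
        then show ?thesis using w l0 by (simp add: W_def powr_mult)
      qed
      define T where "T = \<theta> powr p"
      have T: "0 \<le> T" "T \<le> 1" using th p by (auto simp: T_def powr_le1)
      have "(1 - T) powr (1/p) \<le> 1 - T / p"
        using powr_le_tangent[of "1 - T" "1/p"] T p1 by simp
      then have "W \<le> (1 - T / p) * (W * (1 + 2 * l)) + \<theta> * (W * l powr (1/q))"
        using i1 X Cl th T p W l0
        by (fold W_def T_def) (smt (verit, best) mult_mono mult_left_mono powr_ge_zero divide_le_eq_1)
      also have "\<dots> = W * ((1 - T / p) * (1 + 2 * l) + \<theta> * l powr (1/q))"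
        by (simp add: algebra_simps)
      finally have "1 \<le> (1 - T / p) * (1 + 2 * l) + \<theta> * l powr (1/q)"
        using W by simp
      moreover have "T / p * (2 * l) \<ge> 0" using T p l0 by simp
      \<comment> \<open>At the lower level, the share \<open>T\<close> in the exceptional set costs
        T / p on the main term, and this loss has to be covered by the errors 2 * l and \<theta> * l
        powr (1/q).\<close>
      ultimately have Tb: "T / p \<le> 2 * l + \<theta> * l powr (1/q)"
        by (simp add: algebra_simps)
      \<comment> \<open>Scaling \<theta> by l powr (1/p) leaves an inequality for \<open>z\<close>
        alone, because 1/p + 1/q = 1.\<close>
      define z where "z = \<theta> / l powr (1/p)"
      have z0: "z \<ge> 0" using th by (simp add: z_def)
      have thz: "\<theta> = z * l powr (1/p)" using l0 by (simp add: z_def)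
      have Tz: "T = z powr p * l" unfolding T_def thz using z0 l0 p by (simp add: powr_mult powr_powr)
      have "l powr (1/p) * l powr (1/q) = l" using l0 pq by (simp flip: powr_add)
      then have "\<theta> * l powr (1/q) = z * l" by (simp add: thz mult.assoc)
      then have "(z powr p / p) * l \<le> (2 + z) * l" using Tb by (simp add: Tz algebra_simps)
      then have zp: "z powr p / p \<le> 2 + z" using l0 by (simp only: mult_le_cancel_right_pos)
      have zZ: "z \<le> Z"
      proof (rule ccontr)
        assume "\<not> z \<le> Z"
        then have z: "z > Z" by simp
        have "z powr p = z powr (1 + (p - 1))" by simp
        also have "\<dots> = z powr 1 * z powr (p - 1)" by (rule powr_add)
        also have "z powr 1 = z" using z0 by simp
        finally have "z powr p = z * z powr (p - 1)" .
        moreover have "z * z powr (p - 1) > z * (3 * p)"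
          using z Z1 p powr_less_mono2[of "p - 1" Z z] Zp by (intro mult_strict_left_mono) auto
        ultimately have "z powr p / p > 3 * z" using p by (simp add: field_simps)
        then show False using zp z Z1 by simp
      qed
      have w2: "w2 = w1 * (1 + d)" using w by (simp add: d_def field_simps)
      have dl: "d > K * l" using n w by (simp add: d_def l_def divide_strict_right_mono)
      moreover have "3 * l \<le> K * l" using K l0 by (intro mult_right_mono) auto
      ultimately have d3: "d \<ge> 3 * l" by simp
      have d0: "d > 0" using d3 l0 by simp
      have D: "(C * (t2 - t1 + 1)) powr (1/q) \<le> C * W * (2 * d powr (1/q))"
      proof -
        have "t2 - t1 + 1 \<le> w1 * (d + 3 * l)"
          using t L L1 w2 wl by (simp add: algebra_simps)
        also have "\<dots> \<le> w1 * (2 * d)" using d3 w by simp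
        finally have "(C * (t2 - t1 + 1)) powr (1/q) \<le> (C * (w1 * (2 * d))) powr (1/q)"
          using C t q1 by (intro powr_mono2 mult_left_mono) auto
        also have "\<dots> = C powr (1/q) * (W * (2 powr (1/q) * d powr (1/q)))"
          using C w d0 by (simp add: W_def powr_mult)
        also have "\<dots> \<le> C * (W * (2 * d powr (1/q)))"
        proof -
          have "C powr (1/q) \<le> C" using powr_mono[of "1/q" 1 C] C q1 by simp
          moreover have "2 powr (1/q) \<le> (2::real)" using powr_mono[of "1/q" 1 "2::real"] q1 by simp
          ultimately show ?thesis using C W by (intro mult_mono mult_right_mono mult_left_mono) auto
        qed
        finally show ?thesis by (simp add: mult_ac)
      qed
      have "W * (1 + d) powr (1/q) = w2 powr (1/q)"
        using w d0 by (simp add: w2 W_def powr_mult)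
      also have "\<dots> \<le> W * (1 + 2 * l) + \<theta> * (C * W * (2 * d powr (1/q)))"
        using i2 X D th by (smt (verit) mult_left_mono)
      also have "\<dots> = W * (1 + 2 * l + \<theta> * (C * (2 * d powr (1/q))))" by (simp add: algebra_simps)
      finally have "(1 + d) powr (1/q) \<le> 1 + 2 * l + \<theta> * (C * (2 * d powr (1/q)))"
        using W by simp
      moreover have "\<theta> * (C * (2 * d powr (1/q))) \<le> Z * l powr (1/p) * (C * (2 * d powr (1/q)))"
        unfolding thz using zZ C by (intro mult_right_mono) auto
      ultimately have main: "(1 + d) powr (1/q) \<le> 1 + 2 * l + 2 * Z * C * (l powr (1/p) * d powr (1/q))"
        by (simp add: algebra_simps)
      show False
      \<comment> \<open>For a small gap the concave left side is bounded below by its chord and d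
        cancels; for a large one all terms are compared with multiples of ((1 + d) / 2) powr
        (1/q).\<close>
      proof (cases "d \<le> 1")
        case True
        have "l \<le> d / K" using dl K by (simp add: field_simps)
        have "l powr (1/p) \<le> (d / K) powr (1/p)"
          using \<open>l \<le> d / K\<close> l0 p1 by (intro powr_mono2) auto
        also have "\<dots> = d powr (1/p) * K powr (- 1/p)"
          using d0 K by (simp add: powr_divide powr_minus_divide)
        finally have "l powr (1/p) * d powr (1/q) \<le> d powr (1/p) * K powr (- 1/p) * d powr (1/q)"
          by (rule mult_right_mono) auto
        also have "\<dots> = (d powr (1/p) * d powr (1/q)) * K powr (- 1/p)" by (simp add: mult_ac)
        also have "d powr (1/p) * d powr (1/q) = d" using d0 pq by (simp flip: powr_add)
        finally have *: "l powr (1/p) * d powr (1/q) \<le> d * K powr (- 1/p)" .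
        have "1 + d * (2 powr (1/q) - 1) \<le> (1 + d) powr (1/q)"
          using True d0 q1 by (intro powr_ge_chord) auto
        also have "\<dots> \<le> 1 + 2 * l + 2 * Z * C * (l powr (1/p) * d powr (1/q))" by (rule main)
        also have "\<dots> \<le> 1 + 2 * (d / K) + 2 * Z * C * (d * K powr (- 1/p))"
          using * \<open>l \<le> d / K\<close> Z1 C by (intro add_mono mult_left_mono) auto
        also have "\<dots> = 1 + d * (2 / K + 2 * Z * C * K powr (- 1/p))" by (simp add: algebra_simps)
        also have "\<dots> < 1 + d * (2 powr (1/q) - 1)"
          using K(1) d0 Z1 C
          by (intro add_strict_left_mono mult_strict_left_mono)
            (smt (verit) mult_nonneg_nonneg mult_right_mono powr_ge_zero)+
        finally show False by simp
      next
        case False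
        define s where "s = ((1 + d) / 2) powr (1/q)"
        have s1: "s \<ge> 1" unfolding s_def using False q1 by (intro ge_one_powr_ge_zero) auto
        have s2: "(1 + d) powr (1/q) = 2 powr (1/q) * s" using d0 by (simp add: s_def powr_divide)
        have two: "2 powr (1/q) \<le> (2::real)" using powr_mono[of "1/q" 1 "2::real"] q1 by simp
        have "d powr (1/q) \<le> (1 + d) powr (1/q)" using d0 q1 by (intro powr_mono2) auto
        also have "\<dots> \<le> 2 * s" using s2 two s1 by simp
        finally have ds: "d powr (1/q) \<le> 2 * s" .
        have lp: "l powr (1/p) \<le> K powr (- 1/p)"
        proof -
          have "l powr (1/p) \<le> (1 / K) powr (1/p)" using lK l0 p1 by (intro powr_mono2) auto
          then show ?thesis using K by (simp add: powr_divide powr_minus_divide)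
        qed
        have "2 powr (1/q) * s \<le> 1 + 2 * l + 2 * Z * C * (l powr (1/p) * d powr (1/q))"
          using main s2 by simp
        also have "\<dots> \<le> 1 + 2 * (1/K) + 2 * Z * C * (K powr (- 1/p) * (2 * s))"
          using lp ds lK Z1 C s1 by (intro add_mono mult_left_mono mult_mono) auto
        also have "\<dots> \<le> s + 2 / K * s + 4 * Z * C * K powr (- 1/p) * s"
          using s1 K mult_left_mono[of 1 s "2 / K"] by simp
        also have "\<dots> = (1 + (2 / K + 4 * Z * C * K powr (- 1/p))) * s" by (simp add: algebra_simps)
        also have "\<dots> < 2 powr (1/q) * s"
          using K(1) s1 by (intro mult_strict_right_mono) auto
        finally show False by simp
      qed
    qed
  qed
qed

section \<open>Hoelder's inequality and integration in polar coordinates\<close>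

lemma powr_young_scaled:
  fixes a b A B p q :: real
  assumes p: "p > 1" and q: "q > 1" and pq: "1/p + 1/q = 1"
    and ab: "a \<ge> 0" "b \<ge> 0" and AB: "A > 0" "B > 0"
  shows "a * b \<le> A powr (1/p) * B powr (1/q) * (a powr p / (p * A) + b powr q / (q * B))"
proof -
  define x y where "x = a / A powr (1/p)" and "y = b / B powr (1/q)"
  have "x * y \<le> x powr p / p + y powr q / q"
    by (rule Youngs_inequality[OF p q pq]) (use ab in \<open>auto simp: x_def y_def\<close>)
  then have *: "x * y \<le> a powr p / (p * A) + b powr q / (q * B)"
    using ab AB p q by (simp add: x_def y_def powr_divide powr_powr mult_ac)
  have "a * b = A powr (1/p) * B powr (1/q) * (x * y)"
    using AB by (simp add: x_def y_def)
  also have "\<dots> \<le> A powr (1/p) * B powr (1/q) * (a powr p / (p * A) + b powr q / (q * B))"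
    by (intro mult_left_mono *) auto
  finally show ?thesis .
qed

text \<open>Young's inequality, scaled by the two bounds and integrated. Since \<open>A\<close> and
  \<open>B\<close> may be 0, the scaling uses larger numbers \<open>A'\<close> and
  \<open>B'\<close>, which then tend to them.\<close>

lemma nn_integral_Holder:
  fixes f g :: "'b \<Rightarrow> real"
  assumes p: "p > 1" and q: "q > 1" and pq: "1/p + 1/q = 1"
    and [measurable]: "f \<in> borel_measurable M" "g \<in> borel_measurable M"
    and f0: "\<And>x. f x \<ge> 0" and g0: "\<And>x. g x \<ge> 0"
    and A: "(\<integral>\<^sup>+x. ennreal (f x powr p) \<partial>M) \<le> ennreal A" "A \<ge> 0"
    and B: "(\<integral>\<^sup>+x. ennreal (g x powr q) \<partial>M) \<le> ennreal B" "B \<ge> 0"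
  shows "(\<integral>\<^sup>+x. ennreal (f x * g x) \<partial>M) \<le> ennreal (A powr (1/p) * B powr (1/q))"
proof -
  have *: "(\<integral>\<^sup>+x. ennreal (f x * g x) \<partial>M) \<le> ennreal (A' powr (1/p) * B' powr (1/q))"
    if "A' > A" "B' > B" for A' B'
  proof -
    have pos: "A' > 0" "B' > 0" using that A B by auto
    let ?c = "A' powr (1/p) * B' powr (1/q)"
    have "(\<integral>\<^sup>+x. ennreal (f x * g x) \<partial>M) \<le>
      (\<integral>\<^sup>+x. ennreal ?c * (ennreal (1 / (p * A')) * ennreal (f x powr p) + ennreal (1 / (q * B')) * ennreal (g x powr q)) \<partial>M)"
      using powr_young_scaled[OF p q pq f0 g0 pos] p q pos
      by (intro nn_integral_mono) (simp flip: ennreal_mult ennreal_plus)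
    also have "\<dots> = ennreal ?c * (ennreal (1 / (p * A')) * (\<integral>\<^sup>+x. ennreal (f x powr p) \<partial>M)
         + ennreal (1 / (q * B')) * (\<integral>\<^sup>+x. ennreal (g x powr q) \<partial>M))"
      by (subst nn_integral_cmult, simp, subst nn_integral_add, simp, simp,
          subst nn_integral_cmult, simp, subst nn_integral_cmult, simp, simp)
    also have "\<dots> \<le> ennreal ?c * (ennreal (1 / (p * A')) * ennreal A'
         + ennreal (1 / (q * B')) * ennreal B')"
      using that A B by (intro mult_left_mono add_mono order_trans[OF A(1)] order_trans[OF B(1)] ennreal_leI) auto
    also have "\<dots> = ennreal (?c * (1/p + 1/q))"
      using pos p q by (simp flip: ennreal_mult ennreal_plus)
    finally show ?thesis using pq by simp
  qed
  have lim: "((\<lambda>e. ennreal ((A + e) powr (1/p) * (B + e) powr (1/q))) \<longlongrightarrow>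
      ennreal ((A + 0) powr (1/p) * (B + 0) powr (1/q))) (at_right 0)"
    using A(2) B(2) p q
    by (intro tendsto_ennrealI tendsto_mult tendsto_powr' tendsto_intros) (auto simp: eventually_at_filter)
  show ?thesis
    using tendsto_lowerbound[OF lim, of "\<integral>\<^sup>+x. ennreal (f x * g x) \<partial>M"] *
    by (auto simp: eventually_at_filter)
qed

lemma nn_integral_lborel_reflect:
  fixes F :: "'a::euclidean_space \<Rightarrow> ennreal"
  assumes [measurable]: "F \<in> borel_measurable borel"
  shows "(\<integral>\<^sup>+y. F (x - y) \<partial>lborel) = (\<integral>\<^sup>+y. F y \<partial>lborel)"
  by (subst (2) lborel_affine[of "-1" x]) (auto simp: nn_integral_density nn_integral_distr)

lemma nn_integral_lborel_translate:
  fixes F :: "'a::euclidean_space \<Rightarrow> ennreal"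
  assumes [measurable]: "F \<in> borel_measurable borel"
  shows "(\<integral>\<^sup>+y. F (y - x) \<partial>lborel) = (\<integral>\<^sup>+y. F y \<partial>lborel)"
  by (subst (2) lborel_affine[of 1 "- x"]) (auto simp: nn_integral_density nn_integral_distr)

text \<open>Polar coordinates for radial functions without a surface measure: the image measure is
  identified by its values on half-lines, that is by the volumes of balls.\<close>

lemma distr_norm_lborel:
  "distr lborel borel (norm :: 'a::euclidean_space \<Rightarrow> real) =
     density lborel (\<lambda>r. ennreal (indicator {0<..} r * (real DIM('a) * unit_ball_vol (real DIM('a)) * r ^ (DIM('a) - 1))))"
    (is "?L = ?R")
proof -
  let ?n = "DIM('a)" and ?V = "unit_ball_vol (real DIM('a))"
  have V: "?V \<ge> 0" by simp
  have L: "emeasure ?L {..a} = ennreal (indicator {0..} a * (?V * a ^ ?n))" for a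
  proof -
    have "emeasure ?L {..a} = emeasure lborel (cball (0::'a) a)"
      by (subst emeasure_distr) (auto intro!: arg_cong[where f = "emeasure lborel"])
    also have "\<dots> = ennreal (indicator {0..} a * (?V * a ^ ?n))"
      by (cases "a \<ge> 0") (simp_all add: emeasure_cball)
    finally show ?thesis .
  qed
  have R: "emeasure ?R {..a} = ennreal (indicator {0..} a * (?V * a ^ ?n))" for a
  proof (cases "a \<ge> 0")
    case True
    have "emeasure ?R {..a} = (\<integral>\<^sup>+r. ennreal (real ?n * ?V * r ^ (?n - 1)) * indicator {0..a} r \<partial>lborel)"
      using AE_lborel_singleton[of "0::real"]
      by (subst emeasure_density)
        (auto intro!: nn_integral_cong_AE elim!: eventually_mono split: split_indicator)
    also have "\<dots> = ennreal (?V * a ^ ?n - ?V * 0 ^ ?n)"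
      using True V by (intro nn_integral_FTC_Icc) (auto intro!: derivative_eq_intros)
    finally show ?thesis using True by simp
  next
    case False
    have "emeasure ?R {..a} = (\<integral>\<^sup>+r. ennreal (indicator {0<..} r * (real ?n * ?V * r ^ (?n - 1))) * indicator {..a} r \<partial>lborel)"
      by (rule emeasure_density) auto
    also have "\<dots> = (\<integral>\<^sup>+r. 0 \<partial>(lborel::real measure))"
      using False by (intro nn_integral_cong) (auto split: split_indicator)
    finally show ?thesis using False by simp
  qed
  show ?thesis
  proof (rule measure_eqI_generator_eq[where E = "range (\<lambda>a::real. {..a})" and \<Omega> = UNIV
          and A = "\<lambda>i. {..real i}"])
    show "Int_stable (range (\<lambda>a::real. {..a}))"
      by (auto simp: Int_stable_def)
    show "sets ?L = sigma_sets UNIV (range atMost)" "sets ?R = sigma_sets UNIV (range atMost)"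
      using arg_cong[OF borel_eq_atMost[where 'a = real], of sets] by simp_all
    show "(\<Union>i. {..real i}) = UNIV" by (auto intro: real_arch_simple)
    show "emeasure ?L {..real i} \<noteq> \<infinity>" for i by (simp add: L)
    show "emeasure ?L X = emeasure ?R X" if "X \<in> range atMost" for X
      using that by (elim imageE) (simp only: L R)
  qed auto
qed

lemma nn_integral_radial:
  fixes h :: "real \<Rightarrow> ennreal"
  assumes [measurable]: "h \<in> borel_measurable borel"
  shows "(\<integral>\<^sup>+x. h (norm (x::'a::euclidean_space)) \<partial>lborel) =
    (\<integral>\<^sup>+r. ennreal (indicator {0<..} r * (real DIM('a) * unit_ball_vol (real DIM('a)) * r ^ (DIM('a) - 1))) * h r \<partial>lborel)"
proof -
  have "(\<integral>\<^sup>+x. h (norm (x::'a)) \<partial>lborel) = (\<integral>\<^sup>+r. h r \<partial>distr lborel borel (norm :: 'a \<Rightarrow> real))"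
    by (simp add: nn_integral_distr)
  then show ?thesis
    by (simp add: distr_norm_lborel nn_integral_density)
qed

text \<open>The borderline power: the Riesz kernel of order m, raised to n / (n - m), is a multiple
  of norm x powr (- n). This logarithm is the source of the critical exponent.\<close>

lemma nn_integral_norm_annulus:
  assumes "0 < a" "a \<le> b"
  shows "(\<integral>\<^sup>+x. ennreal (norm (x::'a::euclidean_space) powr (- real DIM('a))) * indicator {x. a \<le> norm x \<and> norm x < b} x \<partial>lborel) =
    ennreal (real DIM('a) * unit_ball_vol (real DIM('a)) * ln (b / a))"
proof -
  let ?n = "DIM('a)" and ?V = "unit_ball_vol (real DIM('a))"
  have V: "?V \<ge> 0" by simp
  have "(\<integral>\<^sup>+x. ennreal (norm (x::'a) powr (- real ?n)) * indicator {x. a \<le> norm x \<and> norm x < b} x \<partial>lborel) =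
    (\<integral>\<^sup>+x. ennreal (norm (x::'a) powr (- real ?n)) * indicator {a..<b} (norm x) \<partial>lborel)"
    by (intro nn_integral_cong) (auto split: split_indicator)
  also have "\<dots> = (\<integral>\<^sup>+r. ennreal (indicator {0<..} r * (real ?n * ?V * r ^ (?n - 1))) *
      (ennreal (r powr (- real ?n)) * indicator {a..<b} r) \<partial>lborel)"
    by (rule nn_integral_radial) measurable
  also have "\<dots> = (\<integral>\<^sup>+r. ennreal (real ?n * ?V / r) * indicator {a..b} r \<partial>lborel)"
  proof (intro nn_integral_cong_AE)
    show "AE r in lborel. ennreal (indicator {0<..} r * (real ?n * ?V * r ^ (?n - 1))) *
      (ennreal (r powr (- real ?n)) * indicator {a..<b} r) = ennreal (real ?n * ?V / r) * indicator {a..b} r"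
      using AE_lborel_singleton[of b]
    proof eventually_elim
      case (elim r)
      have "r ^ (?n - 1) * r powr (- real ?n) = 1 / r" if "r > 0"
        using that DIM_positive[where 'a = 'a]
        by (simp add: of_nat_diff flip: powr_realpow powr_add powr_minus_divide)
      then show ?case using elim assms V
        by (auto split: split_indicator simp: mult.assoc simp flip: ennreal_mult)
    qed
  qed
  also have "\<dots> = ennreal (real ?n * ?V * ln b - real ?n * ?V * ln a)"
    using assms V by (intro nn_integral_FTC_Icc) (auto intro!: derivative_eq_intros simp: field_simps)
  also have "\<dots> = ennreal (real ?n * ?V * ln (b / a))"
    using assms by (simp add: ln_div algebra_simps)
  finally show ?thesis .
qed

lemma nn_integral_norm_powr_ball:
  assumes "0 < s" "0 \<le> \<rho>"
  shows "(\<integral>\<^sup>+x. ennreal (norm (x::'a::euclidean_space) powr (s - real DIM('a))) * indicator {x. norm x < \<rho>} x \<partial>lborel) =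
    ennreal (real DIM('a) * unit_ball_vol (real DIM('a)) / s * \<rho> powr s)"
proof -
  let ?n = "DIM('a)" and ?V = "unit_ball_vol (real DIM('a))"
  have V: "?V \<ge> 0" by simp
  have "(\<integral>\<^sup>+x. ennreal (norm (x::'a) powr (s - real ?n)) * indicator {x. norm x < \<rho>} x \<partial>lborel) =
    (\<integral>\<^sup>+x. ennreal (norm (x::'a) powr (s - real ?n)) * indicator {..<\<rho>} (norm x) \<partial>lborel)"
    by (intro nn_integral_cong) (auto split: split_indicator)
  also have "\<dots> = (\<integral>\<^sup>+r. ennreal (indicator {0<..} r * (real ?n * ?V * r ^ (?n - 1))) *
      (ennreal (r powr (s - real ?n)) * indicator {..<\<rho>} r) \<partial>lborel)"
    by (rule nn_integral_radial) measurable
  also have "\<dots> = (\<integral>\<^sup>+r. ennreal (real ?n * ?V) * (ennreal (r powr (s - 1)) * indicator {0..\<rho>} r) \<partial>lborel)"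
  proof (intro nn_integral_cong_AE)
    show "AE r in lborel. ennreal (indicator {0<..} r * (real ?n * ?V * r ^ (?n - 1))) *
      (ennreal (r powr (s - real ?n)) * indicator {..<\<rho>} r) = ennreal (real ?n * ?V) * (ennreal (r powr (s - 1)) * indicator {0..\<rho>} r)"
      using AE_lborel_singleton[of \<rho>] AE_lborel_singleton[of 0]
    proof eventually_elim
      case (elim r)
      have "r ^ (?n - 1) * r powr (s - real ?n) = r powr (s - 1)" if "r > 0"
        using that DIM_positive[where 'a = 'a]
        by (simp add: of_nat_diff flip: powr_realpow powr_add)
      then show ?case using elim assms V
        by (auto split: split_indicator simp: mult.assoc simp flip: ennreal_mult)
    qed
  qed
  also have "\<dots> = ennreal (real ?n * ?V) * (\<integral>\<^sup>+r. ennreal (r powr (s - 1)) * indicator {0..\<rho>} r \<partial>lborel)"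
    by (rule nn_integral_cmult) measurable
  also have "(\<integral>\<^sup>+r. ennreal (r powr (s - 1)) * indicator {0..\<rho>} r \<partial>lborel) = ennreal (\<rho> powr s / s)"
  proof -
    have "((\<lambda>r. r powr (s - 1)) has_integral (\<rho> powr (s - 1 + 1) / (s - 1 + 1))) {0..\<rho>}"
      using assms by (intro has_integral_powr_from_0) auto
    then have "((\<lambda>r. if r \<in> {0..\<rho>} then r powr (s - 1) else 0) has_integral \<rho> powr s / s) UNIV"
      by (subst has_integral_restrict_UNIV) simp
    then have "(\<integral>\<^sup>+r. ennreal (if r \<in> {0..\<rho>} then r powr (s - 1) else 0) \<partial>lborel) = ennreal (\<rho> powr s / s)"
      by (intro nn_integral_has_integral_lborel) auto
    moreover have "(\<integral>\<^sup>+r. ennreal (r powr (s - 1)) * indicator {0..\<rho>} r \<partial>lborel) =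
        (\<integral>\<^sup>+r. ennreal (if r \<in> {0..\<rho>} then r powr (s - 1) else 0) \<partial>lborel)"
      by (intro nn_integral_cong) (auto split: split_indicator)
    ultimately show ?thesis by simp
  qed
  finally show ?thesis using V assms by (simp add: mult_ac flip: ennreal_mult)
qed

section \<open>Convexity of powers\<close>

lemma powr_ge_tangent:
  fixes x q :: real
  assumes "0 \<le> x" "1 \<le> q"
  shows "1 + q * (x - 1) \<le> x powr q"
  using powr_le_tangent[of "x powr q" "1/q"] assms by (simp add: powr_powr field_simps)

text \<open>The tangent of x powr q at a + b. The first summand keeps the coefficient 1, on which
  the sharp constant depends, and the error is linear in b.\<close>

lemma powr_add_le:
  fixes a b q :: real
  assumes "0 \<le> a" "0 \<le> b" "1 \<le> q"
  shows "(a + b) powr q \<le> a powr q + q * b * (a + b) powr (q - 1)"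
proof (cases "a + b = 0")
  case False
  define c where "c = a + b"
  have c: "c > 0" using False assms by (auto simp: c_def)
  have "c powr q * (1 + q * (a / c - 1)) \<le> c powr q * (a / c) powr q"
    using c assms by (intro mult_left_mono powr_ge_tangent) auto
  also have "\<dots> = a powr q" using c assms by (simp add: powr_divide)
  finally have "c powr q \<le> a powr q + q * ((c - a) / c * c powr q)"
    using c by (simp add: field_simps)
  also have "(c - a) / c * c powr q = b * c powr (q - 1)"
    using c by (simp add: c_def powr_diff)
  finally show ?thesis by (simp only: c_def mult.assoc)
qed (use assms in auto)

text \<open>Integrates the tangent of x powr q at the mean a; the right side may be
  infinite.\<close>

lemma (in prob_space) nn_integral_powr_Jensen:
  fixes f :: "'a \<Rightarrow> real"
  assumes [measurable]: "f \<in> borel_measurable M" and f0: "\<And>x. f x \<ge> 0"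
    and fin: "(\<integral>\<^sup>+x. ennreal (f x) \<partial>M) = ennreal a" and a: "a \<ge> 0" and q: "q \<ge> 1"
  shows "ennreal (a powr q) \<le> (\<integral>\<^sup>+x. ennreal (f x powr q) \<partial>M)"
proof (cases "a = 0")
  case False
  then have a: "a > 0" using a by simp
  have *: "q * a powr (q - 1) * y \<le> y powr q + (q - 1) * a powr q" if "y \<ge> 0" for y
  proof -
    have "a powr q * (1 + q * (y / a - 1)) \<le> a powr q * (y / a) powr q"
      using a that q by (intro mult_left_mono powr_ge_tangent) auto
    also have "\<dots> = y powr q" using a that by (simp add: powr_divide)
    finally show ?thesis using a by (simp add: powr_diff field_simps)
  qed
  have "ennreal (q * a powr (q - 1)) * ennreal a = (\<integral>\<^sup>+x. ennreal (q * a powr (q - 1)) * ennreal (f x) \<partial>M)"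
    by (simp add: nn_integral_cmult fin)
  also have "\<dots> \<le> (\<integral>\<^sup>+x. ennreal (f x powr q) + ennreal ((q - 1) * a powr q) \<partial>M)"
    using * f0 q a by (intro nn_integral_mono) (simp flip: ennreal_mult ennreal_plus)
  also have "\<dots> = (\<integral>\<^sup>+x. ennreal (f x powr q) \<partial>M) + ennreal ((q - 1) * a powr q)"
    by (simp add: nn_integral_add emeasure_space_1)
  finally have "ennreal (q * a powr q) \<le> (\<integral>\<^sup>+x. ennreal (f x powr q) \<partial>M) + ennreal ((q - 1) * a powr q)"
    using a q by (simp add: powr_diff flip: ennreal_mult)
  moreover have "ennreal (q * a powr q) = ennreal (a powr q) + ennreal ((q - 1) * a powr q)"
    using q by (subst ennreal_plus[symmetric]) (auto simp: algebra_simps mult_right_mono[of 1 q, simplified])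
  ultimately show ?thesis by (simp add: ennreal_add_left_cancel_le add.commute)
qed (use q in auto)

section \<open>Exponential integrability of potentials\<close>

text \<open>What the exponential integrability uses of the Bessel kernel: comparison with the Riesz
  kernel, decisive near 0, and integral at most 1, which stands in for the decay at infinity that
  the Riesz kernel does not have.\<close>

locale riesz_dominated =
  fixes g :: "'a::euclidean_space \<Rightarrow> real" and m n \<gamma> :: real
  assumes g_meas [measurable]: "g \<in> borel_measurable borel"
    and g_nonneg: "\<And>z. 0 \<le> g z"
    and n_eq: "n = real DIM('a)"
    and g_le: "\<And>z. z \<noteq> 0 \<Longrightarrow> g z \<le> \<gamma> * norm z powr (m - n)"
    and g_int: "(\<integral>\<^sup>+z. ennreal (g z) \<partial>lborel) \<le> 1"
    and \<gamma>_pos: "0 < \<gamma>" and m_pos: "0 < m" and m_less: "m < n"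
begin

abbreviation V :: real where "V \<equiv> unit_ball_vol n"

lemmas annulus_int = nn_integral_norm_annulus[where 'a = 'a, folded n_eq]
lemmas ball_int = nn_integral_norm_powr_ball[where 'a = 'a, folded n_eq]

definition p :: real where "p = n / m"
definition q :: real where "q = n / (n - m)"
text \<open>For \<gamma> the Riesz constant this is \<open>beta0\<close>, by
  \<open>beta0_eq\<close>. The logarithm in \<open>annulus_int\<close>, multiplied by \<gamma> powr
  q, has the coefficient n / b0.\<close>

definition b0 :: real where "b0 = 1 / (V * \<gamma> powr q)"
definition c1 :: real where "c1 = \<gamma> * (n * V / m)"

lemma p_gt1: "p > 1" and q_gt1: "q > 1" and pq: "1/p + 1/q = 1"
  using m_pos m_less by (auto simp: p_def q_def field_simps)

lemma mq: "(m - n) * q = - n" "(m - n) * (q - 1) = - m"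
  using m_pos m_less by (auto simp: q_def field_simps)

lemma n_pos: "n > 0" using m_pos m_less by simp

lemma V_pos: "V > 0" using n_pos by simp

lemma b0_pos: "b0 > 0" and c1_pos: "c1 > 0"
  using \<gamma>_pos m_pos V_pos n_pos by (auto simp: b0_def c1_def intro!: divide_pos_pos mult_pos_pos)

section \<open>Averages of the kernel over sets of finite measure\<close>

definition avg :: "'a set \<Rightarrow> ('a \<Rightarrow> real) \<Rightarrow> 'a \<Rightarrow> real" where
  "avg E h y = enn2real (\<integral>\<^sup>+x. ennreal (h (x - y)) \<partial>uniform_measure lborel E)"

text \<open>Covers the pieces of the kernel cut out by radii. Domination by \<open>g\<close> gives
  them finite integral, so that \<open>enn2real\<close> in their averages loses nothing.\<close>

definition subkernel :: "('a \<Rightarrow> real) \<Rightarrow> bool" where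
  "subkernel h \<longleftrightarrow> h \<in> borel_measurable borel \<and> (\<forall>z. 0 \<le> h z \<and> h z \<le> g z)"

definition fat :: "'a set \<Rightarrow> bool" where
  "fat E \<longleftrightarrow> E \<in> sets borel \<and> emeasure lborel E \<noteq> 0 \<and> emeasure lborel E \<noteq> \<infinity>"

lemma fat_prob: "fat E \<Longrightarrow> prob_space (uniform_measure lborel E)"
  by (auto simp: fat_def intro!: prob_space_uniform_measure)

lemma avg_nonneg: "avg E h y \<ge> 0" by (simp add: avg_def)

lemma ennreal_avg:
  assumes "fat E" "subkernel h"
  shows "ennreal (avg E h y) = (\<integral>\<^sup>+x. ennreal (h (x - y)) * indicator E x \<partial>lborel) / emeasure lborel E"
    and "ennreal (avg E h y) = (\<integral>\<^sup>+x. ennreal (h (x - y)) \<partial>uniform_measure lborel E)"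
    and "avg E h \<in> borel_measurable borel"
proof -
  have [measurable]: "E \<in> sets borel" "h \<in> borel_measurable borel"
    using assms by (auto simp: fat_def subkernel_def)
  have eq: "(\<integral>\<^sup>+x. ennreal (h (x - y)) \<partial>uniform_measure lborel E) =
    (\<integral>\<^sup>+x. ennreal (h (x - y)) * indicator E x \<partial>lborel) / emeasure lborel E" for y
    by (subst nn_integral_uniform_measure) auto
  have "(\<integral>\<^sup>+x. ennreal (h (x - y)) * indicator E x \<partial>lborel) \<le> (\<integral>\<^sup>+x. ennreal (g (x - y)) \<partial>lborel)" for y
    using assms by (intro nn_integral_mono) (auto simp: subkernel_def split: split_indicator intro!: ennreal_leI)
  also have "\<dots> y \<le> 1" for y
    using g_int by (subst nn_integral_lborel_translate) auto
  finally have lt: "(\<integral>\<^sup>+x. ennreal (h (x - y)) * indicator E x \<partial>lborel) < \<top>" for y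
    by (rule order_le_less_trans) simp
  have fin: "(\<integral>\<^sup>+x. ennreal (h (x - y)) * indicator E x \<partial>lborel) / emeasure lborel E < \<top>" for y
    using assms lt[of y] by (auto simp: fat_def ennreal_divide_eq_top_iff less_top[symmetric])
  then show "ennreal (avg E h y) = (\<integral>\<^sup>+x. ennreal (h (x - y)) * indicator E x \<partial>lborel) / emeasure lborel E"
    "ennreal (avg E h y) = (\<integral>\<^sup>+x. ennreal (h (x - y)) \<partial>uniform_measure lborel E)"
    unfolding avg_def eq by (simp_all add: ennreal_enn2real)
  show "avg E h \<in> borel_measurable borel"
    unfolding avg_def eq by measurable
qed

lemma avg_bound:
  assumes "fat E" "subkernel h" "\<And>z. h z \<le> c" "c \<ge> 0"
  shows "avg E h y \<le> c"
proof -
  interpret prob_space "uniform_measure lborel E" using fat_prob assms by simp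
  have "ennreal (avg E h y) \<le> (\<integral>\<^sup>+x. ennreal c \<partial>uniform_measure lborel E)"
    unfolding ennreal_avg(2)[OF assms(1,2)] using assms by (intro nn_integral_mono ennreal_leI) auto
  also have "\<dots> = ennreal c" using emeasure_space_1 by simp
  finally show ?thesis using assms by simp
qed

lemma avg_bound_int:
  assumes "fat E" "subkernel h" "(\<integral>\<^sup>+z. ennreal (h z) \<partial>lborel) \<le> ennreal c"
    "emeasure lborel E = ennreal r" "r > 0" "c \<ge> 0"
  shows "avg E h y \<le> c / r"
proof -
  have [measurable]: "h \<in> borel_measurable borel"
    using assms by (auto simp: subkernel_def)
  have "(\<integral>\<^sup>+x. ennreal (h (x - y)) * indicator E x \<partial>lborel) \<le> (\<integral>\<^sup>+x. ennreal (h (x - y)) \<partial>lborel)"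
    by (intro nn_integral_mono) (auto split: split_indicator)
  also have "\<dots> \<le> ennreal c" using assms(3) by (subst nn_integral_lborel_translate) auto
  finally have "ennreal (avg E h y) \<le> ennreal c / ennreal r"
    unfolding ennreal_avg(1)[OF assms(1,2)] assms(4) by (rule divide_right_mono_ennreal)
  then show ?thesis using assms by (simp add: divide_ennreal)
qed

lemma avg_add:
  assumes "fat E" "subkernel h1" "subkernel h2" "subkernel h" "\<And>z. h z = h1 z + h2 z"
  shows "avg E h y = avg E h1 y + avg E h2 y"
proof -
  have [measurable]: "h1 \<in> borel_measurable borel" "h2 \<in> borel_measurable borel" "E \<in> sets borel"
    using assms by (auto simp: subkernel_def fat_def)
  have "ennreal (avg E h y) = ennreal (avg E h1 y + avg E h2 y)"
    unfolding ennreal_plus[OF avg_nonneg avg_nonneg] ennreal_avg(2)[OF assms(1,2)] ennreal_avg(2)[OF assms(1,3)]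
      ennreal_avg(2)[OF assms(1,4)] assms(5)
    using assms(2,3) by (subst nn_integral_add[symmetric]) (auto simp: subkernel_def ennreal_plus)
  then show ?thesis by (simp add: avg_nonneg del: ennreal_plus)
qed

text \<open>Averaging over translates does not increase a norm: Jensen's inequality inside, then
  Fubini and invariance under reflection.\<close>

lemma nn_integral_avg_powr:
  assumes "fat E" "subkernel h" "s \<ge> 1"
  shows "(\<integral>\<^sup>+y. ennreal (avg E h y powr s) \<partial>lborel) \<le> (\<integral>\<^sup>+z. ennreal (h z powr s) \<partial>lborel)"
proof -
  interpret prob_space "uniform_measure lborel E" using fat_prob assms by simp
  have [measurable]: "h \<in> borel_measurable borel" "E \<in> sets borel"
    using assms by (auto simp: subkernel_def fat_def)
  have h0: "h z \<ge> 0" for z using assms by (auto simp: subkernel_def)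
  have "(\<integral>\<^sup>+y. ennreal (avg E h y powr s) \<partial>lborel) \<le>
    (\<integral>\<^sup>+y. \<integral>\<^sup>+x. ennreal (h (x - y) powr s) \<partial>uniform_measure lborel E \<partial>lborel)"
    by (intro nn_integral_mono nn_integral_powr_Jensen)
      (use assms h0 in \<open>auto simp: ennreal_avg(2)[OF assms(1,2)] avg_nonneg\<close>)
  also have "\<dots> = (\<integral>\<^sup>+x. \<integral>\<^sup>+y. ennreal (h (x - y) powr s) \<partial>lborel \<partial>uniform_measure lborel E)"
  proof -
    interpret pair_sigma_finite "uniform_measure lborel E" "lborel :: 'a measure" ..
    show ?thesis by (rule Fubini') simp
  qed
  also have "\<dots> = (\<integral>\<^sup>+z. ennreal (h z powr s) \<partial>lborel)"
    using emeasure_space_1 by (subst nn_integral_lborel_reflect) auto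
  finally show ?thesis .
qed

text \<open>The first part enters by its q-norm with constant 1. The second is controlled only in
  the 1-norm, and the pointwise bound \<open>M\<close> on \<open>S\<close> turns it into an additive
  error.\<close>

lemma nn_integral_avg_sum_powr:
  assumes E: "fat E" and h: "subkernel h1" "subkernel h2" and S [measurable]: "S \<in> sets borel"
    and M: "\<And>y. y \<in> S \<Longrightarrow> avg E h1 y + avg E h2 y \<le> M"
    and A: "(\<integral>\<^sup>+z. ennreal (h1 z powr q) \<partial>lborel) \<le> ennreal A"
    and B: "(\<integral>\<^sup>+z. ennreal (h2 z) \<partial>lborel) \<le> ennreal B" and nn: "0 \<le> A" "0 \<le> B" "0 \<le> M"
  shows "(\<integral>\<^sup>+y. ennreal ((avg E h1 y + avg E h2 y) powr q) * indicator S y \<partial>lborel) \<le>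
     ennreal (A + q * M powr (q - 1) * B)"
proof -
  note [measurable] = ennreal_avg(3)[OF E h(1)] ennreal_avg(3)[OF E h(2)]
  have pw: "(avg E h1 y + avg E h2 y) powr q \<le> avg E h1 y powr q + q * M powr (q - 1) * avg E h2 y"
    if "y \<in> S" for y
  proof -
    have "(avg E h1 y + avg E h2 y) powr q \<le>
      avg E h1 y powr q + q * avg E h2 y * (avg E h1 y + avg E h2 y) powr (q - 1)"
      using q_gt1 by (intro powr_add_le avg_nonneg) auto
    also have "\<dots> \<le> avg E h1 y powr q + q * avg E h2 y * M powr (q - 1)"
      using q_gt1 M[OF that] avg_nonneg[of E h1 y] avg_nonneg[of E h2 y]
      by (intro add_left_mono mult_left_mono powr_mono2) auto
    finally show ?thesis by (simp add: mult_ac)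
  qed
  have "(\<integral>\<^sup>+y. ennreal ((avg E h1 y + avg E h2 y) powr q) * indicator S y \<partial>lborel) \<le>
    (\<integral>\<^sup>+y. ennreal (avg E h1 y powr q) + ennreal (q * M powr (q - 1)) * ennreal (avg E h2 y powr 1) \<partial>lborel)"
    using pw q_gt1 avg_nonneg
    by (intro nn_integral_mono)
      (auto split: split_indicator simp: powr_one simp flip: ennreal_mult ennreal_plus intro!: ennreal_leI)
  also have "\<dots> = (\<integral>\<^sup>+y. ennreal (avg E h1 y powr q) \<partial>lborel)
      + ennreal (q * M powr (q - 1)) * (\<integral>\<^sup>+y. ennreal (avg E h2 y powr 1) \<partial>lborel)"
    by (subst nn_integral_add, simp, simp, subst nn_integral_cmult, simp, simp)
  also have "\<dots> \<le> (\<integral>\<^sup>+z. ennreal (h1 z powr q) \<partial>lborel)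
      + ennreal (q * M powr (q - 1)) * (\<integral>\<^sup>+z. ennreal (h2 z powr 1) \<partial>lborel)"
    using q_gt1 E h by (intro add_mono mult_left_mono nn_integral_avg_powr) auto
  also have "(\<integral>\<^sup>+z. ennreal (h2 z powr 1) \<partial>lborel) = (\<integral>\<^sup>+z. ennreal (h2 z) \<partial>lborel)"
    using h(2) by (intro nn_integral_cong) (auto simp: subkernel_def)
  also have "(\<integral>\<^sup>+z. ennreal (h1 z powr q) \<partial>lborel) + ennreal (q * M powr (q - 1)) * (\<integral>\<^sup>+z. ennreal (h2 z) \<partial>lborel)
      \<le> ennreal A + ennreal (q * M powr (q - 1)) * ennreal B"
    using A B by (intro add_mono mult_left_mono) auto
  also have "\<dots> = ennreal (A + q * M powr (q - 1) * B)"
    using nn q_gt1 by (simp flip: ennreal_mult ennreal_plus)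
  finally show ?thesis .
qed

section \<open>Splitting the kernel at a radius\<close>

definition far :: "real \<Rightarrow> 'a \<Rightarrow> real" where "far \<rho> z = (if \<rho> \<le> norm z then g z else 0)"
definition near :: "real \<Rightarrow> 'a \<Rightarrow> real" where "near \<rho> z = (if norm z < \<rho> then g z else 0)"
definition mid :: "real \<Rightarrow> real \<Rightarrow> 'a \<Rightarrow> real" where
  "mid \<rho> \<rho>' z = (if \<rho> \<le> norm z \<and> norm z < \<rho>' then g z else 0)"

lemma subkernels: "subkernel (far \<rho>)" "subkernel (near \<rho>)" "subkernel (mid \<rho> \<rho>')" "subkernel g"
  using g_nonneg by (auto simp: subkernel_def far_def[abs_def] near_def[abs_def] mid_def[abs_def])

lemma g_le_outside:
  assumes "0 < \<rho>" "\<rho> \<le> norm z"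
  shows "g z \<le> \<gamma> * \<rho> powr (m - n)"
proof -
  have "g z \<le> \<gamma> * norm z powr (m - n)" using assms by (intro g_le) auto
  also have "\<dots> \<le> \<gamma> * \<rho> powr (m - n)"
    using assms \<gamma>_pos m_less by (intro mult_left_mono powr_mono2') auto
  finally show ?thesis .
qed

lemma far_le: "0 < \<rho> \<Longrightarrow> far \<rho> z \<le> \<gamma> * \<rho> powr (m - n)"
  using g_le_outside[of \<rho> z] \<gamma>_pos by (auto simp: far_def)

lemma mid_le: "0 < \<rho> \<Longrightarrow> mid \<rho> \<rho>' z \<le> \<gamma> * \<rho> powr (m - n)"
  using g_le_outside[of \<rho> z] \<gamma>_pos by (auto simp: mid_def)

lemma near_int:
  assumes "0 \<le> \<rho>"
  shows "(\<integral>\<^sup>+z. ennreal (near \<rho> z) \<partial>lborel) \<le> ennreal (c1 * \<rho> powr m)"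
proof -
  have "(\<integral>\<^sup>+z. ennreal (near \<rho> z) \<partial>lborel) \<le>
    (\<integral>\<^sup>+z. ennreal \<gamma> * (ennreal (norm (z::'a) powr (m - n)) * indicator {x. norm x < \<rho>} z) \<partial>lborel)"
  proof (intro nn_integral_mono_AE)
    show "AE z in lborel. ennreal (near \<rho> z) \<le> ennreal \<gamma> * (ennreal (norm z powr (m - n)) * indicator {x. norm x < \<rho>} z)"
      using AE_lborel_singleton[of "0::'a"]
      by eventually_elim (use \<gamma>_pos g_le in \<open>auto simp: near_def simp flip: ennreal_mult intro!: ennreal_leI\<close>)
  qed
  also have "\<dots> = ennreal \<gamma> * ennreal (n * V / m * \<rho> powr m)"
    using m_pos assms by (subst nn_integral_cmult, measurable) (simp add: ball_int)
  also have "\<dots> = ennreal (c1 * \<rho> powr m)"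
    using \<gamma>_pos m_pos n_pos V_pos by (subst ennreal_mult[symmetric]) (auto simp: c1_def mult_ac)
  finally show ?thesis .
qed

lemma mid_int:
  assumes "0 < \<rho>" "\<rho> \<le> \<rho>'"
  shows "(\<integral>\<^sup>+z. ennreal (mid \<rho> \<rho>' z powr q) \<partial>lborel) \<le> ennreal (n * ln (\<rho>' / \<rho>) / b0)"
proof -
  have "(\<integral>\<^sup>+z. ennreal (mid \<rho> \<rho>' z powr q) \<partial>lborel) \<le>
    (\<integral>\<^sup>+z. ennreal (\<gamma> powr q) * (ennreal (norm (z::'a) powr (- n)) * indicator {x. \<rho> \<le> norm x \<and> norm x < \<rho>'} z) \<partial>lborel)"
  proof (intro nn_integral_mono)
    fix z :: 'a
    show "ennreal (mid \<rho> \<rho>' z powr q) \<le> ennreal (\<gamma> powr q) * (ennreal (norm z powr (- n)) * indicator {x. \<rho> \<le> norm x \<and> norm x < \<rho>'} z)"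
    proof (cases "\<rho> \<le> norm z \<and> norm z < \<rho>'")
      case True
      then have "g z powr q \<le> (\<gamma> * norm z powr (m - n)) powr q"
        using assms q_gt1 by (intro powr_mono2 g_le g_nonneg) auto
      also have "\<dots> = \<gamma> powr q * norm z powr (- n)"
        using \<gamma>_pos True by (simp add: powr_mult powr_powr mq)
      finally show ?thesis using True \<gamma>_pos by (simp add: mid_def flip: ennreal_mult)
    qed (auto simp: mid_def)
  qed
  also have "\<dots> = ennreal (\<gamma> powr q) * ennreal (n * V * ln (\<rho>' / \<rho>))"
    using assms by (subst nn_integral_cmult, measurable) (simp add: annulus_int)
  also have "\<dots> = ennreal (n * ln (\<rho>' / \<rho>) / b0)"
    using assms n_pos V_pos by (subst ennreal_mult[symmetric]) (auto simp: b0_def mult_ac)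
  finally show ?thesis .
qed

text \<open>Up to radius 1 the Riesz bound gives the logarithm. Beyond it that bound would diverge;
  there g powr q <= \<gamma> powr (q - 1) * g, and the integral of \<open>g\<close> is at most
  1.\<close>

lemma far_int:
  assumes "0 < \<rho>" "\<rho> \<le> 1"
  shows "(\<integral>\<^sup>+z. ennreal (far \<rho> z powr q) \<partial>lborel) \<le> ennreal (n * ln (1 / \<rho>) / b0 + \<gamma> powr (q - 1))"
proof -
  have "(\<integral>\<^sup>+z. ennreal (far \<rho> z powr q) \<partial>lborel) \<le>
    (\<integral>\<^sup>+z. ennreal (mid \<rho> 1 z powr q) + ennreal (\<gamma> powr (q - 1)) * ennreal (g z) \<partial>lborel)"
  proof (intro nn_integral_mono)
    fix z :: 'a
    show "ennreal (far \<rho> z powr q) \<le> ennreal (mid \<rho> 1 z powr q) + ennreal (\<gamma> powr (q - 1)) * ennreal (g z)"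
    proof (cases "norm z \<ge> 1")
      case True
      have g1: "g z \<le> \<gamma>" using g_le_outside[of 1 z] True by simp
      have "g z powr q = g z * g z powr (q - 1)"
        using g_nonneg[of z] by (cases "g z = 0") (auto simp: powr_diff)
      also have "\<dots> \<le> g z * \<gamma> powr (q - 1)"
        using g1 g_nonneg[of z] q_gt1 by (intro mult_left_mono powr_mono2) auto
      finally have "g z powr q \<le> \<gamma> powr (q - 1) * g z" by (simp add: mult.commute)
      then have "ennreal (far \<rho> z powr q) \<le> ennreal (\<gamma> powr (q - 1)) * ennreal (g z)"
        using True assms g_nonneg[of z] by (auto simp: far_def simp flip: ennreal_mult intro!: ennreal_leI)
      then show ?thesis by (simp add: add_increasing)
    qed (auto simp: far_def mid_def)
  qed
  also have "\<dots> = (\<integral>\<^sup>+z. ennreal (mid \<rho> 1 z powr q) \<partial>lborel) + ennreal (\<gamma> powr (q - 1)) * (\<integral>\<^sup>+z. ennreal (g z) \<partial>lborel)"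
  proof -
    have [measurable]: "mid \<rho> 1 \<in> borel_measurable borel" using subkernels(3) by (simp add: subkernel_def)
    show ?thesis by (subst nn_integral_add, simp, simp, subst nn_integral_cmult, simp, simp)
  qed
  also have "\<dots> \<le> ennreal (n * ln (1 / \<rho>) / b0) + ennreal (\<gamma> powr (q - 1)) * 1"
    using assms g_int by (intro add_mono mult_left_mono mid_int) auto
  also have "\<dots> = ennreal (n * ln (1 / \<rho>) / b0 + \<gamma> powr (q - 1))"
  proof -
    have "0 \<le> n * ln (1 / \<rho>) / b0" using assms b0_pos n_pos by simp
    then show ?thesis by simp
  qed
  finally show ?thesis .
qed

definition c2 :: real where "c2 = q * (\<gamma> + c1) powr (q - 1) * c1"
definition c3 :: real where "c3 = q * (2 * \<gamma>) powr (q - 1) * c1"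
text \<open>The radius of a ball whose measure is comparable to exp (- t), the measure of the sets
  over which the kernel is averaged.\<close>

definition rad :: "real \<Rightarrow> real" where "rad t = exp (- t / n)"

lemma c2_nonneg: "c2 \<ge> 0" and c3_nonneg: "c3 \<ge> 0"
  using q_gt1 c1_pos by (auto simp: c2_def c3_def)

lemma rad_pos: "rad t > 0" by (simp add: rad_def)
lemma rad_le1: "t \<ge> 0 \<Longrightarrow> rad t \<le> 1" using n_pos by (simp add: rad_def)
lemma rad_mono: "t \<le> t' \<Longrightarrow> rad t' \<le> rad t" using n_pos by (simp add: rad_def divide_right_mono)
lemma rad_powr_n: "rad t powr n = exp (- t)" using n_pos by (simp add: rad_def powr_def)
lemma rad_ln: "n * ln (1 / rad t) = t" using n_pos by (simp add: rad_def ln_div)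
lemma rad_ln': "n * ln (rad t / rad t') = t' - t" using n_pos by (simp add: rad_def ln_div field_simps)

text \<open>The error term of \<open>nn_integral_avg_sum_powr\<close> is scale invariant: with M = c
  * \<rho> powr (m - n) and B = c1 * \<rho> powr m the powers of \<rho> cancel.\<close>

lemma sum_bound_const:
  assumes "c \<ge> 0" "\<rho> > 0"
  shows "q * (c * \<rho> powr (m - n)) powr (q - 1) * (c1 * \<rho> powr m) = q * c powr (q - 1) * c1"
proof -
  have "(\<rho> powr (m - n)) powr (q - 1) * \<rho> powr m = 1"
    using assms by (simp add: powr_powr mq flip: powr_add)
  then show ?thesis using assms by (simp add: powr_mult mult_ac)
qed

lemma fat_exp: "E \<in> sets borel \<Longrightarrow> emeasure lborel E = ennreal (exp (- t)) \<Longrightarrow> fat E"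
  by (auto simp: fat_def)

text \<open>Dividing the integral of the near part by the measure rad t powr n of the set leads to
  the same power of the radius as in the bound for the far part.\<close>

lemma avg_near_le:
  assumes E: "E \<in> sets borel" "emeasure lborel E = ennreal (exp (- t))"
  shows "avg E (near (rad t)) y \<le> c1 * rad t powr (m - n)"
proof -
  have "avg E (near (rad t)) y \<le> c1 * rad t powr m / exp (- t)"
    using E c1_pos rad_pos[of t] by (intro avg_bound_int fat_exp[OF E] subkernels near_int) auto
  also have "\<dots> = c1 * rad t powr (m - n)"
    using rad_pos by (simp add: powr_diff flip: rad_powr_n)
  finally show ?thesis .
qed

lemma avg_far_le:
  assumes "fat E" "\<rho> > 0"
  shows "avg E (far \<rho>) y \<le> \<gamma> * \<rho> powr (m - n)"
  using assms \<gamma>_pos by (intro avg_bound subkernels far_le) auto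

lemma avg_split: 
  assumes "fat E"
  shows "avg E g y = avg E (far \<rho>) y + avg E (near \<rho>) y"
  using assms by (intro avg_add subkernels) (auto simp: far_def near_def)

lemma avg_g_le:
  assumes E: "E \<in> sets borel" "emeasure lborel E = ennreal (exp (- t))"
  shows "avg E g y \<le> (\<gamma> + c1) * rad t powr (m - n)"
  using avg_near_le[OF E, of y] avg_far_le[OF fat_exp[OF E] rad_pos, of t y] avg_split[OF fat_exp[OF E], of y "rad t"]
  by (simp add: algebra_simps)

text \<open>Cut at the radius belonging to the set, the far part produces t / b0 and the near part
  only a constant.\<close>

lemma avg_g_int:
  assumes E: "E \<in> sets borel" "emeasure lborel E = ennreal (exp (- t))" and t: "t \<ge> 0"
  shows "(\<integral>\<^sup>+y. ennreal (avg E g y powr q) \<partial>lborel) \<le> ennreal (t / b0 + \<gamma> powr (q - 1) + c2)"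
proof -
  note fE = fat_exp[OF E]
  have "(\<integral>\<^sup>+y. ennreal (avg E g y powr q) \<partial>lborel) =
    (\<integral>\<^sup>+y. ennreal ((avg E (far (rad t)) y + avg E (near (rad t)) y) powr q) * indicator UNIV y \<partial>lborel)"
    by (simp add: avg_split[OF fE, of _ "rad t"])
  also have "\<dots> \<le> ennreal ((n * ln (1 / rad t) / b0 + \<gamma> powr (q - 1)) +
      q * ((\<gamma> + c1) * rad t powr (m - n)) powr (q - 1) * (c1 * rad t powr m))"
  proof (intro nn_integral_avg_sum_powr fE subkernels far_int near_int)
    show "avg E (far (rad t)) y + avg E (near (rad t)) y \<le> (\<gamma> + c1) * rad t powr (m - n)" for y
      using avg_g_le[OF E, of y] by (simp add: avg_split[OF fE, of _ "rad t"])
  qed (use t rad_pos[of t] rad_le1[of t] c1_pos \<gamma>_pos b0_pos in \<open>auto simp: rad_ln\<close>)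
  also have "\<dots> = ennreal (t / b0 + \<gamma> powr (q - 1) + c2)"
    using \<gamma>_pos c1_pos by (subst sum_bound_const) (auto simp: rad_ln rad_pos c2_def)
  finally show ?thesis .
qed

text \<open>Only the annulus between the two radii contributes a logarithm, hence the gap t2 -
  t1.\<close>

lemma avg_near_int:
  assumes E: "E \<in> sets borel" "emeasure lborel E = ennreal (exp (- t2))" and t: "t1 \<le> t2"
  shows "(\<integral>\<^sup>+y. ennreal (avg E (near (rad t1)) y powr q) \<partial>lborel) \<le> ennreal ((t2 - t1) / b0 + c2)"
proof -
  note fE = fat_exp[OF E]
  have sp: "avg E (near (rad t1)) y = avg E (mid (rad t2) (rad t1)) y + avg E (near (rad t2)) y" for y
    using fE rad_mono[OF t] by (intro avg_add subkernels) (auto simp: mid_def near_def)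
  have "(\<integral>\<^sup>+y. ennreal (avg E (near (rad t1)) y powr q) \<partial>lborel) =
    (\<integral>\<^sup>+y. ennreal ((avg E (mid (rad t2) (rad t1)) y + avg E (near (rad t2)) y) powr q) * indicator UNIV y \<partial>lborel)"
    by (simp add: sp)
  also have "\<dots> \<le> ennreal ((n * ln (rad t1 / rad t2) / b0) +
      q * ((\<gamma> + c1) * rad t2 powr (m - n)) powr (q - 1) * (c1 * rad t2 powr m))"
  proof (intro nn_integral_avg_sum_powr fE subkernels mid_int near_int)
    fix y
    have "avg E (mid (rad t2) (rad t1)) y \<le> \<gamma> * rad t2 powr (m - n)"
      using \<gamma>_pos by (intro avg_bound fE subkernels mid_le rad_pos) auto
    then show "avg E (mid (rad t2) (rad t1)) y + avg E (near (rad t2)) y \<le> (\<gamma> + c1) * rad t2 powr (m - n)"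
      using avg_near_le[OF E, of y] by (simp add: algebra_simps)
  qed (use t rad_pos[of t2] rad_mono[OF t] c1_pos \<gamma>_pos b0_pos in \<open>auto simp: rad_ln'\<close>)
  also have "\<dots> = ennreal ((t2 - t1) / b0 + c2)"
    using \<gamma>_pos c1_pos by (subst sum_bound_const) (auto simp: rad_ln' rad_pos c2_def)
  finally show ?thesis .
qed

text \<open>The exceptional set \<open>A\<close> is where the part of the average of \<open>g\<close> over \<open>E2\<close> that comes from
  distances below the radius belonging to \<open>E1\<close> is large; this replaces O'Neil's rearrangement.\<close>

lemma avg_exceptional_set:
  assumes E1: "E1 \<in> sets borel" "emeasure lborel E1 = ennreal (exp (- t1))"
    and E2: "E2 \<in> sets borel" "emeasure lborel E2 = ennreal (exp (- t2))" and t: "0 \<le> t1" "t1 \<le> t2"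
  obtains A where "A \<in> sets borel"
    "(\<integral>\<^sup>+y. ennreal (avg E2 g y powr q) * indicator (- A) y \<partial>lborel) \<le> ennreal (t1 / b0 + \<gamma> powr (q - 1) + c3)"
    "(\<integral>\<^sup>+y. ennreal (avg E2 g y powr q) * indicator A y \<partial>lborel) \<le> ennreal (2 powr q * ((t2 - t1) / b0 + c2))"
    "(\<integral>\<^sup>+y. ennreal (avg E1 g y powr q) * indicator A y \<partial>lborel) \<le> ennreal ((\<gamma> + c1) powr q * (c1 / \<gamma>))"
proof -
  note f1 = fat_exp[OF E1] and f2 = fat_exp[OF E2]
  note [measurable] = ennreal_avg(3)[OF f1 subkernels(4)] ennreal_avg(3)[OF f2 subkernels(4)]
    ennreal_avg(3)[OF f2 subkernels(2)]
  define \<rho> where "\<rho> = rad t1"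
  have \<rho>: "\<rho> > 0" "\<rho> \<le> 1" using rad_pos rad_le1 t by (auto simp: \<rho>_def)
  \<comment> \<open>\<open>s\<close> bounds the far part. So off \<open>A\<close> the whole average
    is at most 2 * s, and on \<open>A\<close> it is at most twice its near part.\<close>
  define s where "s = \<gamma> * \<rho> powr (m - n)"
  have s: "s > 0" using \<gamma>_pos \<rho> by (simp add: s_def)
  define A where "A = {y \<in> space lborel. avg E2 (near \<rho>) y > s}"
  have A [measurable]: "A \<in> sets borel" unfolding A_def by measurable
  have far: "avg E2 (far \<rho>) y \<le> s" for y
    unfolding s_def by (rule avg_far_le[OF f2 \<rho>(1)])
  \<comment> \<open>Markov's inequality: the measure of \<open>A\<close> is of order \<rho> powr n,
    like that of \<open>E1\<close>. The pointwise bound for the average over \<open>E1\<close>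
    therefore leaves only a constant on \<open>A\<close>.\<close>
  have "ennreal s * emeasure lborel A = (\<integral>\<^sup>+y. ennreal s * indicator A y \<partial>lborel)"
    by (simp add: nn_integral_cmult_indicator)
  also have "\<dots> \<le> (\<integral>\<^sup>+y. ennreal (avg E2 (near \<rho>) y powr 1) \<partial>lborel)"
    using s by (intro nn_integral_mono) (auto simp: A_def split: split_indicator intro!: ennreal_leI)
  also have "\<dots> \<le> (\<integral>\<^sup>+z. ennreal (near \<rho> z powr 1) \<partial>lborel)"
    by (intro nn_integral_avg_powr f2 subkernels) auto
  also have "\<dots> = (\<integral>\<^sup>+z. ennreal (near \<rho> z) \<partial>lborel)"
    using g_nonneg by (intro nn_integral_cong) (auto simp: near_def)
  also have "\<dots> \<le> ennreal (c1 * \<rho> powr m)" using \<rho> by (intro near_int) auto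
  finally have "ennreal (1 / s) * (ennreal s * emeasure lborel A) \<le> ennreal (1 / s) * ennreal (c1 * \<rho> powr m)"
    by (rule mult_left_mono) simp
  moreover have "1 / s * (c1 * \<rho> powr m) = c1 / \<gamma> * \<rho> powr n"
    using \<rho> \<gamma>_pos by (simp add: s_def powr_diff field_simps)
  ultimately have mA: "emeasure lborel A \<le> ennreal (c1 / \<gamma> * \<rho> powr n)"
    using s c1_pos by (simp add: mult.assoc[symmetric] flip: ennreal_mult)
  show thesis
  proof (rule that[of A])
    have "(\<integral>\<^sup>+y. ennreal (avg E2 g y powr q) * indicator (- A) y \<partial>lborel) =
      (\<integral>\<^sup>+y. ennreal ((avg E2 (far \<rho>) y + avg E2 (near \<rho>) y) powr q) * indicator (- A) y \<partial>lborel)"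
      by (simp add: avg_split[OF f2, of _ \<rho>])
    also have "\<dots> \<le> ennreal ((n * ln (1 / \<rho>) / b0 + \<gamma> powr (q - 1)) +
        q * (2 * \<gamma> * \<rho> powr (m - n)) powr (q - 1) * (c1 * \<rho> powr m))"
    proof (intro nn_integral_avg_sum_powr f2 subkernels far_int near_int)
      show "avg E2 (far \<rho>) y + avg E2 (near \<rho>) y \<le> 2 * \<gamma> * \<rho> powr (m - n)" if "y \<in> - A" for y
        using that far[of y] by (auto simp: A_def s_def)
    qed (use t \<rho> c1_pos \<gamma>_pos b0_pos in \<open>auto simp: \<rho>_def rad_ln\<close>)
    also have "\<dots> = ennreal (t1 / b0 + \<gamma> powr (q - 1) + c3)"
      using \<gamma>_pos \<rho> by (subst sum_bound_const) (auto simp: \<rho>_def rad_ln c3_def)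
    finally show "(\<integral>\<^sup>+y. ennreal (avg E2 g y powr q) * indicator (- A) y \<partial>lborel) \<le> ennreal (t1 / b0 + \<gamma> powr (q - 1) + c3)" .
  next
    have "avg E2 g y powr q \<le> 2 powr q * avg E2 (near \<rho>) y powr q" if "y \<in> A" for y
    proof -
      have "avg E2 g y \<le> 2 * avg E2 (near \<rho>) y"
        using that far[of y] by (auto simp: A_def avg_split[OF f2, of _ \<rho>])
      then have "avg E2 g y powr q \<le> (2 * avg E2 (near \<rho>) y) powr q"
        using q_gt1 avg_nonneg by (intro powr_mono2) auto
      then show ?thesis using avg_nonneg by (simp add: powr_mult)
    qed
    then have "(\<integral>\<^sup>+y. ennreal (avg E2 g y powr q) * indicator A y \<partial>lborel) \<le>
      (\<integral>\<^sup>+y. ennreal (2 powr q) * ennreal (avg E2 (near \<rho>) y powr q) \<partial>lborel)"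
      by (intro nn_integral_mono) (auto split: split_indicator simp flip: ennreal_mult intro!: ennreal_leI)
    also have "\<dots> = ennreal (2 powr q) * (\<integral>\<^sup>+y. ennreal (avg E2 (near \<rho>) y powr q) \<partial>lborel)"
      by (rule nn_integral_cmult) measurable
    also have "\<dots> \<le> ennreal (2 powr q) * ennreal ((t2 - t1) / b0 + c2)"
      unfolding \<rho>_def by (intro mult_left_mono avg_near_int[OF E2 t(2)]) auto
    finally show "(\<integral>\<^sup>+y. ennreal (avg E2 g y powr q) * indicator A y \<partial>lborel) \<le> ennreal (2 powr q * ((t2 - t1) / b0 + c2))"
      using t b0_pos c2_nonneg by (simp flip: ennreal_mult del: ennreal_plus)
  next
    have "avg E1 g y powr q \<le> (\<gamma> + c1) powr q * \<rho> powr (- n)" for y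
    proof -
      have "avg E1 g y powr q \<le> ((\<gamma> + c1) * \<rho> powr (m - n)) powr q"
        unfolding \<rho>_def using q_gt1 avg_nonneg by (intro powr_mono2 avg_g_le E1) auto
      then show ?thesis using \<gamma>_pos c1_pos \<rho> by (simp add: powr_mult powr_powr mq)
    qed
    then have "(\<integral>\<^sup>+y. ennreal (avg E1 g y powr q) * indicator A y \<partial>lborel) \<le>
      (\<integral>\<^sup>+y. ennreal ((\<gamma> + c1) powr q * \<rho> powr (- n)) * indicator A y \<partial>lborel)"
      by (intro nn_integral_mono mult_right_mono ennreal_leI) auto
    also have "\<dots> = ennreal ((\<gamma> + c1) powr q * \<rho> powr (- n)) * emeasure lborel A"
      by (simp add: nn_integral_cmult_indicator)
    also have "\<dots> \<le> ennreal ((\<gamma> + c1) powr q * \<rho> powr (- n)) * ennreal (c1 / \<gamma> * \<rho> powr n)"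
      by (intro mult_left_mono mA) auto
    also have "\<dots> = ennreal ((\<gamma> + c1) powr q * (c1 / \<gamma>) * (\<rho> powr (- n) * \<rho> powr n))"
      using c1_pos \<gamma>_pos by (simp add: mult_ac flip: ennreal_mult)
    also have "\<rho> powr (- n) * \<rho> powr n = 1" using \<rho> by (simp flip: powr_add)
    finally show "(\<integral>\<^sup>+y. ennreal (avg E1 g y powr q) * indicator A y \<partial>lborel) \<le> ennreal ((\<gamma> + c1) powr q * (c1 / \<gamma>))"
      by simp
  qed fact
qed

end

lemma nn_integral_Holder_on:
  fixes f k :: "'b \<Rightarrow> real"
  assumes p: "p > 1" and q: "q > 1" and pq: "1/p + 1/q = 1"
    and [measurable]: "f \<in> borel_measurable M" "k \<in> borel_measurable M" "S \<in> sets M"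
    and f0: "\<And>x. f x \<ge> 0" and k0: "\<And>x. k x \<ge> 0"
    and A: "(\<integral>\<^sup>+x. ennreal (f x powr p) * indicator S x \<partial>M) \<le> ennreal A" "A \<ge> 0"
    and B: "(\<integral>\<^sup>+x. ennreal (k x powr q) * indicator S x \<partial>M) \<le> ennreal B" "B \<ge> 0"
  shows "(\<integral>\<^sup>+x. ennreal (f x * k x) * indicator S x \<partial>M) \<le> ennreal (A powr (1/p) * B powr (1/q))"
proof -
  have "(\<integral>\<^sup>+x. ennreal (f x * k x) * indicator S x \<partial>M) =
      (\<integral>\<^sup>+x. ennreal ((f x * indicator S x) * (k x * indicator S x)) \<partial>M)"
    by (intro nn_integral_cong) (auto split: split_indicator)
  also have "\<dots> \<le> ennreal (A powr (1/p) * B powr (1/q))"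
  proof (rule nn_integral_Holder[OF p q pq])
    have "(\<integral>\<^sup>+x. ennreal ((f x * indicator S x) powr p) \<partial>M) = (\<integral>\<^sup>+x. ennreal (f x powr p) * indicator S x \<partial>M)"
      by (intro nn_integral_cong) (auto split: split_indicator)
    then show "(\<integral>\<^sup>+x. ennreal ((f x * indicator S x) powr p) \<partial>M) \<le> ennreal A" using A by simp
    have "(\<integral>\<^sup>+x. ennreal ((k x * indicator S x) powr q) \<partial>M) = (\<integral>\<^sup>+x. ennreal (k x powr q) * indicator S x \<partial>M)"
      by (intro nn_integral_cong) (auto split: split_indicator)
    then show "(\<integral>\<^sup>+x. ennreal ((k x * indicator S x) powr q) \<partial>M) \<le> ennreal B" using B by simp
  qed (use f0 k0 A B in auto)
  finally show ?thesis .
qed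

section \<open>Levels of a potential against measures of superlevel sets\<close>

context riesz_dominated begin

text \<open>A single constant above all error terms of the estimates at one and at two
  levels.\<close>

definition C0 :: real where
  "C0 = 1 + b0 * (\<gamma> powr (q - 1) + c2 + c3) + b0 * ((\<gamma> + c1) powr q * (c1 / \<gamma>)) + 2 powr q * (1 + b0 * c2)"

lemma C0_ge:
  "C0 \<ge> 1" "b0 * (\<gamma> powr (q - 1) + c2) \<le> C0" "b0 * (\<gamma> powr (q - 1) + c3) \<le> C0"
  "b0 * ((\<gamma> + c1) powr q * (c1 / \<gamma>)) \<le> C0" "2 powr q * (1 + b0 * c2) \<le> C0"
proof -
  have "0 \<le> b0 * \<gamma> powr (q - 1)" "0 \<le> b0 * c2" "0 \<le> b0 * c3" "0 \<le> b0 * ((\<gamma> + c1) powr q * (c1 / \<gamma>))"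
    "0 \<le> 2 powr q * (1 + b0 * c2)"
    using b0_pos c2_nonneg c3_nonneg c1_pos \<gamma>_pos by auto
  then show "C0 \<ge> 1" "b0 * (\<gamma> powr (q - 1) + c2) \<le> C0" "b0 * (\<gamma> powr (q - 1) + c3) \<le> C0"
    "b0 * ((\<gamma> + c1) powr q * (c1 / \<gamma>)) \<le> C0" "2 powr q * (1 + b0 * c2) \<le> C0"
    by (auto simp: C0_def distrib_left)
qed

text \<open>Averaging the potential over E and exchanging the integrals moves the average onto the
  kernel.\<close>

lemma level_le_pairing:
  assumes E: "fat E" and [measurable]: "f \<in> borel_measurable borel" and f0: "\<And>y. f y \<ge> 0"
    and u: "AE x in lborel. x \<in> E \<longrightarrow> ennreal l \<le> (\<integral>\<^sup>+y. ennreal (g (x - y) * f y) \<partial>lborel)"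
  shows "ennreal l \<le> (\<integral>\<^sup>+y. ennreal (f y * avg E g y) \<partial>lborel)"
proof -
  interpret prob_space "uniform_measure lborel E" by (rule fat_prob[OF E])
  interpret pair_sigma_finite "uniform_measure lborel E" "lborel :: 'a measure" ..
  have [measurable]: "E \<in> sets borel" using E by (simp add: fat_def)
  have "ennreal l = (\<integral>\<^sup>+x. ennreal l \<partial>uniform_measure lborel E)"
    using emeasure_space_1 by simp
  also have "\<dots> \<le> (\<integral>\<^sup>+x. \<integral>\<^sup>+y. ennreal (g (x - y) * f y) \<partial>lborel \<partial>uniform_measure lborel E)"
    using u by (intro nn_integral_mono_AE AE_uniform_measureI) auto
  also have "\<dots> = (\<integral>\<^sup>+y. \<integral>\<^sup>+x. ennreal (f y) * ennreal (g (x - y)) \<partial>uniform_measure lborel E \<partial>lborel)"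
    using f0 g_nonneg by (subst Fubini') (auto simp: ennreal_mult mult.commute)
  also have "\<dots> = (\<integral>\<^sup>+y. ennreal (f y * avg E g y) \<partial>lborel)"
    using f0 avg_nonneg
    by (intro nn_integral_cong, subst nn_integral_cmult) (auto simp: ennreal_mult ennreal_avg(2)[OF E subkernels(4)])
  finally show ?thesis .
qed

lemma powr_b0:
  assumes "l \<ge> 0" shows "(b0 * l powr q) powr (1/q) = b0 powr (1/q) * l"
  using b0_pos q_gt1 assms by (simp add: powr_mult powr_powr)

text \<open>Hoelder's inequality against \<open>avg_g_int\<close>. For the superlevel set at s = b0
  * l powr q it bounds the measure by exp (C0 - s).\<close>

lemma level_single:
  assumes E: "E \<in> sets borel" "emeasure lborel E = ennreal (exp (- t))" and t: "t \<ge> 0"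
    and [measurable]: "f \<in> borel_measurable borel" and f0: "\<And>y. f y \<ge> 0"
    and f1: "(\<integral>\<^sup>+y. ennreal (f y powr p) \<partial>lborel) \<le> 1"
    and u: "AE x in lborel. x \<in> E \<longrightarrow> ennreal l \<le> (\<integral>\<^sup>+y. ennreal (g (x - y) * f y) \<partial>lborel)"
    and l0: "l \<ge> 0"
  shows "b0 * l powr q \<le> t + C0"
proof -
  note [measurable] = ennreal_avg(3)[OF fat_exp[OF E] subkernels(4)]
  let ?B = "t / b0 + \<gamma> powr (q - 1) + c2"
  have B0: "?B \<ge> 0" using t b0_pos c2_nonneg by simp
  have "ennreal l \<le> (\<integral>\<^sup>+y. ennreal (f y * avg E g y) \<partial>lborel)"
    by (rule level_le_pairing[OF fat_exp[OF E] _ f0 u]) simp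
  also have "\<dots> \<le> ennreal (1 powr (1/p) * ?B powr (1/q))"
    using f1 B0 avg_g_int[OF E t] by (intro nn_integral_Holder[OF p_gt1 q_gt1 pq]) (auto simp: f0 avg_nonneg)
  finally have "l \<le> ?B powr (1/q)" using ennreal_le_iff by fastforce
  then have "l powr q \<le> (?B powr (1/q)) powr q" using l0 q_gt1 by (intro powr_mono2) auto
  also have "\<dots> = ?B" using B0 q_gt1 by (simp add: powr_powr)
  finally have "b0 * l powr q \<le> b0 * ?B" using b0_pos by simp
  also have "\<dots> = t + b0 * (\<gamma> powr (q - 1) + c2)" using b0_pos by (simp add: field_simps)
  finally show ?thesis using C0_ge(2) by simp
qed

text \<open>Hoelder's inequality separately on the exceptional set and its complement; \<theta> is
  the p-norm of f on the exceptional set. What f spends there is almost lost for the level l1, while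
  it is the only gain available for the level l2.\<close>

lemma level_pair:
  assumes E1: "E1 \<in> sets borel" "emeasure lborel E1 = ennreal (exp (- t1))"
    and E2: "E2 \<in> sets borel" "emeasure lborel E2 = ennreal (exp (- t2))" and t: "0 \<le> t1" "t1 \<le> t2"
    and f [measurable]: "f \<in> borel_measurable borel" and f0: "\<And>y. f y \<ge> 0"
    and f1: "(\<integral>\<^sup>+y. ennreal (f y powr p) \<partial>lborel) \<le> 1"
    and u1: "AE x in lborel. x \<in> E1 \<longrightarrow> ennreal l1 \<le> (\<integral>\<^sup>+y. ennreal (g (x - y) * f y) \<partial>lborel)"
    and u2: "AE x in lborel. x \<in> E2 \<longrightarrow> ennreal l2 \<le> (\<integral>\<^sup>+y. ennreal (g (x - y) * f y) \<partial>lborel)"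
    and l0: "l1 \<ge> 0" "l2 \<ge> 0"
  obtains \<theta> where "0 \<le> \<theta>" "\<theta> \<le> 1"
    "(b0 * l1 powr q) powr (1/q) \<le> (1 - \<theta> powr p) powr (1/p) * (t1 + C0) powr (1/q) + \<theta> * C0 powr (1/q)"
    "(b0 * l2 powr q) powr (1/q) \<le> (t1 + C0) powr (1/q) + \<theta> * (C0 * (t2 - t1 + 1)) powr (1/q)"
proof -
  note fat = fat_exp[OF E1] fat_exp[OF E2]
  note [measurable] = ennreal_avg(3)[OF fat(1) subkernels(4)] ennreal_avg(3)[OF fat(2) subkernels(4)]
  obtain A where A [measurable]: "A \<in> sets borel" and
    a: "(\<integral>\<^sup>+y. ennreal (avg E2 g y powr q) * indicator (- A) y \<partial>lborel) \<le> ennreal (t1 / b0 + \<gamma> powr (q - 1) + c3)"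
    and b: "(\<integral>\<^sup>+y. ennreal (avg E2 g y powr q) * indicator A y \<partial>lborel) \<le> ennreal (2 powr q * ((t2 - t1) / b0 + c2))"
    and c: "(\<integral>\<^sup>+y. ennreal (avg E1 g y powr q) * indicator A y \<partial>lborel) \<le> ennreal ((\<gamma> + c1) powr q * (c1 / \<gamma>))"
    by (rule avg_exceptional_set[OF E1 E2 t])
  have d: "(\<integral>\<^sup>+y. ennreal (avg E1 g y powr q) * indicator (- A) y \<partial>lborel) \<le> ennreal (t1 / b0 + \<gamma> powr (q - 1) + c2)"
    by (rule order_trans[OF _ avg_g_int[OF E1 t(1)]]) (auto intro!: nn_integral_mono split: split_indicator)
  have split: "(\<integral>\<^sup>+y. h y \<partial>lborel) = (\<integral>\<^sup>+y. h y * indicator (- A) y \<partial>lborel) + (\<integral>\<^sup>+y. h y * indicator A y \<partial>lborel)"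
    if [measurable]: "h \<in> borel_measurable borel" for h :: "'a \<Rightarrow> ennreal"
    by (subst nn_integral_add[symmetric]) (auto intro!: nn_integral_cong split: split_indicator)
  define T where "T = enn2real (\<integral>\<^sup>+y. ennreal (f y powr p) * indicator A y \<partial>lborel)"
  have le1: "(\<integral>\<^sup>+y. ennreal (f y powr p) * indicator A y \<partial>lborel) \<le> 1"
    by (rule order_trans[OF _ f1]) (auto intro!: nn_integral_mono split: split_indicator)
  have TA: "(\<integral>\<^sup>+y. ennreal (f y powr p) * indicator A y \<partial>lborel) = ennreal T"
    unfolding T_def using le1 by (intro ennreal_enn2real[symmetric]) (auto simp: less_top[symmetric] top_unique)
  have T: "0 \<le> T" "T \<le> 1" using le1 unfolding TA by (auto simp: T_def)
  have "(\<integral>\<^sup>+y. ennreal (f y powr p) * indicator (- A) y \<partial>lborel) + ennreal T \<le> ennreal (1 - T) + ennreal T"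
    using f1 T by (subst TA[symmetric], subst split[symmetric]) (auto simp flip: ennreal_plus)
  then have TAc: "(\<integral>\<^sup>+y. ennreal (f y powr p) * indicator (- A) y \<partial>lborel) \<le> ennreal (1 - T)"
    by (simp add: ennreal_add_left_cancel_le add.commute)
  have Ac [measurable]: "- A \<in> sets borel" by simp
  \<comment> \<open>The common form of both estimates, with \<open>B1\<close> and \<open>B2\<close>
    bounding the averaged kernel off and on \<open>A\<close>.\<close>
  have bound: "b0 powr (1/q) * l \<le> (1 - T) powr (1/p) * (b0 * B1) powr (1/q) + T powr (1/p) * (b0 * B2) powr (1/q)"
    if E: "fat E" and uE: "AE x in lborel. x \<in> E \<longrightarrow> ennreal l \<le> (\<integral>\<^sup>+y. ennreal (g (x - y) * f y) \<partial>lborel)"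
      and i1: "(\<integral>\<^sup>+y. ennreal (avg E g y powr q) * indicator (- A) y \<partial>lborel) \<le> ennreal B1"
      and i2: "(\<integral>\<^sup>+y. ennreal (avg E g y powr q) * indicator A y \<partial>lborel) \<le> ennreal B2"
      and B: "B1 \<ge> 0" "B2 \<ge> 0" "l \<ge> 0" for E l B1 B2
  proof -
    note [measurable] = ennreal_avg(3)[OF E subkernels(4)]
    have "ennreal l \<le> (\<integral>\<^sup>+y. ennreal (f y * avg E g y) \<partial>lborel)"
      by (rule level_le_pairing[OF E _ f0 uE]) simp
    also have "\<dots> = (\<integral>\<^sup>+y. ennreal (f y * avg E g y) * indicator (- A) y \<partial>lborel) + (\<integral>\<^sup>+y. ennreal (f y * avg E g y) * indicator A y \<partial>lborel)"
      by (rule split) measurable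
    also have "\<dots> \<le> ennreal ((1 - T) powr (1/p) * B1 powr (1/q)) + ennreal (T powr (1/p) * B2 powr (1/q))"
      using T TA TAc i1 i2 B f0 avg_nonneg
      by (intro add_mono nn_integral_Holder_on[OF p_gt1 q_gt1 pq]) auto
    also have "\<dots> = ennreal ((1 - T) powr (1/p) * B1 powr (1/q) + T powr (1/p) * B2 powr (1/q))"
      by simp
    finally have "l \<le> (1 - T) powr (1/p) * B1 powr (1/q) + T powr (1/p) * B2 powr (1/q)"
      by (subst (asm) ennreal_le_iff) auto
    then have "b0 powr (1/q) * l \<le> b0 powr (1/q) * ((1 - T) powr (1/p) * B1 powr (1/q) + T powr (1/p) * B2 powr (1/q))"
      by (rule mult_left_mono) simp
    then show ?thesis using B b0_pos by (simp add: powr_mult algebra_simps)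
  qed
  define \<theta> where "\<theta> = T powr (1/p)"
  have th: "0 \<le> \<theta>" "\<theta> \<le> 1" using T p_gt1 by (auto simp: \<theta>_def powr_le1)
  have thp: "\<theta> powr p = T" using T p_gt1 by (simp add: \<theta>_def powr_powr)
  have q1: "1/q \<ge> 0" using q_gt1 by simp
  have r1: "(b0 * (t1 / b0 + \<gamma> powr (q - 1) + c2)) powr (1/q) \<le> (t1 + C0) powr (1/q)"
    "(b0 * (t1 / b0 + \<gamma> powr (q - 1) + c3)) powr (1/q) \<le> (t1 + C0) powr (1/q)"
    "(b0 * ((\<gamma> + c1) powr q * (c1 / \<gamma>))) powr (1/q) \<le> C0 powr (1/q)"
    using q1 b0_pos t c2_nonneg c3_nonneg C0_ge \<gamma>_pos c1_pos
    by (auto intro!: powr_mono2 simp: distrib_left)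
  have r2: "(b0 * (2 powr q * ((t2 - t1) / b0 + c2))) powr (1/q) \<le> (C0 * (t2 - t1 + 1)) powr (1/q)"
  proof (rule powr_mono2[OF q1])
    show "0 \<le> b0 * (2 powr q * ((t2 - t1) / b0 + c2))"
      using b0_pos t c2_nonneg by simp
    have "b0 * (2 powr q * ((t2 - t1) / b0 + c2)) = 2 powr q * ((t2 - t1) + b0 * c2)"
      using b0_pos by (simp add: field_simps)
    also have "\<dots> \<le> 2 powr q * ((1 + b0 * c2) * (t2 - t1 + 1))"
    proof (rule mult_left_mono)
      have "0 \<le> b0 * c2 * (t2 - t1)" using b0_pos c2_nonneg t by simp
      then show "(t2 - t1) + b0 * c2 \<le> (1 + b0 * c2) * (t2 - t1 + 1)"
        by (simp add: algebra_simps)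
    qed simp
    also have "\<dots> \<le> C0 * (t2 - t1 + 1)"
      using C0_ge(5) t by (auto simp: mult.assoc[symmetric] intro!: mult_right_mono)
    finally show "b0 * (2 powr q * ((t2 - t1) / b0 + c2)) \<le> C0 * (t2 - t1 + 1)" .
  qed
  show thesis
  proof (rule that[OF th])
    have "b0 powr (1/q) * l1 \<le> (1 - T) powr (1/p) * (b0 * (t1 / b0 + \<gamma> powr (q - 1) + c2)) powr (1/q) +
        T powr (1/p) * (b0 * ((\<gamma> + c1) powr q * (c1 / \<gamma>))) powr (1/q)"
      using b0_pos t c2_nonneg \<gamma>_pos c1_pos l0 by (intro bound[OF fat(1) u1 d c]) auto
    also have "\<dots> \<le> (1 - T) powr (1/p) * (t1 + C0) powr (1/q) + T powr (1/p) * C0 powr (1/q)"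
      using r1 by (intro add_mono mult_left_mono) auto
    finally show "(b0 * l1 powr q) powr (1/q) \<le> (1 - \<theta> powr p) powr (1/p) * (t1 + C0) powr (1/q) + \<theta> * C0 powr (1/q)"
      by (simp add: powr_b0[OF l0(1)] thp) (simp add: \<theta>_def)
    have "b0 powr (1/q) * l2 \<le> (1 - T) powr (1/p) * (b0 * (t1 / b0 + \<gamma> powr (q - 1) + c3)) powr (1/q) +
        T powr (1/p) * (b0 * (2 powr q * ((t2 - t1) / b0 + c2))) powr (1/q)"
      using b0_pos t c2_nonneg c3_nonneg \<gamma>_pos c1_pos l0 by (intro bound[OF fat(2) u2 a b]) auto
    also have "\<dots> \<le> 1 * (t1 + C0) powr (1/q) + T powr (1/p) * (C0 * (t2 - t1 + 1)) powr (1/q)"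
      using r1 r2 T p_gt1 by (intro add_mono mult_mono mult_left_mono) (auto intro!: powr_le1)
    finally show "(b0 * l2 powr q) powr (1/q) \<le> (t1 + C0) powr (1/q) + \<theta> * (C0 * (t2 - t1 + 1)) powr (1/q)"
      by (simp add: powr_b0[OF l0(2)]) (simp add: \<theta>_def)
  qed
qed

text \<open>Inside the ball of radius r powr (1/n) the weight is integrated exactly, outside it is
  at most r powr (- \<alpha> / n). Both contributions scale like r powr (1 - \<alpha> / n).\<close>

lemma nn_integral_weight:
  fixes E :: "'a set"
  assumes [measurable]: "E \<in> sets borel" and E: "emeasure lborel E = ennreal r" "r > 0"
    and a: "0 \<le> \<alpha>" "\<alpha> < n"
  shows "(\<integral>\<^sup>+x. ennreal (norm x powr (- \<alpha>)) * indicator E x \<partial>lborel) \<le>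
    ennreal ((n * V / (n - \<alpha>) + 1) * r powr (1 - \<alpha> / n))"
proof -
  define \<rho> where "\<rho> = r powr (1/n)"
  have \<rho>: "\<rho> > 0" using E by (simp add: \<rho>_def)
  have "(\<integral>\<^sup>+x. ennreal (norm x powr (- \<alpha>)) * indicator E x \<partial>lborel) \<le>
    (\<integral>\<^sup>+x. ennreal (norm x powr ((n - \<alpha>) - n)) * indicator {x. norm x < \<rho>} x + ennreal (\<rho> powr (- \<alpha>)) * indicator E x \<partial>lborel)"
    (is "_ \<le> nn_integral _ ?h")
  proof (intro nn_integral_mono)
    fix x :: 'a
    show "ennreal (norm x powr (- \<alpha>)) * indicator E x \<le> ?h x"
    proof (cases "norm x < \<rho>")
      case True
      then show ?thesis by (auto split: split_indicator simp: add_increasing2)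
    next
      case False
      then have "norm x powr (- \<alpha>) \<le> \<rho> powr (- \<alpha>)" using \<rho> a by (intro powr_mono2') auto
      then show ?thesis using False by (auto split: split_indicator intro!: ennreal_leI)
    qed
  qed
  also have "\<dots> = (\<integral>\<^sup>+x. ennreal (norm (x::'a) powr ((n - \<alpha>) - n)) * indicator {x. norm x < \<rho>} x \<partial>lborel) +
      (\<integral>\<^sup>+x. ennreal (\<rho> powr (- \<alpha>)) * indicator E x \<partial>lborel)"
    by (rule nn_integral_add) simp_all
  also have "(\<integral>\<^sup>+x. ennreal (norm (x::'a) powr ((n - \<alpha>) - n)) * indicator {x. norm x < \<rho>} x \<partial>lborel) =
      ennreal (n * V / (n - \<alpha>) * \<rho> powr (n - \<alpha>))"
    using a \<rho> by (intro ball_int) auto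
  also have "(\<integral>\<^sup>+x. ennreal (\<rho> powr (- \<alpha>)) * indicator E x \<partial>lborel) = ennreal (\<rho> powr (- \<alpha>)) * ennreal r"
    by (simp add: nn_integral_cmult_indicator E)
  also have "ennreal (\<rho> powr (- \<alpha>)) * ennreal r = ennreal (\<rho> powr (- \<alpha>) * r)"
    using E by (simp add: ennreal_mult)
  also have "ennreal (n * V / (n - \<alpha>) * \<rho> powr (n - \<alpha>)) + ennreal (\<rho> powr (- \<alpha>) * r) =
      ennreal (n * V / (n - \<alpha>) * \<rho> powr (n - \<alpha>) + \<rho> powr (- \<alpha>) * r)"
    using E a n_pos V_pos by (intro ennreal_plus[symmetric]) auto
  also have "\<rho> powr (n - \<alpha>) = r powr (1 - \<alpha> / n)"
    using n_pos by (simp add: \<rho>_def powr_powr diff_divide_distrib)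
  also have "\<rho> powr (- \<alpha>) * r = r powr (1 - \<alpha> / n)"
  proof -
    have "\<rho> powr (- \<alpha>) * r = r powr (- (\<alpha> / n) + 1)"
      using E by (simp only: \<rho>_def powr_powr powr_add) simp
    then show ?thesis by simp
  qed
  finally show ?thesis by (simp add: algebra_simps)
qed

text \<open>Convolution with a kernel of integral at most 1 does not increase the p-norm. This
  controls the small values of a potential, on which the exponential estimate says nothing.\<close>

lemma nn_integral_conv_powr:
  assumes [measurable]: "f \<in> borel_measurable borel" "u \<in> borel_measurable borel"
    and f0: "\<And>y. f y \<ge> 0" and u0: "\<And>x. u x \<ge> 0"
    and f1: "(\<integral>\<^sup>+y. ennreal (f y powr p) \<partial>lborel) \<le> 1"
    and u: "AE x in lborel. ennreal (u x) \<le> (\<integral>\<^sup>+y. ennreal (g (x - y) * f y) \<partial>lborel)"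
  shows "(\<integral>\<^sup>+x. ennreal (u x powr p) \<partial>lborel) \<le> 1"
proof -
  have pw: "ennreal (u x powr p) \<le> (\<integral>\<^sup>+y. ennreal (g (x - y)) * ennreal (f y powr p) \<partial>lborel)" (is "_ \<le> ?I")
    if ux: "ennreal (u x) \<le> (\<integral>\<^sup>+y. ennreal (g (x - y) * f y) \<partial>lborel)" for x
  proof (cases "?I = \<top>")
    case False
    then obtain A where A: "?I = ennreal A" "A \<ge> 0" by (cases ?I) auto
    \<comment> \<open>For fixed x, Hoelder's inequality is applied with the kernel as density; its
      mass is at most 1.\<close>
    let ?M = "density lborel (\<lambda>y. ennreal (g (x - y)))"
    have "ennreal (u x) \<le> (\<integral>\<^sup>+y. ennreal (f y * 1) \<partial>?M)"
      using ux g_nonneg f0 by (simp add: nn_integral_density ennreal_mult)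
    also have "\<dots> \<le> ennreal (A powr (1/p) * 1 powr (1/q))"
    proof (rule nn_integral_Holder[OF p_gt1 q_gt1 pq])
      show "(\<integral>\<^sup>+y. ennreal (f y powr p) \<partial>?M) \<le> ennreal A" using A by (simp add: nn_integral_density)
      show "(\<integral>\<^sup>+y. ennreal (1 powr q) \<partial>?M) \<le> ennreal 1"
        using g_int by (simp add: emeasure_density nn_integral_lborel_reflect[of "\<lambda>z. ennreal (g z)" x])
    qed (use A f0 in auto)
    finally have "u x \<le> A powr (1/p)" by (subst (asm) ennreal_le_iff) auto
    then have "u x powr p \<le> (A powr (1/p)) powr p" using u0 p_gt1 by (intro powr_mono2) auto
    also have "\<dots> = A" using A p_gt1 by (simp add: powr_powr)
    finally show ?thesis unfolding A by (rule ennreal_leI)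
  qed simp
  have "(\<integral>\<^sup>+x. ennreal (u x powr p) \<partial>lborel) \<le> (\<integral>\<^sup>+x. \<integral>\<^sup>+y. ennreal (g (x - y)) * ennreal (f y powr p) \<partial>lborel \<partial>lborel)"
    using u by (intro nn_integral_mono_AE) (auto elim!: eventually_mono dest: pw)
  also have "\<dots> = (\<integral>\<^sup>+y. \<integral>\<^sup>+x. ennreal (g (x - y)) * ennreal (f y powr p) \<partial>lborel \<partial>lborel)"
    by (rule lborel_pair.Fubini') simp
  also have "\<dots> = (\<integral>\<^sup>+y. (\<integral>\<^sup>+x. ennreal (g (x - y)) \<partial>lborel) * ennreal (f y powr p) \<partial>lborel)"
    by (simp add: nn_integral_multc)
  also have "\<dots> = (\<integral>\<^sup>+y. (\<integral>\<^sup>+x. ennreal (g x) \<partial>lborel) * ennreal (f y powr p) \<partial>lborel)"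
    by (subst nn_integral_lborel_translate) auto
  also have "\<dots> = (\<integral>\<^sup>+x. ennreal (g x) \<partial>lborel) * (\<integral>\<^sup>+y. ennreal (f y powr p) \<partial>lborel)"
    by (rule nn_integral_cmult) measurable
  also have "\<dots> \<le> 1 * 1" by (intro mult_mono g_int f1) auto
  finally show ?thesis by simp
qed

end

lemma summable_exp_linear:
  fixes \<kappa> :: real
  assumes "\<kappa> > 0"
  shows "summable (\<lambda>i::nat. exp (- \<kappa> * real (j + i)) * real (j + i))"
proof (rule summable_comparison_test')
  show "summable (\<lambda>i::nat. 2 / \<kappa> * exp (- \<kappa> / 2) ^ i)"
    using assms by (intro summable_mult summable_geometric) auto
  fix i :: nat
  let ?x = "real (j + i)"
  have "\<kappa> / 2 * ?x \<le> exp (\<kappa> / 2 * ?x)" using exp_ge_add_one_self[of "\<kappa> / 2 * ?x"] by linarith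
  then have "?x \<le> 2 / \<kappa> * exp (\<kappa> / 2 * ?x)" using assms by (simp add: field_simps)
  then have "exp (- \<kappa> * ?x) * ?x \<le> exp (- \<kappa> * ?x) * (2 / \<kappa> * exp (\<kappa> / 2 * ?x))"
    by (rule mult_left_mono) simp
  also have "\<dots> = 2 / \<kappa> * exp (- \<kappa> / 2 * ?x)"
    by (simp add: mult_exp_exp field_simps)
  also have "\<dots> \<le> 2 / \<kappa> * exp (- \<kappa> / 2 * real i)"
    using assms by (intro mult_left_mono) auto
  also have "exp (- \<kappa> / 2 * real i) = exp (- \<kappa> / 2) ^ i"
    by (simp flip: exp_of_nat_mult add: mult_ac)
  finally show "norm (exp (- \<kappa> * ?x) * ?x) \<le> 2 / \<kappa> * exp (- \<kappa> / 2) ^ i" by simp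
qed

section \<open>The distribution function and its exponential integral\<close>

context riesz_dominated begin

text \<open>\<open>measure\<close> is 0 on sets of infinite measure, so the values are meaningful
  only at levels whose superlevel set is known to be finite.\<close>

definition distribution :: "('a \<Rightarrow> real) \<Rightarrow> real \<Rightarrow> real" where
  "distribution w s = measure lborel {x. s < w x}"

text \<open>The conclusion of \<open>adams_numeric\<close> for the constants of the locale, as a
  predicate, so that \<open>K\<close> can be fixed before f and u.\<close>

definition adams_const :: "real \<Rightarrow> bool" where
  "adams_const K \<longleftrightarrow> K \<ge> 1 \<and> (\<forall>L w1 w2 t1 t2 \<theta>. C0 \<le> L \<longrightarrow> 0 \<le> \<theta> \<longrightarrow> \<theta> \<le> 1 \<longrightarrow> 0 < w1 \<longrightarrow> w1 \<le> w2 \<longrightarrow>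
      0 \<le> t1 \<longrightarrow> t1 \<le> t2 \<longrightarrow> t1 \<le> w1 + L \<longrightarrow> t2 \<le> w2 + L \<longrightarrow> w1 \<le> t1 + C0 \<longrightarrow>
      w1 powr (1/q) \<le> (1 - \<theta> powr p) powr (1/p) * (t1 + C0) powr (1/q) + \<theta> * C0 powr (1/q) \<longrightarrow>
      w2 powr (1/q) \<le> (t1 + C0) powr (1/q) + \<theta> * (C0 * (t2 - t1 + 1)) powr (1/q) \<longrightarrow>
      w1 \<le> K * L \<or> w2 - w1 \<le> K * L)"

lemma adams_const_exists: "\<exists>K. adams_const K"
  unfolding adams_const_def using adams_numeric[OF p_gt1 q_gt1 pq C0_ge(1)] by metis

text \<open>Levels start at b0, that is at u = 1. From there on Chebyshev's inequality with the
  p-norm gives measures at most 1, so their logarithms have the sign that the level estimates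
  presuppose.\<close>

lemma superlevel_estimates:
  assumes f [measurable]: "f \<in> borel_measurable borel" and f0: "\<And>y. f y \<ge> 0"
    and f1: "(\<integral>\<^sup>+y. ennreal (f y powr p) \<partial>lborel) \<le> 1"
    and u [measurable]: "u \<in> borel_measurable borel" and u0: "\<And>x. u x \<ge> 0"
    and conv: "AE x in lborel. ennreal (u x) \<le> (\<integral>\<^sup>+y. ennreal (g (x - y) * f y) \<partial>lborel)"
  defines "w \<equiv> \<lambda>x. b0 * u x powr q"
  defines "N \<equiv> distribution w"
  defines "lv \<equiv> \<lambda>s. (s / b0) powr (1/q)"
  shows "\<And>s. s \<ge> b0 \<Longrightarrow> emeasure lborel {x. s < w x} = ennreal (N s)"
    "\<And>s. s \<ge> b0 \<Longrightarrow> N s \<le> 1"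
    "\<And>s. s \<ge> b0 \<Longrightarrow> N s > 0 \<Longrightarrow> s \<le> - ln (N s) + C0"
    "mono_on {b0..} (\<lambda>s. - N s)"
    "\<And>s. s \<ge> b0 \<Longrightarrow> AE x in lborel. x \<in> {x. s < w x} \<longrightarrow> ennreal (lv s) \<le> (\<integral>\<^sup>+y. ennreal (g (x - y) * f y) \<partial>lborel)"
    "\<And>s. s \<ge> b0 \<Longrightarrow> b0 * lv s powr q = s" "\<And>s. lv s \<ge> 0"
    "\<And>s. {x. s < w x} \<in> sets borel"
proof -
  have w [measurable]: "w \<in> borel_measurable borel" unfolding w_def by measurable
  show lev [measurable]: "{x. s < w x} \<in> sets borel" for s by simp
  have up: "(\<integral>\<^sup>+x. ennreal (u x powr p) \<partial>lborel) \<le> 1"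
    by (rule nn_integral_conv_powr[OF f u f0 u0 f1 conv])
  have le1: "emeasure lborel {x. s < w x} \<le> 1" if "s \<ge> b0" for s
  proof -
    have "emeasure lborel {x. s < w x} = (\<integral>\<^sup>+x. indicator {x. s < w x} x \<partial>lborel)" by simp
    also have "\<dots> \<le> (\<integral>\<^sup>+x. ennreal (u x powr p) \<partial>lborel)"
    proof (intro nn_integral_mono)
      fix x
      show "indicator {x. s < w x} x \<le> ennreal (u x powr p)"
      proof (cases "s < w x")
        case True
        then have "b0 * 1 < b0 * u x powr q" using that by (simp add: w_def)
        then have "1 < u x powr q" using b0_pos by (simp only: mult_less_cancel_left_pos)
        then have "u x > 1" using u0[of x] q_gt1 powr_le1[of q "u x"] by force
        then have "u x powr p \<ge> 1" using p_gt1 by (intro ge_one_powr_ge_zero) auto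
        then show ?thesis using True by simp
      qed simp
    qed
    finally show ?thesis using up by simp
  qed
  show em: "emeasure lborel {x. s < w x} = ennreal (N s)" if "s \<ge> b0" for s
    unfolding N_def distribution_def using le1[OF that]
    by (intro emeasure_eq_ennreal_measure) (auto simp: top_unique)
  show N1: "N s \<le> 1" if "s \<ge> b0" for s
    using em[OF that] le1[OF that] by simp
  have N0: "N s \<ge> 0" for s by (simp add: N_def distribution_def)
  show "mono_on {b0..} (\<lambda>s. - N s)"
  proof (rule mono_onI)
    fix r s assume rs: "r \<in> {b0..}" "s \<in> {b0..}" "r \<le> s"
    have "emeasure lborel {x. s < w x} \<le> emeasure lborel {x. r < w x}"
      using rs by (intro emeasure_mono) auto
    then show "- N r \<le> - N s" using rs N0 by (simp add: em)
  qed
  show lv1: "b0 * lv s powr q = s" if "s \<ge> b0" for s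
    using that b0_pos q_gt1 by (auto simp: lv_def powr_powr)
  show lv2: "lv s \<ge> 0" for s by (simp add: lv_def)
  show ae: "AE x in lborel. x \<in> {x. s < w x} \<longrightarrow> ennreal (lv s) \<le> (\<integral>\<^sup>+y. ennreal (g (x - y) * f y) \<partial>lborel)"
    if "s \<ge> b0" for s
    using conv
  proof eventually_elim
    case (elim x)
    show ?case
    proof
      assume "x \<in> {x. s < w x}"
      then have "s / b0 < u x powr q" using b0_pos by (simp add: w_def field_simps)
      then have "lv s \<le> (u x powr q) powr (1/q)"
        unfolding lv_def using b0_pos that q_gt1 by (intro powr_mono2) auto
      also have "\<dots> = u x" using u0 q_gt1 by (simp add: powr_powr)
      finally show "ennreal (lv s) \<le> (\<integral>\<^sup>+y. ennreal (g (x - y) * f y) \<partial>lborel)"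
        using elim by (meson ennreal_leI order_trans)
    qed
  qed
  have emt: "emeasure lborel {x. s < w x} = ennreal (exp (- (- ln (N s))))" if "s \<ge> b0" "N s > 0" for s
    using that by (simp add: em)
  have t0: "0 \<le> - ln (N s)" if "s \<ge> b0" "N s > 0" for s
    using N1[OF that(1)] that(2) by simp
  show single: "s \<le> - ln (N s) + C0" if "s \<ge> b0" "N s > 0" for s
    using level_single[OF lev emt[OF that] t0[OF that] f f0 f1 ae[OF that(1)] lv2]
    by (simp add: lv1[OF that(1)])
qed

text \<open>A level s is good for L if its measure is at least exp (- s - L), that is t <= s + L.
  For two good levels \<open>level_pair\<close> supplies the remaining hypotheses of
  \<open>adams_numeric\<close>.\<close>

lemma good_levels_clustered:
  assumes K: "adams_const K"
    and f [measurable]: "f \<in> borel_measurable borel" and f0: "\<And>y. f y \<ge> 0"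
    and f1: "(\<integral>\<^sup>+y. ennreal (f y powr p) \<partial>lborel) \<le> 1"
    and u [measurable]: "u \<in> borel_measurable borel" and u0: "\<And>x. u x \<ge> 0"
    and conv: "AE x in lborel. ennreal (u x) \<le> (\<integral>\<^sup>+y. ennreal (g (x - y) * f y) \<partial>lborel)"
  defines "N \<equiv> distribution (\<lambda>x. b0 * u x powr q)"
  assumes A: "C0 \<le> L" "b0 \<le> s1" "s1 \<le> s2" "exp (- s1 - L) \<le> N s1" "exp (- s2 - L) \<le> N s2"
  shows "s1 \<le> K * L \<or> s2 - s1 \<le> K * L"
proof -
  define w where "w x = b0 * u x powr q" for x
  define lv where "lv s = (s / b0) powr (1/q)" for s
  note dp = superlevel_estimates[OF f f0 f1 u u0 conv, folded w_def lv_def, folded N_def[folded w_def]]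
  note em = dp(1) and N1 = dp(2) and single = dp(3) and mono = dp(4) and ae = dp(5) and lv = dp(6,7) and lev = dp(8)
  have emt: "emeasure lborel {x. s < w x} = ennreal (exp (- (- ln (N s))))" if "s \<ge> b0" "N s > 0" for s
    using that by (simp add: em)
  have t0: "0 \<le> - ln (N s)" if "s \<ge> b0" "N s > 0" for s
    using N1[OF that(1)] that(2) by simp
  have pos: "N s1 > 0" "N s2 > 0" using A(4,5) exp_gt_zero less_le_trans by blast+
  have s2: "b0 \<le> s2" using A by simp
  have "N s2 \<le> N s1"
    using mono A s2 by (auto simp: mono_on_def)
  then have t12: "- ln (N s1) \<le> - ln (N s2)" using pos by simp
  have tb: "- ln (N s1) \<le> s1 + L" "- ln (N s2) \<le> s2 + L"
    using ln_mono[OF A(4) exp_gt_zero] ln_mono[OF A(5) exp_gt_zero] by simp_all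
  from level_pair[OF lev emt[OF A(2) pos(1)] lev emt[OF s2 pos(2)] t0[OF A(2) pos(1)] t12 f f0 f1
      ae[OF A(2)] ae[OF s2] lv(2) lv(2)]
  obtain \<theta> where th: "0 \<le> \<theta>" "\<theta> \<le> 1"
    "s1 powr (1/q) \<le> (1 - \<theta> powr p) powr (1/p) * (- ln (N s1) + C0) powr (1/q) + \<theta> * C0 powr (1/q)"
    "s2 powr (1/q) \<le> (- ln (N s1) + C0) powr (1/q) + \<theta> * (C0 * (- ln (N s2) - - ln (N s1) + 1)) powr (1/q)"
    by (simp only: lv(1)[OF A(2)] lv(1)[OF s2]) metis
  show "s1 \<le> K * L \<or> s2 - s1 \<le> K * L"
    using K A(1,2,3) th b0_pos t0[OF A(2) pos(1)] t12 tb single[OF A(2) pos(1)]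
    unfolding adams_const_def by (smt (verit, best))
qed

text \<open>A single point s0 > a of S confines the others: each lies between 0 and a or within
  distance a of s0.\<close>

lemma emeasure_clustered_set:
  assumes "S \<in> sets borel" "S \<subseteq> {0..}" "a \<ge> 0"
    and S: "\<And>s1 s2. s1 \<in> S \<Longrightarrow> s2 \<in> S \<Longrightarrow> s1 \<le> s2 \<Longrightarrow> s1 \<le> a \<or> s2 - s1 \<le> a"
  shows "emeasure lborel (S :: real set) \<le> ennreal (3 * a)"
proof (cases "S \<subseteq> {0..a}")
  case True
  then have "emeasure lborel S \<le> emeasure lborel {0..a}" by (intro emeasure_mono) auto
  also have "\<dots> \<le> ennreal (3 * a)" using assms by (auto intro: ennreal_leI)
  finally show ?thesis .
next
  case False
  then obtain s0 where s0: "s0 \<in> S" "s0 > a" using assms(2) by (auto simp: subset_iff not_le)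
  have "S \<subseteq> {0..a} \<union> {s0 - a..s0 + a}"
  proof
    fix s assume "s \<in> S"
    then show "s \<in> {0..a} \<union> {s0 - a..s0 + a}"
      using S[of s s0] S[of s0 s] s0 assms(2) by (cases "s \<le> s0") auto
  qed
  then have "emeasure lborel S \<le> emeasure lborel ({0..a} \<union> {s0 - a..s0 + a})"
    by (intro emeasure_mono) auto
  also have "\<dots> \<le> emeasure lborel {0..a} + emeasure lborel {s0 - a..s0 + a}"
    by (intro emeasure_subadditive) auto
  also have "\<dots> = ennreal (3 * a)"
    using assms by (simp flip: ennreal_plus)
  finally show ?thesis .
qed

text \<open>With F = - ln (N s) - s the integrand is exp (- \<kappa> * F). Levels are sorted by the
  ceiling of F; the length of a class grows at most linearly by clustering, while the integrand
  decays exponentially.\<close>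

lemma distribution_exp_integral:
  assumes \<kappa>: "\<kappa> > 0"
  obtains C where "C \<ge> 0" "\<And>f u. f \<in> borel_measurable borel \<Longrightarrow> (\<And>y. f y \<ge> 0) \<Longrightarrow>
      (\<integral>\<^sup>+y. ennreal (f y powr p) \<partial>lborel) \<le> 1 \<Longrightarrow> u \<in> borel_measurable borel \<Longrightarrow> (\<And>x. u x \<ge> 0) \<Longrightarrow>
      (AE x in lborel. ennreal (u x) \<le> (\<integral>\<^sup>+y. ennreal (g (x - y) * f y) \<partial>lborel)) \<Longrightarrow>
     (\<integral>\<^sup>+s. ennreal (exp (\<kappa> * s) * distribution (\<lambda>x. b0 * u x powr q) s powr \<kappa>) * indicator {b0..} s \<partial>lborel) \<le> ennreal C"
proof -
  obtain K where K: "adams_const K" using adams_const_exists by auto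
  then have K1: "K \<ge> 1" by (simp add: adams_const_def)
  define j where "j = nat \<lceil>C0\<rceil>"
  have j: "C0 \<le> real j" by (simp add: j_def of_nat_ceiling)
  define A where "A = exp (\<kappa> * (2 * real j + 1))"
  define c where "c i = A * (exp (- \<kappa> * real (j + i)) * (3 * (K * real (j + i))))" for i
  have c0: "c i \<ge> 0" for i using K1 by (simp add: c_def A_def)
  have sc: "summable c"
  proof -
    have "c = (\<lambda>i. A * 3 * K * (exp (- \<kappa> * real (j + i)) * real (j + i)))"
      by (auto simp: c_def fun_eq_iff)
    then show ?thesis using summable_mult[OF summable_exp_linear[OF \<kappa>, of j], of "A * 3 * K"] by simp
  qed
  show thesis
  proof (rule that[of "suminf c"])
    show "suminf c \<ge> 0" using c0 sc by (intro suminf_nonneg) auto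
    fix f u :: "'a \<Rightarrow> real"
    assume f: "f \<in> borel_measurable borel" "\<And>y. f y \<ge> 0" "(\<integral>\<^sup>+y. ennreal (f y powr p) \<partial>lborel) \<le> 1"
      and u: "u \<in> borel_measurable borel" "\<And>x. u x \<ge> 0"
        "AE x in lborel. ennreal (u x) \<le> (\<integral>\<^sup>+y. ennreal (g (x - y) * f y) \<partial>lborel)"
    define N where "N = distribution (\<lambda>x. b0 * u x powr q)"
    note gs = superlevel_estimates[OF f(1,2,3) u(1,2,3), folded N_def]
    have N0: "N s \<ge> 0" for s by (simp add: N_def distribution_def)
    \<comment> \<open>\<open>N\<close> is known to be monotone only from \<open>b0\<close> on;
      clamping the argument makes it monotone, hence measurable, on the whole line.\<close>
    have "(\<lambda>s. N (max b0 s)) = (\<lambda>s. - (- N (max b0 s)))" by simp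
    moreover have "mono (\<lambda>s. - N (max b0 s))"
      using gs(4) by (auto simp: mono_def mono_on_def)
    ultimately have Nm [measurable]: "(\<lambda>s. N (max b0 s)) \<in> borel_measurable borel"
      by (metis borel_measurable_mono borel_measurable_uminus)
    define S where "S L = {s. b0 \<le> s \<and> exp (- s - L) \<le> N (max b0 s)}" for L
    have Sm [measurable]: "S L \<in> sets borel" for L unfolding S_def by measurable
    have Sem: "emeasure lborel (S (real (j + i))) \<le> ennreal (3 * (K * real (j + i)))" for i
    proof (rule emeasure_clustered_set)
      show "S (real (j + i)) \<subseteq> {0..}" using b0_pos by (auto simp: S_def)
      show "s1 \<le> K * real (j + i) \<or> s2 - s1 \<le> K * real (j + i)"
        if "s1 \<in> S (real (j + i))" "s2 \<in> S (real (j + i))" "s1 \<le> s2" for s1 s2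
        using that j by (intro good_levels_clustered[OF K f(1,2,3) u(1,2,3), folded N_def]) (auto simp: S_def max_def split: if_splits)
    qed (use K1 in auto)
    have pw: "ennreal (exp (\<kappa> * s) * N s powr \<kappa>) * indicator {b0..} s \<le>
        (\<Sum>i. ennreal (A * exp (- \<kappa> * real (j + i))) * indicator (S (real (j + i))) s)" for s
    proof (cases "s \<ge> b0 \<and> N s > 0")
      case False
      then have "N s = 0 \<or> s < b0" using N0[of s] by auto
      then show ?thesis using \<kappa> by auto
    next
      case True
      define F where "F = - ln (N s) - s"
      have F: "F \<ge> - real j" using gs(3)[of s] True j by (simp add: F_def)
      have NF: "N s = exp (- s - F)" using True by (simp add: F_def)
      \<comment> \<open>The classes are numbered by j + i so that L = real (j + i) is at least C0,
        as clustering requires. All levels with F <= j go to i = 0; as F >= - j, the factor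
        \<open>A\<close> absorbs what the exponential overestimates there.\<close>
      define i where "i = nat (\<lceil>F\<rceil> - int j)"
      have i1: "F \<le> real (j + i)" unfolding i_def by linarith
      have i2: "- F \<le> 2 * real j + 1 - real (j + i)"
      proof (cases "\<lceil>F\<rceil> \<le> int j")
        case True
        then have "i = 0" by (simp add: i_def)
        then show ?thesis using F by simp
      next
        case False
        then have "real (j + i) = of_int \<lceil>F\<rceil>" by (simp add: i_def)
        then have "real (j + i) < F + 1" by linarith
        then show ?thesis by linarith
      qed
      have sS: "s \<in> S (real (j + i))"
        using True i1 by (simp add: S_def NF max_def)
      have "exp (\<kappa> * s) * N s powr \<kappa> = exp (\<kappa> * (- F))"
        by (simp add: NF powr_def mult_exp_exp algebra_simps)
      also have "\<dots> \<le> exp (\<kappa> * (2 * real j + 1 - real (j + i)))"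
        by (simp only: exp_le_cancel_iff) (rule mult_left_mono[OF i2], use \<kappa> in simp)
      also have "\<dots> = A * exp (- \<kappa> * real (j + i))"
        by (simp add: A_def mult_exp_exp algebra_simps)
      finally have "ennreal (exp (\<kappa> * s) * N s powr \<kappa>) * indicator {b0..} s \<le>
        ennreal (A * exp (- \<kappa> * real (j + i))) * indicator (S (real (j + i))) s"
        using sS True by (auto intro: ennreal_leI)
      also have "\<dots> \<le> (\<Sum>i. ennreal (A * exp (- \<kappa> * real (j + i))) * indicator (S (real (j + i))) s)"
      proof -
        have "T i \<le> (\<Sum>i. T i)" for T :: "nat \<Rightarrow> ennreal"
          using sum_le_suminf[OF summableI, of "{i}" T] by simp
        then show ?thesis .
      qed
      finally show ?thesis .
    qed
    have "(\<integral>\<^sup>+s. ennreal (exp (\<kappa> * s) * N s powr \<kappa>) * indicator {b0..} s \<partial>lborel) \<le>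
      (\<integral>\<^sup>+s. (\<Sum>i. ennreal (A * exp (- \<kappa> * real (j + i))) * indicator (S (real (j + i))) s) \<partial>lborel)"
      by (intro nn_integral_mono pw)
    also have "\<dots> = (\<Sum>i. \<integral>\<^sup>+s. ennreal (A * exp (- \<kappa> * real (j + i))) * indicator (S (real (j + i))) s \<partial>lborel)"
      by (rule nn_integral_suminf) measurable
    also have "\<dots> = (\<Sum>i. ennreal (A * exp (- \<kappa> * real (j + i))) * emeasure lborel (S (real (j + i))))"
      by (simp add: nn_integral_cmult_indicator)
    also have "\<dots> \<le> (\<Sum>i. ennreal (c i))"
    proof (intro suminf_le summableI)
      fix i
      have "ennreal (A * exp (- \<kappa> * real (j + i))) * emeasure lborel (S (real (j + i))) \<le>
        ennreal (A * exp (- \<kappa> * real (j + i))) * ennreal (3 * (K * real (j + i)))"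
        by (intro mult_left_mono Sem) auto
      also have "\<dots> = ennreal (c i)"
        using K1 by (subst ennreal_mult[symmetric]) (auto simp: c_def A_def mult_ac)
      finally show "ennreal (A * exp (- \<kappa> * real (j + i))) * emeasure lborel (S (real (j + i))) \<le> ennreal (c i)" .
    qed
    also have "\<dots> = ennreal (suminf c)" using c0 sc by (intro suminf_ennreal2) auto
    finally show "(\<integral>\<^sup>+s. ennreal (exp (\<kappa> * s) * distribution (\<lambda>x. b0 * u x powr q) s powr \<kappa>) * indicator {b0..} s \<partial>lborel) \<le> ennreal (suminf c)"
      by (simp add: N_def)
  qed
qed

text \<open>Below the level b0 the behaviour of \<phi> at 0 and the p-norm of u suffice. Above it
  the weight replaces the measure of a superlevel set by its power \<kappa> = 1 - \<alpha> / n, and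
  the same factor \<kappa> reduces the exponent, so both combine to the integral of
  \<open>distribution_exp_integral\<close>.\<close>

theorem singular_adams_potential:
  assumes a: "0 \<le> \<alpha>" "\<alpha> < n" and b: "0 \<le> \<beta>" "\<beta> \<le> (1 - \<alpha> / n) * b0"
    and \<phi>: "\<And>t. t \<ge> 0 \<Longrightarrow> \<phi> t \<le> exp t" "\<And>t. 0 \<le> t \<Longrightarrow> t \<le> b0 \<Longrightarrow> \<phi> t \<le> D * t powr (p / q)"
    and D: "D \<ge> 0"
  obtains C where "\<And>f u. f \<in> borel_measurable borel \<Longrightarrow> (\<And>y. f y \<ge> 0) \<Longrightarrow>
      (\<integral>\<^sup>+y. ennreal (f y powr p) \<partial>lborel) \<le> 1 \<Longrightarrow> u \<in> borel_measurable borel \<Longrightarrow> (\<And>x. u x \<ge> 0) \<Longrightarrow>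
      (AE x in lborel. ennreal (u x) \<le> (\<integral>\<^sup>+y. ennreal (g (x - y) * f y) \<partial>lborel)) \<Longrightarrow>
     (\<integral>\<^sup>+x. ennreal (\<phi> (\<beta> * u x powr q) / norm x powr \<alpha>) \<partial>lborel) \<le> ennreal C"
proof -
  define \<kappa> where "\<kappa> = 1 - \<alpha> / n"
  have \<kappa>: "\<kappa> > 0" "\<kappa> \<le> 1" using a n_pos by (auto simp: \<kappa>_def)
  obtain C1 where C1: "C1 \<ge> 0" "\<And>f u. f \<in> borel_measurable borel \<Longrightarrow> (\<And>y. f y \<ge> 0) \<Longrightarrow>
      (\<integral>\<^sup>+y. ennreal (f y powr p) \<partial>lborel) \<le> 1 \<Longrightarrow> u \<in> borel_measurable borel \<Longrightarrow> (\<And>x. u x \<ge> 0) \<Longrightarrow>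
      (AE x in lborel. ennreal (u x) \<le> (\<integral>\<^sup>+y. ennreal (g (x - y) * f y) \<partial>lborel)) \<Longrightarrow>
     (\<integral>\<^sup>+s. ennreal (exp (\<kappa> * s) * distribution (\<lambda>x. b0 * u x powr q) s powr \<kappa>) * indicator {b0..} s \<partial>lborel) \<le> ennreal C1"
    by (rule distribution_exp_integral[OF \<kappa>(1)]) blast
  define Ca where "Ca = n * V / (n - \<alpha>) + 1"
  have Ca: "Ca \<ge> 1" using a n_pos V_pos by (simp add: Ca_def)
  define E where "E = D * b0 powr (p / q)"
  have E: "E \<ge> 0" using D by (simp add: E_def)
  have bb: "\<beta> \<le> b0" "\<beta> \<le> \<kappa> * b0"
  proof -
    show "\<beta> \<le> \<kappa> * b0" using b(2) unfolding \<kappa>_def .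
    also have "\<dots> \<le> 1 * b0" using \<kappa> b0_pos by (intro mult_right_mono) auto
    finally show "\<beta> \<le> b0" by simp
  qed
  show thesis
  proof (rule that[of "E * (n * V / (n - \<alpha>) + 1) + (exp (\<kappa> * b0) * Ca + \<kappa> * Ca * C1)"])
    fix f u :: "'a \<Rightarrow> real"
    assume f: "f \<in> borel_measurable borel" "\<And>y. f y \<ge> 0" "(\<integral>\<^sup>+y. ennreal (f y powr p) \<partial>lborel) \<le> 1"
      and u: "u \<in> borel_measurable borel" "\<And>x. u x \<ge> 0"
        "AE x in lborel. ennreal (u x) \<le> (\<integral>\<^sup>+y. ennreal (g (x - y) * f y) \<partial>lborel)"
    note [measurable] = f(1) u(1)
    define w where "w x = b0 * u x powr q" for x
    have [measurable]: "w \<in> borel_measurable borel" unfolding w_def[abs_def] by measurable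
    define N where "N = distribution w"
    have N0: "N s \<ge> 0" for s by (simp add: N_def distribution_def)
    note gs = superlevel_estimates[OF f(1,2,3) u(1,2,3), folded w_def, folded N_def]
    have mu: "(\<integral>\<^sup>+x. ennreal (norm x powr (- \<alpha>)) * indicator {x. s < w x} x \<partial>lborel) \<le> ennreal (Ca * N s powr \<kappa>)"
      if "s \<ge> b0" for s
    proof (cases "N s = 0")
      case True
      then have "emeasure lborel {x. s < w x} = 0" using gs(1)[OF that] by simp
      then have "AE x in lborel. x \<notin> {x. s < w x}" by (intro AE_not_in null_setsI) auto
      then have "(\<integral>\<^sup>+x. ennreal (norm x powr (- \<alpha>)) * indicator {x. s < w x} x \<partial>lborel) = (\<integral>\<^sup>+x. 0 \<partial>(lborel::'a measure))"
        by (intro nn_integral_cong_AE) (auto elim!: eventually_mono)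
      then show ?thesis by simp
    next
      case False
      then show ?thesis
        using N0[of s] a unfolding Ca_def \<kappa>_def
        by (intro nn_integral_weight gs(1)[OF that]) auto
    qed
    have split: "ennreal (\<phi> (\<beta> * u x powr q) / norm x powr \<alpha>) \<le>
       ennreal E * (ennreal (norm x powr ((n - \<alpha>) - n)) * indicator {x. norm x < 1} x + ennreal (u x powr p)) +
       (ennreal (exp (\<kappa> * b0)) * (ennreal (norm x powr (- \<alpha>)) * indicator {x. b0 < w x} x) +
       (\<integral>\<^sup>+s. ennreal (\<kappa> * exp (\<kappa> * s)) * indicator {b0..} s * (ennreal (norm x powr (- \<alpha>)) * indicator {x. s < w x} x) \<partial>lborel))"
      (is "_ \<le> ?P x + (?Q x + ?R x)") for x
    proof (cases "b0 < w x")
      case False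
      have "w x \<le> b0 * 1" using False by simp
      then have u1: "u x powr q \<le> 1" using b0_pos unfolding w_def by (simp only: mult_le_cancel_left_pos)
      have t: "\<beta> * u x powr q \<le> b0" using bb(1) u1 b(1) b0_pos mult_mono[of \<beta> b0 "u x powr q" 1] by simp
      have "\<phi> (\<beta> * u x powr q) \<le> D * (\<beta> * u x powr q) powr (p / q)"
        using t b by (intro \<phi>) auto
      also have "\<dots> \<le> D * (b0 * u x powr q) powr (p / q)"
        using D bb b p_gt1 q_gt1 by (intro mult_left_mono powr_mono2 mult_right_mono) auto
      also have "\<dots> = E * u x powr p"
        using b0_pos u q_gt1 by (simp add: E_def powr_mult powr_powr)
      finally have ph: "\<phi> (\<beta> * u x powr q) \<le> E * u x powr p" .
      \<comment> \<open>Near the origin u <= 1 leaves the integrable weight; away from it the weight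
        is at most 1 and leaves u powr p.\<close>
      have "\<phi> (\<beta> * u x powr q) / norm x powr \<alpha> \<le> E * (norm x powr (- \<alpha>) * indicator {x. norm x < 1} x + u x powr p)"
      proof (cases "norm x < 1")
        case True
        have "u x \<le> 1"
        proof (rule ccontr)
          assume "\<not> u x \<le> 1"
          then have "1 < u x powr q" using q_gt1 by (intro gr_one_powr) auto
          then show False using u1 by simp
        qed
        then have "u x powr p \<le> 1" using u p_gt1 by (intro powr_le1) auto
        then have "E * u x powr p \<le> E * 1" using E by (rule mult_left_mono)
        then have "\<phi> (\<beta> * u x powr q) / norm x powr \<alpha> \<le> E / norm x powr \<alpha>"
          using ph by (intro divide_right_mono) auto
        also have "\<dots> = E * norm x powr (- \<alpha>)" by (simp add: powr_minus divide_inverse)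
        also have "\<dots> \<le> E * (norm x powr (- \<alpha>) * indicator {x. norm x < 1} x + u x powr p)"
          using True E by (intro mult_left_mono) auto
        finally show ?thesis .
      next
        case False
        then have "norm x powr \<alpha> \<ge> 1" using a by (intro ge_one_powr_ge_zero) auto
        moreover have "E * u x powr p \<ge> 0" using E by simp
        ultimately have "E * u x powr p / norm x powr \<alpha> \<le> E * u x powr p / 1"
          by (intro divide_left_mono) auto
        moreover have "\<phi> (\<beta> * u x powr q) / norm x powr \<alpha> \<le> E * u x powr p / norm x powr \<alpha>"
          using ph by (rule divide_right_mono) simp
        ultimately have "\<phi> (\<beta> * u x powr q) / norm x powr \<alpha> \<le> E * u x powr p" by simp
        then show ?thesis using False by simp
      qed
      then have "ennreal (\<phi> (\<beta> * u x powr q) / norm x powr \<alpha>) \<le> ?P x"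
        using E by (auto simp: ennreal_mult ennreal_plus ennreal_indicator[symmetric] simp flip: ennreal_mult ennreal_plus intro!: ennreal_leI)
      then show ?thesis by (rule order_trans) simp
    next
      case True
      have "\<beta> * u x powr q \<le> \<kappa> * b0 * u x powr q" using bb(2) by (rule mult_right_mono) simp
      then have "\<beta> * u x powr q \<le> \<kappa> * w x" by (simp add: w_def mult.assoc)
      then have "\<phi> (\<beta> * u x powr q) \<le> exp (\<kappa> * w x)"
        using \<phi>(1)[of "\<beta> * u x powr q"] b by (meson exp_le_cancel_iff mult_nonneg_nonneg order_trans powr_ge_zero)
      then have "\<phi> (\<beta> * u x powr q) / norm x powr \<alpha> \<le> exp (\<kappa> * w x) * norm x powr (- \<alpha>)"
        by (simp add: powr_minus divide_inverse mult_right_mono)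
      then have "ennreal (\<phi> (\<beta> * u x powr q) / norm x powr \<alpha>) \<le> ennreal (exp (\<kappa> * w x)) * ennreal (norm x powr (- \<alpha>))"
        by (simp flip: ennreal_mult add: ennreal_leI)
      \<comment> \<open>Layer-cake formula: the exponential becomes an integral over the levels
        between b0 and w x, so that the integral over x can be taken level by level.\<close>
      also have "ennreal (exp (\<kappa> * w x)) = ennreal (exp (\<kappa> * b0)) + ennreal (exp (\<kappa> * w x) - exp (\<kappa> * b0))"
        using True \<kappa> by (simp flip: ennreal_plus)
      also have "ennreal (exp (\<kappa> * w x) - exp (\<kappa> * b0)) = (\<integral>\<^sup>+s. ennreal (\<kappa> * exp (\<kappa> * s)) * indicator {b0..w x} s \<partial>lborel)"
        using True \<kappa> by (intro nn_integral_FTC_Icc[symmetric]) (auto intro!: derivative_eq_intros)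
      also have "\<dots> = (\<integral>\<^sup>+s. ennreal (\<kappa> * exp (\<kappa> * s)) * indicator {b0..} s * indicator {x. s < w x} x \<partial>lborel)"
        using AE_lborel_singleton[of "w x"] by (intro nn_integral_cong_AE) (auto elim!: eventually_mono split: split_indicator)
      also have "(ennreal (exp (\<kappa> * b0)) + (\<integral>\<^sup>+s. ennreal (\<kappa> * exp (\<kappa> * s)) * indicator {b0..} s * indicator {x. s < w x} x \<partial>lborel)) *
          ennreal (norm x powr (- \<alpha>)) = ?Q x + ?R x"
      proof -
        have "(\<integral>\<^sup>+s. ennreal (\<kappa> * exp (\<kappa> * s)) * indicator {b0..} s * indicator {x. s < w x} x \<partial>lborel) * ennreal (norm x powr (- \<alpha>)) =
          (\<integral>\<^sup>+s. ennreal (\<kappa> * exp (\<kappa> * s)) * indicator {b0..} s * indicator {s. s < w x} s * ennreal (norm x powr (- \<alpha>)) \<partial>lborel)"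
          by (subst nn_integral_multc[symmetric]) (auto intro!: nn_integral_cong split: split_indicator)
        also have "\<dots> = ?R x" by (auto intro!: nn_integral_cong split: split_indicator simp: mult_ac)
        finally show ?thesis using True by (simp add: distrib_right)
      qed
      finally show ?thesis by (rule order_trans) simp
    qed
    have [measurable]: "{s \<in> space (borel \<Otimes>\<^sub>M borel). fst s < w (snd s)} \<in> sets (borel \<Otimes>\<^sub>M (borel :: 'a measure))"
      by measurable
    have R: "(\<integral>\<^sup>+x. ?R x \<partial>lborel) \<le> ennreal (\<kappa> * Ca * C1)"
    proof -
      have "(\<integral>\<^sup>+x. ?R x \<partial>lborel) = (\<integral>\<^sup>+s. \<integral>\<^sup>+x. ennreal (\<kappa> * exp (\<kappa> * s)) * indicator {b0..} s * (ennreal (norm x powr (- \<alpha>)) * indicator {x. s < w x} x) \<partial>lborel \<partial>lborel)"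
        by (rule lborel_pair.Fubini') measurable
      also have "\<dots> = (\<integral>\<^sup>+s. ennreal (\<kappa> * exp (\<kappa> * s)) * indicator {b0..} s * (\<integral>\<^sup>+x. ennreal (norm x powr (- \<alpha>)) * indicator {x. s < w x} x \<partial>lborel) \<partial>lborel)"
        by (intro nn_integral_cong nn_integral_cmult) measurable
      also have "\<dots> \<le> (\<integral>\<^sup>+s. ennreal (\<kappa> * Ca) * (ennreal (exp (\<kappa> * s) * N s powr \<kappa>) * indicator {b0..} s) \<partial>lborel)"
      proof (intro nn_integral_mono)
        fix s
        show "ennreal (\<kappa> * exp (\<kappa> * s)) * indicator {b0..} s * (\<integral>\<^sup>+x. ennreal (norm x powr (- \<alpha>)) * indicator {x. s < w x} x \<partial>lborel) \<le>
          ennreal (\<kappa> * Ca) * (ennreal (exp (\<kappa> * s) * N s powr \<kappa>) * indicator {b0..} s)"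
        proof (cases "s \<ge> b0")
          case True
          have "ennreal (\<kappa> * exp (\<kappa> * s)) * (\<integral>\<^sup>+x. ennreal (norm x powr (- \<alpha>)) * indicator {x. s < w x} x \<partial>lborel) \<le>
            ennreal (\<kappa> * exp (\<kappa> * s)) * ennreal (Ca * N s powr \<kappa>)"
            by (intro mult_left_mono mu True) auto
          also have "\<dots> = ennreal (\<kappa> * Ca) * ennreal (exp (\<kappa> * s) * N s powr \<kappa>)"
            using \<kappa> Ca by (simp add: mult_ac flip: ennreal_mult)
          finally show ?thesis using True by simp
        qed simp
      qed
      also have "\<dots> \<le> ennreal (\<kappa> * Ca) * ennreal C1"
      proof -
        have Nmeas: "(\<lambda>s. ennreal (exp (\<kappa> * s) * N s powr \<kappa>) * indicator {b0..} s) \<in> borel_measurable lborel"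
        proof -
          have "mono (\<lambda>s. - N (max b0 s))"
            using gs(4) by (auto simp: mono_def mono_on_def)
          then have "(\<lambda>s. - (- N (max b0 s))) \<in> borel_measurable borel"
            by (intro borel_measurable_uminus borel_measurable_mono)
          then have [measurable]: "(\<lambda>s. N (max b0 s)) \<in> borel_measurable borel" by simp
          have "(\<lambda>s. ennreal (exp (\<kappa> * s) * N (max b0 s) powr \<kappa>) * indicator {b0..} s) \<in> borel_measurable lborel"
            by measurable
          also have "(\<lambda>s. ennreal (exp (\<kappa> * s) * N (max b0 s) powr \<kappa>) * indicator {b0..} s) =
            (\<lambda>s. ennreal (exp (\<kappa> * s) * N s powr \<kappa>) * indicator {b0..} s)"
            by (auto simp: fun_eq_iff max_def split: split_indicator)
          finally show ?thesis .
        qed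
        show ?thesis
          using C1(2)[OF f u] by (subst nn_integral_cmult[OF Nmeas]) (auto simp: N_def w_def[abs_def] intro!: mult_left_mono)
      qed
      also have "\<dots> = ennreal (\<kappa> * Ca * C1)" using \<kappa> Ca C1 by (simp flip: ennreal_mult)
      finally show ?thesis .
    qed
    have Q: "(\<integral>\<^sup>+x. ?Q x \<partial>lborel) \<le> ennreal (exp (\<kappa> * b0) * Ca)"
    proof -
      have "(\<integral>\<^sup>+x. ?Q x \<partial>lborel) = ennreal (exp (\<kappa> * b0)) * (\<integral>\<^sup>+x. ennreal (norm x powr (- \<alpha>)) * indicator {x. b0 < w x} x \<partial>lborel)"
        by (rule nn_integral_cmult) measurable
      also have "\<dots> \<le> ennreal (exp (\<kappa> * b0)) * ennreal (Ca * N b0 powr \<kappa>)"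
        by (intro mult_left_mono mu) auto
      also have "\<dots> \<le> ennreal (exp (\<kappa> * b0)) * ennreal (Ca * 1)"
        using gs(2)[of b0] N0[of b0] Ca \<kappa> by (intro mult_left_mono ennreal_leI powr_le1) auto
      finally show ?thesis using Ca by (simp flip: ennreal_mult)
    qed
    have P: "(\<integral>\<^sup>+x. ?P x \<partial>lborel) \<le> ennreal (E * (n * V / (n - \<alpha>) + 1))"
    proof -
      have "(\<integral>\<^sup>+x. ?P x \<partial>lborel) = ennreal E * (\<integral>\<^sup>+x. ennreal (norm x powr ((n - \<alpha>) - n)) * indicator {x. norm x < 1} x + ennreal (u x powr p) \<partial>lborel)"
        by (rule nn_integral_cmult) measurable
      also have "(\<integral>\<^sup>+x. ennreal (norm x powr ((n - \<alpha>) - n)) * indicator {x. norm x < 1} x + ennreal (u x powr p) \<partial>lborel) =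
        (\<integral>\<^sup>+x. ennreal (norm (x::'a) powr ((n - \<alpha>) - n)) * indicator {x. norm x < 1} x \<partial>lborel) + (\<integral>\<^sup>+x. ennreal (u x powr p) \<partial>lborel)"
        by (rule nn_integral_add) measurable
      also have "\<dots> \<le> ennreal (n * V / (n - \<alpha>) * 1 powr (n - \<alpha>)) + ennreal 1"
      proof (rule add_mono)
        show "(\<integral>\<^sup>+x. ennreal (norm (x::'a) powr ((n - \<alpha>) - n)) * indicator {x. norm x < 1} x \<partial>lborel) \<le> ennreal (n * V / (n - \<alpha>) * 1 powr (n - \<alpha>))"
          using a ball_int[of "n - \<alpha>" 1] by simp
        show "(\<integral>\<^sup>+x. ennreal (u x powr p) \<partial>lborel) \<le> ennreal 1"
          using nn_integral_conv_powr[OF f(1) u(1) f(2) u(2) f(3) u(3)] by simp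
      qed
      also have "\<dots> = ennreal (n * V / (n - \<alpha>) + 1)"
        using a n_pos V_pos by (subst ennreal_plus[symmetric]) auto
      finally show ?thesis using E a n_pos V_pos by (simp add: ennreal_mult mult_left_mono)
    qed
    have "(\<integral>\<^sup>+x. ennreal (\<phi> (\<beta> * u x powr q) / norm x powr \<alpha>) \<partial>lborel) \<le> (\<integral>\<^sup>+x. ?P x + (?Q x + ?R x) \<partial>lborel)"
      by (intro nn_integral_mono split)
    also have "\<dots> = (\<integral>\<^sup>+x. ?P x \<partial>lborel) + ((\<integral>\<^sup>+x. ?Q x \<partial>lborel) + (\<integral>\<^sup>+x. ?R x \<partial>lborel))"
    proof -
      have Rm: "?R \<in> borel_measurable lborel" by measurable
      have Qm: "?Q \<in> borel_measurable lborel" by measurable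
      have Pm: "?P \<in> borel_measurable lborel" by measurable
      show ?thesis
        by (subst nn_integral_add[OF Pm borel_measurable_add[OF Qm Rm]], subst nn_integral_add[OF Qm Rm], rule refl)
    qed
    also have "\<dots> \<le> ennreal (E * (n * V / (n - \<alpha>) + 1)) + (ennreal (exp (\<kappa> * b0) * Ca) + ennreal (\<kappa> * Ca * C1))"
      by (intro add_mono P Q R)
    also have "\<dots> = ennreal (E * (n * V / (n - \<alpha>) + 1) + (exp (\<kappa> * b0) * Ca + \<kappa> * Ca * C1))"
    proof -
      have "ennreal X + (ennreal Y + ennreal Z) = ennreal (X + (Y + Z))" if "X \<ge> 0" "Y \<ge> 0" "Z \<ge> 0" for X Y Z :: real
        using that by simp
      then show ?thesis using E a n_pos V_pos Ca \<kappa> C1(1) by simp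
    qed
    finally show "(\<integral>\<^sup>+x. ennreal (\<phi> (\<beta> * u x powr q) / norm x powr \<alpha>) \<partial>lborel) \<le>
      ennreal (E * (n * V / (n - \<alpha>) + 1) + (exp (\<kappa> * b0) * Ca + \<kappa> * Ca * C1))" .
  qed
qed

end

section \<open>Test functions of product form and integration by parts\<close>

text \<open>Concrete test functions will be products of one-variable functions of the coordinates,
  so smoothness is set up in one variable first.\<close>

primrec smooth_upto :: "nat \<Rightarrow> (real \<Rightarrow> real) \<Rightarrow> bool" where
  "smooth_upto 0 f \<longleftrightarrow> continuous_on UNIV f"
| "smooth_upto (Suc k) f \<longleftrightarrow> (\<exists>f'. (\<forall>x. (f has_real_derivative f' x) (at x)) \<and> smooth_upto k f')"

definition smooth1 :: "(real \<Rightarrow> real) \<Rightarrow> bool" where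
  "smooth1 f \<longleftrightarrow> (\<forall>k. smooth_upto k f)"

lemma smooth_upto_continuous: "smooth_upto k f \<Longrightarrow> continuous_on UNIV f"
  by (cases k) (auto intro: DERIV_continuous_on)

lemma smooth_upto_Suc_D: "smooth_upto (Suc k) f \<Longrightarrow> smooth_upto k f"
proof (induction k arbitrary: f)
  case 0
  then show ?case using smooth_upto_continuous[of "Suc 0" f] by simp
next
  case (Suc k)
  from Suc.prems obtain f' where "\<And>x. (f has_real_derivative f' x) (at x)" "smooth_upto (Suc k) f'"
    by auto
  with Suc.IH show ?case by auto
qed

lemma smooth_upto_add: "smooth_upto k f \<Longrightarrow> smooth_upto k g \<Longrightarrow> smooth_upto k (\<lambda>x. f x + g x)"
proof (induction k arbitrary: f g)
  case (Suc k)
  then obtain f' g' where "\<And>x. (f has_real_derivative f' x) (at x)" "smooth_upto k f'"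
    "\<And>x. (g has_real_derivative g' x) (at x)" "smooth_upto k g'" by auto
  with Suc.IH show ?case by (auto intro!: exI[of _ "\<lambda>x. f' x + g' x"] DERIV_add)
qed (auto intro: continuous_on_add)

lemma smooth_upto_mult: "smooth_upto k f \<Longrightarrow> smooth_upto k g \<Longrightarrow> smooth_upto k (\<lambda>x. f x * g x)"
proof (induction k arbitrary: f g)
  case (Suc k)
  then obtain f' g' where d: "\<And>x. (f has_real_derivative f' x) (at x)" "smooth_upto k f'"
    "\<And>x. (g has_real_derivative g' x) (at x)" "smooth_upto k g'" by auto
  have "smooth_upto k (\<lambda>x. f' x * g x + g' x * f x)"
    using Suc d smooth_upto_Suc_D by (intro smooth_upto_add Suc.IH) blast+
  then show ?case using d by (auto intro!: exI[of _ "\<lambda>x. f' x * g x + g' x * f x"] DERIV_mult)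
qed (auto intro: continuous_on_mult)

lemma smooth_upto_affine: "smooth_upto k f \<Longrightarrow> smooth_upto k (\<lambda>x. c * f (a * x + b))"
proof (induction k arbitrary: f c)
  case (Suc k)
  then obtain f' where d: "\<And>x. (f has_real_derivative f' x) (at x)" "smooth_upto k f'" by auto
  have "((\<lambda>x. c * f (a * x + b)) has_real_derivative c * a * f' (a * x + b)) (at x)" for x
    by (rule derivative_eq_intros DERIV_chain2[OF d(1)] refl | simp)+
  with Suc.IH[OF d(2), of "c * a"] show ?case
    unfolding smooth_upto.simps by (intro exI[of _ "\<lambda>x. c * a * f' (a * x + b)"] conjI allI)
qed (auto intro!: continuous_intros intro: continuous_on_compose2[where s = UNIV])

lemma smooth1_mult: "smooth1 f \<Longrightarrow> smooth1 g \<Longrightarrow> smooth1 (\<lambda>x. f x * g x)"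
  by (simp add: smooth1_def smooth_upto_mult)

lemma smooth1_affine: "smooth1 f \<Longrightarrow> smooth1 (\<lambda>x. c * f (a * x + b))"
  by (simp add: smooth1_def smooth_upto_affine)

lemma smooth1_deriv:
  assumes "smooth1 f"
  shows "(f has_real_derivative deriv f x) (at x)" "smooth1 (deriv f)"
proof -
  have "\<exists>f'. (\<forall>x. (f has_real_derivative f' x) (at x)) \<and> smooth_upto k f'" for k
    using assms unfolding smooth1_def by (metis smooth_upto.simps(2))
  moreover have "f' = deriv f" if "\<forall>x. (f has_real_derivative f' x) (at x)" for f'
    using that by (intro ext DERIV_imp_deriv[symmetric]) auto
  ultimately have *: "(\<forall>x. (f has_real_derivative deriv f x) (at x)) \<and> smooth_upto k (deriv f)" for k
    by metis
  then show "(f has_real_derivative deriv f x) (at x)" "smooth1 (deriv f)"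
    by (auto simp: smooth1_def)
qed

lemma smooth1_continuous: "smooth1 f \<Longrightarrow> continuous_on UNIV f"
  by (auto simp: smooth1_def intro: smooth_upto_continuous)

text \<open>Coinduction: it is enough to exhibit a set of functions closed under differentiation.
  Used for the families \<open>expinv\<close> and \<open>gk\<close>.\<close>

lemma smooth1I:
  assumes "\<And>f. f \<in> S \<Longrightarrow> \<exists>f'\<in>S. \<forall>x. (f has_real_derivative f' x) (at x)" "f \<in> S"
  shows "smooth1 f"
proof -
  have "f \<in> S \<Longrightarrow> smooth_upto k f" for k f
  proof (induction k arbitrary: f)
    case 0
    then obtain f' where "\<forall>x. (f has_real_derivative f' x) (at x)" using assms(1) by blast
    then show ?case by (auto intro: DERIV_continuous_on)
  next
    case (Suc k)
    then show ?case using assms(1)[OF Suc.prems] by auto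
  qed
  then show ?thesis using assms(2) by (simp add: smooth1_def)
qed

text \<open>The additional power y ^ k makes the induction over the coefficients go through.\<close>

lemma poly_div_exp_tendsto_0: "((\<lambda>y::real. y ^ k * poly P y / exp y) \<longlongrightarrow> 0) at_top"
proof (induction P arbitrary: k)
  case (pCons a P)
  have "((\<lambda>y. a * (y ^ k / exp y) + y ^ Suc k * poly P y / exp y) \<longlongrightarrow> a * 0 + 0) at_top"
    by (intro tendsto_intros tendsto_power_div_exp_0 pCons.IH)
  then show ?case by (simp add: algebra_simps add_divide_distrib)
qed simp

text \<open>The polynomial parameter makes the family closed under differentiation; P = 1 is the
  usual flat function from which bump functions are made.\<close>

definition expinv :: "real poly \<Rightarrow> real \<Rightarrow> real" where
  "expinv P x = (if x > 0 then poly P (1 / x) * exp (- (1 / x)) else 0)"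

text \<open>For positive x differentiation turns P into X^2 * (P - P'), a polynomial in 1 / x again.
  At 0 the exponential beats every polynomial.\<close>

lemma expinv_deriv:
  "(expinv P has_real_derivative expinv (pCons 0 (pCons 0 (P - pderiv P))) x) (at x)"
proof -
  consider "x > 0" | "x < 0" | "x = 0" by linarith
  then show ?thesis
  proof cases
    case 1
    have "((\<lambda>x. poly P (1 / x) * exp (- (1 / x))) has_real_derivative
        expinv (pCons 0 (pCons 0 (P - pderiv P))) x) (at x)"
      using 1 by (auto intro!: derivative_eq_intros simp: expinv_def field_simps power2_eq_square)
    moreover have "eventually (\<lambda>y. expinv P y = poly P (1 / y) * exp (- (1 / y))) (nhds x)"
      using eventually_nhds_in_open[of "{0<..}" x] 1 by (auto elim!: eventually_mono simp: expinv_def)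
    ultimately show ?thesis by (subst DERIV_cong_ev[OF refl _ refl]) auto
  next
    case 2
    have "eventually (\<lambda>y. expinv P y = 0) (nhds x)"
      using eventually_nhds_in_open[of "{..<0}" x] 2 by (auto elim!: eventually_mono simp: expinv_def)
    then show ?thesis using 2 by (subst DERIV_cong_ev[OF refl _ refl, where g = "\<lambda>_. 0"]) (auto simp: expinv_def)
  next
    case 3
    have "((\<lambda>y. expinv P y / y) \<longlongrightarrow> 0) (at_left 0)"
      by (rule tendsto_eventually) (auto simp: eventually_at_filter expinv_def)
    moreover have "((\<lambda>y. expinv P y / y) \<longlongrightarrow> 0) (at_right 0)"
    proof -
      \<comment> \<open>In terms of 1 / y the difference quotient at 0 is a polynomial divided by an
        exponential at infinity.\<close>
      have "((\<lambda>y. inverse y ^ 1 * poly P (inverse y) / exp (inverse y)) \<longlongrightarrow> 0) (at_right 0)"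
        by (rule filterlim_compose[OF poly_div_exp_tendsto_0 filterlim_inverse_at_top_right])
      moreover have "eventually (\<lambda>y. inverse y ^ 1 * poly P (inverse y) / exp (inverse y) = expinv P y / y) (at_right (0::real))"
        by (auto simp: eventually_at_filter expinv_def exp_minus field_simps)
      ultimately show ?thesis by (rule Lim_transform_eventually)
    qed
    ultimately have "((\<lambda>y. expinv P y / y) \<longlongrightarrow> 0) (at 0)"
      by (simp add: filterlim_split_at)
    then show ?thesis using 3 by (simp add: has_field_derivative_iff expinv_def)
  qed
qed

lemma smooth1_expinv: "smooth1 (expinv P)"
  by (rule smooth1I[where S = "range expinv"]) (auto intro: expinv_deriv)

definition prodf :: "('a::euclidean_space \<Rightarrow> real \<Rightarrow> real) \<Rightarrow> 'a \<Rightarrow> real" where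
  "prodf h x = (\<Prod>b\<in>Basis. h b (x \<bullet> b))"

lemma prodf_has_derivative:
  assumes "\<And>b. b \<in> Basis \<Longrightarrow> (h b has_real_derivative h' b) (at (x \<bullet> b))"
  shows "(prodf h has_derivative (\<lambda>y. \<Sum>i\<in>Basis. h' i * (y \<bullet> i) * (\<Prod>j\<in>Basis - {i}. h j (x \<bullet> j)))) (at x)"
proof -
  have *: "((\<lambda>x. h b (x \<bullet> b)) has_derivative (\<lambda>y. h' b * (y \<bullet> b))) (at x)" if "b \<in> Basis" for b
  proof -
    have "(h b has_derivative (\<lambda>t. h' b * t)) (at (x \<bullet> b))"
      using assms[OF that] by (simp add: has_field_derivative_def)
    then show ?thesis
      by (intro has_derivative_compose[where g = "h b" and f = "\<lambda>x. x \<bullet> b" and f' = "\<lambda>y. y \<bullet> b"])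
        (auto intro!: derivative_eq_intros)
  qed
  then show ?thesis unfolding prodf_def[abs_def] by (intro has_derivative_prod)
qed

lemma prodf_partial:
  assumes "\<And>b. b \<in> Basis \<Longrightarrow> (h b has_real_derivative h' b) (at (x \<bullet> b))" "c \<in> Basis"
  shows "partial_deriv c (prodf h) x = h' c * (\<Prod>j\<in>Basis - {c}. h j (x \<bullet> j))"
proof -
  have "partial_deriv c (prodf h) x = (\<Sum>i\<in>Basis. h' i * (c \<bullet> i) * (\<Prod>j\<in>Basis - {i}. h j (x \<bullet> j)))"
  proof -
    have "(prodf h has_derivative (\<lambda>y. \<Sum>i\<in>Basis. h' i * (y \<bullet> i) * (\<Prod>j\<in>Basis - {i}. h j (x \<bullet> j)))) (at x)"
      by (rule prodf_has_derivative) (rule assms(1))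
    from frechet_derivative_at[OF this, symmetric] show ?thesis by (simp add: partial_deriv_def)
  qed
  also have "\<dots> = (\<Sum>i\<in>Basis. if i = c then h' c * (\<Prod>j\<in>Basis - {c}. h j (x \<bullet> j)) else 0)"
    using assms(2) by (intro sum.cong) (auto simp: inner_Basis)
  finally show ?thesis using assms(2) by simp
qed

lemma prodf_upd:
  assumes "c \<in> Basis"
  shows "prodf (h(c := k)) x = k (x \<bullet> c) * (\<Prod>j\<in>Basis - {c}. h j (x \<bullet> j))"
proof -
  have "prodf (h(c := k)) x = (h(c := k)) c (x \<bullet> c) * (\<Prod>j\<in>Basis - {c}. (h(c := k)) j (x \<bullet> j))"
    unfolding prodf_def using assms by (intro prod.remove) auto
  also have "(\<Prod>j\<in>Basis - {c}. (h(c := k)) j (x \<bullet> j)) = (\<Prod>j\<in>Basis - {c}. h j (x \<bullet> j))"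
    by (intro prod.cong) auto
  finally show ?thesis by (simp only: fun_upd_same)
qed

lemma partial_deriv_prodf:
  assumes "\<And>b. b \<in> Basis \<Longrightarrow> smooth1 (h b)" "c \<in> Basis"
  shows "partial_deriv c (prodf h) = prodf (h(c := deriv (h c)))"
  using assms by (auto simp: fun_eq_iff prodf_upd intro!: prodf_partial smooth1_deriv)

lemma continuous_on_prodf:
  assumes "\<And>b. b \<in> Basis \<Longrightarrow> continuous_on UNIV (h b)"
  shows "continuous_on UNIV (prodf h)"
  unfolding prodf_def[abs_def]
  by (intro continuous_on_prod continuous_on_compose2[OF assms] continuous_intros) auto

lemma Ck_prodf:
  assumes "\<And>b. b \<in> Basis \<Longrightarrow> smooth1 (h b)"
  shows "Ck k (prodf h)"
  using assms
proof (induction k arbitrary: h)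
  case 0
  then show ?case by (simp add: continuous_on_prodf smooth1_continuous)
next
  case (Suc k)
  have "prodf h differentiable at x" for x
    using prodf_has_derivative[of h "\<lambda>b. deriv (h b) (x \<bullet> b)" x] Suc.prems smooth1_deriv(1)
    unfolding differentiable_def by blast
  then have "prodf h differentiable_on UNIV"
    by (simp add: differentiable_on_def)
  moreover have "Ck k (partial_deriv b (prodf h))" if "b \<in> Basis" for b
  proof -
    have "partial_deriv b (prodf h) = prodf (h(b := deriv (h b)))"
      by (rule partial_deriv_prodf) (use Suc.prems that in auto)
    moreover have "Ck k (prodf (h(b := deriv (h b))))"
      by (rule Suc.IH) (use Suc.prems smooth1_deriv(2) that in auto)
    ultimately show ?thesis by simp
  qed
  ultimately show ?case by simp
qed

lemma prodf_test_function:
  fixes a :: "'a::euclidean_space"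
  assumes "\<And>b. b \<in> Basis \<Longrightarrow> smooth1 (h b)"
    and "\<And>b t. b \<in> Basis \<Longrightarrow> t \<notin> {a \<bullet> b..c \<bullet> b} \<Longrightarrow> h b t = 0"
  shows "prodf h \<in> test_functions"
proof -
  have "{x. prodf h x \<noteq> 0} \<subseteq> cbox a c"
    using assms(2) by (force simp: prodf_def cbox_def)
  then have "closure {x. prodf h x \<noteq> 0} \<subseteq> cbox a c" by (intro closure_minimal) auto
  then have "compact (closure {x. prodf h x \<noteq> 0})"
    by (meson closed_closure compact_cbox compact_Int_closed inf.absorb_iff2 bounded_subset bounded_cbox compact_eq_bounded_closed)
  moreover have "Ck k (prodf h)" for k by (rule Ck_prodf) (rule assms(1))
  ultimately show ?thesis by (simp add: test_functions_def)
qed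

section \<open>General test functions and integration by parts\<close>

lemma test_functionsD:
  assumes "\<psi> \<in> test_functions"
  shows "continuous_on UNIV \<psi>" "\<psi> differentiable at x" "b \<in> Basis \<Longrightarrow> continuous_on UNIV (partial_deriv b \<psi>)"
    "\<exists>R>0. \<forall>x. norm x \<ge> R \<longrightarrow> \<psi> x = 0"
proof -
  have C: "Ck k \<psi>" for k using assms by (simp add: test_functions_def)
  show "continuous_on UNIV \<psi>" using C[of 0] by simp
  show "\<psi> differentiable at x" using C[of 1] by (simp add: differentiable_on_def)
  show "b \<in> Basis \<Longrightarrow> continuous_on UNIV (partial_deriv b \<psi>)" using C[of 1] by simp
  have "bounded (closure {x. \<psi> x \<noteq> 0})"
    using assms by (simp add: test_functions_def compact_imp_bounded)
  then obtain B where B: "\<And>x. x \<in> closure {x. \<psi> x \<noteq> 0} \<Longrightarrow> norm x \<le> B"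
    unfolding bounded_iff by blast
  have "\<psi> x = 0" if "norm x \<ge> \<bar>B\<bar> + 1" for x
  proof (rule ccontr)
    assume "\<psi> x \<noteq> 0"
    then have "norm x \<le> B" by (intro B) (auto intro: closure_subset[THEN subsetD])
    then show False using that by simp
  qed
  then show "\<exists>R>0. \<forall>x. norm x \<ge> R \<longrightarrow> \<psi> x = 0" by (intro exI[of _ "\<bar>B\<bar> + 1"]) auto
qed

lemma frechet_zero_outside:
  assumes "x \<notin> closure {x. \<psi> x \<noteq> (0::real)}"
  shows "frechet_derivative \<psi> (at x) = (\<lambda>_. 0)"
proof -
  have "(\<psi> has_derivative (\<lambda>_. 0)) (at x)"
    by (rule has_derivative_transform_within_open[where s = "- closure {x. \<psi> x \<noteq> 0}" and f = "\<lambda>_. 0"])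
      (use assms in \<open>auto intro: closure_subset[THEN subsetD]\<close>)
  then show ?thesis by (rule frechet_derivative_at[symmetric])
qed

lemma test_functions_partial:
  assumes "\<psi> \<in> test_functions" "b \<in> Basis"
  shows "partial_deriv b \<psi> \<in> test_functions"
proof -
  have "Ck k (partial_deriv b \<psi>)" for k
    using assms by (auto simp: test_functions_def dest: spec[of _ "Suc k"])
  moreover have "closure {x. partial_deriv b \<psi> x \<noteq> 0} \<subseteq> closure {x. \<psi> x \<noteq> 0}"
  proof (rule closure_minimal)
    show "{x. partial_deriv b \<psi> x \<noteq> 0} \<subseteq> closure {x. \<psi> x \<noteq> 0}"
    proof
      fix x assume "x \<in> {x. partial_deriv b \<psi> x \<noteq> 0}"
      then show "x \<in> closure {x. \<psi> x \<noteq> 0}"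
        using frechet_zero_outside[of x \<psi>] by (cases "x \<in> closure {x. \<psi> x \<noteq> 0}") (auto simp: partial_deriv_def)
    qed
  qed simp
  then have "compact (closure {x. partial_deriv b \<psi> x \<noteq> 0})"
    using assms(1) by (metis (mono_tags, lifting) closed_closure compact_Int_closed inf.absorb_iff2 mem_Collect_eq test_functions_def)
  ultimately show ?thesis by (simp add: test_functions_def)
qed

lemma test_functions_iter_partial:
  "\<psi> \<in> test_functions \<Longrightarrow> set bs \<subseteq> Basis \<Longrightarrow> iter_partial bs \<psi> \<in> test_functions"
  by (induction bs) (auto intro: test_functions_partial)

lemma iter_partial_append: "iter_partial (as @ bs) f = iter_partial as (iter_partial bs f)"
  by (induction as) auto

lemma continuous_compact_support_integrable:
  fixes F :: "'a::euclidean_space \<Rightarrow> real"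
  assumes "continuous_on UNIV F" "\<And>x. norm x \<ge> R \<Longrightarrow> F x = 0"
  shows "integrable lborel F"
proof -
  have "integrable lborel (\<lambda>x. indicator (cball 0 R) x *\<^sub>R F x)"
    using assms by (intro borel_integrable_compact) (auto intro: continuous_on_subset)
  also have "(\<lambda>x. indicator (cball 0 R) x *\<^sub>R F x) = F"
    using assms(2) by (auto simp: fun_eq_iff split: split_indicator)
  finally show ?thesis .
qed

lemma bounded_compact_support:
  fixes F :: "'a::euclidean_space \<Rightarrow> real"
  assumes "continuous_on UNIV F" "\<And>x. norm x \<ge> R \<Longrightarrow> F x = 0"
  obtains M where "M \<ge> 0" "\<And>x. \<bar>F x\<bar> \<le> M"
proof -
  have "bounded (F ` cball 0 R)"
    using assms(1) by (intro compact_imp_bounded compact_continuous_image) (auto intro: continuous_on_subset)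
  then obtain M where "\<forall>x\<in>cball 0 R. \<bar>F x\<bar> \<le> M"
    unfolding bounded_iff by auto
  then have "\<bar>F x\<bar> \<le> max M 0" for x
    using assms(2)[of x] by (cases "norm x \<ge> R") (auto simp: le_max_iff_disj)
  then show thesis by (intro that[of "max M 0"]) auto
qed

lemma integrable_lborel_translate:
  fixes F :: "'a::euclidean_space \<Rightarrow> real"
  assumes "integrable lborel F"
  shows "integrable lborel (\<lambda>x. F (x + c))" "(\<integral>x. F (x + c) \<partial>lborel) = (\<integral>x. F x \<partial>lborel)"
proof -
  have [measurable]: "F \<in> borel_measurable borel" using assms by simp
  have d: "distr lborel borel (\<lambda>x. x + c) = (lborel :: 'a measure)"
  proof -
    have "(\<lambda>x. x + c) = (+) c" by (simp add: fun_eq_iff add.commute)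
    then show ?thesis using lborel_distr_plus[of c] by simp
  qed
  show "integrable lborel (\<lambda>x. F (x + c))"
    using assms d integrable_distr_eq[of "\<lambda>x. x + c" lborel borel F] by simp
  show "(\<integral>x. F (x + c) \<partial>lborel) = (\<integral>x. F x \<partial>lborel)"
    using d integral_distr[of "\<lambda>x. x + c" lborel borel F] by simp
qed

lemma directional_DERIV:
  fixes F :: "'a::euclidean_space \<Rightarrow> real"
  assumes "F differentiable at (x + t *\<^sub>R b)"
  shows "((\<lambda>t. F (x + t *\<^sub>R b)) has_real_derivative partial_deriv b F (x + t *\<^sub>R b)) (at t)"
proof -
  have F: "(F has_derivative frechet_derivative F (at (x + t *\<^sub>R b))) (at (x + t *\<^sub>R b))"
    using assms frechet_derivative_works by blast
  have "((\<lambda>t. x + t *\<^sub>R b) has_derivative (\<lambda>s. s *\<^sub>R b)) (at t)"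
    by (auto intro!: derivative_eq_intros)
  from has_derivative_compose[OF this F]
  have "((\<lambda>t. F (x + t *\<^sub>R b)) has_derivative (\<lambda>s. frechet_derivative F (at (x + t *\<^sub>R b)) (s *\<^sub>R b))) (at t)" .
  also have "(\<lambda>s. frechet_derivative F (at (x + t *\<^sub>R b)) (s *\<^sub>R b)) = (\<lambda>s. partial_deriv b F (x + t *\<^sub>R b) * s)"
    using linear_frechet_derivative[OF assms] by (auto simp: partial_deriv_def linear_scale)
  finally show ?thesis by (simp add: has_field_derivative_def)
qed

text \<open>Difference quotients of F have integral 0 by translation invariance. Dominated
  convergence passes to the derivative, with the mean value theorem providing the bound.\<close>

lemma integral_partial_deriv_zero:
  fixes F :: "'a::euclidean_space \<Rightarrow> real"
  assumes d: "\<And>x. F differentiable at x" and c: "continuous_on UNIV (partial_deriv b F)"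
    and z: "\<And>x. norm x \<ge> R \<Longrightarrow> F x = 0" and b: "b \<in> Basis"
  shows "(\<integral>x. partial_deriv b F x \<partial>lborel) = 0"
proof -
  have cF: "continuous_on UNIV F"
    using d by (auto intro!: differentiable_imp_continuous_on simp: differentiable_on_def)
  have iF: "integrable lborel F" by (rule continuous_compact_support_integrable[OF cF z])
  have z': "partial_deriv b F x = 0" if "norm x \<ge> R + 1" for x
  proof -
    have "{x. F x \<noteq> 0} \<subseteq> cball 0 R"
    proof
      fix x assume "x \<in> {x. F x \<noteq> 0}"
      then show "x \<in> cball 0 R" using z[of x] by (cases "R \<le> norm x") auto
    qed
    then have "closure {x. F x \<noteq> 0} \<subseteq> cball 0 R" by (intro closure_minimal) auto
    then have "x \<notin> closure {x. F x \<noteq> 0}" using that by auto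
    then show ?thesis by (simp add: partial_deriv_def frechet_zero_outside)
  qed
  obtain M where M: "M \<ge> 0" "\<And>x. \<bar>partial_deriv b F x\<bar> \<le> M"
    using bounded_compact_support[OF c z'] by blast
  \<comment> \<open>Step sizes of at most 1 keep all difference quotients supported in the ball of
    radius R + 1.\<close>
  define h where "h i = 1 / (real i + 1)" for i
  have h: "h i > 0" "h i \<le> 1" for i by (auto simp: h_def)
  have hn: "h i \<noteq> 0" for i using h(1)[of i] by simp
  define Q where "Q i x = (F (x + h i *\<^sub>R b) - F x) / h i" for i x
  have lim: "(\<lambda>i. Q i x) \<longlonglongrightarrow> partial_deriv b F x" for x
  proof -
    have "((\<lambda>t. F (x + t *\<^sub>R b)) has_real_derivative partial_deriv b F x) (at 0)"
      using directional_DERIV[of F x 0 b] d by simp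
    then have "((\<lambda>t. (F (x + t *\<^sub>R b) - F x) / t) \<longlongrightarrow> partial_deriv b F x) (at 0)"
      by (simp add: has_field_derivative_iff)
    moreover have "filterlim h (at 0) sequentially"
      unfolding filterlim_at
    proof
      show "\<forall>\<^sub>F i in sequentially. h i \<in> UNIV \<and> h i \<noteq> 0" using h by (auto simp: less_imp_neq[symmetric])
      show "h \<longlonglongrightarrow> 0" unfolding h_def using LIMSEQ_inverse_real_of_nat by (simp add: inverse_eq_divide add.commute)
    qed
    ultimately show ?thesis unfolding Q_def by (rule filterlim_compose)
  qed
  have bd: "\<bar>Q i x\<bar> \<le> M * indicator (cball 0 (R + 1)) x" for i x
  proof (cases "norm x \<le> R + 1")
    case True
    have "\<exists>t. 0 < t \<and> t < h i \<and> F (x + h i *\<^sub>R b) - F (x + 0 *\<^sub>R b) = (h i - 0) * partial_deriv b F (x + t *\<^sub>R b)"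
      by (rule MVT2) (use h d in \<open>auto intro: directional_DERIV\<close>)
    then obtain t where "F (x + h i *\<^sub>R b) - F x = h i * partial_deriv b F (x + t *\<^sub>R b)" by auto
    then have "Q i x = partial_deriv b F (x + t *\<^sub>R b)" using h[of i] by (simp add: Q_def)
    then show ?thesis using True M by simp
  next
    case False
    have "norm x - norm (h i *\<^sub>R b) \<le> norm (x + h i *\<^sub>R b)"
      by (rule norm_diff_ineq)
    moreover have "norm (h i *\<^sub>R b) \<le> 1" using h[of i] b by simp
    ultimately have "norm (x + h i *\<^sub>R b) \<ge> R" using False by linarith
    then show ?thesis using False z by (simp add: Q_def)
  qed
  have "(\<lambda>i. \<integral>x. Q i x \<partial>lborel) \<longlonglongrightarrow> (\<integral>x. partial_deriv b F x \<partial>lborel)"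
  proof (rule integral_dominated_convergence[where w = "\<lambda>x. M * indicator (cball 0 (R + 1)) x"])
    show "integrable lborel (\<lambda>x::'a. M * indicator (cball 0 (R + 1)) x)"
      using emeasure_bounded_finite[OF bounded_cball, of "0::'a" "R + 1"]
      by (intro integrable_mult_right integrable_real_indicator) auto
  qed (use lim bd cF c hn in \<open>auto simp: Q_def intro!: borel_measurable_continuous_onI continuous_intros intro: continuous_on_compose2[where s = UNIV]\<close>)
  moreover have "(\<integral>x. Q i x \<partial>lborel) = 0" for i
    using integrable_lborel_translate[OF iF, of "h i *\<^sub>R b"] iF by (simp add: Q_def)
  ultimately show ?thesis by (simp add: LIMSEQ_const_iff)
qed

lemma integration_by_parts_test:
  fixes \<phi> \<psi> :: "'a::euclidean_space \<Rightarrow> real"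
  assumes d: "\<And>x. \<phi> differentiable at x" and c: "continuous_on UNIV (partial_deriv b \<phi>)"
    and \<psi>: "\<psi> \<in> test_functions" and b: "b \<in> Basis"
  shows "(\<integral>x. \<phi> x * partial_deriv b \<psi> x \<partial>lborel) = - (\<integral>x. partial_deriv b \<phi> x * \<psi> x \<partial>lborel)"
proof -
  note t = test_functionsD[OF \<psi>] and t' = test_functionsD[OF test_functions_partial[OF \<psi> b]]
  have c\<phi>: "continuous_on UNIV \<phi>"
    using d by (auto intro!: differentiable_imp_continuous_on simp: differentiable_on_def)
  obtain R where R: "\<And>x. norm x \<ge> R \<Longrightarrow> \<psi> x = 0" using t(4) by blast
  obtain R' where R': "\<And>x. norm x \<ge> R' \<Longrightarrow> partial_deriv b \<psi> x = 0" using t'(4) by blast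
  have pd: "partial_deriv b (\<lambda>x. \<phi> x * \<psi> x) x = \<phi> x * partial_deriv b \<psi> x + partial_deriv b \<phi> x * \<psi> x" for x
  proof -
    have "((\<lambda>x. \<phi> x * \<psi> x) has_derivative
      (\<lambda>h. \<phi> x * frechet_derivative \<psi> (at x) h + frechet_derivative \<phi> (at x) h * \<psi> x)) (at x)"
      using d[of x] t(2)[of x] by (intro has_derivative_mult) (simp_all add: frechet_derivative_works[symmetric])
    from frechet_derivative_at[OF this, symmetric] show ?thesis by (simp add: partial_deriv_def)
  qed
  have "0 = (\<integral>x. partial_deriv b (\<lambda>x. \<phi> x * \<psi> x) x \<partial>lborel)"
  proof (rule integral_partial_deriv_zero[symmetric])
    show "(\<lambda>x. \<phi> x * \<psi> x) differentiable at x" for x using d t(2) by (intro differentiable_mult)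
    show "continuous_on UNIV (partial_deriv b (\<lambda>x. \<phi> x * \<psi> x))"
      unfolding pd[abs_def] using c c\<phi> t(1) t(3)[OF b] by (intro continuous_intros)
  qed (use R b in auto)
  also have "\<dots> = (\<integral>x. \<phi> x * partial_deriv b \<psi> x + partial_deriv b \<phi> x * \<psi> x \<partial>lborel)"
    by (simp add: pd)
  also have "\<dots> = (\<integral>x. \<phi> x * partial_deriv b \<psi> x \<partial>lborel) + (\<integral>x. partial_deriv b \<phi> x * \<psi> x \<partial>lborel)"
  proof (rule Bochner_Integration.integral_add)
    show "integrable lborel (\<lambda>x. \<phi> x * partial_deriv b \<psi> x)"
      using c\<phi> t(3)[OF b] R' by (intro continuous_compact_support_integrable[where R = R'] continuous_intros) auto
    show "integrable lborel (\<lambda>x. partial_deriv b \<phi> x * \<psi> x)"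
      using c t(1) R by (intro continuous_compact_support_integrable[where R = R] continuous_intros) auto
  qed
  finally show ?thesis by simp
qed

section \<open>Derivatives of the heat kernel\<close>

text \<open>Hermite polynomials up to scaling: the j-th derivative of exp (- r^2 / 4) is
  \<open>hermite j\<close> times this Gaussian.\<close>

primrec hermite :: "nat \<Rightarrow> real poly" where
  "hermite 0 = 1"
| "hermite (Suc j) = pderiv (hermite j) - [:0, 1/2:] * hermite j"

definition hg :: "nat \<Rightarrow> real \<Rightarrow> real" where
  "hg j r = poly (hermite j) r * exp (- r\<^sup>2 / 4)"

lemma hg_deriv: "(hg j has_real_derivative hg (Suc j) r) (at r)"
  unfolding hg_def[abs_def]
  by (rule derivative_eq_intros poly_DERIV refl | simp add: field_simps)+

lemma poly_le_exp_square:
  fixes P :: "real poly"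
  shows "\<epsilon> > 0 \<Longrightarrow> \<exists>C\<ge>0. \<forall>r. \<bar>poly P r\<bar> \<le> C * exp (\<epsilon> * r\<^sup>2)"
proof (induction P arbitrary: \<epsilon>)
  case (pCons a P)
  obtain C where C: "C \<ge> 0" "\<And>r. \<bar>poly P r\<bar> \<le> C * exp (\<epsilon> / 2 * r\<^sup>2)"
    using pCons.IH[of "\<epsilon> / 2"] pCons.prems by auto
  define D where "D = max 1 (2 / \<epsilon>)"
  have D: "\<bar>r\<bar> \<le> D * exp (\<epsilon> / 2 * r\<^sup>2)" for r :: real
  proof -
    have "\<bar>r\<bar> \<le> 1 + r\<^sup>2"
      using zero_le_power2[of "\<bar>r\<bar> - 1"] by (simp add: power2_diff)
    also have "\<dots> \<le> D * 1 + D * (\<epsilon> / 2 * r\<^sup>2)"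
    proof (rule add_mono)
      have "1 \<le> D * (\<epsilon> / 2)" using pCons.prems by (simp add: D_def max_def field_simps)
      from mult_right_mono[OF this, of "r\<^sup>2"] show "r\<^sup>2 \<le> D * (\<epsilon> / 2 * r\<^sup>2)" by (simp add: mult.assoc)
    qed (simp add: D_def)
    also have "\<dots> = D * (1 + \<epsilon> / 2 * r\<^sup>2)" by (simp add: algebra_simps)
    also have "\<dots> \<le> D * exp (\<epsilon> / 2 * r\<^sup>2)" by (intro mult_left_mono exp_ge_add_one_self) (simp add: D_def)
    finally show ?thesis .
  qed
  have "\<bar>poly (pCons a P) r\<bar> \<le> (\<bar>a\<bar> + D * C) * exp (\<epsilon> * r\<^sup>2)" for r
  proof -
    have "\<bar>poly (pCons a P) r\<bar> \<le> \<bar>a\<bar> + \<bar>r\<bar> * \<bar>poly P r\<bar>"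
      by (simp add: abs_mult[symmetric] abs_triangle_ineq)
    also have "\<dots> \<le> \<bar>a\<bar> * 1 + (D * exp (\<epsilon> / 2 * r\<^sup>2)) * (C * exp (\<epsilon> / 2 * r\<^sup>2))"
      using C D[of r] by (intro add_mono mult_mono) auto
    also have "(D * exp (\<epsilon> / 2 * r\<^sup>2)) * (C * exp (\<epsilon> / 2 * r\<^sup>2)) = D * C * exp (\<epsilon> * r\<^sup>2)"
      by (simp add: mult_exp_exp algebra_simps)
    also have "\<bar>a\<bar> * 1 + D * C * exp (\<epsilon> * r\<^sup>2) \<le> \<bar>a\<bar> * exp (\<epsilon> * r\<^sup>2) + D * C * exp (\<epsilon> * r\<^sup>2)"
      using pCons.prems mult_left_mono[of 1 "exp (\<epsilon> * r\<^sup>2)" "\<bar>a\<bar>"] by simp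
    finally show ?thesis by (simp add: algebra_simps)
  qed
  moreover have "D \<ge> 0" by (simp add: D_def le_max_iff_disj)
  then have "\<bar>a\<bar> + D * C \<ge> 0" using C by simp
  ultimately show ?case by blast
qed (auto intro: exI[of _ 0])

text \<open>Half of the Gaussian decay is spent on the polynomial.\<close>

lemma hg_bound: "\<exists>B\<ge>0. \<forall>r. \<bar>hg j r\<bar> \<le> B * exp (- r\<^sup>2 / 8)"
proof -
  obtain C where C: "C \<ge> 0" "\<And>r. \<bar>poly (hermite j) r\<bar> \<le> C * exp (1/8 * r\<^sup>2)"
    using poly_le_exp_square[of "1/8" "hermite j"] by auto
  have "\<bar>hg j r\<bar> \<le> C * exp (- r\<^sup>2 / 8)" for r
  proof -
    have "\<bar>hg j r\<bar> \<le> C * exp (1/8 * r\<^sup>2) * exp (- r\<^sup>2 / 4)"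
      unfolding hg_def abs_mult using C by (intro mult_mono) auto
    also have "\<dots> = C * exp (- r\<^sup>2 / 8)" by (simp add: mult.assoc mult_exp_exp)
    finally show ?thesis .
  qed
  then show ?thesis using C by blast
qed

text \<open>The \<open>j\<close>-th space derivative of the one-dimensional heat kernel at time \<open>s\<close>.\<close>

definition gk :: "nat \<Rightarrow> real \<Rightarrow> real \<Rightarrow> real" where
  "gk j s r = s powr (- (real j + 1) / 2) * hg j (r / sqrt s) / sqrt (4 * pi)"

lemma powr_minus_half: "s > 0 \<Longrightarrow> s powr (a - 1/2) = s powr a / sqrt s"
  by (simp add: powr_diff powr_half_sqrt)

lemma powr_neg_half: "c > 0 \<Longrightarrow> c powr (- (1/2)) = 1 / sqrt c"
  by (simp add: powr_minus powr_half_sqrt inverse_eq_divide)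

lemma gk_deriv:
  assumes "s > 0"
  shows "(gk j s has_real_derivative gk (Suc j) s r) (at r)"
proof -
  have "((\<lambda>r. hg j (r / sqrt s)) has_real_derivative hg (Suc j) (r / sqrt s) * (1 / sqrt s)) (at r)"
    by (rule DERIV_chain2[OF hg_deriv]) (rule DERIV_cdivide[OF DERIV_ident])
  then have "(gk j s has_real_derivative s powr (- (real j + 1) / 2) * (hg (Suc j) (r / sqrt s) * (1 / sqrt s)) / sqrt (4 * pi)) (at r)"
    unfolding gk_def[abs_def] by (intro DERIV_cdivide DERIV_cmult)
  also have "s powr (- (real j + 1) / 2) * (hg (Suc j) (r / sqrt s) * (1 / sqrt s)) / sqrt (4 * pi) = gk (Suc j) s r"
  proof -
    have ex: "- (real (Suc j) + 1) / 2 = - (real j + 1) / 2 - 1/2" by (simp add: field_simps)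
    show ?thesis unfolding gk_def ex powr_minus_half[OF assms] by simp
  qed
  finally show ?thesis .
qed

lemma smooth1_gk: "s > 0 \<Longrightarrow> smooth1 (gk j s)"
  by (rule smooth1I[where S = "range (\<lambda>j. gk j s)"]) (auto intro: gk_deriv)

lemma gk0_eq: "s > 0 \<Longrightarrow> gk 0 s r = exp (- r\<^sup>2 / (4 * s)) / sqrt (4 * pi * s)"
  by (simp add: gk_def hg_def powr_minus powr_half_sqrt power_divide real_sqrt_mult field_simps)

lemma gk0_normal: "s > 0 \<Longrightarrow> gk 0 s = normal_density 0 (sqrt (2 * s))"
  by (auto simp: fun_eq_iff gk0_eq normal_density_def field_simps)

lemma gk0_pos: "s > 0 \<Longrightarrow> gk 0 s r > 0"
  by (simp add: gk0_eq)

text \<open>Each derivative costs a factor s powr (-1/2), and the loss of half the Gaussian decay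
  amounts to doubling the time. So all derivatives are dominated by heat kernels, which have
  integral 1.\<close>

lemma gk_bound: "\<exists>B\<ge>0. \<forall>s>0. \<forall>r. \<bar>gk j s r\<bar> \<le> B * s powr (- real j / 2) * gk 0 (2 * s) r"
proof -
  obtain B where B: "B \<ge> 0" "\<And>r. \<bar>hg j r\<bar> \<le> B * exp (- r\<^sup>2 / 8)" using hg_bound by blast
  have "\<bar>gk j s r\<bar> \<le> (sqrt 2 * B) * s powr (- real j / 2) * gk 0 (2 * s) r" if s: "s > 0" for s r
  proof -
    have "\<bar>gk j s r\<bar> = s powr (- (real j + 1) / 2) * \<bar>hg j (r / sqrt s)\<bar> / sqrt (4 * pi)"
      by (simp add: gk_def abs_mult)
    also have "\<dots> \<le> s powr (- (real j + 1) / 2) * (B * exp (- (r / sqrt s)\<^sup>2 / 8)) / sqrt (4 * pi)"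
      using B by (intro divide_right_mono mult_left_mono) auto
    also have "- (real j + 1) / 2 = - real j / 2 - 1/2" by (simp add: field_simps)
    also have "s powr (- real j / 2 - 1/2) = s powr (- real j / 2) / sqrt s" by (rule powr_minus_half[OF s])
    also have "s powr (- real j / 2) / sqrt s * (B * exp (- (r / sqrt s)\<^sup>2 / 8)) / sqrt (4 * pi) =
      (sqrt 2 * B) * s powr (- real j / 2) * gk 0 (2 * s) r"
    proof -
      have "sqrt (4 * pi * (2 * s)) = sqrt 2 * (sqrt (4 * pi) * sqrt s)"
        by (simp only: real_sqrt_mult[symmetric]) (simp add: mult_ac)
      moreover have "(r / sqrt s)\<^sup>2 / 8 = r\<^sup>2 / (4 * (2 * s))" using s by (simp add: power_divide)
      ultimately show ?thesis using s by (simp add: gk0_eq mult_ac)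
    qed
    finally show ?thesis .
  qed
  then show ?thesis using B by (intro exI[of _ "sqrt 2 * B"]) auto
qed

lemma gk_measurable [measurable]:
  assumes [measurable]: "f \<in> borel_measurable M" "g \<in> borel_measurable M"
  shows "(\<lambda>z. gk j (f z) (g z)) \<in> borel_measurable M"
proof -
  have [measurable]: "hg j \<in> borel_measurable borel"
    by (intro borel_measurable_continuous_onI DERIV_continuous_on[OF DERIV_subset[OF hg_deriv]]) auto
  show ?thesis unfolding gk_def by measurable
qed

text \<open>The multi-index \<open>e\<close> counts the derivatives in each coordinate direction, unlike the lists of Defs.\<close>

definition heatD :: "('a::euclidean_space \<Rightarrow> nat) \<Rightarrow> real \<Rightarrow> 'a \<Rightarrow> real" where
  "heatD e s = prodf (\<lambda>b. gk (e b) s)"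

abbreviation heat :: "real \<Rightarrow> 'a::euclidean_space \<Rightarrow> real" where
  "heat \<equiv> heatD (\<lambda>_. 0)"

lemma heatD_measurable [measurable]:
  fixes g :: "'z \<Rightarrow> 'a::euclidean_space"
  assumes [measurable]: "f \<in> borel_measurable M" "g \<in> borel_measurable M"
  shows "(\<lambda>z. heatD e (f z) (g z)) \<in> borel_measurable M"
  unfolding heatD_def prodf_def by measurable

lemma heat_pos: "s > 0 \<Longrightarrow> heat s x > 0"
  unfolding heatD_def prodf_def by (intro prod_pos) (simp add: gk0_pos)

lemma heat_eq:
  fixes x :: "'a::euclidean_space"
  assumes "s > 0"
  shows "heat s x = (4 * pi * s) powr (- real DIM('a) / 2) * exp (- (norm x)\<^sup>2 / (4 * s))"
proof -
  have "heat s x = (\<Prod>b\<in>Basis. exp (- (x \<bullet> b)\<^sup>2 / (4 * s)) * (4 * pi * s) powr (- (1/2)))"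
    unfolding heatD_def prodf_def using assms powr_neg_half[of "4 * pi * s"]
    by (intro prod.cong) (auto simp: gk0_eq)
  also have "\<dots> = (\<Prod>b\<in>(Basis::'a set). exp (- (x \<bullet> b)\<^sup>2 / (4 * s))) * ((4 * pi * s) powr (- (1/2))) ^ DIM('a)"
    by (simp add: prod.distrib)
  also have "(\<Prod>b\<in>(Basis::'a set). exp (- (x \<bullet> b)\<^sup>2 / (4 * s))) = exp (\<Sum>b\<in>(Basis::'a set). - (x \<bullet> b)\<^sup>2 / (4 * s))"
    by (simp add: exp_sum)
  also have "(\<Sum>b\<in>(Basis::'a set). - (x \<bullet> b)\<^sup>2 / (4 * s)) = - (norm x)\<^sup>2 / (4 * s)"
    by (simp add: norm_eq_sqrt_inner euclidean_inner[of x x] power2_eq_square sum_divide_distrib[symmetric] sum_negf sum_nonneg)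
  also have "((4 * pi * s) powr (- (1/2))) ^ DIM('a) = (4 * pi * s) powr (- real DIM('a) / 2)"
    using assms by (simp add: powr_powr flip: powr_realpow)
  finally show ?thesis by simp
qed

lemma heat_minus: "heat s (- x) = heat s (x :: 'a::euclidean_space)"
  unfolding heatD_def prodf_def by (simp add: gk_def hg_def)

lemma heat_commute: "heat s (x - y) = heat s (y - x :: 'a::euclidean_space)"
  using heat_minus[of s "x - y"] by simp

lemma heat_le:
  assumes "s > 0"
  shows "heat s (x::'a::euclidean_space) \<le> (4 * pi * s) powr (- real DIM('a) / 2)"
  using assms by (simp add: heat_eq mult_left_le)

lemma nn_integral_heat:
  assumes "s > 0"
  shows "(\<integral>\<^sup>+x. ennreal (heat s (x::'a::euclidean_space)) \<partial>lborel) = 1"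
proof -
  have "(\<integral>\<^sup>+x. ennreal (heat s (x::'a)) \<partial>lborel) = (\<integral>\<^sup>+x. (\<Prod>b\<in>Basis. ennreal (gk 0 s ((x::'a) \<bullet> b))) \<partial>lborel)"
    using assms by (simp add: heatD_def prodf_def prod_ennreal gk0_pos less_imp_le)
  also have "\<dots> = (\<Prod>b\<in>(Basis::'a set). \<integral>\<^sup>+r. ennreal (gk 0 s r) \<partial>lborel)"
    by (rule nn_integral_lborel_prod[of "\<lambda>_ r. ennreal (gk 0 s r)"]) auto
  also have "(\<integral>\<^sup>+r. ennreal (gk 0 s r) \<partial>lborel) = 1"
  proof -
    have "(\<integral>\<^sup>+r. ennreal (normal_density 0 (sqrt (2 * s)) r) \<partial>lborel) = ennreal 1"
      using assms integral_normal_density[of "sqrt (2 * s)" 0] integrable_normal_density[of "sqrt (2 * s)" 0]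
      by (subst nn_integral_eq_integral) auto
    then show ?thesis using assms by (simp add: gk0_normal)
  qed
  finally show ?thesis by simp
qed

lemma heatD_bound:
  fixes e :: "'a::euclidean_space \<Rightarrow> nat"
  assumes \<epsilon>: "\<epsilon> > 0"
  shows "\<exists>C\<ge>0. \<forall>s\<ge>\<epsilon>. \<forall>x. \<bar>heatD e s x\<bar> \<le> C * heat (2 * s) x"
proof -
  define B where "B j = (SOME B. B \<ge> 0 \<and> (\<forall>s>0. \<forall>r. \<bar>gk j s r\<bar> \<le> B * s powr (- real j / 2) * gk 0 (2 * s) r))" for j
  have B: "B j \<ge> 0" "\<And>s r. s > 0 \<Longrightarrow> \<bar>gk j s r\<bar> \<le> B j * s powr (- real j / 2) * gk 0 (2 * s) r" for j
    using someI_ex[of "\<lambda>B. B \<ge> 0 \<and> (\<forall>s>0. \<forall>r. \<bar>gk j s r\<bar> \<le> B * s powr (- real j / 2) * gk 0 (2 * s) r)"]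
      gk_bound[of j] unfolding B_def by blast+
  define C where "C = (\<Prod>b\<in>(Basis::'a set). B (e b) * \<epsilon> powr (- real (e b) / 2))"
  have "\<bar>heatD e s x\<bar> \<le> C * heat (2 * s) x" if s: "s \<ge> \<epsilon>" for s x
  proof -
    have s0: "s > 0" using s \<epsilon> by simp
    have "\<bar>heatD e s x\<bar> = (\<Prod>b\<in>Basis. \<bar>gk (e b) s (x \<bullet> b)\<bar>)"
      by (simp add: heatD_def prodf_def abs_prod)
    also have "\<dots> \<le> (\<Prod>b\<in>Basis. B (e b) * \<epsilon> powr (- real (e b) / 2) * gk 0 (2 * s) (x \<bullet> b))"
    proof (intro prod_mono conjI)
      fix b :: 'a
      have "\<bar>gk (e b) s (x \<bullet> b)\<bar> \<le> B (e b) * s powr (- real (e b) / 2) * gk 0 (2 * s) (x \<bullet> b)"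
        using B s0 by auto
      also have "\<dots> \<le> B (e b) * \<epsilon> powr (- real (e b) / 2) * gk 0 (2 * s) (x \<bullet> b)"
        using B s \<epsilon> s0 gk0_pos[of "2 * s" "x \<bullet> b"] by (intro mult_right_mono mult_left_mono powr_mono2') auto
      finally show "\<bar>gk (e b) s (x \<bullet> b)\<bar> \<le> B (e b) * \<epsilon> powr (- real (e b) / 2) * gk 0 (2 * s) (x \<bullet> b)" .
    qed simp
    also have "\<dots> = C * heat (2 * s) x" by (simp add: C_def heatD_def prodf_def prod.distrib)
    finally show ?thesis .
  qed
  moreover have "C \<ge> 0" unfolding C_def using B by (intro prod_nonneg) auto
  ultimately show ?thesis by blast
qed

text \<open>The one-dimensional heat equation, checked by computing the second Hermite
  polynomial.\<close>

lemma gk0_time_deriv: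
  assumes "s > 0"
  shows "((\<lambda>s. gk 0 s r) has_real_derivative gk 2 s r) (at s)"
proof -
  have h2: "hg 2 y = (y\<^sup>2 / 4 - 1/2) * exp (- y\<^sup>2 / 4)" for y
    by (simp add: hg_def numeral_2_eq_2 pderiv_pCons algebra_simps power2_eq_square)
  have "((\<lambda>s. exp (- r\<^sup>2 / (4 * s)) / sqrt (4 * pi * s)) has_real_derivative gk 2 s r) (at s)"
  proof -
    have e: "s powr (- 3 / 2) = 1 / (s * sqrt s)"
    proof -
      have "s powr (- 3 / 2) = s powr (- 1 - 1/2)" by simp
      also have "\<dots> = s powr (- 1) / sqrt s" by (rule powr_minus_half[OF assms])
      finally show ?thesis using assms by (simp add: powr_minus_divide)
    qed
    have g: "gk 2 s r = exp (- r\<^sup>2 / (4 * s)) / sqrt (4 * pi * s) * (r\<^sup>2 / (4 * s\<^sup>2) - 1 / (2 * s))"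
    proof -
      have "- (real 2 + 1) / 2 = (- 3 / 2 :: real)" by simp
      then show ?thesis unfolding gk_def h2
        using assms by (simp only: e) (simp add: power_divide real_sqrt_mult field_simps power2_eq_square)
    qed
    show ?thesis unfolding g
      using assms by (auto intro!: derivative_eq_intros simp: real_sqrt_mult field_simps power2_eq_square)
  qed
  moreover have "eventually (\<lambda>t. gk 0 t r = exp (- r\<^sup>2 / (4 * t)) / sqrt (4 * pi * t)) (nhds s)"
    using eventually_nhds_in_open[of "{0<..}" s] assms by (auto elim!: eventually_mono simp: gk0_eq)
  ultimately show ?thesis by (subst DERIV_cong_ev[OF refl _ refl]) auto
qed

lemma heat_time_deriv:
  fixes z :: "'a::euclidean_space"
  assumes "s > 0"
  shows "((\<lambda>s. heat s z) has_real_derivative (\<Sum>b\<in>Basis. heatD ((\<lambda>_. 0)(b := 2)) s z)) (at s)"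
proof -
  have "((\<lambda>s. \<Prod>b\<in>Basis. gk 0 s (z \<bullet> b)) has_derivative
      (\<lambda>y. \<Sum>b\<in>Basis. gk 2 s (z \<bullet> b) * y * (\<Prod>j\<in>Basis - {b}. gk 0 s (z \<bullet> j)))) (at s)"
    by (intro has_derivative_prod) (use gk0_time_deriv[OF assms] in \<open>simp add: has_field_derivative_def\<close>)
  moreover have "heatD ((\<lambda>_. 0)(b := 2)) s z = gk 2 s (z \<bullet> b) * (\<Prod>j\<in>Basis - {b}. gk 0 s (z \<bullet> j))" if "b \<in> Basis" for b :: 'a
  proof -
    have "heatD ((\<lambda>_. 0)(b := 2)) s z = prodf ((\<lambda>_. gk 0 s)(b := gk 2 s)) z"
      unfolding heatD_def prodf_def by (intro prod.cong) auto
    then show ?thesis using that by (simp add: prodf_upd)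
  qed
  then have "(\<lambda>y. \<Sum>b\<in>Basis. gk 2 s (z \<bullet> b) * y * (\<Prod>j\<in>Basis - {b}. gk 0 s (z \<bullet> j))) =
      (*) (\<Sum>b\<in>Basis. heatD ((\<lambda>_. 0)(b := 2)) s z)"
    unfolding fun_eq_iff sum_distrib_right by (intro allI sum.cong) (auto simp: mult_ac simp del: fun_upd_apply)
  ultimately show ?thesis
    by (simp add: has_field_derivative_def heatD_def[of "\<lambda>_. 0"] prodf_def)
qed

lemma heatD_shift: "heatD e s (x - y) = prodf (\<lambda>b t. gk (e b) s (t - y \<bullet> b)) x"
  by (simp add: heatD_def prodf_def inner_diff_left)

lemma smooth1_gk_shift: "s > 0 \<Longrightarrow> smooth1 (\<lambda>t. gk j s (t - c))"
  using smooth1_affine[OF smooth1_gk[of s j], of 1 1 "- c"] by simp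

lemma deriv_gk_shift: "s > 0 \<Longrightarrow> deriv (\<lambda>t. gk j s (t - c)) = (\<lambda>t. gk (Suc j) s (t - c))"
  by (intro ext DERIV_imp_deriv DERIV_chain2[OF gk_deriv, where x = "_ :: real", THEN DERIV_cong])
    (auto intro!: derivative_eq_intros)

lemma heatD_shift_smooth:
  assumes "s > 0" "b \<in> Basis"
  shows "(\<lambda>x. heatD e s (x - y)) differentiable at x"
    "partial_deriv b (\<lambda>x. heatD e s (x - y)) = (\<lambda>x. heatD (e(b := Suc (e b))) s (x - y))"
    "continuous_on UNIV (\<lambda>x. heatD e s (x - y))"
proof -
  have sm: "smooth1 (\<lambda>t. gk (e b) s (t - y \<bullet> b))" for b using assms by (intro smooth1_gk_shift)
  have "Ck 1 (prodf (\<lambda>b t. gk (e b) s (t - y \<bullet> b)))" by (rule Ck_prodf) (rule sm)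
  then show "(\<lambda>x. heatD e s (x - y)) differentiable at x"
    unfolding heatD_shift[abs_def] by (simp add: differentiable_on_def)
  show "continuous_on UNIV (\<lambda>x. heatD e s (x - y))"
    unfolding heatD_shift[abs_def] by (rule continuous_on_prodf) (rule smooth1_continuous[OF sm])
  have "partial_deriv b (prodf (\<lambda>b t. gk (e b) s (t - y \<bullet> b))) =
    prodf ((\<lambda>b t. gk (e b) s (t - y \<bullet> b))(b := deriv (\<lambda>t. gk (e b) s (t - y \<bullet> b))))"
    by (rule partial_deriv_prodf) (use sm assms in auto)
  also have "\<dots> = prodf (\<lambda>c t. gk ((e(b := Suc (e b))) c) s (t - y \<bullet> c))"
    using assms by (intro arg_cong[where f = prodf]) (auto simp: deriv_gk_shift fun_eq_iff)
  finally show "partial_deriv b (\<lambda>x. heatD e s (x - y)) = (\<lambda>x. heatD (e(b := Suc (e b))) s (x - y))"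
    unfolding heatD_shift[abs_def] .
qed

text \<open>Links the two encodings of multi-indices: the directions in a list are counted on top of
  \<open>e\<close>.\<close>

primrec add_order :: "'a list \<Rightarrow> ('a \<Rightarrow> nat) \<Rightarrow> 'a \<Rightarrow> nat" where
  "add_order [] e = e"
| "add_order (b # bs) e = add_order bs (e(b := Suc (e b)))"

lemma heatD_by_parts:
  assumes "s > 0" "\<psi> \<in> test_functions" "set bs \<subseteq> Basis"
  shows "(\<integral>x. heatD e s (x - y) * iter_partial bs \<psi> x \<partial>lborel) =
    (-1) ^ length bs * (\<integral>x. heatD (add_order bs e) s (x - y) * \<psi> x \<partial>lborel)"
  using assms(3)
proof (induction bs arbitrary: e)
  case (Cons b bs)
  note h = heatD_shift_smooth[OF assms(1), of b]
  have b: "b \<in> Basis" using Cons.prems by simp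
  have "(\<integral>x. heatD e s (x - y) * iter_partial (b # bs) \<psi> x \<partial>lborel) =
      - (\<integral>x. heatD (e(b := Suc (e b))) s (x - y) * iter_partial bs \<psi> x \<partial>lborel)"
    using integration_by_parts_test[of "\<lambda>x. heatD e s (x - y)" b "iter_partial bs \<psi>"] h[OF b]
      test_functions_iter_partial[OF assms(2)] Cons.prems b by (simp del: fun_upd_apply)
  then show ?case using Cons.IH[of "e(b := Suc (e b))"] Cons.prems by (simp del: fun_upd_apply)
qed simp

text \<open>From |u| <= 1 + |u| powr p: a bounded integrable function can be paired with every
  function of L^p, without reference to the conjugate exponent.\<close>

lemma integrable_mult_Lp:
  fixes u k :: "'b \<Rightarrow> real"
  assumes [measurable]: "u \<in> borel_measurable M" and k: "integrable M k"
    and p: "p \<ge> 1" and u: "integrable M (\<lambda>x. \<bar>u x\<bar> powr p)" and C: "\<And>x. \<bar>k x\<bar> \<le> C"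
  shows "integrable M (\<lambda>x. u x * k x)"
proof (rule Bochner_Integration.integrable_bound)
  show "integrable M (\<lambda>x. \<bar>k x\<bar> + C * \<bar>u x\<bar> powr p)" using k u by auto
  have [measurable]: "k \<in> borel_measurable M" using k by simp
  show "(\<lambda>x. u x * k x) \<in> borel_measurable M" by measurable
  show "AE x in M. norm (u x * k x) \<le> norm (\<bar>k x\<bar> + C * \<bar>u x\<bar> powr p)"
  proof (rule AE_I2)
    fix x
    have C0: "C \<ge> 0" using C[of x] by linarith
    have "\<bar>u x\<bar> \<le> 1 + \<bar>u x\<bar> powr p"
    proof (cases "\<bar>u x\<bar> \<le> 1")
      case False
      then show ?thesis using powr_mono[of 1 p "\<bar>u x\<bar>"] p by simp
    qed (simp add: add_increasing2)
    then have "\<bar>u x\<bar> * \<bar>k x\<bar> \<le> (1 + \<bar>u x\<bar> powr p) * \<bar>k x\<bar>" by (rule mult_right_mono) simp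
    also have "\<dots> \<le> \<bar>k x\<bar> + C * \<bar>u x\<bar> powr p"
      using mult_left_mono[OF C[of x], of "\<bar>u x\<bar> powr p"] by (simp add: algebra_simps)
    finally show "norm (u x * k x) \<le> norm (\<bar>k x\<bar> + C * \<bar>u x\<bar> powr p)"
      using C0 by (simp add: abs_mult)
  qed
qed

lemma integrable_heat: "s > 0 \<Longrightarrow> integrable lborel (\<lambda>x. heat s (x - y :: 'a::euclidean_space))"
  using nn_integral_heat[of s, where 'a = 'a] nn_integral_lborel_translate[of "\<lambda>x. ennreal (heat s x)" y]
  by (intro integrableI_nonneg) (auto simp: heat_pos less_imp_le)

section \<open>The fundamental lemma of the calculus of variations\<close>

text \<open>The value 1 at the single point 0 is enough, since the argument will be divided by a
  radius that tends to infinity.\<close>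

definition cutoff :: "real \<Rightarrow> real" where
  "cutoff t = expinv 1 (1 - t) * expinv 1 (1 + t) / (expinv 1 1)\<^sup>2"

lemma smooth1_cutoff: "smooth1 cutoff"
proof -
  have "smooth1 (\<lambda>t. (1 / (expinv 1 1)\<^sup>2 * expinv 1 (- 1 * t + 1)) * (1 * expinv 1 (1 * t + 1)))"
    by (intro smooth1_mult smooth1_affine smooth1_expinv)
  also have "(\<lambda>t. (1 / (expinv 1 1)\<^sup>2 * expinv 1 (- 1 * t + 1)) * (1 * expinv 1 (1 * t + 1))) = cutoff"
    by (auto simp: fun_eq_iff cutoff_def add.commute)
  finally show ?thesis .
qed

lemma cutoff_0 [simp]: "cutoff 0 = 1"
  by (simp add: cutoff_def power2_eq_square expinv_def)

lemma cutoff_outside: "\<bar>t\<bar> \<ge> 1 \<Longrightarrow> cutoff t = 0"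
  by (auto simp: cutoff_def expinv_def)

lemma deriv_zero_outside:
  assumes "\<And>t. \<bar>t\<bar> \<ge> R \<Longrightarrow> f t = 0" "\<bar>t\<bar> > (R::real)"
  shows "deriv f t = (0::real)"
proof -
  have "open {t. \<bar>t\<bar> > R}" by (intro open_Collect_less continuous_intros)
  then have "eventually (\<lambda>t. f t = 0) (nhds t)"
    using eventually_nhds_in_open[of "{t. \<bar>t\<bar> > R}" t] assms by (auto elim!: eventually_mono)
  then have "deriv f t = deriv (\<lambda>_. 0) t" by (intro deriv_cong_ev) auto
  then show ?thesis by simp
qed

lemma cutoff_bounds:
  obtains M where "M \<ge> 0" "\<And>t. \<bar>cutoff t\<bar> \<le> M" "\<And>t. \<bar>deriv cutoff t\<bar> \<le> M" "\<And>t. \<bar>deriv (deriv cutoff) t\<bar> \<le> M"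
proof -
  note s1 = smooth1_deriv(2)[OF smooth1_cutoff] note s2 = smooth1_deriv(2)[OF s1]
  have d1: "deriv cutoff t = 0" if "\<bar>t\<bar> \<ge> 2" for t
    by (rule deriv_zero_outside[where R = 1]) (use that cutoff_outside in auto)
  have d2: "deriv (deriv cutoff) t = 0" if "\<bar>t\<bar> \<ge> 3" for t
    by (rule deriv_zero_outside[where R = 2]) (use that d1 in auto)
  obtain M0 where M0: "\<And>t. \<bar>cutoff t\<bar> \<le> M0" "M0 \<ge> 0"
    by (rule bounded_compact_support[OF smooth1_continuous[OF smooth1_cutoff], of 1]) (auto simp: cutoff_outside)
  obtain M1 where M1: "\<And>t. \<bar>deriv cutoff t\<bar> \<le> M1"
    by (rule bounded_compact_support[OF smooth1_continuous[OF s1], of 2]) (auto simp: d1)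
  obtain M2 where M2: "\<And>t. \<bar>deriv (deriv cutoff) t\<bar> \<le> M2"
    by (rule bounded_compact_support[OF smooth1_continuous[OF s2], of 3]) (auto simp: d2)
  show thesis
    by (rule that[of "max M0 (max M1 M2)"]) (use M0 M1 M2 in \<open>auto simp: le_max_iff_disj\<close>)
qed

definition cutgauss :: "real \<Rightarrow> real \<Rightarrow> real \<Rightarrow> real \<Rightarrow> real" where
  "cutgauss R s c t = cutoff (t / R) * gk 0 s (t - c)"

lemma smooth1_cutgauss: "s > 0 \<Longrightarrow> smooth1 (cutgauss R s c)"
  using smooth1_mult[OF smooth1_affine[OF smooth1_cutoff, of 1 "1 / R" 0] smooth1_gk_shift[of s 0 c]]
  by (simp add: cutgauss_def[abs_def])

lemma cutgauss_deriv2: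
  assumes s: "s > 0"
  shows "deriv (deriv (cutgauss R s c)) t = deriv (deriv cutoff) (t / R) / R / R * gk 0 s (t - c)
     + 2 * (deriv cutoff (t / R) / R * gk 1 s (t - c)) + cutoff (t / R) * gk 2 s (t - c)"
proof -
  have g: "((\<lambda>t. gk j s (t - c)) has_real_derivative gk (Suc j) s (t - c)) (at t)" for j t
    using smooth1_deriv(1)[OF smooth1_gk_shift[OF s], of j c t] by (simp add: deriv_gk_shift[OF s])
  have k: "((\<lambda>t. f (t / R)) has_real_derivative deriv f (t / R) / R) (at t)" if "smooth1 f" for f t
  proof -
    have "((\<lambda>t. t / R) has_real_derivative 1 / R) (at t)" by (rule DERIV_cdivide[OF DERIV_ident])
    from DERIV_chain2[OF smooth1_deriv(1)[OF that] this] show ?thesis by simp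
  qed
  note s1 = smooth1_deriv(2)[OF smooth1_cutoff]
  have "(cutgauss R s c has_real_derivative deriv cutoff (t / R) / R * gk 0 s (t - c) + cutoff (t / R) * gk 1 s (t - c)) (at t)" for t
    unfolding cutgauss_def[abs_def] using DERIV_mult[OF k[OF smooth1_cutoff] g[of 0]] by (simp add: mult.commute)
  then have d1: "deriv (cutgauss R s c) = (\<lambda>t. deriv cutoff (t / R) / R * gk 0 s (t - c) + cutoff (t / R) * gk 1 s (t - c))"
    by (intro ext DERIV_imp_deriv)
  have "((\<lambda>t. deriv cutoff (t / R) / R * gk 0 s (t - c) + cutoff (t / R) * gk 1 s (t - c)) has_real_derivative
     (deriv (deriv cutoff) (t / R) / R / R * gk 0 s (t - c) + gk 1 s (t - c) * (deriv cutoff (t / R) / R)) +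
     (deriv cutoff (t / R) / R * gk 1 s (t - c) + gk 2 s (t - c) * cutoff (t / R))) (at t)"
    using DERIV_add[OF DERIV_mult[OF DERIV_cdivide[OF k[OF s1], of R] g[of 0]] DERIV_mult[OF k[OF smooth1_cutoff] g[of 1]]]
    by (simp add: numeral_2_eq_2)
  then show ?thesis unfolding d1 by (subst DERIV_imp_deriv) (auto simp: algebra_simps)
qed

text \<open>The heat kernel does not have compact support. Cutting off each coordinate at radius i +
  1 gives test functions that converge, with their second derivatives, pointwise and under a
  multiple of the heat kernel at time 2 * s.\<close>

lemma gaussian_pairing:
  fixes u v :: "'a::euclidean_space \<Rightarrow> real"
  assumes s: "s > 0" and b: "b \<in> Basis" and p: "p \<ge> 1"
    and u [measurable]: "u \<in> borel_measurable borel" and v [measurable]: "v \<in> borel_measurable borel"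
    and up: "integrable lborel (\<lambda>x. \<bar>u x\<bar> powr p)" and vp: "integrable lborel (\<lambda>x. \<bar>v x\<bar> powr p)"
    and weak: "\<And>\<psi>. \<psi> \<in> test_functions \<Longrightarrow>
      (\<integral>x. u x * iter_partial [b, b] \<psi> x \<partial>lborel) = (\<integral>x. v x * \<psi> x \<partial>lborel)"
  shows "(\<integral>x. u x * heatD ((\<lambda>_. 0)(b := 2)) s (x - y) \<partial>lborel) = (\<integral>x. v x * heat s (x - y) \<partial>lborel)"
proof -
  define H where "H i c = cutgauss (real i + 1) s (y \<bullet> c)" for i and c :: 'a
  define \<psi> where "\<psi> i = prodf (H i)" for i
  define D where "D i = prodf ((H i)(b := deriv (deriv (H i b))))" for i
  have smH: "smooth1 (H i c)" for i c unfolding H_def using s by (rule smooth1_cutgauss)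
  have test: "\<psi> i \<in> test_functions" for i
    unfolding \<psi>_def
  proof (rule prodf_test_function[where a = "- (real i + 1) *\<^sub>R One" and c = "(real i + 1) *\<^sub>R One"])
    fix c :: 'a and t assume c: "c \<in> Basis" "t \<notin> {(- (real i + 1) *\<^sub>R One) \<bullet> c..((real i + 1) *\<^sub>R One) \<bullet> c}"
    then have "\<bar>t\<bar> > real i + 1" by auto
    then show "H i c t = 0" by (simp add: H_def cutgauss_def cutoff_outside)
  qed (rule smH)
  have iter: "iter_partial [b, b] (\<psi> i) = D i" for i
  proof -
    have 1: "partial_deriv b (\<psi> i) = prodf ((H i)(b := deriv (H i b)))"
      unfolding \<psi>_def by (rule partial_deriv_prodf) (use smH b in auto)
    have "partial_deriv b (prodf ((H i)(b := deriv (H i b)))) =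
       prodf (((H i)(b := deriv (H i b)))(b := deriv (((H i)(b := deriv (H i b))) b)))"
      by (rule partial_deriv_prodf) (use smH b smooth1_deriv(2) in auto)
    then show ?thesis by (simp add: 1 D_def)
  qed
  obtain M where M: "M \<ge> 0" "\<And>t. \<bar>cutoff t\<bar> \<le> M" "\<And>t. \<bar>deriv cutoff t\<bar> \<le> M" "\<And>t. \<bar>deriv (deriv cutoff) t\<bar> \<le> M"
    using cutoff_bounds by blast
  have "\<exists>K\<ge>0. \<forall>r. \<bar>gk j s r\<bar> \<le> K * gk 0 (2 * s) r" for j
  proof -
    obtain B where B: "B \<ge> 0" "\<forall>s>0. \<forall>r. \<bar>gk j s r\<bar> \<le> B * s powr (- real j / 2) * gk 0 (2 * s) r"
      using gk_bound by blast
    then show ?thesis using s by (intro exI[of _ "B * s powr (- real j / 2)"]) auto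
  qed
  then obtain K where K: "\<And>j. K j \<ge> 0" "\<And>j r. \<bar>gk j s r\<bar> \<le> K j * gk 0 (2 * s) r" by metis
  \<comment> \<open>One constant for a coordinate factor and for its second derivative, so a product
    with any one factor differentiated twice is bounded by \<open>L ^ DIM('a)\<close> times a heat
    kernel.\<close>
  define L where "L = M * (K 0 + 2 * K 1 + K 2)"
  have L0: "L \<ge> 0" using M K(1) by (simp add: L_def)
  have g2: "gk 0 (2 * s) r > 0" for r using s by (simp add: gk0_pos)
  have bH: "\<bar>H i c t\<bar> \<le> L * gk 0 (2 * s) (t - y \<bullet> c)" for i c t
  proof -
    have "\<bar>H i c t\<bar> \<le> M * (K 0 * gk 0 (2 * s) (t - y \<bullet> c))"
      unfolding H_def cutgauss_def abs_mult using M K by (intro mult_mono) auto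
    also have "\<dots> \<le> M * ((K 0 + 2 * K 1 + K 2) * gk 0 (2 * s) (t - y \<bullet> c))"
      using M K(1) g2 by (intro mult_left_mono mult_right_mono) (auto simp: less_imp_le add_increasing2)
    finally show ?thesis by (simp add: L_def)
  qed
  have bD: "\<bar>deriv (deriv (H i c)) t\<bar> \<le> L * gk 0 (2 * s) (t - y \<bullet> c)" for i c t
  proof -
    let ?R = "real i + 1" and ?G = "gk 0 (2 * s) (t - y \<bullet> c)"
    have R1: "\<bar>a / ?R\<bar> \<le> M" if "\<bar>a\<bar> \<le> M" for a
      using that M(1) by (simp add: abs_divide divide_le_eq) (metis abs_ge_zero add_increasing2 mult_left_mono mult.right_neutral le_add_same_cancel2 of_nat_0_le_iff order_trans)
    have "\<bar>deriv (deriv (H i c)) t\<bar> \<le> \<bar>deriv (deriv cutoff) (t / ?R) / ?R / ?R\<bar> * \<bar>gk 0 s (t - y \<bullet> c)\<bar>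
      + 2 * (\<bar>deriv cutoff (t / ?R) / ?R\<bar> * \<bar>gk 1 s (t - y \<bullet> c)\<bar>) + \<bar>cutoff (t / ?R)\<bar> * \<bar>gk 2 s (t - y \<bullet> c)\<bar>"
      unfolding H_def cutgauss_deriv2[OF s]
      by (intro order_trans[OF abs_triangle_ineq] add_mono) (simp_all only: abs_mult abs_numeral order_refl)
    also have "\<dots> \<le> M * (K 0 * ?G) + 2 * (M * (K 1 * ?G)) + M * (K 2 * ?G)"
      by (intro add_mono mult_mono mult_left_mono R1 M K(2)) (auto intro!: mult_nonneg_nonneg M K simp: g2 less_imp_le)
    also have "\<dots> = L * ?G" by (simp add: L_def algebra_simps)
    finally show ?thesis .
  qed
  have prod_bound: "\<bar>prodf h x\<bar> \<le> L ^ DIM('a) * heat (2 * s) (x - y)"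
    if "\<And>c t. c \<in> Basis \<Longrightarrow> \<bar>h c t\<bar> \<le> L * gk 0 (2 * s) (t - y \<bullet> c)" for h x
  proof -
    have "\<bar>prodf h x\<bar> = (\<Prod>c\<in>Basis. \<bar>h c (x \<bullet> c)\<bar>)" by (simp add: prodf_def abs_prod)
    also have "\<dots> \<le> (\<Prod>c\<in>Basis. L * gk 0 (2 * s) (x \<bullet> c - y \<bullet> c))"
      using that by (intro prod_mono) auto
    also have "\<dots> = L ^ DIM('a) * heat (2 * s) (x - y)"
      by (simp add: prod.distrib heatD_def prodf_def inner_diff_left)
    finally show ?thesis .
  qed
  have limR: "(\<lambda>i. t / (real i + 1)) \<longlonglongrightarrow> 0" for t :: real
    using tendsto_mult_left[OF LIMSEQ_inverse_real_of_nat, of t] by (simp add: divide_inverse add.commute)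
  have cont: "(\<lambda>i. f (t / (real i + 1))) \<longlonglongrightarrow> f 0" if "smooth1 f" for f :: "real \<Rightarrow> real" and t
    using smooth1_continuous[OF that] limR[of t]
    by (metis continuous_on_eq_continuous_at isCont_tendsto_compose open_UNIV UNIV_I)
  note s1 = smooth1_deriv(2)[OF smooth1_cutoff] note s2 = smooth1_deriv(2)[OF s1]
  have limH: "(\<lambda>i. H i c t) \<longlonglongrightarrow> gk 0 s (t - y \<bullet> c)" for c t
    unfolding H_def cutgauss_def using tendsto_mult_right[OF cont[OF smooth1_cutoff, of t], of "gk 0 s (t - y \<bullet> c)"] by simp
  have limD: "(\<lambda>i. deriv (deriv (H i c)) t) \<longlonglongrightarrow> gk 2 s (t - y \<bullet> c)" for c t
  proof -
    have inv: "(\<lambda>i. 1 / (real i + 1)) \<longlonglongrightarrow> 0" using limR[of 1] .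
    have "(\<lambda>i. deriv (deriv cutoff) (t / (real i + 1)) * (1 / (real i + 1)) * (1 / (real i + 1)) * gk 0 s (t - y \<bullet> c)
     + 2 * (deriv cutoff (t / (real i + 1)) * (1 / (real i + 1)) * gk 1 s (t - y \<bullet> c)) + cutoff (t / (real i + 1)) * gk 2 s (t - y \<bullet> c))
     \<longlonglongrightarrow> deriv (deriv cutoff) 0 * 0 * 0 * gk 0 s (t - y \<bullet> c) + 2 * (deriv cutoff 0 * 0 * gk 1 s (t - y \<bullet> c)) + cutoff 0 * gk 2 s (t - y \<bullet> c)"
      by (intro tendsto_intros inv cont s1 s2 smooth1_cutoff)
    then show ?thesis unfolding H_def cutgauss_deriv2[OF s] by simp
  qed
  let ?w = "\<lambda>x. L ^ DIM('a) * heat (2 * s) (x - y)"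
  have bw: "\<bar>?w x\<bar> \<le> L ^ DIM('a) * (4 * pi * (2 * s)) powr (- real DIM('a) / 2)" for x
    using s L0 heat_pos[of "2 * s" "x - y"] heat_le[of "2 * s" "x - y"] by (simp add: abs_mult mult_left_mono)
  have iw: "integrable lborel ?w" using s by (intro integrable_mult_right integrable_heat) auto
  have w0: "?w x \<ge> 0" for x using L0 heat_pos[of "2 * s" "x - y"] s by simp
  have au: "integrable lborel (\<lambda>x. \<bar>u x\<bar> * ?w x)"
    using integrable_mult_Lp[OF _ iw p _ bw, of "\<lambda>x. \<bar>u x\<bar>"] up by simp
  have av: "integrable lborel (\<lambda>x. \<bar>v x\<bar> * ?w x)"
    using integrable_mult_Lp[OF _ iw p _ bw, of "\<lambda>x. \<bar>v x\<bar>"] vp by simp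
  have mp [measurable]: "prodf h \<in> borel_measurable borel" if "\<And>c. c \<in> Basis \<Longrightarrow> smooth1 (h c)" for h :: "'a \<Rightarrow> real \<Rightarrow> real"
    using that by (intro borel_measurable_continuous_onI continuous_on_prodf smooth1_continuous)
  have mD [measurable]: "D i \<in> borel_measurable borel" for i
    unfolding D_def by (rule mp) (use smH smooth1_deriv(2) in auto)
  have m\<psi> [measurable]: "\<psi> i \<in> borel_measurable borel" for i
    unfolding \<psi>_def by (rule mp) (use smH in auto)
  have "(\<lambda>i. \<integral>x. u x * D i x \<partial>lborel) \<longlonglongrightarrow> (\<integral>x. u x * heatD ((\<lambda>_. 0)(b := 2)) s (x - y) \<partial>lborel)"
  proof (rule integral_dominated_convergence[OF _ _ au])
    show "AE x in lborel. (\<lambda>i. u x * D i x) \<longlonglongrightarrow> u x * heatD ((\<lambda>_. 0)(b := 2)) s (x - y)"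
    proof (rule AE_I2)
      fix x
      have "(\<lambda>i. D i x) \<longlonglongrightarrow> heatD ((\<lambda>_. 0)(b := 2)) s (x - y)"
        unfolding D_def heatD_shift prodf_def by (intro tendsto_prod) (use limH limD in auto)
      then show "(\<lambda>i. u x * D i x) \<longlonglongrightarrow> u x * heatD ((\<lambda>_. 0)(b := 2)) s (x - y)" by (rule tendsto_mult_left)
    qed
    show "AE x in lborel. norm (u x * D i x) \<le> \<bar>u x\<bar> * ?w x" for i
    proof (rule AE_I2)
      fix x
      have "\<bar>D i x\<bar> \<le> ?w x" unfolding D_def by (rule prod_bound) (use bH bD in auto)
      then show "norm (u x * D i x) \<le> \<bar>u x\<bar> * ?w x" by (simp add: abs_mult mult_left_mono)
    qed
  qed measurable
  moreover have "(\<lambda>i. \<integral>x. v x * \<psi> i x \<partial>lborel) \<longlonglongrightarrow> (\<integral>x. v x * heat s (x - y) \<partial>lborel)"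
  proof (rule integral_dominated_convergence[OF _ _ av])
    show "AE x in lborel. (\<lambda>i. v x * \<psi> i x) \<longlonglongrightarrow> v x * heat s (x - y)"
    proof (rule AE_I2)
      fix x
      have "(\<lambda>i. \<psi> i x) \<longlonglongrightarrow> heat s (x - y)"
        unfolding \<psi>_def heatD_shift prodf_def by (intro tendsto_prod) (use limH in auto)
      then show "(\<lambda>i. v x * \<psi> i x) \<longlonglongrightarrow> v x * heat s (x - y)" by (rule tendsto_mult_left)
    qed
    show "AE x in lborel. norm (v x * \<psi> i x) \<le> \<bar>v x\<bar> * ?w x" for i
    proof (rule AE_I2)
      fix x
      have "\<bar>\<psi> i x\<bar> \<le> ?w x" unfolding \<psi>_def by (rule prod_bound) (use bH in auto)
      then show "norm (v x * \<psi> i x) \<le> \<bar>v x\<bar> * ?w x" by (simp add: abs_mult mult_left_mono)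
    qed
  qed measurable
  moreover have "(\<integral>x. u x * D i x \<partial>lborel) = (\<integral>x. v x * \<psi> i x \<partial>lborel)" for i
    using weak[OF test[of i], unfolded iter] .
  ultimately show ?thesis using LIMSEQ_unique by simp
qed

text \<open>The measures whose densities are the positive and the negative part of f agree on boxes,
  which generate the Borel sets; hence they agree, and so do the densities.\<close>

lemma AE_zero_if_box_integrals_zero:
  fixes f :: "'a::euclidean_space \<Rightarrow> real"
  assumes [measurable]: "f \<in> borel_measurable borel"
    and int: "\<And>a c. integrable lborel (\<lambda>x. indicator (box a c) x * f x)"
    and zero: "\<And>a c. (\<integral>x. indicator (box a c) x * f x \<partial>lborel) = 0"
  shows "AE x in lborel. f x = 0"
proof -
  let ?P = "density lborel (\<lambda>x. ennreal (f x))" and ?N = "density lborel (\<lambda>x. ennreal (- f x))"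
  have eq: "emeasure ?P (box a c) = emeasure ?N (box a c) \<and> emeasure ?P (box a c) \<noteq> \<infinity>" for a c
  proof -
    let ?h = "\<lambda>x. indicator (box a c) x * f x"
    have P: "emeasure ?P (box a c) = (\<integral>\<^sup>+x. ennreal (?h x) \<partial>lborel)"
      by (subst emeasure_density) (auto intro!: nn_integral_cong split: split_indicator)
    have N: "emeasure ?N (box a c) = (\<integral>\<^sup>+x. ennreal (- ?h x) \<partial>lborel)"
      by (subst emeasure_density) (auto intro!: nn_integral_cong split: split_indicator)
    have f1: "(\<integral>\<^sup>+x. ennreal (?h x) \<partial>lborel) \<noteq> \<infinity>" "(\<integral>\<^sup>+x. ennreal (- ?h x) \<partial>lborel) \<noteq> \<infinity>"
      using int[of a c] by (auto simp: real_integrable_def)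
    have "enn2real (\<integral>\<^sup>+x. ennreal (?h x) \<partial>lborel) = enn2real (\<integral>\<^sup>+x. ennreal (- ?h x) \<partial>lborel)"
      using zero[of a c] real_lebesgue_integral_def[OF int[of a c]] by simp
    then have "(\<integral>\<^sup>+x. ennreal (?h x) \<partial>lborel) = (\<integral>\<^sup>+x. ennreal (- ?h x) \<partial>lborel)"
    proof -
      have "X = Y" if "enn2real X = enn2real Y" "X \<noteq> \<infinity>" "Y \<noteq> \<infinity>" for X Y
        using that by (cases X; cases Y) auto
      then show "enn2real (\<integral>\<^sup>+x. ennreal (?h x) \<partial>lborel) = enn2real (\<integral>\<^sup>+x. ennreal (- ?h x) \<partial>lborel) \<Longrightarrow> ?thesis"
        using f1 by blast
    qed
    then show ?thesis using P N f1 by simp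
  qed
  have "?P = ?N"
  proof (rule measure_eqI_generator_eq[where E = "range (\<lambda>(a, c). box a c)" and \<Omega> = UNIV and A = "\<lambda>i. box (- real i *\<^sub>R One) (real i *\<^sub>R One)"])
    show "Int_stable (range (\<lambda>(a, c). box a c :: 'a set))"
      unfolding Int_stable_def by (auto simp: box_Int_box)
    show "sets ?P = sigma_sets UNIV (range (\<lambda>(a, c). box a c))" "sets ?N = sigma_sets UNIV (range (\<lambda>(a, c). box a c))"
      using arg_cong[OF borel_eq_box[where 'a = 'a], of sets] by simp_all
    show "(\<Union>i. box (- real i *\<^sub>R One) (real i *\<^sub>R One)) = (UNIV :: 'a set)"
      using UN_box_eq_UNIV by simp
    show "emeasure ?P X = emeasure ?N X" if "X \<in> range (\<lambda>(a, c). box a c)" for X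
      using that eq by auto
    show "emeasure ?P (box (- real i *\<^sub>R One) (real i *\<^sub>R One)) \<noteq> \<infinity>" for i
      using eq by blast
  qed auto
  then have "AE x in lborel. ennreal (f x) = ennreal (- f x)"
    by (subst (asm) sigma_finite_measure.density_unique_iff[OF sigma_finite_lborel]) auto
  then show ?thesis
  proof eventually_elim
    case (elim x)
    then show ?case by (cases "f x \<ge> 0") (auto simp: ennreal_eq_0_iff ennreal_neg)
  qed
qed

text \<open>The indicator of an open box is the pointwise limit of test functions with values
  between 0 and 1 that vanish off the closed box.\<close>

lemma AE_zero_if_weakly_zero:
  fixes f :: "'a::euclidean_space \<Rightarrow> real"
  assumes f [measurable]: "f \<in> borel_measurable borel"
    and int: "\<And>a c. integrable lborel (\<lambda>x. indicator (cbox a c) x * f x)"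
    and zero: "\<And>\<psi>. \<psi> \<in> test_functions \<Longrightarrow> (\<integral>x. f x * \<psi> x \<partial>lborel) = 0"
  shows "AE x in lborel. f x = 0"
proof (rule AE_zero_if_box_integrals_zero[OF f])
  fix a c :: 'a
  show "integrable lborel (\<lambda>x. indicator (box a c) x * f x)"
    by (rule Bochner_Integration.integrable_bound[OF int[of a c]])
      (auto split: split_indicator simp: box_subset_cbox[THEN subsetD])
  define h where "h j b t = expinv 1 ((real j + 1) * (t - a \<bullet> b)) * expinv 1 ((real j + 1) * (c \<bullet> b - t))" for j b t
  have sm: "smooth1 (h j b)" for j b
  proof -
    have "smooth1 (\<lambda>t. (1 * expinv 1 ((real j + 1) * t + (- (real j + 1) * (a \<bullet> b)))) *
        (1 * expinv 1 (- (real j + 1) * t + (real j + 1) * (c \<bullet> b))))"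
      by (intro smooth1_mult smooth1_affine smooth1_expinv)
    then show ?thesis by (simp add: h_def[abs_def] algebra_simps)
  qed
  have e01: "0 \<le> expinv 1 t" "expinv 1 t \<le> 1" for t by (auto simp: expinv_def)
  have out: "h j b t = 0" if "t \<notin> {a \<bullet> b..c \<bullet> b}" for j b t
    using that by (auto simp: h_def expinv_def zero_less_mult_iff)
  have test: "prodf (h j) \<in> test_functions" for j
    by (rule prodf_test_function[where a = a and c = c]) (auto simp: sm out)
  have h01: "0 \<le> h j b t \<and> h j b t \<le> 1" for j b t
    unfolding h_def using e01 by (auto intro: mult_le_one)
  have elim: "(\<lambda>j. expinv 1 ((real j + 1) * t)) \<longlonglongrightarrow> (if t > 0 then 1 else 0)" for t
  proof (cases "t > 0")
    case True
    have "(\<lambda>j. 1 / (real j + 1)) \<longlonglongrightarrow> 0"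
      using LIMSEQ_inverse_real_of_nat by (simp add: inverse_eq_divide add.commute)
    then have "(\<lambda>j. 1 / t * (1 / (real j + 1))) \<longlonglongrightarrow> 1 / t * 0"
      by (rule tendsto_mult_left)
    then have "(\<lambda>j. exp (- (1 / t * (1 / (real j + 1))))) \<longlonglongrightarrow> exp (- (1 / t * 0))"
      by (intro tendsto_exp tendsto_minus)
    then show ?thesis using True by (simp add: expinv_def mult.commute)
  qed (auto simp: expinv_def zero_less_mult_iff)
  have lim: "(\<lambda>j. prodf (h j) x) \<longlonglongrightarrow> indicator (box a c) x" for x
  proof -
    have "(\<lambda>j. prodf (h j) x) \<longlonglongrightarrow> (\<Prod>b\<in>Basis. (if x \<bullet> b - a \<bullet> b > 0 then 1 else 0) * (if c \<bullet> b - x \<bullet> b > 0 then 1 else 0))"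
      unfolding prodf_def h_def by (intro tendsto_prod tendsto_mult elim)
    also have "(\<Prod>b\<in>Basis. (if x \<bullet> b - a \<bullet> b > 0 then 1 else 0) * (if c \<bullet> b - x \<bullet> b > 0 then 1 else 0)) = (indicator (box a c) x :: real)"
      by (auto simp: indicator_def mem_box)
    finally show ?thesis .
  qed
  have [measurable]: "prodf (h j) \<in> borel_measurable borel" for j
    by (intro borel_measurable_continuous_onI continuous_on_prodf smooth1_continuous sm)
  have "(\<lambda>j. \<integral>x. f x * prodf (h j) x \<partial>lborel) \<longlonglongrightarrow> (\<integral>x. indicator (box a c) x * f x \<partial>lborel)"
  proof (rule integral_dominated_convergence[where w = "\<lambda>x. \<bar>indicator (cbox a c) x * f x\<bar>"])
    show "AE x in lborel. (\<lambda>j. f x * prodf (h j) x) \<longlonglongrightarrow> indicator (box a c) x * f x"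
      using lim by (auto simp: mult.commute intro!: tendsto_mult_left AE_I2)
    show "AE x in lborel. norm (f x * prodf (h j) x) \<le> \<bar>indicator (cbox a c) x * f x\<bar>" for j
    proof (rule AE_I2)
      fix x
      have "0 \<le> prodf (h j) x" "prodf (h j) x \<le> 1"
        unfolding prodf_def using h01 by (auto intro!: prod_nonneg prod_le_1)
      moreover have "prodf (h j) x = 0" if "x \<notin> cbox a c"
        using that out unfolding prodf_def by (force simp: mem_box)
      ultimately show "norm (f x * prodf (h j) x) \<le> \<bar>indicator (cbox a c) x * f x\<bar>"
        by (cases "x \<in> cbox a c") (auto simp: abs_mult mult_left_le)
    qed
    show "integrable lborel (\<lambda>x. \<bar>indicator (cbox a c) x * f x\<bar>)" by (intro integrable_abs int)
  qed measurable
  then show "(\<integral>x. indicator (box a c) x * f x \<partial>lborel) = 0"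
    using zero[OF test] by (simp add: LIMSEQ_const_iff)
qed

section \<open>Superpositions of heat kernels and the Bessel kernel\<close>

text \<open>The first component under \<open>N\<close> is a time, the second a centre. The
  derivative stands under the integral; \<open>mix_by_parts\<close> shows that it is a weak
  derivative of the superposition.\<close>

definition mix :: "(real \<times> 'a::euclidean_space) measure \<Rightarrow> ('a \<Rightarrow> nat) \<Rightarrow> 'a \<Rightarrow> real" where
  "mix N e x = (\<integral>z. heatD e (fst z) (x - snd z) \<partial>N)"

text \<open>Times bounded away from 0 and finite total mass make every \<open>mix\<close> bounded
  and integrable, hence an element of all L^p with p >= 1.\<close>

locale heat_mixture = finite_measure N for N :: "(real \<times> 'a::euclidean_space) measure" +
  fixes \<epsilon> :: real
  assumes sets_N [measurable_cong]: "sets N = sets (borel \<Otimes>\<^sub>M borel)"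
    and eps_pos: "\<epsilon> > 0" and eps_le: "AE z in N. \<epsilon> \<le> fst z"
begin

sublocale P: pair_sigma_finite "lborel :: 'a measure" N ..

lemma heat_le_eps:
  assumes "s \<ge> \<epsilon>"
  shows "heat (2 * s) (x :: 'a) \<le> (8 * pi * \<epsilon>) powr (- real DIM('a) / 2)"
proof -
  have "heat (2 * s) x \<le> (4 * pi * (2 * s)) powr (- real DIM('a) / 2)"
    using assms eps_pos by (intro heat_le) auto
  also have "\<dots> \<le> (8 * pi * \<epsilon>) powr (- real DIM('a) / 2)"
    using assms eps_pos by (intro powr_mono2') auto
  finally show ?thesis .
qed

lemma heatD_AE_bound:
  obtains C D where "C \<ge> 0" "D \<ge> 0"
    "\<And>s y x. s \<ge> \<epsilon> \<Longrightarrow> \<bar>heatD e s (x - y :: 'a)\<bar> \<le> C * heat (2 * s) (x - y)"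
    "\<And>s x. s \<ge> \<epsilon> \<Longrightarrow> heat (2 * s) (x :: 'a) \<le> D"
proof -
  obtain C where C: "C \<ge> 0" "\<forall>s\<ge>\<epsilon>. \<forall>x. \<bar>heatD e s x\<bar> \<le> C * heat (2 * s) x"
    using heatD_bound[OF eps_pos, of e] by blast
  then show thesis using heat_le_eps by (intro that[of C "(8 * pi * \<epsilon>) powr (- real DIM('a) / 2)"]) auto
qed

lemma mix_measurable [measurable]: "mix N e \<in> borel_measurable borel"
  unfolding mix_def by measurable

lemma mix_integrand_integrable: "integrable N (\<lambda>z. heatD e (fst z) (x - snd z))"
proof -
  obtain C D where CD: "C \<ge> 0" "D \<ge> 0"
    "\<And>s y x. s \<ge> \<epsilon> \<Longrightarrow> \<bar>heatD e s (x - y :: 'a)\<bar> \<le> C * heat (2 * s) (x - y)"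
    "\<And>s x. s \<ge> \<epsilon> \<Longrightarrow> heat (2 * s) (x :: 'a) \<le> D" using heatD_AE_bound[of e] by blast
  show ?thesis
  proof (rule integrable_const_bound[where B = "C * D"])
    show "AE z in N. norm (heatD e (fst z) (x - snd z)) \<le> C * D"
      using eps_le
    proof eventually_elim
      case (elim z)
      have "C * heat (2 * fst z) (x - snd z) \<le> C * D" using CD elim by (intro mult_left_mono) auto
      then show ?case using CD(3)[OF elim, of x "snd z"] by simp
    qed
  qed measurable
qed

lemma mix_bounded: obtains B where "B \<ge> 0" "\<And>x. \<bar>mix N e x\<bar> \<le> B"
proof -
  obtain C D where CD: "C \<ge> 0" "D \<ge> 0"
    "\<And>s y x. s \<ge> \<epsilon> \<Longrightarrow> \<bar>heatD e s (x - y :: 'a)\<bar> \<le> C * heat (2 * s) (x - y)"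
    "\<And>s x. s \<ge> \<epsilon> \<Longrightarrow> heat (2 * s) (x :: 'a) \<le> D" using heatD_AE_bound[of e] by blast
  have "\<bar>mix N e x\<bar> \<le> C * D * measure N (space N)" for x
  proof -
    have "\<bar>mix N e x\<bar> \<le> (\<integral>z. \<bar>heatD e (fst z) (x - snd z)\<bar> \<partial>N)"
      unfolding mix_def by (rule integral_abs_bound)
    also have "\<dots> \<le> (\<integral>z. C * D \<partial>N)"
    proof (rule integral_mono_AE)
      show "integrable N (\<lambda>z. \<bar>heatD e (fst z) (x - snd z)\<bar>)"
        by (intro integrable_abs mix_integrand_integrable)
      show "AE z in N. \<bar>heatD e (fst z) (x - snd z)\<bar> \<le> C * D"
        using eps_le
      proof eventually_elim
        case (elim z)
        have "C * heat (2 * fst z) (x - snd z) \<le> C * D" using CD elim by (intro mult_left_mono) auto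
        then show ?case using CD(3)[OF elim, of x "snd z"] by simp
      qed
    qed simp
    finally show ?thesis by (simp add: mult_ac)
  qed
  then show thesis using CD by (intro that[of "C * D * measure N (space N)"]) auto
qed

lemma joint_integrable:
  assumes [measurable]: "k \<in> borel_measurable borel" and B: "B \<ge> 0"
    "\<And>s y. s \<ge> \<epsilon> \<Longrightarrow> (\<integral>\<^sup>+x. ennreal (\<bar>k x\<bar> * heat (2 * s) (x - y)) \<partial>lborel) \<le> ennreal B"
  shows "integrable (lborel \<Otimes>\<^sub>M N) (\<lambda>(x, z). k x * heatD e (fst z) (x - snd z))"
proof (rule integrableI_bounded)
  obtain C D where CD: "C \<ge> 0" "D \<ge> 0"
    "\<And>s y x. s \<ge> \<epsilon> \<Longrightarrow> \<bar>heatD e s (x - y :: 'a)\<bar> \<le> C * heat (2 * s) (x - y)"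
    "\<And>s x. s \<ge> \<epsilon> \<Longrightarrow> heat (2 * s) (x :: 'a) \<le> D" using heatD_AE_bound[of e] by blast
  show "(\<lambda>(x, z). k x * heatD e (fst z) (x - snd z)) \<in> borel_measurable (lborel \<Otimes>\<^sub>M N)"
    by measurable
  have "(\<integral>\<^sup>+w. ennreal (norm (case w of (x, z) \<Rightarrow> k x * heatD e (fst z) (x - snd z))) \<partial>(lborel \<Otimes>\<^sub>M N)) =
    (\<integral>\<^sup>+z. \<integral>\<^sup>+x. ennreal \<bar>k x * heatD e (fst z) (x - snd z)\<bar> \<partial>lborel \<partial>N)"
    by (subst P.nn_integral_snd[symmetric]) (auto simp: split_beta')
  also have "\<dots> \<le> (\<integral>\<^sup>+z. ennreal (C * B) \<partial>N)"
  proof (rule nn_integral_mono_AE)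
    show "AE z in N. (\<integral>\<^sup>+x. ennreal \<bar>k x * heatD e (fst z) (x - snd z)\<bar> \<partial>lborel) \<le> ennreal (C * B)"
      using eps_le
    proof eventually_elim
      case (elim z)
      have "(\<integral>\<^sup>+x. ennreal \<bar>k x * heatD e (fst z) (x - snd z)\<bar> \<partial>lborel) \<le>
        (\<integral>\<^sup>+x. ennreal C * ennreal (\<bar>k x\<bar> * heat (2 * fst z) (x - snd z)) \<partial>lborel)"
      proof (intro nn_integral_mono)
        fix x
        have "\<bar>k x\<bar> * \<bar>heatD e (fst z) (x - snd z)\<bar> \<le> \<bar>k x\<bar> * (C * heat (2 * fst z) (x - snd z))"
          by (intro mult_left_mono CD(3) elim) auto
        then show "ennreal \<bar>k x * heatD e (fst z) (x - snd z)\<bar> \<le> ennreal C * ennreal (\<bar>k x\<bar> * heat (2 * fst z) (x - snd z))"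
          using CD(1) by (simp add: abs_mult mult_ac ennreal_leI flip: ennreal_mult')
      qed
      also have "\<dots> = ennreal C * (\<integral>\<^sup>+x. ennreal (\<bar>k x\<bar> * heat (2 * fst z) (x - snd z)) \<partial>lborel)"
        by (rule nn_integral_cmult) measurable
      also have "\<dots> \<le> ennreal C * ennreal B" by (intro mult_left_mono B elim) auto
      finally show ?case using CD B by (simp add: ennreal_mult)
    qed
  qed
  also have "\<dots> < \<infinity>"
    using emeasure_finite[of "space N"] by (auto simp: ennreal_mult_eq_top_iff less_top[symmetric])
  finally show "(\<integral>\<^sup>+w. ennreal (norm (case w of (x, z) \<Rightarrow> k x * heatD e (fst z) (x - snd z))) \<partial>(lborel \<Otimes>\<^sub>M N)) < \<infinity>" .
qed

text \<open>The bound against all heat kernels, uniform in time and centre, holds for bounded k as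
  well as for k in L^p, and these are the two uses.\<close>

lemma mix_Fubini:
  assumes [measurable]: "k \<in> borel_measurable borel" and B: "B \<ge> 0"
    "\<And>s y. s \<ge> \<epsilon> \<Longrightarrow> (\<integral>\<^sup>+x. ennreal (\<bar>k x\<bar> * heat (2 * s) (x - y)) \<partial>lborel) \<le> ennreal B"
  shows "(\<integral>x. k x * mix N e x \<partial>lborel) = (\<integral>z. \<integral>x. k x * heatD e (fst z) (x - snd z) \<partial>lborel \<partial>N)"
    and "integrable lborel (\<lambda>x. k x * mix N e x)"
  using P.Fubini_integral[OF joint_integrable[OF assms, of e]] P.integrable_fst'[OF joint_integrable[OF assms, of e]]
  by (simp_all add: mix_def)

lemma heat_bound_const:
  assumes "\<And>x. \<bar>k x\<bar> \<le> K" "s \<ge> \<epsilon>"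
  shows "(\<integral>\<^sup>+x. ennreal (\<bar>k x\<bar> * heat (2 * s) (x - y :: 'a)) \<partial>lborel) \<le> ennreal K"
proof -
  have s: "2 * s > 0" using assms(2) eps_pos by simp
  have K: "K \<ge> 0" using assms(1)[of 0] by linarith
  have "(\<integral>\<^sup>+x. ennreal (\<bar>k x\<bar> * heat (2 * s) (x - y)) \<partial>lborel) \<le> (\<integral>\<^sup>+x. ennreal K * ennreal (heat (2 * s) (x - y)) \<partial>lborel)"
    using assms(1) heat_pos[OF s, THEN less_imp_le] K
    by (intro nn_integral_mono) (auto simp flip: ennreal_mult' intro!: ennreal_leI mult_right_mono simp: less_imp_le)
  also have "\<dots> = ennreal K"
    using nn_integral_heat[OF s, where 'a = 'a] nn_integral_lborel_translate[of "\<lambda>x. ennreal (heat (2 * s) x)" y]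
    by (subst nn_integral_cmult) auto
  finally show ?thesis .
qed

lemma mix_integrable: "integrable lborel (mix N e)"
  using mix_Fubini(2)[of "\<lambda>_. 1" 1 e] heat_bound_const[of "\<lambda>_. 1" 1] by simp

lemma mix_Lp:
  assumes "p \<ge> 1"
  shows "integrable lborel (\<lambda>x. \<bar>mix N e x\<bar> powr p)"
proof -
  obtain B where B: "B \<ge> 0" "\<And>x. \<bar>mix N e x\<bar> \<le> B" using mix_bounded[of e] by blast
  show ?thesis
  proof (rule Bochner_Integration.integrable_bound)
    show "integrable lborel (\<lambda>x. B powr (p - 1) * mix N e x)" by (intro integrable_mult_right mix_integrable)
    show "AE x in lborel. norm (\<bar>mix N e x\<bar> powr p) \<le> norm (B powr (p - 1) * mix N e x)"
    proof (rule AE_I2)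
      fix x
      have "\<bar>mix N e x\<bar> powr p = \<bar>mix N e x\<bar> powr (p - 1) * \<bar>mix N e x\<bar>"
        by (cases "mix N e x = 0") (auto simp: powr_diff)
      also have "\<dots> \<le> B powr (p - 1) * \<bar>mix N e x\<bar>"
        using B assms by (intro mult_right_mono powr_mono2) auto
      finally show "norm (\<bar>mix N e x\<bar> powr p) \<le> norm (B powr (p - 1) * mix N e x)" by (simp add: abs_mult)
    qed
  qed measurable
qed

lemma mix_by_parts:
  assumes \<psi>: "\<psi> \<in> test_functions" and bs: "set bs \<subseteq> Basis"
  shows "(\<integral>x. mix N e x * iter_partial bs \<psi> x \<partial>lborel) =
    (-1) ^ length bs * (\<integral>x. mix N (add_order bs e) x * \<psi> x \<partial>lborel)"
proof -
  have test: "iter_partial bs \<psi> \<in> test_functions" using test_functions_iter_partial[OF \<psi> bs] .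
  have bd: "\<exists>K\<ge>0. \<forall>x. \<bar>\<eta> x\<bar> \<le> K" if t: "\<eta> \<in> test_functions" for \<eta> :: "'a \<Rightarrow> real"
  proof -
    obtain R where "\<forall>x. norm x \<ge> R \<longrightarrow> \<eta> x = 0" using test_functionsD(4)[OF t] by blast
    then show ?thesis using bounded_compact_support[OF test_functionsD(1)[OF t], of R] by metis
  qed
  have F: "(\<integral>x. mix N e x * \<eta> x \<partial>lborel) = (\<integral>z. \<integral>x. heatD e (fst z) (x - snd z) * \<eta> x \<partial>lborel \<partial>N)"
    if t: "\<eta> \<in> test_functions" for \<eta> e
  proof -
    have [measurable]: "\<eta> \<in> borel_measurable borel"
      by (intro borel_measurable_continuous_onI test_functionsD(1)[OF t])
    obtain K where K: "K \<ge> 0" "\<forall>x. \<bar>\<eta> x\<bar> \<le> K" using bd[OF t] by blast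
    have "(\<integral>x. \<eta> x * mix N e x \<partial>lborel) = (\<integral>z. \<integral>x. \<eta> x * heatD e (fst z) (x - snd z) \<partial>lborel \<partial>N)"
      by (rule mix_Fubini(1)[OF _ K(1)]) (use K heat_bound_const in auto)
    then show ?thesis by (simp add: mult.commute)
  qed
  have "(\<integral>x. mix N e x * iter_partial bs \<psi> x \<partial>lborel) = (\<integral>z. \<integral>x. heatD e (fst z) (x - snd z) * iter_partial bs \<psi> x \<partial>lborel \<partial>N)"
    by (rule F[OF test])
  also have "\<dots> = (\<integral>z. (-1) ^ length bs * (\<integral>x. heatD (add_order bs e) (fst z) (x - snd z) * \<psi> x \<partial>lborel) \<partial>N)"
  proof (rule integral_cong_AE)
    have [measurable]: "iter_partial bs \<psi> \<in> borel_measurable borel" "\<psi> \<in> borel_measurable borel"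
      by (intro borel_measurable_continuous_onI test_functionsD(1)[OF test])
        (intro borel_measurable_continuous_onI test_functionsD(1)[OF \<psi>])
    show "(\<lambda>z. \<integral>x. heatD e (fst z) (x - snd z) * iter_partial bs \<psi> x \<partial>lborel) \<in> borel_measurable N"
      "(\<lambda>z. (-1) ^ length bs * (\<integral>x. heatD (add_order bs e) (fst z) (x - snd z) * \<psi> x \<partial>lborel)) \<in> borel_measurable N"
      by measurable
    show "AE z in N. (\<integral>x. heatD e (fst z) (x - snd z) * iter_partial bs \<psi> x \<partial>lborel) =
      (-1) ^ length bs * (\<integral>x. heatD (add_order bs e) (fst z) (x - snd z) * \<psi> x \<partial>lborel)"
      using eps_le by eventually_elim (rule heatD_by_parts[OF _ \<psi> bs], use eps_pos in simp)
  qed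
  also have "\<dots> = (-1) ^ length bs * (\<integral>x. mix N (add_order bs e) x * \<psi> x \<partial>lborel)"
    by (simp add: F[OF \<psi>])
  finally show ?thesis .
qed

text \<open>Again |u| <= 1 + |u| powr p: the 1 integrates to 1 against a heat kernel, and for the
  power the heat kernel is replaced by its maximum, which is bounded for times from \<epsilon>
  on.\<close>

lemma heat_bound_Lp:
  assumes [measurable]: "u \<in> borel_measurable borel" and p: "p \<ge> 1" and u: "integrable lborel (\<lambda>x. \<bar>u x\<bar> powr p)"
  shows "\<exists>B\<ge>0. \<forall>s\<ge>\<epsilon>. \<forall>y. (\<integral>\<^sup>+x. ennreal (\<bar>u x\<bar> * heat (2 * s) (x - y :: 'a)) \<partial>lborel) \<le> ennreal B"
proof -
  obtain D where CD: "D \<ge> 0" "\<And>s x. s \<ge> \<epsilon> \<Longrightarrow> heat (2 * s) (x :: 'a) \<le> D"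
    using heat_le_eps powr_ge_zero by blast
  let ?I = "\<integral>x. \<bar>u x\<bar> powr p \<partial>lborel"
  have "(\<integral>\<^sup>+x. ennreal (\<bar>u x\<bar> * heat (2 * s) (x - y)) \<partial>lborel) \<le> ennreal (1 + D * ?I)" if "s \<ge> \<epsilon>" for s y
  proof -
    have s: "2 * s > 0" using that eps_pos by simp
    have "(\<integral>\<^sup>+x. ennreal (\<bar>u x\<bar> * heat (2 * s) (x - y)) \<partial>lborel) \<le>
      (\<integral>\<^sup>+x. ennreal (heat (2 * s) (x - y)) + ennreal D * ennreal (\<bar>u x\<bar> powr p) \<partial>lborel)"
    proof (intro nn_integral_mono)
      fix x
      let ?h = "heat (2 * s) (x - y)"
      have h: "0 \<le> ?h" "?h \<le> D" using heat_pos[OF s, of "x - y"] CD(2)[OF that] by auto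
      have "\<bar>u x\<bar> \<le> 1 + \<bar>u x\<bar> powr p"
      proof (cases "\<bar>u x\<bar> \<le> 1")
        case False
        then show ?thesis using powr_mono[of 1 p "\<bar>u x\<bar>"] p by simp
      qed (simp add: add_increasing2)
      then have "\<bar>u x\<bar> * ?h \<le> (1 + \<bar>u x\<bar> powr p) * ?h" by (rule mult_right_mono) (rule h)
      also have "\<dots> \<le> ?h + D * \<bar>u x\<bar> powr p"
        using mult_left_mono[OF h(2), of "\<bar>u x\<bar> powr p"] by (simp add: algebra_simps)
      finally show "ennreal (\<bar>u x\<bar> * ?h) \<le> ennreal ?h + ennreal D * ennreal (\<bar>u x\<bar> powr p)"
        using h CD(1) by (simp add: ennreal_leI flip: ennreal_mult ennreal_plus)
    qed
    also have "\<dots> = (\<integral>\<^sup>+x. ennreal (heat (2 * s) (x - y)) \<partial>lborel) + (\<integral>\<^sup>+x. ennreal D * ennreal (\<bar>u x\<bar> powr p) \<partial>lborel)"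
      by (rule nn_integral_add) measurable
    also have "(\<integral>\<^sup>+x. ennreal D * ennreal (\<bar>u x\<bar> powr p) \<partial>lborel) = ennreal D * ennreal ?I"
      using u by (simp add: nn_integral_cmult nn_integral_eq_integral)
    also have "(\<integral>\<^sup>+x. ennreal (heat (2 * s) (x - y)) \<partial>lborel) = 1"
      using nn_integral_heat[OF s, where 'a = 'a] nn_integral_lborel_translate[of "\<lambda>x. ennreal (heat (2 * s) x)" y] by simp
    also have "1 + ennreal D * ennreal ?I = ennreal (1 + D * ?I)"
      using CD(1) by (simp add: ennreal_mult)
    finally show ?thesis .
  qed
  moreover have "1 + D * ?I \<ge> 0" using CD(1) by simp
  ultimately show ?thesis by blast
qed

text \<open>\<open>gaussian_pairing\<close>, integrated over times and centres.\<close>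

lemma mix_pairing:
  assumes b: "b \<in> Basis" and p: "p \<ge> 1"
    and u [measurable]: "u \<in> borel_measurable borel" and v [measurable]: "v \<in> borel_measurable borel"
    and up: "integrable lborel (\<lambda>x. \<bar>u x\<bar> powr p)" and vp: "integrable lborel (\<lambda>x. \<bar>v x\<bar> powr p)"
    and weak: "\<And>\<psi>. \<psi> \<in> test_functions \<Longrightarrow>
      (\<integral>x. u x * iter_partial [b, b] \<psi> x \<partial>lborel) = (\<integral>x. v x * \<psi> x \<partial>lborel)"
  shows "(\<integral>x. u x * mix N ((\<lambda>_. 0)(b := 2)) x \<partial>lborel) = (\<integral>x. v x * mix N (\<lambda>_. 0) x \<partial>lborel)"
proof -
  obtain Bu where Bu: "Bu \<ge> 0" "\<forall>s\<ge>\<epsilon>. \<forall>y. (\<integral>\<^sup>+x. ennreal (\<bar>u x\<bar> * heat (2 * s) (x - y :: 'a)) \<partial>lborel) \<le> ennreal Bu"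
    using heat_bound_Lp[OF u p up] by blast
  obtain Bv where Bv: "Bv \<ge> 0" "\<forall>s\<ge>\<epsilon>. \<forall>y. (\<integral>\<^sup>+x. ennreal (\<bar>v x\<bar> * heat (2 * s) (x - y :: 'a)) \<partial>lborel) \<le> ennreal Bv"
    using heat_bound_Lp[OF v p vp] by blast
  have "(\<integral>x. u x * mix N ((\<lambda>_. 0)(b := 2)) x \<partial>lborel) = (\<integral>z. \<integral>x. u x * heatD ((\<lambda>_. 0)(b := 2)) (fst z) (x - snd z) \<partial>lborel \<partial>N)"
    by (rule mix_Fubini(1)[OF u Bu(1)]) (use Bu in auto)
  also have "\<dots> = (\<integral>z. \<integral>x. v x * heat (fst z) (x - snd z) \<partial>lborel \<partial>N)"
  proof (rule integral_cong_AE)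
    show "AE z in N. (\<integral>x. u x * heatD ((\<lambda>_. 0)(b := 2)) (fst z) (x - snd z) \<partial>lborel) = (\<integral>x. v x * heat (fst z) (x - snd z) \<partial>lborel)"
      using eps_le by eventually_elim (rule gaussian_pairing[OF _ b p u v up vp weak], use eps_pos in auto)
  qed measurable
  also have "\<dots> = (\<integral>x. v x * mix N (\<lambda>_. 0) x \<partial>lborel)"
    by (rule mix_Fubini(1)[OF v Bv(1), symmetric]) (use Bv in auto)
  finally show ?thesis .
qed

end

section \<open>Time weights and inversion of I - Laplacian\<close>

definition gamma_weight :: "nat \<Rightarrow> real \<Rightarrow> real" where
  "gamma_weight k t = t ^ k * exp (- t) / fact k"

lemma gamma_weight_erlang: "t \<ge> 0 \<Longrightarrow> erlang_density k 1 t = gamma_weight k t"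
  by (simp add: erlang_density_def gamma_weight_def)

lemma gamma_weight_nonneg: "t \<ge> 0 \<Longrightarrow> gamma_weight k t \<ge> 0"
  by (simp add: gamma_weight_def)

text \<open>Integrating the heat kernel against \<open>ladder \<epsilon> k\<close> gives the kernel of \<open>(I - \<Delta>)\<^bsup>-k\<^esup>\<close> composed with the
  heat flow for time \<open>\<epsilon>\<close>; the latter keeps all integrals away from the singularity at time 0.\<close>

primrec ladder :: "real \<Rightarrow> nat \<Rightarrow> real measure" where
  "ladder \<epsilon> 0 = return borel \<epsilon>"
| "ladder \<epsilon> (Suc k) = density lborel (\<lambda>s. ennreal (erlang_density k 1 (s - \<epsilon>)))"

lemma sets_ladder [measurable_cong, simp]: "sets (ladder \<epsilon> k) = sets borel"
  by (cases k) auto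

lemma space_ladder [simp]: "space (ladder \<epsilon> k) = UNIV"
  by (cases k) auto

lemma prob_space_ladder: "prob_space (ladder \<epsilon> k)"
proof (cases k)
  case (Suc j)
  have "emeasure (ladder \<epsilon> k) UNIV = (\<integral>\<^sup>+s. ennreal (erlang_density j 1 (s - \<epsilon>)) \<partial>lborel)"
    by (simp add: Suc emeasure_density)
  also have "\<dots> = (\<integral>\<^sup>+s. ennreal (erlang_density j 1 s) \<partial>lborel)"
    by (rule nn_integral_lborel_translate) measurable
  also have "\<dots> = emeasure (density lborel (\<lambda>s. ennreal (erlang_density j 1 s))) UNIV"
    by (simp add: emeasure_density)
  also have "\<dots> = 1"
    using prob_space.emeasure_space_1[OF prob_space_erlang_density[of 1 j]] by simp
  finally show ?thesis by (intro prob_spaceI) simp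
qed (auto intro: prob_space_return)

lemma ladder_ge: "AE s in ladder \<epsilon> k. \<epsilon> \<le> s"
proof (cases k)
  case 0
  then show ?thesis by (simp only: ladder.simps) (subst AE_return, auto)
next
  case (Suc j)
  show ?thesis unfolding Suc ladder.simps
    by (subst AE_density) (auto intro!: AE_I2 simp: erlang_density_def split: if_splits)
qed

lemma integral_ladder_Suc:
  assumes [measurable]: "f \<in> borel_measurable borel"
  shows "(\<integral>s. f s \<partial>ladder \<epsilon> (Suc k)) = (\<integral>s. indicator {\<epsilon>..} s * (gamma_weight k (s - \<epsilon>) * f s) \<partial>lborel)"
proof -
  have "(\<integral>s. f s \<partial>ladder \<epsilon> (Suc k)) = (\<integral>s. erlang_density k 1 (s - \<epsilon>) *\<^sub>R f s \<partial>lborel)"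
    by (simp add: integral_density)
  also have "\<dots> = (\<integral>s. indicator {\<epsilon>..} s * (gamma_weight k (s - \<epsilon>) * f s) \<partial>lborel)"
    by (intro Bochner_Integration.integral_cong) (auto simp: gamma_weight_def erlang_density_def split: split_indicator)
  finally show ?thesis .
qed

lemma integrable_ladder_Suc:
  assumes [measurable]: "f \<in> borel_measurable borel" and f: "\<And>s. s \<ge> \<epsilon> \<Longrightarrow> \<bar>f s\<bar> \<le> B"
  shows "integrable lborel (\<lambda>s. indicator {\<epsilon>..} s * (gamma_weight k (s - \<epsilon>) * f s))"
proof -
  interpret prob_space "ladder \<epsilon> (Suc k)" by (rule prob_space_ladder)
  have "integrable (ladder \<epsilon> (Suc k)) f"
    by (rule integrable_const_bound[where B = B]) (use ladder_ge[of \<epsilon> "Suc k"] f in \<open>auto elim!: eventually_mono\<close>)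
  then have "integrable lborel (\<lambda>s. erlang_density k 1 (s - \<epsilon>) *\<^sub>R f s)"
    by (simp add: integrable_density)
  also have "(\<lambda>s. erlang_density k 1 (s - \<epsilon>) *\<^sub>R f s) = (\<lambda>s. indicator {\<epsilon>..} s * (gamma_weight k (s - \<epsilon>) * f s))"
    by (auto simp: fun_eq_iff gamma_weight_def erlang_density_def split: split_indicator)
  finally show ?thesis .
qed

lemma integral_FTC_Ici:
  fixes F f :: "real \<Rightarrow> real"
  assumes d: "\<And>s. s \<ge> a \<Longrightarrow> (F has_real_derivative f s) (at s)" and c: "continuous_on {a..} f"
    and int: "integrable lborel (\<lambda>s. indicator {a..} s * f s)" and lim: "(F \<longlongrightarrow> L) at_top"
  shows "(\<integral>s. indicator {a..} s * f s \<partial>lborel) = L - F a"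
proof -
  have "(\<lambda>i. \<integral>s. indicator {a..a + real i} s * f s \<partial>lborel) \<longlonglongrightarrow> (\<integral>s. indicator {a..} s * f s \<partial>lborel)"
  proof (rule integral_dominated_convergence[OF _ _ integrable_abs[OF int]])
    show mf: "(\<lambda>s. indicator {a..} s * f s) \<in> borel_measurable lborel" using int by simp
    have "(\<lambda>s. indicator {a..a + real i} s * f s) = (\<lambda>s. indicator {a..a + real i} s * (indicator {a..} s * f s))" for i
      by (auto simp: fun_eq_iff split: split_indicator)
    then show "(\<lambda>s. indicator {a..a + real i} s * f s) \<in> borel_measurable lborel" for i
      using mf by simp
    show "AE s in lborel. (\<lambda>i. indicator {a..a + real i} s * f s) \<longlonglongrightarrow> indicator {a..} s * f s"
    proof (rule AE_I2, rule tendsto_eventually)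
      fix s
      have "eventually (\<lambda>i. real i \<ge> s - a) sequentially"
        using filterlim_real_sequentially by (simp add: filterlim_at_top)
      then show "eventually (\<lambda>i. indicator {a..a + real i} s * f s = indicator {a..} s * f s) sequentially"
        by eventually_elim (auto split: split_indicator)
    qed
  qed (auto split: split_indicator)
  moreover have "(\<integral>s. indicator {a..a + real i} s * f s \<partial>lborel) = F (a + real i) - F a" for i
    using integral_FTC_Icc[of a "a + real i" F f] d c
    by (simp add: has_real_derivative_iff_has_vector_derivative[symmetric] has_field_derivative_at_within continuous_on_subset)
  moreover have "(\<lambda>i. F (a + real i) - F a) \<longlonglongrightarrow> L - F a"
    by (intro tendsto_diff tendsto_const filterlim_compose[OF lim] filterlim_tendsto_add_at_top[OF tendsto_const] filterlim_real_sequentially)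
  ultimately show ?thesis using LIMSEQ_unique by simp
qed

lemma gamma_weight_deriv:
  "(gamma_weight 0 has_real_derivative - gamma_weight 0 t) (at t)"
  "(gamma_weight (Suc k) has_real_derivative gamma_weight k t - gamma_weight (Suc k) t) (at t)"
proof -
  show "(gamma_weight 0 has_real_derivative - gamma_weight 0 t) (at t)"
    unfolding gamma_weight_def[abs_def] by (auto intro!: derivative_eq_intros)
  have "((\<lambda>t. t ^ Suc k * exp (- t) / fact (Suc k)) has_real_derivative
      (real (Suc k) * t ^ k * exp (- t) - t ^ Suc k * exp (- t)) / fact (Suc k)) (at t)"
    by (rule derivative_eq_intros refl | simp)+
  also have "(real (Suc k) * t ^ k * exp (- t) - t ^ Suc k * exp (- t)) / fact (Suc k) = gamma_weight k t - gamma_weight (Suc k) t"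
    by (simp add: gamma_weight_def diff_divide_distrib del: of_nat_Suc power_Suc)
  finally show "(gamma_weight (Suc k) has_real_derivative gamma_weight k t - gamma_weight (Suc k) t) (at t)"
    unfolding gamma_weight_def[abs_def] .
qed

lemma gamma_weight_tendsto_0: "(gamma_weight k \<longlongrightarrow> 0) at_top"
proof -
  have "((\<lambda>t::real. 1 / fact k * (t ^ k / exp t)) \<longlongrightarrow> 1 / fact k * 0) at_top"
    by (intro tendsto_mult_left tendsto_power_div_exp_0)
  moreover have "(\<lambda>t::real. 1 / fact k * (t ^ k / exp t)) = gamma_weight k"
    by (auto simp: fun_eq_iff gamma_weight_def exp_minus divide_inverse mult_ac)
  ultimately show ?thesis by simp
qed

text \<open>The heat equation turns the Laplacian into a time derivative, which is moved onto the
  weight; the derivative of a weight is its predecessor minus itself. The boundary term at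
  \<epsilon> survives only for the first weight and yields the heat kernel at time \<epsilon>, the
  bottom of the ladder.\<close>

lemma ladder_step:
  fixes z :: "'a::euclidean_space"
  assumes \<epsilon>: "\<epsilon> > 0"
  shows "(\<integral>s. heat s z - (\<Sum>b\<in>Basis. heatD ((\<lambda>_. 0)(b := 2)) s z) \<partial>ladder \<epsilon> (Suc k)) = (\<integral>s. heat s z \<partial>ladder \<epsilon> k)"
proof -
  define S where "S s = (\<Sum>b\<in>Basis. heatD ((\<lambda>_. 0)(b := 2)) s z)" for s
  define h where "h s = heat s z" for s
  have [measurable]: "S \<in> borel_measurable borel" "h \<in> borel_measurable borel"
    unfolding S_def[abs_def] h_def[abs_def] by measurable
  have bd: "\<exists>B. \<forall>s\<ge>\<epsilon>. \<bar>heatD e s z\<bar> \<le> B" for e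
  proof -
    obtain C where C: "C \<ge> 0" "\<forall>s\<ge>\<epsilon>. \<forall>x::'a. \<bar>heatD e s x\<bar> \<le> C * heat (2 * s) x"
      using heatD_bound[OF \<epsilon>] by blast
    have "\<bar>heatD e s z\<bar> \<le> C * (4 * pi * (2 * \<epsilon>)) powr (- real DIM('a) / 2)" if "s \<ge> \<epsilon>" for s
    proof -
      have "\<bar>heatD e s z\<bar> \<le> C * heat (2 * s) z" using C that by auto
      also have "\<dots> \<le> C * (4 * pi * (2 * s)) powr (- real DIM('a) / 2)"
        using C that \<epsilon> by (intro mult_left_mono heat_le) auto
      also have "\<dots> \<le> C * (4 * pi * (2 * \<epsilon>)) powr (- real DIM('a) / 2)"
        using C that \<epsilon> by (intro mult_left_mono powr_mono2') auto
      finally show ?thesis .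
    qed
    then show ?thesis by blast
  qed
  obtain Bh where Bh: "\<And>s. s \<ge> \<epsilon> \<Longrightarrow> \<bar>h s\<bar> \<le> Bh" using bd[of "\<lambda>_. 0"] unfolding h_def by blast
  obtain BS where BS: "\<And>s. s \<ge> \<epsilon> \<Longrightarrow> \<bar>S s\<bar> \<le> BS"
  proof -
    have "\<forall>b. \<exists>B. \<forall>s\<ge>\<epsilon>. \<bar>heatD ((\<lambda>_. 0)(b := 2)) s z\<bar> \<le> B" using bd by blast
    from choice[OF this] obtain B where "\<forall>b. \<forall>s\<ge>\<epsilon>. \<bar>heatD ((\<lambda>_. 0)(b := 2)) s z\<bar> \<le> B b" by blast
    then have "\<bar>S s\<bar> \<le> (\<Sum>b\<in>Basis. B b)" if "s \<ge> \<epsilon>" for s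
      unfolding S_def using that by (intro order_trans[OF sum_abs] sum_mono) blast
    then show thesis by (rule that)
  qed
  have dh: "(h has_real_derivative S s) (at s)" if "s \<ge> \<epsilon>" for s
    unfolding h_def[abs_def] S_def using that \<epsilon> by (intro heat_time_deriv) auto
  have cS: "continuous_on {\<epsilon>..} S"
  proof -
    have "continuous_on {\<epsilon>..} (\<lambda>s. gk j s r)" for j r
    proof -
      have "continuous_on UNIV (hg j)" by (intro DERIV_continuous_on[OF DERIV_subset[OF hg_deriv]]) auto
      then have "continuous_on {\<epsilon>..} (\<lambda>s. hg j (r / sqrt s))"
        by (rule continuous_on_compose2) (use \<epsilon> in \<open>auto intro!: continuous_intros\<close>)
      then show ?thesis unfolding gk_def using \<epsilon> by (intro continuous_intros) auto
    qed
    then show ?thesis unfolding S_def heatD_def prodf_def by (intro continuous_intros)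
  qed
  have ch: "continuous_on {\<epsilon>..} h"
    using dh by (intro DERIV_continuous_on[OF DERIV_subset]) auto
  have cg: "continuous_on {\<epsilon>..} (\<lambda>s. gamma_weight k (s - \<epsilon>))" for k
    unfolding gamma_weight_def by (intro continuous_intros) auto
  define w where "w k s = gamma_weight k (s - \<epsilon>)" for k s
  have lim: "((\<lambda>s. w k s * h s) \<longlongrightarrow> 0) at_top" for k
  proof (rule Lim_null_comparison)
    show "eventually (\<lambda>s. norm (w k s * h s) \<le> w k s * Bh) at_top"
      using eventually_ge_at_top[of \<epsilon>]
      by eventually_elim (auto simp: w_def abs_mult gamma_weight_nonneg intro!: mult_left_mono Bh)
    have "((\<lambda>s. w k s) \<longlongrightarrow> 0) at_top"
      unfolding w_def by (rule filterlim_compose[OF gamma_weight_tendsto_0])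
        (use filterlim_tendsto_add_at_top[OF tendsto_const[of "- \<epsilon>"] filterlim_ident] in simp)
    then show "((\<lambda>s. w k s * Bh) \<longlongrightarrow> 0) at_top" using tendsto_mult_left_zero by blast
  qed
  have ih: "integrable lborel (\<lambda>s. indicator {\<epsilon>..} s * (w k s * h s))" for k
    unfolding w_def by (rule integrable_ladder_Suc) (use Bh in auto)
  have iS: "integrable lborel (\<lambda>s. indicator {\<epsilon>..} s * (w k s * S s))" for k
    unfolding w_def by (rule integrable_ladder_Suc) (use BS in auto)
  have lhs: "(\<integral>s. h s - S s \<partial>ladder \<epsilon> (Suc k)) = (\<integral>s. indicator {\<epsilon>..} s * (w k s * h s) \<partial>lborel) - (\<integral>s. indicator {\<epsilon>..} s * (w k s * S s) \<partial>lborel)"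
    using ih iS by (subst integral_ladder_Suc) (auto simp: w_def[symmetric] right_diff_distrib)
  have "(\<integral>s. h s - S s \<partial>ladder \<epsilon> (Suc k)) = (\<integral>s. h s \<partial>ladder \<epsilon> k)"
  proof (cases k)
    case 0
    have "(\<integral>s. indicator {\<epsilon>..} s * (- w 0 s * h s + S s * w 0 s) \<partial>lborel) = 0 - w 0 \<epsilon> * h \<epsilon>"
    proof (rule integral_FTC_Ici[OF _ _ _ lim])
      show "((\<lambda>s. w 0 s * h s) has_real_derivative - w 0 s * h s + S s * w 0 s) (at s)" if "s \<ge> \<epsilon>" for s
        unfolding w_def using that
        by (intro DERIV_mult dh DERIV_chain2[OF gamma_weight_deriv(1), where Db = 1, simplified])
          (auto intro!: derivative_eq_intros)
      show "continuous_on {\<epsilon>..} (\<lambda>s. - w 0 s * h s + S s * w 0 s)"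
        unfolding w_def by (intro continuous_intros cg ch cS)
      have "integrable lborel (\<lambda>s. - (indicator {\<epsilon>..} s * (w 0 s * h s)) + indicator {\<epsilon>..} s * (w 0 s * S s))"
        using ih iS by (intro Bochner_Integration.integrable_add Bochner_Integration.integrable_minus)
      then show "integrable lborel (\<lambda>s. indicator {\<epsilon>..} s * (- w 0 s * h s + S s * w 0 s))"
        by (simp add: algebra_simps)
    qed
    also have "(\<integral>s. indicator {\<epsilon>..} s * (- w 0 s * h s + S s * w 0 s) \<partial>lborel) =
       - (\<integral>s. indicator {\<epsilon>..} s * (w 0 s * h s) \<partial>lborel) + (\<integral>s. indicator {\<epsilon>..} s * (w 0 s * S s) \<partial>lborel)"
      using ih[of 0] iS[of 0] by (simp add: algebra_simps flip: Bochner_Integration.integral_diff)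
    finally show ?thesis using lhs by (simp add: 0 w_def gamma_weight_def integral_return)
  next
    case (Suc j)
    have "(\<integral>s. indicator {\<epsilon>..} s * ((w j s - w k s) * h s + S s * w k s) \<partial>lborel) = 0 - w k \<epsilon> * h \<epsilon>"
    proof (rule integral_FTC_Ici[OF _ _ _ lim])
      show "((\<lambda>s. w k s * h s) has_real_derivative (w j s - w k s) * h s + S s * w k s) (at s)" if "s \<ge> \<epsilon>" for s
        unfolding w_def Suc using that
        by (intro DERIV_mult dh DERIV_chain2[OF gamma_weight_deriv(2), where Db = 1, simplified])
          (auto intro!: derivative_eq_intros)
      show "continuous_on {\<epsilon>..} (\<lambda>s. (w j s - w k s) * h s + S s * w k s)"
        unfolding w_def by (intro continuous_intros cg ch cS)
      have "integrable lborel (\<lambda>s. indicator {\<epsilon>..} s * (w j s * h s) - (indicator {\<epsilon>..} s * (w k s * h s)) + indicator {\<epsilon>..} s * (w k s * S s))"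
        using ih iS by (intro Bochner_Integration.integrable_add Bochner_Integration.integrable_diff)
      then show "integrable lborel (\<lambda>s. indicator {\<epsilon>..} s * ((w j s - w k s) * h s + S s * w k s))"
        by (simp add: algebra_simps)
    qed
    also have "(\<integral>s. indicator {\<epsilon>..} s * ((w j s - w k s) * h s + S s * w k s) \<partial>lborel) =
      (\<integral>s. indicator {\<epsilon>..} s * (w j s * h s) - (indicator {\<epsilon>..} s * (w k s * h s)) + indicator {\<epsilon>..} s * (w k s * S s) \<partial>lborel)"
      by (intro Bochner_Integration.integral_cong) (auto simp: algebra_simps)
    also have "\<dots> = (\<integral>s. indicator {\<epsilon>..} s * (w j s * h s) \<partial>lborel) - (\<integral>s. indicator {\<epsilon>..} s * (w k s * h s) \<partial>lborel) + (\<integral>s. indicator {\<epsilon>..} s * (w k s * S s) \<partial>lborel)"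
      using ih iS by simp
    moreover have "w k \<epsilon> = 0" by (simp add: w_def gamma_weight_def Suc)
    moreover have "(\<integral>s. h s \<partial>ladder \<epsilon> k) = (\<integral>s. indicator {\<epsilon>..} s * (w j s * h s) \<partial>lborel)"
      unfolding Suc by (subst integral_ladder_Suc) (auto simp: w_def)
    ultimately show ?thesis using lhs by simp
  qed
  then show ?thesis by (simp only: h_def S_def)
qed

lemma heat_mixture_ladder:
  fixes F :: "'a::euclidean_space measure"
  assumes \<epsilon>: "\<epsilon> > 0" and F: "finite_measure F" and [measurable_cong]: "sets F = sets borel"
  shows "heat_mixture (ladder \<epsilon> k \<Otimes>\<^sub>M F) \<epsilon>"
proof -
  interpret L: prob_space "ladder \<epsilon> k" by (rule prob_space_ladder)
  interpret F: finite_measure F by fact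
  interpret pair_sigma_finite "ladder \<epsilon> k" F ..
  interpret LF: finite_measure "ladder \<epsilon> k \<Otimes>\<^sub>M F"
    by (rule finite_measure_pair_measure) unfold_locales
  show ?thesis
  proof
    show "sets (ladder \<epsilon> k \<Otimes>\<^sub>M F) = sets (borel \<Otimes>\<^sub>M borel)"
      by (rule sets_pair_measure_cong) (auto simp: assms)
    show "AE z in ladder \<epsilon> k \<Otimes>\<^sub>M F. \<epsilon> \<le> fst z"
    proof (rule AE_pair_measure, goal_cases)
      case 1
      show ?case by measurable
    next
      case 2
      show ?case unfolding fst_conv using ladder_ge[of \<epsilon> k] by (rule eventually_mono) simp
    qed
  qed fact
qed

lemma mix_ladder:
  fixes F :: "'a::euclidean_space measure"
  assumes \<epsilon>: "\<epsilon> > 0" and F: "finite_measure F" and [measurable_cong]: "sets F = sets borel"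
  shows "mix (ladder \<epsilon> k \<Otimes>\<^sub>M F) e x = (\<integral>y. \<integral>s. heatD e s (x - y) \<partial>ladder \<epsilon> k \<partial>F)"
proof -
  interpret heat_mixture "ladder \<epsilon> k \<Otimes>\<^sub>M F" \<epsilon> by (rule heat_mixture_ladder[OF assms])
  interpret L: prob_space "ladder \<epsilon> k" by (rule prob_space_ladder)
  interpret F: finite_measure F by fact
  interpret pair_sigma_finite "ladder \<epsilon> k" F ..
  show ?thesis
    using integral_snd[of "\<lambda>s y. heatD e s (x - y)"] mix_integrand_integrable[of e x]
    by (simp add: mix_def split_beta')
qed

lemma mix_ladder_step:
  fixes F :: "'a::euclidean_space measure"
  assumes \<epsilon>: "\<epsilon> > 0" and F: "finite_measure F" and [measurable_cong]: "sets F = sets borel"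
  shows "mix (ladder \<epsilon> (Suc k) \<Otimes>\<^sub>M F) (\<lambda>_. 0) x - (\<Sum>b\<in>Basis. mix (ladder \<epsilon> (Suc k) \<Otimes>\<^sub>M F) ((\<lambda>_. 0)(b := 2)) x)
     = mix (ladder \<epsilon> k \<Otimes>\<^sub>M F) (\<lambda>_. 0) x"
proof -
  let ?N = "ladder \<epsilon> (Suc k) \<Otimes>\<^sub>M F"
  interpret heat_mixture ?N \<epsilon> by (rule heat_mixture_ladder[OF assms])
  interpret L: prob_space "ladder \<epsilon> (Suc k)" by (rule prob_space_ladder)
  interpret F: finite_measure F by fact
  interpret pair_sigma_finite "ladder \<epsilon> (Suc k)" F ..
  let ?f = "\<lambda>s y. heat s (x - y) - (\<Sum>b\<in>Basis. heatD ((\<lambda>_. 0)(b := 2)) s (x - y))"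
  have int: "integrable ?N (\<lambda>z. ?f (fst z) (snd z))"
    by (intro Bochner_Integration.integrable_diff Bochner_Integration.integrable_sum mix_integrand_integrable)
  have "mix ?N (\<lambda>_. 0) x - (\<Sum>b\<in>Basis. mix ?N ((\<lambda>_. 0)(b := 2)) x) = (\<integral>z. ?f (fst z) (snd z) \<partial>?N)"
    unfolding mix_def
    by (subst Bochner_Integration.integral_diff[OF mix_integrand_integrable Bochner_Integration.integrable_sum[OF mix_integrand_integrable]],
        subst Bochner_Integration.integral_sum[OF mix_integrand_integrable], rule refl)
  also have "\<dots> = (\<integral>y. \<integral>s. ?f s y \<partial>ladder \<epsilon> (Suc k) \<partial>F)"
    using integral_snd[of ?f] int by (simp add: split_beta')
  also have "\<dots> = (\<integral>y. \<integral>s. heat s (x - y) \<partial>ladder \<epsilon> k \<partial>F)"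
    by (intro Bochner_Integration.integral_cong refl ladder_step \<epsilon>)
  also have "\<dots> = mix (ladder \<epsilon> k \<Otimes>\<^sub>M F) (\<lambda>_. 0) x"
    by (rule mix_ladder[OF assms, symmetric])
  finally show ?thesis .
qed

text \<open>Duality: in each step the kernel climbs one rung, and I - Laplacian is transferred to
  the function through its weak second derivatives \<open>v\<close>.\<close>

lemma mix_ladder_chain:
  fixes F :: "'a::euclidean_space measure" and g :: "nat \<Rightarrow> 'a \<Rightarrow> real" and v :: "nat \<Rightarrow> 'a \<Rightarrow> 'a \<Rightarrow> real"
  assumes \<epsilon>: "\<epsilon> > 0" and F: "finite_measure F" and sF: "sets F = sets borel" and p: "p \<ge> 1"
    and g: "\<And>i. i \<le> k \<Longrightarrow> g i \<in> borel_measurable borel" "\<And>i. i \<le> k \<Longrightarrow> integrable lborel (\<lambda>x. \<bar>g i x\<bar> powr p)"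
    and v: "\<And>i b. i < k \<Longrightarrow> b \<in> Basis \<Longrightarrow> v i b \<in> borel_measurable borel"
      "\<And>i b. i < k \<Longrightarrow> b \<in> Basis \<Longrightarrow> integrable lborel (\<lambda>x. \<bar>v i b x\<bar> powr p)"
    and weak: "\<And>i b \<psi>. i < k \<Longrightarrow> b \<in> Basis \<Longrightarrow> \<psi> \<in> test_functions \<Longrightarrow>
      (\<integral>x. g i x * iter_partial [b, b] \<psi> x \<partial>lborel) = (\<integral>x. v i b x * \<psi> x \<partial>lborel)"
    and step: "\<And>i. i < k \<Longrightarrow> AE x in lborel. g (Suc i) x = g i x - (\<Sum>b\<in>Basis. v i b x)"
    and i: "i \<le> k"
  shows "(\<integral>x. g 0 x * mix (ladder \<epsilon> 0 \<Otimes>\<^sub>M F) (\<lambda>_. 0) x \<partial>lborel) = (\<integral>x. g i x * mix (ladder \<epsilon> i \<Otimes>\<^sub>M F) (\<lambda>_. 0) x \<partial>lborel)"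
  using i
proof (induction i)
  case (Suc i)
  let ?N = "ladder \<epsilon> (Suc i) \<Otimes>\<^sub>M F"
  have ik: "i < k" "i \<le> k" "Suc i \<le> k" using Suc.prems by auto
  interpret N: heat_mixture ?N \<epsilon> by (rule heat_mixture_ladder[OF \<epsilon> F sF])
  have I: "integrable lborel (\<lambda>x. w x * mix ?N e x)"
    if w: "w \<in> borel_measurable borel" "integrable lborel (\<lambda>x. \<bar>w x\<bar> powr p)" for w e
  proof -
    obtain B where B: "B \<ge> 0" "\<And>x. \<bar>mix ?N e x\<bar> \<le> B" using N.mix_bounded[of e] by blast
    show ?thesis by (rule integrable_mult_Lp[OF _ N.mix_integrable p w(2) B(2)]) (use w in auto)
  qed
  have "(\<integral>x. g i x * mix (ladder \<epsilon> i \<Otimes>\<^sub>M F) (\<lambda>_. 0) x \<partial>lborel) =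
    (\<integral>x. g i x * mix ?N (\<lambda>_. 0) x - (\<Sum>b\<in>Basis. g i x * mix ?N ((\<lambda>_. 0)(b := 2)) x) \<partial>lborel)"
    by (simp only: mix_ladder_step[OF \<epsilon> F sF, of i, symmetric] right_diff_distrib sum_distrib_left)
  also have "\<dots> = (\<integral>x. g i x * mix ?N (\<lambda>_. 0) x \<partial>lborel) - (\<Sum>b\<in>Basis. \<integral>x. g i x * mix ?N ((\<lambda>_. 0)(b := 2)) x \<partial>lborel)"
    by (subst Bochner_Integration.integral_diff[OF I[OF g[OF ik(2)]] Bochner_Integration.integrable_sum[OF I[OF g[OF ik(2)]]]],
        subst Bochner_Integration.integral_sum[OF I[OF g[OF ik(2)]]], rule refl)
  also have "(\<Sum>b\<in>Basis. \<integral>x. g i x * mix ?N ((\<lambda>_. 0)(b := 2)) x \<partial>lborel) = (\<Sum>b\<in>Basis. \<integral>x. v i b x * mix ?N (\<lambda>_. 0) x \<partial>lborel)"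
    by (intro sum.cong refl N.mix_pairing[OF _ p g(1)[OF ik(2)] v(1)[OF ik(1)] g(2)[OF ik(2)] v(2)[OF ik(1)] weak[OF ik(1)]])
  also have "(\<integral>x. g i x * mix ?N (\<lambda>_. 0) x \<partial>lborel) - (\<Sum>b\<in>Basis. \<integral>x. v i b x * mix ?N (\<lambda>_. 0) x \<partial>lborel) =
      (\<integral>x. g i x * mix ?N (\<lambda>_. 0) x - (\<Sum>b\<in>Basis. v i b x * mix ?N (\<lambda>_. 0) x) \<partial>lborel)"
  proof -
    have Iv: "integrable lborel (\<lambda>x. v i b x * mix ?N (\<lambda>_. 0) x)" if "b \<in> Basis" for b
      by (rule I[OF v[OF ik(1) that]])
    show ?thesis
      using I[OF g[OF ik(2)], of "\<lambda>_. 0"] Iv by (simp add: Bochner_Integration.integral_diff Bochner_Integration.integral_sum)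
  qed
  also have "\<dots> = (\<integral>x. g (Suc i) x * mix ?N (\<lambda>_. 0) x \<partial>lborel)"
  proof (rule integral_cong_AE)
    show "AE x in lborel. g i x * mix ?N (\<lambda>_. 0) x - (\<Sum>b\<in>Basis. v i b x * mix ?N (\<lambda>_. 0) x) = g (Suc i) x * mix ?N (\<lambda>_. 0) x"
      using step[OF ik(1)] by eventually_elim (simp add: left_diff_distrib sum_distrib_right)
    have [measurable]: "g i \<in> borel_measurable borel" "g (Suc i) \<in> borel_measurable borel"
      "\<And>b. b \<in> Basis \<Longrightarrow> v i b \<in> borel_measurable borel" using g(1) v(1) ik by auto
    show "(\<lambda>x. g i x * mix ?N (\<lambda>_. 0) x - (\<Sum>b\<in>Basis. v i b x * mix ?N (\<lambda>_. 0) x)) \<in> borel_measurable lborel"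
      "(\<lambda>x. g (Suc i) x * mix ?N (\<lambda>_. 0) x) \<in> borel_measurable lborel" by measurable
  qed
  finally show ?case using Suc by simp
qed simp

section \<open>Riesz and Bessel kernels as time integrals of heat kernels\<close>

lemma nn_integral_inverse_gamma:
  assumes a: "a > 0" and c: "c > 0"
  shows "(\<integral>\<^sup>+s. ennreal (indicator {0<..} s * (s powr (- a - 1) * exp (- c / s))) \<partial>lborel) = ennreal (Gamma a * c powr (- a))"
proof -
  define f where "f s = s powr (- a - 1) * exp (- c / s)" for s
  have "((\<lambda>t. if t \<in> {0<..} then t powr (a - 1) / exp t else 0) has_integral Gamma a) {0..}"
    by (rule has_integral_spike[of "{0}", rotated 2, OF Gamma_integral_real[OF a]]) auto
  then have "((\<lambda>t. t powr (a - 1) / exp t) has_integral Gamma a) {0<..}"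
    by (subst (asm) has_integral_restrict) auto
  then have "((\<lambda>t. c powr (- a) * (t powr (a - 1) / exp t)) has_integral c powr (- a) * Gamma a) {0<..}"
    by (rule has_integral_mult_right)
  \<comment> \<open>The substitution s = c / t, an involution of the positive half-line with
    Jacobian c / t^2, takes the Gamma integral to that of \<open>f\<close>.\<close>
  moreover have "c powr (- a) * (t powr (a - 1) / exp t) = \<bar>- c / t\<^sup>2\<bar> * f (c / t)" if "t \<in> {0<..}" for t
  proof -
    have t: "t > 0" using that by simp
    have "(c / t) powr (- a - 1) = c powr (- a) / c * (t powr (a - 1) * t\<^sup>2)"
    proof -
      have "(c / t) powr (- a - 1) = c powr (- a - 1) / t powr (- a - 1)" using c t by (simp add: powr_divide)
      also have "c powr (- a - 1) = c powr (- a) / c" using c by (simp add: powr_diff)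
      also have "t powr (- a - 1) = inverse (t powr (a - 1 + 2))"
      proof -
        have "- a - 1 = - (a - 1 + 2)" by simp
        then show ?thesis by (simp only: powr_minus)
      qed
      also have "t powr (a - 1 + 2) = t powr (a - 1) * t\<^sup>2" using t by (simp only: powr_add) simp
      finally show ?thesis by (simp add: divide_inverse)
    qed
    then show ?thesis using c t by (simp add: f_def exp_minus field_simps)
  qed
  ultimately have hi: "((\<lambda>t. \<bar>- c / t\<^sup>2\<bar> * f (c / t)) has_integral c powr (- a) * Gamma a) {0<..}"
    by (rule has_integral_eq[rotated]) 
  have f0: "f s \<ge> 0" for s by (simp add: f_def)
  have img: "(\<lambda>t. c / t) ` {0<..} = {0<..}"
  proof
    show "{0<..} \<subseteq> (\<lambda>t. c / t) ` {0<..}"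
    proof
      fix s :: real assume "s \<in> {0<..}"
      then show "s \<in> (\<lambda>t. c / t) ` {0<..}" using c by (intro image_eqI[of _ _ "c / s"]) auto
    qed
  qed (use c in auto)
  have "(\<lambda>t. \<bar>- c / t\<^sup>2\<bar> * f (c / t)) absolutely_integrable_on {0<..} \<and>
      integral {0<..} (\<lambda>t. \<bar>- c / t\<^sup>2\<bar> * f (c / t)) = c powr (- a) * Gamma a"
    using hi f0 by (auto intro!: nonnegative_absolutely_integrable_1 simp: has_integral_iff)
  moreover have "(\<lambda>t. \<bar>- c / t\<^sup>2\<bar> * f (c / t)) absolutely_integrable_on {0<..} \<and>
      integral {0<..} (\<lambda>t. \<bar>- c / t\<^sup>2\<bar> * f (c / t)) = c powr (- a) * Gamma a \<longleftrightarrow>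
      f absolutely_integrable_on ((\<lambda>t. c / t) ` {0<..}) \<and> integral ((\<lambda>t. c / t) ` {0<..}) f = c powr (- a) * Gamma a"
  proof (rule has_absolute_integral_change_of_variables_1')
    show "((\<lambda>t. c / t) has_field_derivative - c / t\<^sup>2) (at t within {0<..})" if "t \<in> {0<..}" for t
      using that by (auto intro!: derivative_eq_intros simp: power2_eq_square field_simps)
    show "inj_on (\<lambda>t. c / t) {0<..}" using c by (auto simp: inj_on_def field_simps)
  qed auto
  ultimately have "f absolutely_integrable_on ((\<lambda>t. c / t) ` {0<..}) \<and> integral ((\<lambda>t. c / t) ` {0<..}) f = c powr (- a) * Gamma a"
    by blast
  then have "(f has_integral c powr (- a) * Gamma a) {0<..}"
    unfolding img using set_lebesgue_integral_eq_integral(1) by (auto simp: has_integral_iff)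
  then have "(\<integral>\<^sup>+s. ennreal (indicator {0<..} s * f s) \<partial>lborel) = ennreal (c powr (- a) * Gamma a)"
    using f0 by (intro nn_integral_has_integral_lebesgue) auto
  then show ?thesis by (simp add: f_def mult.commute)
qed

text \<open>The constant of the Riesz kernel of order m, and the reciprocal of the bracket in
  \<open>beta0\<close>.\<close>

definition riesz_const :: "nat \<Rightarrow> nat \<Rightarrow> real" where
  "riesz_const n m = Gamma ((real n - real m) / 2) / (pi powr (real n / 2) * 2 ^ m * Gamma (real m / 2))"

text \<open>Without the factor exp (- s) the time integral is a Gamma integral after inversion of
  time.\<close>

lemma riesz_kernel:
  fixes z :: "'a::euclidean_space"
  assumes z: "z \<noteq> 0" and j: "2 * Suc j < DIM('a)"
  shows "(\<integral>\<^sup>+s. ennreal (indicator {0<..} s * (s ^ j / fact j * heat s z)) \<partial>lborel) =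
    ennreal (riesz_const DIM('a) (2 * Suc j) * norm z powr (real (2 * Suc j) - real DIM('a)))"
proof -
  let ?n = "real DIM('a)"
  define a where "a = (?n - real (2 * Suc j)) / 2"
  define c where "c = (norm z)\<^sup>2 / 4"
  have a: "a > 0" using j by (simp add: a_def)
  have c: "c > 0" using z by (simp add: c_def)
  let ?k = "(4 * pi) powr (- ?n / 2) / fact j"
  have "(\<integral>\<^sup>+s. ennreal (indicator {0<..} s * (s ^ j / fact j * heat s z)) \<partial>lborel) =
    (\<integral>\<^sup>+s. ennreal ?k * ennreal (indicator {0<..} s * (s powr (- a - 1) * exp (- c / s))) \<partial>lborel)"
  proof (intro nn_integral_cong)
    fix s :: real
    show "ennreal (indicator {0<..} s * (s ^ j / fact j * heat s z)) =
      ennreal ?k * ennreal (indicator {0<..} s * (s powr (- a - 1) * exp (- c / s)))"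
    proof (cases "s > 0")
      case True
      have "(4 * pi * s) powr (- ?n / 2) = (4 * pi) powr (- ?n / 2) * s powr (- ?n / 2)"
        using True by (simp add: powr_mult)
      moreover have "s ^ j * s powr (- ?n / 2) = s powr (- a - 1)"
      proof -
        have "s ^ j * s powr (- ?n / 2) = s powr (real j + (- ?n / 2))"
          by (simp only: powr_add powr_realpow[OF True])
        also have "real j + (- ?n / 2) = - a - 1" by (simp add: a_def field_simps)
        finally show ?thesis .
      qed
      ultimately have "s ^ j / fact j * heat s z = ?k * (s powr (- a - 1) * exp (- c / s))"
        using True by (simp add: heat_eq c_def field_simps)
      then show ?thesis using True by (simp flip: ennreal_mult)
    qed simp
  qed
  also have "\<dots> = ennreal ?k * ennreal (Gamma a * c powr (- a))"
    by (subst nn_integral_cmult) (simp, simp only: nn_integral_inverse_gamma[OF a c])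
  also have "\<dots> = ennreal (?k * (Gamma a * c powr (- a)))"
    using Gamma_real_pos[OF a] by (intro ennreal_mult[symmetric]) auto
  also have "?k * (Gamma a * c powr (- a)) = riesz_const DIM('a) (2 * Suc j) * norm z powr (real (2 * Suc j) - ?n)"
  proof -
    have "c powr (- a) = (norm z)\<^sup>2 powr (- a) / 4 powr (- a)" using z by (simp add: c_def powr_divide)
    also have "(norm z)\<^sup>2 powr (- a) = norm z powr (2 * (- a))" using z by (simp flip: powr_numeral add: powr_powr)
    also have "2 * (- a) = real (2 * Suc j) - ?n" by (simp add: a_def field_simps)
    finally have c': "c powr (- a) = norm z powr (real (2 * Suc j) - ?n) / 4 powr (- a)" .
    have gen: "(b * pi) powr x / b powr (- y) = b powr (x + y) * pi powr x" if "b > 0" for b x y :: real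
      using that by (simp add: powr_mult powr_add powr_minus divide_inverse mult_ac)
    have "(4 * pi) powr (- ?n / 2) / 4 powr (- a) = 4 powr (- ?n / 2 + a) * pi powr (- ?n / 2)"
      by (rule gen) simp
    also have "- ?n / 2 + a = - real (Suc j)" by (simp add: a_def field_simps)
    also have "(4::real) powr (- real (Suc j)) = inverse (4 ^ Suc j)"
      by (simp only: powr_minus powr_realpow[of 4, simplified])
    also have "(4::real) ^ Suc j = 2 ^ (2 * Suc j)" by (simp only: power_mult) simp
    also have "pi powr (- ?n / 2) = inverse (pi powr (?n / 2))" by (simp add: powr_minus)
    finally have e: "(4 * pi) powr (- ?n / 2) / 4 powr (- a) = inverse (2 ^ (2 * Suc j)) * inverse (pi powr (?n / 2))" .
    have "real (2 * Suc j) / 2 = 1 + real j" by simp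
    then have G: "Gamma (real (2 * Suc j) / 2) = fact j" by (simp only: Gamma_fact)
    have alg: "X / f * (Ga * (Z / Y)) = Ga / (P * T * f) * Z" if "X / Y = inverse T * inverse P" for X f Ga Z Y P T :: real
    proof -
      have "X / f * (Ga * (Z / Y)) = X / Y * (Ga * Z / f)" by simp
      then show ?thesis unfolding that by (simp add: divide_inverse mult_ac)
    qed
    show ?thesis unfolding riesz_const_def a_def[symmetric] G c' by (rule alg[OF e])
  qed
  finally show ?thesis .
qed

text \<open>The kernel of \<open>(I - \<Delta>)\<^bsup>-(j+1)\<^esup>\<close>, that is of order \<open>m = 2 * Suc j\<close>.\<close>

definition bessel :: "nat \<Rightarrow> 'a::euclidean_space \<Rightarrow> real" where
  "bessel j z = (\<integral>s. indicator {0<..} s * (gamma_weight j s * heat s z) \<partial>lborel)"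

lemma gamma_weight_measurable [measurable]: "gamma_weight j \<in> borel_measurable borel"
  unfolding gamma_weight_def[abs_def] by measurable

lemma bessel_integrand_nonneg: "0 \<le> indicator {0<..} s * (gamma_weight j s * heat s z)"
  using heat_pos[of s z] by (auto simp: gamma_weight_nonneg split: split_indicator)

lemma bessel_measurable [measurable]: "bessel j \<in> borel_measurable borel"
  unfolding bessel_def[abs_def] by measurable

lemma bessel_nonneg: "0 \<le> bessel j z"
  unfolding bessel_def by (intro Bochner_Integration.integral_nonneg bessel_integrand_nonneg)

text \<open>Dropping exp (- s) from the weight leaves the Riesz integral. At z = 0 the time integral
  diverges and \<open>bessel\<close> has the default value 0, hence the exclusion of that
  point.\<close>

lemma bessel_integral_le:
  fixes z :: "'a::euclidean_space"
  assumes z: "z \<noteq> 0" and j: "2 * Suc j < DIM('a)"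
  shows "integrable lborel (\<lambda>s. indicator {0<..} s * (gamma_weight j s * heat s z))"
    "ennreal (bessel j z) = (\<integral>\<^sup>+s. ennreal (indicator {0<..} s * (gamma_weight j s * heat s z)) \<partial>lborel)"
    "bessel j z \<le> riesz_const DIM('a) (2 * Suc j) * norm z powr (real (2 * Suc j) - real DIM('a))"
proof -
  have le: "(\<integral>\<^sup>+s. ennreal (indicator {0<..} s * (gamma_weight j s * heat s z)) \<partial>lborel) \<le>
    ennreal (riesz_const DIM('a) (2 * Suc j) * norm z powr (real (2 * Suc j) - real DIM('a)))"
    unfolding riesz_kernel[OF z j, symmetric]
  proof (intro nn_integral_mono ennreal_leI)
    fix s :: real
    show "indicator {0<..} s * (gamma_weight j s * heat s z) \<le> indicator {0<..} s * (s ^ j / fact j * heat s z)"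
    proof (cases "s > 0")
      case True
      then have "s ^ j * exp (- s) \<le> s ^ j * 1" by (intro mult_left_mono) auto
      then have "gamma_weight j s \<le> s ^ j / fact j" by (simp add: gamma_weight_def divide_right_mono)
      then have "gamma_weight j s * heat s z \<le> s ^ j / fact j * heat s z"
        by (rule mult_right_mono) (use heat_pos[OF True, of z] in simp)
      then show ?thesis using True by simp
    qed simp
  qed
  then have "(\<integral>\<^sup>+s. ennreal (indicator {0<..} s * (gamma_weight j s * heat s z)) \<partial>lborel) < \<infinity>"
    by (rule order_le_less_trans) simp
  then show int: "integrable lborel (\<lambda>s. indicator {0<..} s * (gamma_weight j s * heat s z))"
    by (intro integrableI_nonneg) (auto simp: bessel_integrand_nonneg)
  show eq: "ennreal (bessel j z) = (\<integral>\<^sup>+s. ennreal (indicator {0<..} s * (gamma_weight j s * heat s z)) \<partial>lborel)"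
    unfolding bessel_def using int by (intro nn_integral_eq_integral[symmetric]) (auto simp: bessel_integrand_nonneg)
  have "riesz_const DIM('a) (2 * Suc j) \<ge> 0"
    unfolding riesz_const_def using j by (intro divide_nonneg_nonneg mult_nonneg_nonneg less_imp_le[OF Gamma_real_pos]) auto
  then show "bessel j z \<le> riesz_const DIM('a) (2 * Suc j) * norm z powr (real (2 * Suc j) - real DIM('a))"
    using le unfolding eq[symmetric] by simp
qed

lemma nn_integral_gamma_weight: "(\<integral>\<^sup>+s. ennreal (indicator {0<..} s * gamma_weight j s) \<partial>lborel) = 1"
proof -
  have "(\<integral>\<^sup>+s. ennreal (indicator {0<..} s * gamma_weight j s) \<partial>lborel) = (\<integral>\<^sup>+s. ennreal (erlang_density j 1 s) \<partial>lborel)"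
    using AE_lborel_singleton[of "0::real"]
    by (intro nn_integral_cong_AE)
      (auto elim!: eventually_mono simp: gamma_weight_erlang[symmetric] erlang_density_def split: split_indicator)
  also have "\<dots> = emeasure (density lborel (\<lambda>s. ennreal (erlang_density j 1 s))) UNIV"
    by (simp add: emeasure_density)
  also have "\<dots> = 1"
    using prob_space.emeasure_space_1[OF prob_space_erlang_density[of 1 j]] by simp
  finally show ?thesis .
qed

text \<open>Heat kernels and the time weight both have integral 1.\<close>

lemma nn_integral_bessel:
  assumes j: "2 * Suc j < DIM('a::euclidean_space)"
  shows "(\<integral>\<^sup>+z. ennreal (bessel j (z::'a)) \<partial>lborel) = 1"
proof -
  have "(\<integral>\<^sup>+z. ennreal (bessel j (z::'a)) \<partial>lborel) =
    (\<integral>\<^sup>+z. \<integral>\<^sup>+s. ennreal (indicator {0<..} s * (gamma_weight j s * heat s (z::'a))) \<partial>lborel \<partial>lborel)"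
    using AE_lborel_singleton[of "0::'a"]
    by (intro nn_integral_cong_AE) (auto elim!: eventually_mono simp: bessel_integral_le(2)[OF _ j])
  also have "\<dots> = (\<integral>\<^sup>+s. \<integral>\<^sup>+z. ennreal (indicator {0<..} s * (gamma_weight j s * heat s (z::'a))) \<partial>lborel \<partial>lborel)"
    by (rule lborel_pair.Fubini') measurable
  also have "\<dots> = (\<integral>\<^sup>+s. ennreal (indicator {0<..} s * gamma_weight j s) \<partial>lborel)"
  proof (intro nn_integral_cong)
    fix s :: real
    show "(\<integral>\<^sup>+z. ennreal (indicator {0<..} s * (gamma_weight j s * heat s (z::'a))) \<partial>lborel) = ennreal (indicator {0<..} s * gamma_weight j s)"
    proof (cases "s > 0")
      case True
      then have "(\<integral>\<^sup>+z. ennreal (indicator {0<..} s * (gamma_weight j s * heat s (z::'a))) \<partial>lborel) =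
        (\<integral>\<^sup>+z. ennreal (gamma_weight j s) * ennreal (heat s (z::'a)) \<partial>lborel)"
        by (intro nn_integral_cong) (auto simp: gamma_weight_nonneg ennreal_mult' heat_pos less_imp_le)
      also have "\<dots> = ennreal (gamma_weight j s)"
        by (subst nn_integral_cmult) (auto simp: nn_integral_heat[OF True])
      finally show ?thesis using True by simp
    qed simp
  qed
  also have "\<dots> = 1" by (rule nn_integral_gamma_weight)
  finally show ?thesis .
qed

text \<open>The Bessel kernel after heat flow for the time \<epsilon>, which is bounded also at
  0.\<close>

definition besseleps :: "real \<Rightarrow> nat \<Rightarrow> 'a::euclidean_space \<Rightarrow> real" where
  "besseleps \<epsilon> j z = (\<integral>s. heat s z \<partial>ladder \<epsilon> (Suc j))"

lemma besseleps_eq: "besseleps \<epsilon> j z = (\<integral>s. indicator {\<epsilon>..} s * (gamma_weight j (s - \<epsilon>) * heat s z) \<partial>lborel)"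
  unfolding besseleps_def by (rule integral_ladder_Suc) measurable

text \<open>Shifting the weight by \<epsilon> costs at most the factor exp \<epsilon>, so the Bessel
  integrand dominates all shifts with \<epsilon> <= 1 up to exp 1.\<close>

lemma shifted_weight_le:
  assumes "\<epsilon> > 0"
  shows "0 \<le> indicator {\<epsilon>..} s * (gamma_weight j (s - \<epsilon>) * heat s z)"
    "indicator {\<epsilon>..} s * (gamma_weight j (s - \<epsilon>) * heat s z) \<le> exp \<epsilon> * (indicator {0<..} s * (gamma_weight j s * heat s z))"
proof -
  have "0 \<le> indicator {\<epsilon>..} s * (gamma_weight j (s - \<epsilon>) * heat s z) \<and>
     indicator {\<epsilon>..} s * (gamma_weight j (s - \<epsilon>) * heat s z) \<le> exp \<epsilon> * (indicator {0<..} s * (gamma_weight j s * heat s z))"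
  proof (cases "s \<ge> \<epsilon>")
    case True
    then have s: "s > 0" using assms by simp
    have "(s - \<epsilon>) ^ j \<le> s ^ j" using True assms by (intro power_mono) auto
    then have "(s - \<epsilon>) ^ j * exp (- (s - \<epsilon>)) \<le> s ^ j * exp (- (s - \<epsilon>))" by (rule mult_right_mono) simp
    then have "gamma_weight j (s - \<epsilon>) \<le> s ^ j * exp (- (s - \<epsilon>)) / fact j"
      unfolding gamma_weight_def by (rule divide_right_mono) simp
    also have "exp (- (s - \<epsilon>)) = exp \<epsilon> * exp (- s)" by (simp add: mult_exp_exp)
    finally have "gamma_weight j (s - \<epsilon>) \<le> exp \<epsilon> * gamma_weight j s" by (simp add: gamma_weight_def mult_ac)
    then have "gamma_weight j (s - \<epsilon>) * heat s z \<le> exp \<epsilon> * gamma_weight j s * heat s z"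
      using heat_pos[OF s, of z] by (intro mult_right_mono) auto
    then show ?thesis using True s heat_pos[OF s, of z] gamma_weight_nonneg[of "s - \<epsilon>" j] by (simp add: mult.assoc)
  next
    case False
    then show ?thesis using bessel_integrand_nonneg[of s j z] by simp
  qed
  then show "0 \<le> indicator {\<epsilon>..} s * (gamma_weight j (s - \<epsilon>) * heat s z)"
    "indicator {\<epsilon>..} s * (gamma_weight j (s - \<epsilon>) * heat s z) \<le> exp \<epsilon> * (indicator {0<..} s * (gamma_weight j s * heat s z))"
    by auto
qed

lemma besseleps_le_bessel:
  fixes z :: "'a::euclidean_space"
  assumes z: "z \<noteq> 0" and j: "2 * Suc j < DIM('a)" and \<epsilon>: "\<epsilon> > 0"
  shows "0 \<le> besseleps \<epsilon> j z" "besseleps \<epsilon> j z \<le> exp \<epsilon> * bessel j z"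
proof -
  show "0 \<le> besseleps \<epsilon> j z"
    unfolding besseleps_eq by (intro Bochner_Integration.integral_nonneg shifted_weight_le \<epsilon>)
  have int: "integrable lborel (\<lambda>s. exp \<epsilon> * (indicator {0<..} s * (gamma_weight j s * heat s z)))"
    by (intro integrable_mult_right bessel_integral_le(1)[OF z j])
  have int': "integrable lborel (\<lambda>s. indicator {\<epsilon>..} s * (gamma_weight j (s - \<epsilon>) * heat s z))"
    by (rule Bochner_Integration.integrable_bound[OF int])
      (auto simp: abs_of_nonneg[OF shifted_weight_le(1)[OF \<epsilon>]] intro!: AE_I2 order_trans[OF shifted_weight_le(2)[OF \<epsilon>] abs_ge_self])
  have "besseleps \<epsilon> j z \<le> (\<integral>s. exp \<epsilon> * (indicator {0<..} s * (gamma_weight j s * heat s z)) \<partial>lborel)"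
    unfolding besseleps_eq by (intro integral_mono int int' shifted_weight_le \<epsilon>)
  then show "besseleps \<epsilon> j z \<le> exp \<epsilon> * bessel j z" by (simp add: bessel_def)
qed

lemma besseleps_tendsto:
  fixes z :: "'a::euclidean_space"
  assumes z: "z \<noteq> 0" and j: "2 * Suc j < DIM('a)"
  shows "(\<lambda>i. besseleps (1 / (real i + 1)) j z) \<longlonglongrightarrow> bessel j z"
  unfolding besseleps_eq bessel_def
proof (rule integral_dominated_convergence)
  let ?e = "\<lambda>i. 1 / (real i + 1)"
  have e0: "?e i > 0" "?e i \<le> 1" for i by auto
  have elim: "?e \<longlonglongrightarrow> 0" using LIMSEQ_inverse_real_of_nat by (simp add: inverse_eq_divide add.commute)
  show "integrable lborel (\<lambda>s. exp 1 * (indicator {0<..} s * (gamma_weight j s * heat s z)))"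
    by (intro integrable_mult_right bessel_integral_le(1)[OF z j])
  show "AE s in lborel. (\<lambda>i. indicator {?e i..} s * (gamma_weight j (s - ?e i) * heat s z)) \<longlonglongrightarrow> indicator {0<..} s * (gamma_weight j s * heat s z)"
  proof (rule AE_I2)
    fix s :: real
    show "(\<lambda>i. indicator {?e i..} s * (gamma_weight j (s - ?e i) * heat s z)) \<longlonglongrightarrow> indicator {0<..} s * (gamma_weight j s * heat s z)"
    proof (cases "s > 0")
      case True
      have "eventually (\<lambda>i. ?e i < s) sequentially" using order_tendstoD(2)[OF elim True] .
      then have "eventually (\<lambda>i. gamma_weight j (s - ?e i) * heat s z = indicator {?e i..} s * (gamma_weight j (s - ?e i) * heat s z)) sequentially"
        by eventually_elim auto
      moreover have "(\<lambda>i. gamma_weight j (s - ?e i)) \<longlonglongrightarrow> gamma_weight j (s - 0)"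
        unfolding gamma_weight_def by (intro tendsto_intros elim) auto
      then have "(\<lambda>i. gamma_weight j (s - ?e i) * heat s z) \<longlonglongrightarrow> gamma_weight j s * heat s z"
        by (intro tendsto_mult tendsto_const) simp
      ultimately show ?thesis using True by (auto intro: Lim_transform_eventually)
    next
      case False
      have "s < ?e i" for i using False e0(1)[of i] by linarith
      then have "indicator {?e i..} s = (0::real)" for i by (simp add: not_le)
      then show ?thesis using False by simp
    qed
  qed
  show "AE s in lborel. norm (indicator {?e i..} s * (gamma_weight j (s - ?e i) * heat s z)) \<le> exp 1 * (indicator {0<..} s * (gamma_weight j s * heat s z))" for i
  proof (rule AE_I2)
    fix s
    have "indicator {?e i..} s * (gamma_weight j (s - ?e i) * heat s z) \<le> exp (?e i) * (indicator {0<..} s * (gamma_weight j s * heat s z))"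
      by (rule shifted_weight_le) (rule e0)
    also have "\<dots> \<le> exp 1 * (indicator {0<..} s * (gamma_weight j s * heat s z))"
      by (intro mult_right_mono bessel_integrand_nonneg) (use e0 in simp)
    finally show "norm (indicator {?e i..} s * (gamma_weight j (s - ?e i) * heat s z)) \<le> exp 1 * (indicator {0<..} s * (gamma_weight j s * heat s z))"
      using shifted_weight_le(1)[OF e0(1)[of i], of s j z] by simp
  qed
qed measurable

lemma integral_lborel_affine:
  fixes f :: "'a::euclidean_space \<Rightarrow> real"
  assumes [measurable]: "f \<in> borel_measurable borel" and c: "c \<noteq> 0"
  shows "(\<integral>y. f y \<partial>lborel) = \<bar>c\<bar> ^ DIM('a) * (\<integral>w. f (t + c *\<^sub>R w) \<partial>lborel)"
  by (subst lborel_affine[OF c, of t]) (simp add: integral_density integral_distr)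

lemma heat_scale:
  assumes "s > 0"
  shows "sqrt s ^ DIM('a) * heat s (sqrt s *\<^sub>R w) = heat 1 (w :: 'a::euclidean_space)"
proof -
  have "sqrt s ^ DIM('a) = s powr (real DIM('a) / 2)"
    using assms by (simp add: powr_half_sqrt[symmetric] powr_powr flip: powr_realpow)
  moreover have "(4 * pi * s) powr (- real DIM('a) / 2) = (4 * pi) powr (- real DIM('a) / 2) * s powr (- real DIM('a) / 2)"
    using assms by (simp add: powr_mult)
  moreover have "s powr (real DIM('a) / 2) * s powr (- real DIM('a) / 2) = 1"
    using assms by (simp flip: powr_add)
  ultimately show ?thesis using assms by (simp add: heat_eq power_mult_distrib)
qed

section \<open>Limits for vanishing time and the Bessel representation\<close>

definition box_measure :: "'a::euclidean_space \<Rightarrow> 'a \<Rightarrow> 'a measure" where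
  "box_measure a c = density lborel (\<lambda>y. ennreal (indicator (box a c) y))"

lemma box_measure:
  fixes f :: "'a::euclidean_space \<Rightarrow> real"
  shows
  "finite_measure (box_measure a c)" "sets (box_measure a c) = sets borel"
  "f \<in> borel_measurable borel \<Longrightarrow> (\<integral>y. f y \<partial>box_measure a c) = (\<integral>y. indicator (box a c) y * f y \<partial>lborel)"
proof -
  have "emeasure (box_measure a c) UNIV = emeasure lborel (box a c)"
    unfolding box_measure_def by (subst emeasure_density) (auto simp: ennreal_indicator)
  then show "finite_measure (box_measure a c)"
    using emeasure_bounded_finite[OF bounded_box, of a c] by (intro finite_measureI) (auto simp: box_measure_def)
  show "sets (box_measure a c) = sets borel" by (simp add: box_measure_def)
  show "f \<in> borel_measurable borel \<Longrightarrow> (\<integral>y. f y \<partial>box_measure a c) = (\<integral>y. indicator (box a c) y * f y \<partial>lborel)"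
    unfolding box_measure_def by (subst integral_density) auto
qed

lemma abs_le_one_plus_powr: "p \<ge> 1 \<Longrightarrow> \<bar>t\<bar> \<le> 1 + \<bar>t::real\<bar> powr p"
proof (cases "\<bar>t\<bar> \<le> 1")
  case False
  then show "p \<ge> 1 \<Longrightarrow> ?thesis" using powr_mono[of 1 p "\<bar>t\<bar>"] by simp
qed (simp add: add_increasing2)

lemma integrable_box_shift:
  fixes g :: "'a::euclidean_space \<Rightarrow> real"
  assumes [measurable]: "g \<in> borel_measurable borel" and p: "p \<ge> 1" and gp: "integrable lborel (\<lambda>x. \<bar>g x\<bar> powr p)"
  shows "(\<integral>\<^sup>+x. ennreal \<bar>g x * indicator (box a c) (x - h)\<bar> \<partial>lborel) \<le> ennreal (measure lborel (box a c) + (\<integral>x. \<bar>g x\<bar> powr p \<partial>lborel))"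
    "integrable lborel (\<lambda>x. g x * indicator (box a c) (x - h))"
proof -
  have e: "emeasure lborel (box a c) = ennreal (measure lborel (box a c))"
    using emeasure_bounded_finite[OF bounded_box, of a c] by (intro emeasure_eq_ennreal_measure) auto
  have "(\<integral>\<^sup>+x. ennreal \<bar>g x * indicator (box a c) (x - h)\<bar> \<partial>lborel) \<le>
     (\<integral>\<^sup>+x. indicator (box a c) (x - h) + ennreal (\<bar>g x\<bar> powr p) \<partial>lborel)"
  proof (intro nn_integral_mono)
    fix x
    show "ennreal \<bar>g x * indicator (box a c) (x - h)\<bar> \<le> indicator (box a c) (x - h) + ennreal (\<bar>g x\<bar> powr p)"
      using abs_le_one_plus_powr[OF p, of "g x"]
      by (auto split: split_indicator simp flip: ennreal_plus ennreal_1 intro!: ennreal_leI)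
  qed
  also have "\<dots> = (\<integral>\<^sup>+x. indicator (box a c) (x - h) \<partial>lborel) + (\<integral>\<^sup>+x. ennreal (\<bar>g x\<bar> powr p) \<partial>lborel)"
    by (rule nn_integral_add) measurable
  also have "(\<integral>\<^sup>+x. indicator (box a c) (x - h) \<partial>lborel) = emeasure lborel (box a c)"
    using nn_integral_lborel_translate[of "indicator (box a c)" h] by simp
  also have "(\<integral>\<^sup>+x. ennreal (\<bar>g x\<bar> powr p) \<partial>lborel) = ennreal (\<integral>x. \<bar>g x\<bar> powr p \<partial>lborel)"
    using gp by (intro nn_integral_eq_integral) auto
  finally show le: "(\<integral>\<^sup>+x. ennreal \<bar>g x * indicator (box a c) (x - h)\<bar> \<partial>lborel) \<le> ennreal (measure lborel (box a c) + (\<integral>x. \<bar>g x\<bar> powr p \<partial>lborel))"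
    by (simp add: e)
  show "integrable lborel (\<lambda>x. g x * indicator (box a c) (x - h))"
    using order_le_less_trans[OF le] by (intro integrableI_bounded) auto
qed

text \<open>Off the boundary of the box, a null set, the shifted indicators are eventually constant.
  Bounded shifts stay in one larger box, which gives the dominating function.\<close>

lemma box_shift_tendsto:
  fixes g :: "'a::euclidean_space \<Rightarrow> real"
  assumes [measurable]: "g \<in> borel_measurable borel" and p: "p \<ge> 1" and gp: "integrable lborel (\<lambda>x. \<bar>g x\<bar> powr p)"
    and h: "h \<longlonglongrightarrow> 0"
  shows "(\<lambda>i. \<integral>x. g x * indicator (box a c) (x - h i) \<partial>lborel) \<longlonglongrightarrow> (\<integral>x. g x * indicator (box a c) x \<partial>lborel)"
proof -
  obtain H where H: "\<And>i. norm (h i) \<le> H"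
    using convergent_imp_bounded[OF h] unfolding bounded_iff by auto
  obtain R where R: "\<And>x. x \<in> box a c \<Longrightarrow> norm x \<le> R"
    using bounded_box[of a c] unfolding bounded_iff by auto
  define One' where "One' = (R + H + 1) *\<^sub>R (One :: 'a)"
  have inb: "x \<in> box (- One') One'" if "x - h i \<in> box a c" for x i
  proof -
    have "norm x \<le> norm (x - h i) + norm (h i)" using norm_triangle_ineq[of "x - h i" "h i"] by simp
    then have "norm x < R + H + 1" using R[OF that] H[of i] by linarith
    then have "\<bar>x \<bullet> b\<bar> < R + H + 1" if "b \<in> Basis" for b using Basis_le_norm[OF that, of x] by linarith
    then show ?thesis by (auto simp: mem_box One'_def abs_less_iff) (smt (verit))+
  qed
  show ?thesis
  proof (rule integral_dominated_convergence[where w = "\<lambda>x. \<bar>g x * indicator (box (- One') One') (x - 0)\<bar>"])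
    show "integrable lborel (\<lambda>x. \<bar>g x * indicator (box (- One') One') (x - 0)\<bar>)"
      by (intro integrable_abs integrable_box_shift[OF _ p gp]) simp
    show "AE x in lborel. norm (g x * indicator (box a c) (x - h i)) \<le> \<bar>g x * indicator (box (- One') One') (x - 0)\<bar>" for i
      using inb by (auto split: split_indicator intro!: AE_I2)
    have "negligible (cbox a c - box a c)" by (rule negligible_frontier_interval)
    then have "AE x in lebesgue. x \<notin> cbox a c - box a c"
      by (intro AE_not_in) (simp add: negligible_iff_null_sets)
    then have "AE x in lborel. x \<notin> cbox a c - box a c"
      by (simp add: AE_completion_iff)
    then show "AE x in lborel. (\<lambda>i. g x * indicator (box a c) (x - h i)) \<longlonglongrightarrow> g x * indicator (box a c) x"
    proof eventually_elim
      case (elim x)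
      have lim: "(\<lambda>i. x - h i) \<longlonglongrightarrow> x" using tendsto_diff[OF tendsto_const h, of x] by simp
      have "eventually (\<lambda>i. indicator (box a c) (x - h i) = (indicator (box a c) x :: real)) sequentially"
      proof (cases "x \<in> box a c")
        case True
        then have "eventually (\<lambda>i. x - h i \<in> box a c) sequentially"
          using topological_tendstoD[OF lim open_box] by blast
        then show ?thesis by eventually_elim (use True in simp)
      next
        case False
        then have "x \<in> - cbox a c" using elim by auto
        then have "eventually (\<lambda>i. x - h i \<in> - cbox a c) sequentially"
          using topological_tendstoD[OF lim, of "- cbox a c"] by (simp add: closed_cbox open_Compl)
        then show ?thesis
          by eventually_elim (use False box_subset_cbox[of a c, THEN subsetD] in \<open>auto simp: indicator_def\<close>)
      qed
      then show ?case by (intro tendsto_eventually) (auto elim: eventually_mono)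
    qed
  qed measurable
qed

text \<open>Substituting y = x - sqrt \<epsilon> * w rescales the heat kernel to time 1 and turns
  smoothing into shifts of the box, so \<open>box_shift_tendsto\<close> applies under the integral
  over w.\<close>

lemma heat_average_limit:
  fixes g :: "'a::euclidean_space \<Rightarrow> real"
  assumes g [measurable]: "g \<in> borel_measurable borel" and p: "p \<ge> 1" and gp: "integrable lborel (\<lambda>x. \<bar>g x\<bar> powr p)"
    and e0: "\<And>i. e i > 0" and elim: "e \<longlonglongrightarrow> 0"
  shows "(\<lambda>i. \<integral>x. g x * mix (ladder (e i) 0 \<Otimes>\<^sub>M box_measure a c) (\<lambda>_. 0) x \<partial>lborel) \<longlonglongrightarrow> (\<integral>x. g x * indicator (box a c) x \<partial>lborel)"
proof -
  define C where "C h = (\<integral>x. g x * indicator (box a c) (x - h) \<partial>lborel)" for h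
  define B where "B = measure lborel (box a c) + (\<integral>x. \<bar>g x\<bar> powr p \<partial>lborel)"
  have B0: "B \<ge> 0" by (simp add: B_def)
  have Cm [measurable]: "C \<in> borel_measurable borel" unfolding C_def[abs_def] by measurable
  have Cb: "\<bar>C h\<bar> \<le> B" for h
  proof -
    have "ennreal \<bar>C h\<bar> \<le> (\<integral>\<^sup>+x. ennreal \<bar>g x * indicator (box a c) (x - h)\<bar> \<partial>lborel)"
      unfolding C_def using integral_norm_bound_ennreal[OF integrable_box_shift(2)[OF g p gp]] by simp
    also have "\<dots> \<le> ennreal B" unfolding B_def by (rule integrable_box_shift(1)[OF g p gp])
    finally show ?thesis using B0 by simp
  qed
  have eq: "(\<integral>x. g x * mix (ladder (e i) 0 \<Otimes>\<^sub>M box_measure a c) (\<lambda>_. 0) x \<partial>lborel) = (\<integral>w. heat 1 w * C (sqrt (e i) *\<^sub>R w) \<partial>lborel)" for i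
  proof -
    let ?s = "sqrt (e i)"
    have m: "mix (ladder (e i) 0 \<Otimes>\<^sub>M box_measure a c) (\<lambda>_. 0) x = (\<integral>w. indicator (box a c) (x - ?s *\<^sub>R w) * heat 1 w \<partial>lborel)" for x
    proof -
      have "mix (ladder (e i) 0 \<Otimes>\<^sub>M box_measure a c) (\<lambda>_. 0) x = (\<integral>y. \<integral>s. heat s (x - y) \<partial>ladder (e i) 0 \<partial>box_measure a c)"
        by (rule mix_ladder[OF e0 box_measure(1,2)])
      also have "\<dots> = (\<integral>y. heat (e i) (x - y) \<partial>box_measure a c)"
        by (simp add: integral_return)
      also have "\<dots> = (\<integral>y. indicator (box a c) y * heat (e i) (x - y) \<partial>lborel)"
        by (rule box_measure) measurable
      also have "\<dots> = \<bar>- ?s\<bar> ^ DIM('a) * (\<integral>w. indicator (box a c) (x + (- ?s) *\<^sub>R w) * heat (e i) (x - (x + (- ?s) *\<^sub>R w)) \<partial>lborel)"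
        using e0[of i] by (intro integral_lborel_affine) auto
      also have "\<dots> = (\<integral>w. indicator (box a c) (x - ?s *\<^sub>R w) * (?s ^ DIM('a) * heat (e i) (?s *\<^sub>R w)) \<partial>lborel)"
        using e0[of i] by (simp add: mult_ac flip: integral_mult_right_zero)
      finally show ?thesis using heat_scale[OF e0[of i], where 'a = 'a] by simp
    qed
    have int: "integrable (lborel \<Otimes>\<^sub>M lborel) (\<lambda>(x, w). g x * (indicator (box a c) (x - ?s *\<^sub>R w) * heat 1 w))"
    proof (rule integrableI_bounded)
      have "(\<integral>\<^sup>+z. ennreal (norm (case z of (x, w) \<Rightarrow> g x * (indicator (box a c) (x - ?s *\<^sub>R w) * heat 1 w))) \<partial>(lborel \<Otimes>\<^sub>M lborel)) =
        (\<integral>\<^sup>+w. \<integral>\<^sup>+x. ennreal (norm (g x * (indicator (box a c) (x - ?s *\<^sub>R w) * heat 1 w))) \<partial>lborel \<partial>lborel)"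
        by (subst lborel_pair.nn_integral_snd[symmetric]) auto
      also have "\<dots> = (\<integral>\<^sup>+w. \<integral>\<^sup>+x. ennreal (heat 1 w) * ennreal \<bar>g x * indicator (box a c) (x - ?s *\<^sub>R w)\<bar> \<partial>lborel \<partial>lborel)"
        by (intro nn_integral_cong) (auto simp: abs_mult heat_pos less_imp_le mult_ac simp flip: ennreal_mult')
      also have "\<dots> = (\<integral>\<^sup>+w. ennreal (heat 1 w) * (\<integral>\<^sup>+x. ennreal \<bar>g x * indicator (box a c) (x - ?s *\<^sub>R w)\<bar> \<partial>lborel) \<partial>lborel)"
        by (intro nn_integral_cong nn_integral_cmult) measurable
      also have "\<dots> \<le> (\<integral>\<^sup>+w. ennreal (heat 1 (w::'a)) * ennreal B \<partial>lborel)"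
        unfolding B_def by (intro nn_integral_mono mult_left_mono integrable_box_shift(1)[OF g p gp]) auto
      also have "\<dots> = ennreal B"
        by (subst nn_integral_multc) (auto simp: nn_integral_heat)
      also have "\<dots> < \<infinity>" by simp
      finally show "(\<integral>\<^sup>+z. ennreal (norm (case z of (x, w) \<Rightarrow> g x * (indicator (box a c) (x - ?s *\<^sub>R w) * heat 1 w))) \<partial>(lborel \<Otimes>\<^sub>M lborel)) < \<infinity>" .
    qed measurable
    have "(\<integral>x. g x * mix (ladder (e i) 0 \<Otimes>\<^sub>M box_measure a c) (\<lambda>_. 0) x \<partial>lborel) =
      (\<integral>x. \<integral>w. g x * (indicator (box a c) (x - ?s *\<^sub>R w) * heat 1 w) \<partial>lborel \<partial>lborel)"
      by (simp only: m) simp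
    also have "\<dots> = (\<integral>w. \<integral>x. g x * (indicator (box a c) (x - ?s *\<^sub>R w) * heat 1 w) \<partial>lborel \<partial>lborel)"
      by (rule lborel_pair.Fubini_integral[OF int, symmetric])
    also have "\<dots> = (\<integral>w. heat 1 w * C (?s *\<^sub>R w) \<partial>lborel)"
      by (simp add: C_def mult_ac flip: integral_mult_right_zero)
    finally show ?thesis .
  qed
  have "(\<lambda>i. \<integral>w. heat 1 w * C (sqrt (e i) *\<^sub>R w) \<partial>lborel) \<longlonglongrightarrow> (\<integral>w. heat 1 (w::'a) * C 0 \<partial>lborel)"
  proof (rule integral_dominated_convergence[where w = "\<lambda>w. heat 1 w * B"])
    show "integrable lborel (\<lambda>w::'a. heat 1 w * B)"
      using integrable_heat[of 1 "0::'a"] by simp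
    show "AE w in lborel. (\<lambda>i. heat 1 w * C (sqrt (e i) *\<^sub>R w)) \<longlonglongrightarrow> heat 1 w * C 0"
    proof (rule AE_I2)
      fix w :: 'a
      have "(\<lambda>i. sqrt (e i) *\<^sub>R w) \<longlonglongrightarrow> sqrt 0 *\<^sub>R w" by (intro tendsto_intros elim)
      then have "(\<lambda>i. C (sqrt (e i) *\<^sub>R w)) \<longlonglongrightarrow> C 0"
        unfolding C_def using box_shift_tendsto[OF g p gp] by simp
      then show "(\<lambda>i. heat 1 w * C (sqrt (e i) *\<^sub>R w)) \<longlonglongrightarrow> heat 1 w * C 0" by (rule tendsto_mult_left)
    qed
    show "AE w in lborel. norm (heat 1 w * C (sqrt (e i) *\<^sub>R w)) \<le> heat 1 w * B" for i
    proof (rule AE_I2)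
      fix w :: 'a
      have "heat 1 w * \<bar>C (sqrt (e i) *\<^sub>R w)\<bar> \<le> heat 1 w * B"
        using heat_pos[of 1 w] by (intro mult_left_mono Cb) auto
      then show "norm (heat 1 w * C (sqrt (e i) *\<^sub>R w)) \<le> heat 1 w * B"
        using heat_pos[of 1 w] by (simp add: abs_mult)
    qed
  qed measurable
  also have "(\<integral>w. heat 1 (w::'a) * C 0 \<partial>lborel) = C 0"
  proof -
    have "(\<integral>w. heat 1 (w::'a) \<partial>lborel) = 1"
      using nn_integral_heat[of 1, where 'a = 'a]
      by (subst integral_eq_nn_integral) (auto simp: heat_pos less_imp_le)
    then show ?thesis by simp
  qed
  finally show ?thesis unfolding eq by (simp add: C_def)
qed

lemma bessel_commute: "bessel j (x - y) = bessel j (y - x :: 'a::euclidean_space)"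
  unfolding bessel_def by (simp add: heat_commute[of _ x y])

text \<open>The smoothed kernels averaged over a box are at most exp 1 times the Bessel potential of
  the box. That potential is bounded and integrable, so it can be paired with functions of L^p and
  dominates the limit.\<close>

lemma bessel_average_limit:
  fixes g :: "'a::euclidean_space \<Rightarrow> real"
  assumes g [measurable]: "g \<in> borel_measurable borel" and p: "p \<ge> 1" and gp: "integrable lborel (\<lambda>x. \<bar>g x\<bar> powr p)"
    and j: "2 * Suc j < DIM('a)"
  shows "(\<lambda>i. \<integral>x. g x * mix (ladder (1 / (real i + 1)) (Suc j) \<Otimes>\<^sub>M box_measure a c) (\<lambda>_. 0) x \<partial>lborel) \<longlonglongrightarrow>
      (\<integral>y. indicator (box a c) y * (\<integral>x. bessel j (y - x) * g x \<partial>lborel) \<partial>lborel)"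
    "integrable lborel (\<lambda>y. indicator (box a c) y * (\<integral>x. bessel j (y - x) * g x \<partial>lborel))"
proof -
  let ?e = "\<lambda>i. 1 / (real i + 1)"
  have e0: "?e i > 0" "?e i \<le> 1" for i by auto
  define I where "I y = (indicator (box a c) y :: real)" for y
  have [measurable]: "I \<in> borel_measurable borel" unfolding I_def[abs_def] by measurable
  have I01: "0 \<le> I y" "I y \<le> 1" for y by (auto simp: I_def)
  define h where "h x = (\<integral>y. I y * bessel j (x - y) \<partial>lborel)" for x
  have bint: "integrable lborel (\<lambda>y. bessel j (x - y))" for x :: 'a
    using nn_integral_bessel[OF j] nn_integral_lborel_reflect[of "\<lambda>z. ennreal (bessel j z)" x]
    by (intro integrableI_nonneg) (auto simp: bessel_nonneg)
  have hint: "integrable lborel (\<lambda>y. I y * bessel j (x - y))" for x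
    by (rule Bochner_Integration.integrable_bound[OF bint[of x]])
      (use I01 in \<open>auto intro!: AE_I2 simp: abs_mult bessel_nonneg mult_left_le_one_le\<close>)
  have bm [measurable]: "besseleps \<epsilon> j \<in> borel_measurable (borel :: 'a measure)" for \<epsilon>
    unfolding besseleps_eq[abs_def] by measurable
  have m: "mix (ladder (?e i) (Suc j) \<Otimes>\<^sub>M box_measure a c) (\<lambda>_. 0) x = (\<integral>y. I y * besseleps (?e i) j (x - y) \<partial>lborel)" for i x
    unfolding I_def
    by (subst mix_ladder[OF e0(1) box_measure(1,2)], fold besseleps_def, rule box_measure(3)) measurable
  have pw: "AE y in lborel. 0 \<le> besseleps (?e i) j (x - y) \<and> besseleps (?e i) j (x - y) \<le> exp 1 * bessel j (x - y)" for i and x :: 'a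
    using AE_lborel_singleton[of x]
  proof eventually_elim
    case (elim y)
    then have z: "x - y \<noteq> 0" by simp
    have "besseleps (?e i) j (x - y) \<le> exp (?e i) * bessel j (x - y)" by (rule besseleps_le_bessel(2)[OF z j e0(1)])
    also have "\<dots> \<le> exp 1 * bessel j (x - y)" using e0(2)[of i] by (intro mult_right_mono bessel_nonneg) auto
    finally show ?case using besseleps_le_bessel(1)[OF z j e0(1)] by simp
  qed
  have mle: "\<bar>mix (ladder (?e i) (Suc j) \<Otimes>\<^sub>M box_measure a c) (\<lambda>_. 0) x\<bar> \<le> exp 1 * h x" for i x
  proof -
    have "\<bar>\<integral>y. I y * besseleps (?e i) j (x - y) \<partial>lborel\<bar> \<le> (\<integral>y. \<bar>I y * besseleps (?e i) j (x - y)\<bar> \<partial>lborel)"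
      by (rule integral_abs_bound)
    also have "\<dots> \<le> (\<integral>y. exp 1 * (I y * bessel j (x - y)) \<partial>lborel)"
    proof (rule integral_mono_AE')
      show "integrable lborel (\<lambda>y. exp 1 * (I y * bessel j (x - y)))" using hint by simp
      show "AE y in lborel. \<bar>I y * besseleps (?e i) j (x - y)\<bar> \<le> exp 1 * (I y * bessel j (x - y))"
        using pw[of i x] by eventually_elim (auto simp: abs_mult I_def split: split_indicator)
    qed (auto intro!: AE_I2 mult_nonneg_nonneg simp: I01 bessel_nonneg)
    finally show ?thesis by (simp only: m h_def) simp
  qed
  have hlim: "(\<lambda>i. mix (ladder (?e i) (Suc j) \<Otimes>\<^sub>M box_measure a c) (\<lambda>_. 0) x) \<longlonglongrightarrow> h x" for x
    unfolding m h_def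
  proof (rule integral_dominated_convergence[where w = "\<lambda>y. exp 1 * (I y * bessel j (x - y))"])
    show "integrable lborel (\<lambda>y. exp 1 * (I y * bessel j (x - y)))" using hint by simp
    show "AE y in lborel. (\<lambda>i. I y * besseleps (?e i) j (x - y)) \<longlonglongrightarrow> I y * bessel j (x - y)"
      using AE_lborel_singleton[of x]
      by eventually_elim (intro tendsto_mult_left besseleps_tendsto[OF _ j], simp)
    show "AE y in lborel. norm (I y * besseleps (?e i) j (x - y)) \<le> exp 1 * (I y * bessel j (x - y))" for i
      using pw[of i x] by eventually_elim (auto simp: abs_mult I_def split: split_indicator)
  qed measurable
  have h0: "h x \<ge> 0" for x
    unfolding h_def by (intro Bochner_Integration.integral_nonneg mult_nonneg_nonneg I01 bessel_nonneg)
  have hnn: "ennreal (h x) = (\<integral>\<^sup>+y. ennreal (I y * bessel j (x - y)) \<partial>lborel)" for x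
    unfolding h_def using hint[of x] by (intro nn_integral_eq_integral[symmetric]) (auto simp: I01 bessel_nonneg)
  have h1: "\<bar>h x\<bar> \<le> 1" for x
  proof -
    have "ennreal (h x) \<le> (\<integral>\<^sup>+y. ennreal (bessel j (x - y)) \<partial>lborel)"
      unfolding hnn by (intro nn_integral_mono ennreal_leI mult_left_le_one_le I01 bessel_nonneg)
    also have "\<dots> = 1" using nn_integral_bessel[OF j] nn_integral_lborel_reflect[of "\<lambda>z. ennreal (bessel j z)" x] by simp
    finally show ?thesis using h0[of x] by simp
  qed
  have [measurable]: "h \<in> borel_measurable borel" unfolding h_def[abs_def] by measurable
  have ih: "integrable lborel h"
  proof (rule integrableI_nonneg)
    have "(\<integral>\<^sup>+x. ennreal (h x) \<partial>lborel) = (\<integral>\<^sup>+y. \<integral>\<^sup>+x. ennreal (I y * bessel j (x - y)) \<partial>lborel \<partial>lborel)"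
      unfolding hnn by (rule lborel_pair.Fubini') measurable
    also have "\<dots> = (\<integral>\<^sup>+y. ennreal (I y) * (\<integral>\<^sup>+x. ennreal (bessel j (x - y)) \<partial>lborel) \<partial>lborel)"
      by (intro nn_integral_cong, subst nn_integral_cmult[symmetric]) (auto simp: ennreal_mult' I01)
    also have "\<dots> = (\<integral>\<^sup>+y. ennreal (I y) \<partial>lborel)"
      using nn_integral_bessel[OF j] nn_integral_lborel_translate[of "\<lambda>z::'a. ennreal (bessel j z)"] by simp
    also have "\<dots> = emeasure lborel (box a c)" by (simp add: I_def ennreal_indicator)
    also have "\<dots> < \<infinity>" by (rule emeasure_bounded_finite[OF bounded_box])
    finally show "(\<integral>\<^sup>+x. ennreal (h x) \<partial>lborel) < \<infinity>" .
  qed (auto simp: h0)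
  have igh: "integrable lborel (\<lambda>x. g x * h x)" by (rule integrable_mult_Lp[OF _ ih p gp h1]) simp
  have lim: "(\<lambda>i. \<integral>x. g x * mix (ladder (?e i) (Suc j) \<Otimes>\<^sub>M box_measure a c) (\<lambda>_. 0) x \<partial>lborel) \<longlonglongrightarrow> (\<integral>x. g x * h x \<partial>lborel)"
  proof (rule integral_dominated_convergence[where w = "\<lambda>x. exp 1 * \<bar>g x * h x\<bar>"])
    show "integrable lborel (\<lambda>x. exp 1 * \<bar>g x * h x\<bar>)" using igh by simp
    show "AE x in lborel. (\<lambda>i. g x * mix (ladder (?e i) (Suc j) \<Otimes>\<^sub>M box_measure a c) (\<lambda>_. 0) x) \<longlonglongrightarrow> g x * h x"
      by (intro AE_I2 tendsto_mult_left hlim)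
    show "AE x in lborel. norm (g x * mix (ladder (?e i) (Suc j) \<Otimes>\<^sub>M box_measure a c) (\<lambda>_. 0) x) \<le> exp 1 * \<bar>g x * h x\<bar>" for i
    proof (rule AE_I2)
      fix x
      have "\<bar>g x\<bar> * \<bar>mix (ladder (?e i) (Suc j) \<Otimes>\<^sub>M box_measure a c) (\<lambda>_. 0) x\<bar> \<le> \<bar>g x\<bar> * (exp 1 * h x)"
        by (intro mult_left_mono mle) auto
      then show "norm (g x * mix (ladder (?e i) (Suc j) \<Otimes>\<^sub>M box_measure a c) (\<lambda>_. 0) x) \<le> exp 1 * \<bar>g x * h x\<bar>"
        using h0[of x] by (simp add: abs_mult mult_ac)
    qed
    have "mix (ladder (?e i) (Suc j) \<Otimes>\<^sub>M box_measure a c) (\<lambda>_. 0) \<in> borel_measurable borel" for i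
      unfolding m[abs_def] by measurable
    then show "(\<lambda>x. g x * mix (ladder (?e i) (Suc j) \<Otimes>\<^sub>M box_measure a c) (\<lambda>_. 0) x) \<in> borel_measurable lborel" for i
      by measurable
  qed measurable
  have joint: "integrable (lborel \<Otimes>\<^sub>M lborel) (\<lambda>(x, y). g x * (I y * bessel j (x - y)))"
  proof (rule integrableI_bounded)
    have "(\<integral>\<^sup>+z. ennreal (norm (case z of (x, y) \<Rightarrow> g x * (I y * bessel j (x - y)))) \<partial>(lborel \<Otimes>\<^sub>M lborel)) =
      (\<integral>\<^sup>+x. \<integral>\<^sup>+y. ennreal (norm (g x * (I y * bessel j (x - y)))) \<partial>lborel \<partial>lborel)"
      by (subst lborel.nn_integral_fst[symmetric]) auto
    also have "\<dots> = (\<integral>\<^sup>+x. \<integral>\<^sup>+y. ennreal \<bar>g x\<bar> * ennreal (I y * bessel j (x - y)) \<partial>lborel \<partial>lborel)"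
      by (intro nn_integral_cong) (simp add: abs_mult I01 bessel_nonneg flip: ennreal_mult')
    also have "\<dots> = (\<integral>\<^sup>+x. ennreal \<bar>g x\<bar> * ennreal (h x) \<partial>lborel)"
      unfolding hnn by (intro nn_integral_cong nn_integral_cmult) measurable
    also have "\<dots> = (\<integral>\<^sup>+x. ennreal (norm (g x * h x)) \<partial>lborel)"
      by (intro nn_integral_cong) (simp add: abs_mult h0 flip: ennreal_mult')
    also have "\<dots> < \<infinity>" using igh by (simp add: integrable_iff_bounded)
    finally show "(\<integral>\<^sup>+z. ennreal (norm (case z of (x, y) \<Rightarrow> g x * (I y * bessel j (x - y)))) \<partial>(lborel \<Otimes>\<^sub>M lborel)) < \<infinity>" .
  qed measurable
  have swap: "I y * (\<integral>x. bessel j (y - x) * g x \<partial>lborel) = (\<integral>x. g x * (I y * bessel j (x - y)) \<partial>lborel)" for y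
    by (simp add: bessel_commute[of j _ y] mult_ac flip: integral_mult_right_zero)
  have "(\<integral>x. g x * h x \<partial>lborel) = (\<integral>x. \<integral>y. g x * (I y * bessel j (x - y)) \<partial>lborel \<partial>lborel)"
    by (simp add: h_def)
  also have "\<dots> = (\<integral>y. \<integral>x. g x * (I y * bessel j (x - y)) \<partial>lborel \<partial>lborel)"
    by (rule lborel_pair.Fubini_integral[OF joint, symmetric])
  also have "\<dots> = (\<integral>y. I y * (\<integral>x. bessel j (y - x) * g x \<partial>lborel) \<partial>lborel)" by (simp only: swap)
  finally show "(\<lambda>i. \<integral>x. g x * mix (ladder (?e i) (Suc j) \<Otimes>\<^sub>M box_measure a c) (\<lambda>_. 0) x \<partial>lborel) \<longlonglongrightarrow>
      (\<integral>y. indicator (box a c) y * (\<integral>x. bessel j (y - x) * g x \<partial>lborel) \<partial>lborel)"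
    using lim by (simp add: I_def)
  have "integrable lborel (\<lambda>y. \<integral>x. g x * (I y * bessel j (x - y)) \<partial>lborel)"
    using lborel_pair.integrable_snd[OF joint] by simp
  then show "integrable lborel (\<lambda>y. indicator (box a c) y * (\<integral>x. bessel j (y - x) * g x \<partial>lborel))"
    by (simp only: swap[symmetric]) (simp add: I_def)
qed

text \<open>Tested on boxes: \<open>mix_ladder_chain\<close> equates a heat average of
  \<open>g 0\<close> with a smoothed Bessel average of \<open>g (Suc j)\<close>, and as the time
  tends to 0 both become integrals over the box.\<close>

theorem bessel_representation:
  fixes g :: "nat \<Rightarrow> 'a::euclidean_space \<Rightarrow> real" and v :: "nat \<Rightarrow> 'a \<Rightarrow> 'a \<Rightarrow> real"
  assumes p: "p \<ge> 1" and j: "2 * Suc j < DIM('a)"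
    and g: "\<And>i. i \<le> Suc j \<Longrightarrow> g i \<in> borel_measurable borel" "\<And>i. i \<le> Suc j \<Longrightarrow> integrable lborel (\<lambda>x. \<bar>g i x\<bar> powr p)"
    and v: "\<And>i b. i < Suc j \<Longrightarrow> b \<in> Basis \<Longrightarrow> v i b \<in> borel_measurable borel"
      "\<And>i b. i < Suc j \<Longrightarrow> b \<in> Basis \<Longrightarrow> integrable lborel (\<lambda>x. \<bar>v i b x\<bar> powr p)"
    and weak: "\<And>i b \<psi>. i < Suc j \<Longrightarrow> b \<in> Basis \<Longrightarrow> \<psi> \<in> test_functions \<Longrightarrow>
      (\<integral>x. g i x * iter_partial [b, b] \<psi> x \<partial>lborel) = (\<integral>x. v i b x * \<psi> x \<partial>lborel)"
    and step: "\<And>i. i < Suc j \<Longrightarrow> AE x in lborel. g (Suc i) x = g i x - (\<Sum>b\<in>Basis. v i b x)"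
  shows "AE y in lborel. g 0 y = (\<integral>x. bessel j (y - x) * g (Suc j) x \<partial>lborel)"
proof -
  let ?f = "g (Suc j)"
  note f = g(1)[OF order_refl] g(2)[OF order_refl]
  have g0: "g 0 \<in> borel_measurable borel" "integrable lborel (\<lambda>x. \<bar>g 0 x\<bar> powr p)" using g by auto
  note [measurable] = f(1) g0(1)
  define R where "R y = (\<integral>x. bessel j (y - x) * ?f x \<partial>lborel)" for y
  have [measurable]: "R \<in> borel_measurable borel" unfolding R_def[abs_def] by measurable
  let ?e = "\<lambda>i. 1 / (real i + 1)"
  have e0: "?e i > 0" for i by auto
  have elim: "?e \<longlonglongrightarrow> 0" using LIMSEQ_inverse_real_of_nat by (simp add: inverse_eq_divide add.commute)
  have box: "(\<integral>x. g 0 x * indicator (box a c) x \<partial>lborel) = (\<integral>x. indicator (box a c) x * R x \<partial>lborel)" for a c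
  proof -
    have "(\<lambda>i. \<integral>x. g 0 x * mix (ladder (?e i) 0 \<Otimes>\<^sub>M box_measure a c) (\<lambda>_. 0) x \<partial>lborel) \<longlonglongrightarrow> (\<integral>x. g 0 x * indicator (box a c) x \<partial>lborel)"
      by (rule heat_average_limit[OF g0(1) p g0(2) e0 elim])
    moreover have "(\<integral>x. g 0 x * mix (ladder (?e i) 0 \<Otimes>\<^sub>M box_measure a c) (\<lambda>_. 0) x \<partial>lborel) =
       (\<integral>x. ?f x * mix (ladder (?e i) (Suc j) \<Otimes>\<^sub>M box_measure a c) (\<lambda>_. 0) x \<partial>lborel)" for i
      by (rule mix_ladder_chain[where k = "Suc j" and v = v, OF e0 box_measure(1,2) p g v weak step]) auto
    ultimately show ?thesis
      using bessel_average_limit(1)[OF f(1) p f(2) j, of a c] LIMSEQ_unique unfolding R_def by simp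
  qed
  have i1: "integrable lborel (\<lambda>x. indicator (box a c) x * g 0 x)" for a c
    using integrable_box_shift(2)[OF g0(1) p g0(2), of a c 0] by (simp add: mult.commute)
  have i2: "integrable lborel (\<lambda>x. indicator (box a c) x * R x)" for a c
    using bessel_average_limit(2)[OF f(1) p f(2) j] unfolding R_def .
  have "AE x in lborel. g 0 x - R x = 0"
  proof (rule AE_zero_if_box_integrals_zero)
    fix a c :: 'a
    show "integrable lborel (\<lambda>x. indicator (box a c) x * (g 0 x - R x))"
      using i1[of a c] i2[of a c] by (simp add: right_diff_distrib)
    show "(\<integral>x. indicator (box a c) x * (g 0 x - R x) \<partial>lborel) = 0"
      using box[of a c] i1[of a c] i2[of a c] by (simp add: right_diff_distrib mult.commute)
  qed measurable
  then show ?thesis by eventually_elim (simp add: R_def)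
qed

section \<open>Weak derivatives and Sobolev functions\<close>

text \<open>Function spaces and weak derivatives refer to the completed measure, the arguments with
  Fubini to Borel functions; one passes between them up to null sets.\<close>

lemma lebesgue_borel_rep:
  fixes f :: "'a::euclidean_space \<Rightarrow> real"
  assumes "f \<in> borel_measurable lebesgue"
  obtains f' where "f' \<in> borel_measurable borel" "AE x in lborel. f x = f' x"
  using completion_ex_borel_measurable_real[OF assms] by auto

lemma integral_lebesgue_lborel:
  fixes f f' :: "'a::euclidean_space \<Rightarrow> real"
  assumes f: "f \<in> borel_measurable lebesgue" and f' [measurable]: "f' \<in> borel_measurable borel"
    and eq: "AE x in lborel. f x = f' x"
  shows "(\<integral>x. f x \<partial>lebesgue) = (\<integral>x. f' x \<partial>lborel)" "integrable lebesgue f \<longleftrightarrow> integrable lborel f'"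
proof -
  have f'l: "f' \<in> borel_measurable lebesgue" by (rule measurable_completion) simp
  have ae: "AE x in lebesgue. f x = f' x" by (rule AE_completion[OF eq])
  have "(\<integral>x. f x \<partial>lebesgue) = (\<integral>x. f' x \<partial>lebesgue)"
    by (rule integral_cong_AE[OF f f'l ae])
  also have "\<dots> = (\<integral>x. f' x \<partial>lborel)" by (rule integral_completion) simp
  finally show "(\<integral>x. f x \<partial>lebesgue) = (\<integral>x. f' x \<partial>lborel)" .
  have "integrable lebesgue f \<longleftrightarrow> integrable lebesgue f'"
    by (rule integrable_cong_AE[OF f f'l ae])
  also have "\<dots> \<longleftrightarrow> integrable lborel f'" by (rule integrable_completion) simp
  finally show "integrable lebesgue f \<longleftrightarrow> integrable lborel f'" .
qed

lemma borel_imp_lebesgue: "f \<in> borel_measurable borel \<Longrightarrow> f \<in> borel_measurable (lebesgue :: 'a::euclidean_space measure)"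
  by (rule measurable_completion) simp

lemma test_function_borel: "\<psi> \<in> test_functions \<Longrightarrow> \<psi> \<in> borel_measurable (borel :: 'a::euclidean_space measure)"
  by (intro borel_measurable_continuous_onI test_functionsD(1))

lemma test_function_bounded:
  fixes \<psi> :: "'a::euclidean_space \<Rightarrow> real"
  assumes "\<psi> \<in> test_functions"
  obtains K R where "K \<ge> 0" "\<And>x. \<bar>\<psi> x\<bar> \<le> K * indicator (cball 0 R) x"
proof -
  obtain R where R: "\<forall>x. norm x \<ge> R \<longrightarrow> \<psi> x = 0" using test_functionsD(4)[OF assms] by blast
  obtain K where K: "K \<ge> 0" "\<And>x. \<bar>\<psi> x\<bar> \<le> K"
    using bounded_compact_support[OF test_functionsD(1)[OF assms], of R] R by metis
  have "\<bar>\<psi> x\<bar> \<le> K * indicator (cball 0 R) x" for x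
    using R K by (cases "norm x \<le> R") auto
  then show thesis using K(1) by (intro that)
qed

lemma locally_integrable_measurable:
  fixes f :: "'a::euclidean_space \<Rightarrow> real"
  assumes "locally_integrable f"
  shows "f \<in> borel_measurable lebesgue"
proof (rule borel_measurable_LIMSEQ_real)
  show "(\<lambda>x. indicator (cball 0 (real i)) x *\<^sub>R f x) \<in> borel_measurable lebesgue" for i
    using assms[unfolded locally_integrable_def, rule_format, OF compact_cball[of 0 "real i"]]
    by (simp add: set_integrable_def borel_measurable_integrable)
  show "(\<lambda>i. indicator (cball 0 (real i)) x *\<^sub>R f x) \<longlonglongrightarrow> f x" for x
  proof (rule tendsto_eventually)
    have "eventually (\<lambda>i. real i \<ge> norm x) sequentially"
      using filterlim_real_sequentially by (simp add: filterlim_at_top)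
    then show "eventually (\<lambda>i. indicator (cball 0 (real i)) x *\<^sub>R f x = f x) sequentially"
      by eventually_elim simp
  qed
qed

lemma locally_integrable_test:
  fixes f :: "'a::euclidean_space \<Rightarrow> real"
  assumes f: "locally_integrable f" and \<psi>: "\<psi> \<in> test_functions"
  shows "integrable lebesgue (\<lambda>x. f x * \<psi> x)"
proof -
  obtain K R where K: "K \<ge> 0" "\<And>x. \<bar>\<psi> x\<bar> \<le> K * indicator (cball 0 R) x"
    using test_function_bounded[OF \<psi>] by blast
  have i: "integrable lebesgue (\<lambda>x. K * (indicator (cball 0 R) x *\<^sub>R f x))"
    using f by (auto simp: locally_integrable_def set_integrable_def)
  have [measurable]: "f \<in> borel_measurable lebesgue" "\<psi> \<in> borel_measurable lebesgue"
    using locally_integrable_measurable[OF f] borel_imp_lebesgue[OF test_function_borel[OF \<psi>]] by auto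
  show ?thesis
  proof (rule Bochner_Integration.integrable_bound[OF i])
    show "AE x in lebesgue. norm (f x * \<psi> x) \<le> norm (K * (indicator (cball 0 R) x *\<^sub>R f x))"
    proof (rule AE_I2)
      fix x
      have "\<bar>f x\<bar> * \<bar>\<psi> x\<bar> \<le> \<bar>f x\<bar> * (K * indicator (cball 0 R) x)" by (intro mult_left_mono K) auto
      then show "norm (f x * \<psi> x) \<le> norm (K * (indicator (cball 0 R) x *\<^sub>R f x))"
        using K(1) by (simp add: abs_mult mult_ac)
    qed
  qed measurable
qed

lemma locally_integrable_lincomb:
  fixes f g :: "'a::euclidean_space \<Rightarrow> real"
  assumes "locally_integrable f" "locally_integrable g"
  shows "locally_integrable (\<lambda>x. s * f x + t * g x)"
  unfolding locally_integrable_def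
proof (intro allI impI)
  fix K :: "'a set" assume "compact K"
  then have "set_integrable lebesgue K f" "set_integrable lebesgue K g"
    using assms by (auto simp: locally_integrable_def)
  then have "integrable lebesgue (\<lambda>x. s * (indicator K x *\<^sub>R f x) + t * (indicator K x *\<^sub>R g x))"
    unfolding set_integrable_def by auto
  then show "set_integrable lebesgue K (\<lambda>x. s * f x + t * g x)"
    unfolding set_integrable_def by (simp add: algebra_simps)
qed

lemma has_weak_deriv_lincomb:
  assumes "has_weak_deriv bs u v" "has_weak_deriv bs u' v'" "set bs \<subseteq> Basis"
  shows "has_weak_deriv bs (\<lambda>x. s * u x + t * u' x) (\<lambda>x. s * v x + t * v' x)"
  unfolding has_weak_deriv_def
proof (intro conjI ballI)
  note d = assms[unfolded has_weak_deriv_def]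
  show "locally_integrable (\<lambda>x. s * u x + t * u' x)" "locally_integrable (\<lambda>x. s * v x + t * v' x)"
    using d by (auto intro: locally_integrable_lincomb)
  fix \<psi> :: "'a \<Rightarrow> real" assume \<psi>: "\<psi> \<in> test_functions"
  have it: "iter_partial bs \<psi> \<in> test_functions" by (rule test_functions_iter_partial[OF \<psi> assms(3)])
  have lin: "(\<integral>x. (s * a x + t * b x) * \<eta> x \<partial>lebesgue) = s * (\<integral>x. a x * \<eta> x \<partial>lebesgue) + t * (\<integral>x. b x * \<eta> x \<partial>lebesgue)"
    if "locally_integrable a" "locally_integrable b" "\<eta> \<in> test_functions" for a b \<eta> :: "'a \<Rightarrow> real"
  proof -
    have "(\<integral>x. (s * a x + t * b x) * \<eta> x \<partial>lebesgue) = (\<integral>x. s * (a x * \<eta> x) + t * (b x * \<eta> x) \<partial>lebesgue)"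
      by (simp add: algebra_simps)
    then show ?thesis
      using locally_integrable_test[OF that(1,3)] locally_integrable_test[OF that(2,3)] by simp
  qed
  have "(\<integral>x. (s * u x + t * u' x) * iter_partial bs \<psi> x \<partial>lebesgue) =
    s * (\<integral>x. u x * iter_partial bs \<psi> x \<partial>lebesgue) + t * (\<integral>x. u' x * iter_partial bs \<psi> x \<partial>lebesgue)"
    by (rule lin) (use d it in auto)
  also have "(\<integral>x. u x * iter_partial bs \<psi> x \<partial>lebesgue) = (-1) ^ length bs * (\<integral>x. v x * \<psi> x \<partial>lebesgue)"
    using d(1) \<psi> by blast
  also have "(\<integral>x. u' x * iter_partial bs \<psi> x \<partial>lebesgue) = (-1) ^ length bs * (\<integral>x. v' x * \<psi> x \<partial>lebesgue)"
    using d(2) \<psi> by blast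
  also have "s * ((-1) ^ length bs * (\<integral>x. v x * \<psi> x \<partial>lebesgue)) + t * ((-1) ^ length bs * (\<integral>x. v' x * \<psi> x \<partial>lebesgue)) =
    (-1) ^ length bs * (s * (\<integral>x. v x * \<psi> x \<partial>lebesgue) + t * (\<integral>x. v' x * \<psi> x \<partial>lebesgue))"
    by (simp add: distrib_left mult.left_commute)
  also have "s * (\<integral>x. v x * \<psi> x \<partial>lebesgue) + t * (\<integral>x. v' x * \<psi> x \<partial>lebesgue) = (\<integral>x. (s * v x + t * v' x) * \<psi> x \<partial>lebesgue)"
    by (rule lin[symmetric]) (use d \<psi> in auto)
  finally show "(\<integral>x. (s * u x + t * u' x) * iter_partial bs \<psi> x \<partial>lebesgue) =
    (-1) ^ length bs * (\<integral>x. (s * v x + t * v' x) * \<psi> x \<partial>lebesgue)" .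
qed

text \<open>The fundamental lemma for a Borel representative of the difference. It makes the choice
  in \<open>weak_deriv\<close> immaterial up to null sets.\<close>

lemma weak_deriv_unique:
  fixes u :: "'a::euclidean_space \<Rightarrow> real"
  assumes "has_weak_deriv bs u v" "has_weak_deriv bs u w"
  shows "AE x in lebesgue. v x = w x"
proof -
  define f where "f x = 1 * v x + (-1) * w x" for x
  have loc: "locally_integrable v" "locally_integrable w" "locally_integrable f"
    using assms locally_integrable_lincomb[of v w 1 "-1"] by (auto simp: has_weak_deriv_def f_def[abs_def])
  have fm: "f \<in> borel_measurable lebesgue" by (rule locally_integrable_measurable[OF loc(3)])
  obtain f' where f' [measurable]: "f' \<in> borel_measurable borel" and ae: "AE x in lborel. f x = f' x"
    by (rule lebesgue_borel_rep[OF fm])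
  have "AE x in lborel. f' x = 0"
  proof (rule AE_zero_if_weakly_zero[OF f'])
    fix a c :: 'a
    have "integrable lebesgue (\<lambda>x. indicator (cbox a c) x *\<^sub>R f x)"
      using loc(3) by (simp add: locally_integrable_def set_integrable_def)
    moreover have "(\<lambda>x. indicator (cbox a c) x *\<^sub>R f x) \<in> borel_measurable lebesgue"
      using borel_measurable_integrable[OF calculation] .
    moreover have "AE x in lborel. indicator (cbox a c) x *\<^sub>R f x = indicator (cbox a c) x * f' x"
      using ae by eventually_elim simp
    ultimately show "integrable lborel (\<lambda>x. indicator (cbox a c) x * f' x)"
      by (subst (asm) integral_lebesgue_lborel(2)[where f' = "\<lambda>x. indicator (cbox a c) x * f' x"]) auto
  next
    fix \<psi> :: "'a \<Rightarrow> real" assume \<psi>: "\<psi> \<in> test_functions"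
    have \<psi>m: "\<psi> \<in> borel_measurable borel" "\<psi> \<in> borel_measurable lebesgue"
      using test_function_borel[OF \<psi>] borel_imp_lebesgue by auto
    have "(-1) ^ length bs * (\<integral>x. v x * \<psi> x \<partial>lebesgue) = (-1) ^ length bs * (\<integral>x. w x * \<psi> x \<partial>lebesgue)"
      using assms \<psi> by (auto simp: has_weak_deriv_def)
    then have "(\<integral>x. v x * \<psi> x \<partial>lebesgue) = (\<integral>x. w x * \<psi> x \<partial>lebesgue)" by simp
    moreover have "(\<integral>x. f x * \<psi> x \<partial>lebesgue) = (\<integral>x. v x * \<psi> x - w x * \<psi> x \<partial>lebesgue)"
      by (simp add: f_def algebra_simps)
    ultimately have "(\<integral>x. f x * \<psi> x \<partial>lebesgue) = 0"
      using locally_integrable_test[OF loc(1) \<psi>] locally_integrable_test[OF loc(2) \<psi>] by simp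
    moreover have "(\<integral>x. f x * \<psi> x \<partial>lebesgue) = (\<integral>x. f' x * \<psi> x \<partial>lborel)"
      using fm \<psi>m ae by (intro integral_lebesgue_lborel(1)) auto
    ultimately show "(\<integral>x. f' x * \<psi> x \<partial>lborel) = 0" by simp
  qed
  then have "AE x in lborel. f x = 0" using ae by eventually_elim simp
  then have "AE x in lebesgue. f x = 0" by (rule AE_completion)
  then show ?thesis by eventually_elim (simp add: f_def)
qed

lemma Lp_space_lincomb:
  assumes "f \<in> Lp_space p" "g \<in> Lp_space p" "p \<ge> 1"
  shows "(\<lambda>x. s * f x + t * g x) \<in> Lp_space p"
proof -
  have [measurable]: "f \<in> borel_measurable lebesgue" "g \<in> borel_measurable lebesgue"
    and i: "integrable lebesgue (\<lambda>x. \<bar>f x\<bar> powr p)" "integrable lebesgue (\<lambda>x. \<bar>g x\<bar> powr p)"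
    using assms by (auto simp: Lp_space_def)
  have "integrable lebesgue (\<lambda>x. \<bar>s * f x + t * g x\<bar> powr p)"
  proof (rule Bochner_Integration.integrable_bound)
    show "integrable lebesgue (\<lambda>x. (2 * \<bar>s\<bar>) powr p * \<bar>f x\<bar> powr p + (2 * \<bar>t\<bar>) powr p * \<bar>g x\<bar> powr p)" using i by simp
    show "AE x in lebesgue. norm (\<bar>s * f x + t * g x\<bar> powr p) \<le> norm ((2 * \<bar>s\<bar>) powr p * \<bar>f x\<bar> powr p + (2 * \<bar>t\<bar>) powr p * \<bar>g x\<bar> powr p)"
    proof (rule AE_I2)
      fix x
      let ?a = "2 * \<bar>s\<bar> * \<bar>f x\<bar>" and ?b = "2 * \<bar>t\<bar> * \<bar>g x\<bar>"
      have "\<bar>s * f x + t * g x\<bar> \<le> \<bar>s\<bar> * \<bar>f x\<bar> + \<bar>t\<bar> * \<bar>g x\<bar>"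
        by (metis abs_mult abs_triangle_ineq)
      also have "\<dots> \<le> max ?a ?b" by (simp add: max_def)
      finally have "\<bar>s * f x + t * g x\<bar> powr p \<le> max ?a ?b powr p"
        using assms(3) by (intro powr_mono2) auto
      also have "\<dots> \<le> ?a powr p + ?b powr p" by (simp add: max_def)
      finally show "norm (\<bar>s * f x + t * g x\<bar> powr p) \<le> norm ((2 * \<bar>s\<bar>) powr p * \<bar>f x\<bar> powr p + (2 * \<bar>t\<bar>) powr p * \<bar>g x\<bar> powr p)"
        by (simp add: powr_mult)
    qed
  qed measurable
  then show ?thesis by (simp add: Lp_space_def)
qed

lemma Lp_space_zero: "(\<lambda>_. 0) \<in> Lp_space p"
  by (simp add: Lp_space_def)

lemma Lp_space_AE_cong:
  assumes "f \<in> Lp_space p" "AE x in lebesgue. f x = g x" "g \<in> borel_measurable lebesgue"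
  shows "g \<in> Lp_space p"
proof -
  have [measurable]: "f \<in> borel_measurable lebesgue" and i: "integrable lebesgue (\<lambda>x. \<bar>f x\<bar> powr p)"
    using assms by (auto simp: Lp_space_def)
  note [measurable] = assms(3)
  have "integrable lebesgue (\<lambda>x. \<bar>g x\<bar> powr p)"
    using assms(2) by (intro integrable_cong_AE_imp[OF i]) (auto elim: eventually_mono)
  then show ?thesis using assms(3) by (simp add: Lp_space_def)
qed

lemma Lp_space_locally_integrable:
  assumes "f \<in> Lp_space p" "p \<ge> 1"
  shows "locally_integrable f"
  unfolding locally_integrable_def set_integrable_def
proof (intro allI impI)
  fix K :: "'a set" assume K: "compact K"
  have [measurable]: "f \<in> borel_measurable lebesgue" and i: "integrable lebesgue (\<lambda>x. \<bar>f x\<bar> powr p)"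
    using assms by (auto simp: Lp_space_def)
  have [measurable]: "K \<in> sets lebesgue" using K by (simp add: compact_imp_closed)
  have "emeasure lebesgue K < \<infinity>"
    using K emeasure_bounded_finite[of K] by (simp add: compact_imp_bounded compact_imp_closed)
  then have iK: "integrable lebesgue (\<lambda>x. indicator K x :: real)" by (intro integrable_real_indicator) auto
  show "integrable lebesgue (\<lambda>x. indicator K x *\<^sub>R f x)"
  proof (rule Bochner_Integration.integrable_bound)
    show "integrable lebesgue (\<lambda>x. indicator K x + \<bar>f x\<bar> powr p)" using iK i by simp
    show "AE x in lebesgue. norm (indicator K x *\<^sub>R f x) \<le> norm (indicator K x + \<bar>f x\<bar> powr p)"
      using abs_le_one_plus_powr[OF assms(2)] by (intro AE_I2) (auto split: split_indicator)
  qed measurable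
qed

text \<open>The chosen derivative may differ from the one provided by the Sobolev space, but only on
  a null set, so it inherits integrability.\<close>

lemma weak_deriv_sobolev:
  assumes u: "u \<in> sobolev_space m p" and bs: "set bs \<subseteq> Basis" "length bs \<le> m"
  shows "has_weak_deriv bs u (weak_deriv bs u)" "weak_deriv bs u \<in> Lp_space p"
proof -
  obtain v where v: "v \<in> Lp_space p" "has_weak_deriv bs u v"
    using u bs by (auto simp: sobolev_space_def)
  show w: "has_weak_deriv bs u (weak_deriv bs u)"
    unfolding weak_deriv_def by (rule someI[of "has_weak_deriv bs u", OF v(2)])
  have "AE x in lebesgue. v x = weak_deriv bs u x" by (rule weak_deriv_unique[OF v(2) w])
  moreover have "weak_deriv bs u \<in> borel_measurable lebesgue"
    using w by (auto simp: has_weak_deriv_def intro: locally_integrable_measurable)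
  ultimately show "weak_deriv bs u \<in> Lp_space p" by (rule Lp_space_AE_cong[OF v(1)])
qed

text \<open>Tests v with \<open>iter_partial bs \<psi>\<close>. In cs @ bs the directions bs act
  first on \<psi>, so derivatives never have to be interchanged.\<close>

lemma has_weak_deriv_compose:
  assumes "has_weak_deriv cs u v" "has_weak_deriv (cs @ bs) u w" "set bs \<subseteq> Basis"
  shows "has_weak_deriv bs v w"
  unfolding has_weak_deriv_def
proof (intro conjI ballI)
  show "locally_integrable v" "locally_integrable w" using assms by (auto simp: has_weak_deriv_def)
  fix \<psi> :: "'a \<Rightarrow> real" assume \<psi>: "\<psi> \<in> test_functions"
  have it: "iter_partial bs \<psi> \<in> test_functions" by (rule test_functions_iter_partial[OF \<psi> assms(3)])
  have 1: "(\<integral>x. u x * iter_partial cs (iter_partial bs \<psi>) x \<partial>lebesgue) = (-1) ^ length cs * (\<integral>x. v x * iter_partial bs \<psi> x \<partial>lebesgue)"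
    using assms(1) it by (auto simp: has_weak_deriv_def)
  have 2: "(\<integral>x. u x * iter_partial cs (iter_partial bs \<psi>) x \<partial>lebesgue) = (-1) ^ (length cs + length bs) * (\<integral>x. w x * \<psi> x \<partial>lebesgue)"
    using assms(2) \<psi> by (auto simp: has_weak_deriv_def iter_partial_append)
  have "(-1) ^ length cs * (\<integral>x. v x * iter_partial bs \<psi> x \<partial>lebesgue) = (-1) ^ length cs * ((-1) ^ length bs * (\<integral>x. w x * \<psi> x \<partial>lebesgue))"
    using 1 2 by (simp add: power_add mult.assoc)
  then show "(\<integral>x. v x * iter_partial bs \<psi> x \<partial>lebesgue) = (-1) ^ length bs * (\<integral>x. w x * \<psi> x \<partial>lebesgue)"
    by simp
qed

lemma sobolev_space_mono: "u \<in> sobolev_space m p \<Longrightarrow> k \<le> m \<Longrightarrow> u \<in> sobolev_space k p"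
  by (auto simp: sobolev_space_def)

lemma sobolev_space_lincomb:
  assumes "u \<in> sobolev_space m p" "w \<in> sobolev_space m p" "p \<ge> 1"
  shows "(\<lambda>x. s * u x + t * w x) \<in> sobolev_space m p"
  unfolding sobolev_space_def
proof (intro CollectI conjI allI impI)
  show "(\<lambda>x. s * u x + t * w x) \<in> Lp_space p"
    using assms by (intro Lp_space_lincomb) (auto simp: sobolev_space_def)
  fix bs :: "'a list" assume bs: "set bs \<subseteq> Basis \<and> length bs \<le> m"
  then obtain v v' where "v \<in> Lp_space p" "has_weak_deriv bs u v" "v' \<in> Lp_space p" "has_weak_deriv bs w v'"
    using assms by (auto simp: sobolev_space_def) blast
  then show "\<exists>v\<in>Lp_space p. has_weak_deriv bs (\<lambda>x. s * u x + t * w x) v"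
    using bs assms(3) by (intro bexI[of _ "\<lambda>x. s * v x + t * v' x"] has_weak_deriv_lincomb Lp_space_lincomb) auto
qed

lemma sobolev_space_zero: "p \<ge> 1 \<Longrightarrow> (\<lambda>_. 0) \<in> sobolev_space m p"
  unfolding sobolev_space_def has_weak_deriv_def
  by (auto intro!: bexI[of _ "\<lambda>_. 0"] simp: Lp_space_zero Lp_space_locally_integrable)

lemma sobolev_space_sum:
  assumes "p \<ge> 1" "finite I" "\<And>i. i \<in> I \<Longrightarrow> w i \<in> sobolev_space m p"
  shows "(\<lambda>x. \<Sum>i\<in>I. w i x) \<in> sobolev_space m p"
  using assms(2,3)
proof (induction I rule: finite_induct)
  case (insert i I)
  have "(\<lambda>x. 1 * w i x + 1 * (\<Sum>i\<in>I. w i x)) \<in> sobolev_space m p"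
    using insert assms(1) by (intro sobolev_space_lincomb) auto
  then show ?case using insert by simp
qed (simp add: sobolev_space_zero assms)

lemma weak_deriv_in_sobolev:
  assumes u: "u \<in> sobolev_space m p" and cs: "set cs \<subseteq> Basis" "length cs + k \<le> m"
  shows "weak_deriv cs u \<in> sobolev_space k p"
  unfolding sobolev_space_def
proof (intro CollectI conjI allI impI)
  show "weak_deriv cs u \<in> Lp_space p" using weak_deriv_sobolev(2)[OF u] cs by simp
  fix bs :: "'a list" assume bs: "set bs \<subseteq> Basis \<and> length bs \<le> k"
  have "has_weak_deriv bs (weak_deriv cs u) (weak_deriv (cs @ bs) u)"
    by (rule has_weak_deriv_compose[of cs u]) (use weak_deriv_sobolev(1)[OF u] cs bs in auto)
  moreover have "weak_deriv (cs @ bs) u \<in> Lp_space p"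
    by (rule weak_deriv_sobolev(2)[OF u]) (use cs bs in auto)
  ultimately show "\<exists>v\<in>Lp_space p. has_weak_deriv bs (weak_deriv cs u) v" by blast
qed

text \<open>One application consumes two orders of differentiability, so m / 2 applications are
  covered by the Sobolev space of order m.\<close>

lemma neg_laplacian_sobolev:
  assumes u: "u \<in> sobolev_space (k + 2) p" and p: "p \<ge> 1"
  shows "neg_laplacian_plus_id u \<in> sobolev_space k p"
proof -
  have "(\<lambda>x. \<Sum>b\<in>Basis. weak_deriv [b, b] u x) \<in> sobolev_space k p"
    using p by (intro sobolev_space_sum weak_deriv_in_sobolev[OF u]) auto
  then have "(\<lambda>x. (-1) * (\<Sum>b\<in>Basis. weak_deriv [b, b] u x) + 1 * u x) \<in> sobolev_space k p"
    using sobolev_space_mono[OF u, of k] p by (intro sobolev_space_lincomb) auto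
  then show ?thesis by (simp add: neg_laplacian_plus_id_def[abs_def] weak_laplacian_def)
qed

lemma Lp_space_rep:
  assumes "f \<in> Lp_space p"
  obtains f' where "f' \<in> borel_measurable borel" "AE x in lborel. f x = f' x"
    "integrable lborel (\<lambda>x. \<bar>f' x\<bar> powr p)" "(\<integral>x. \<bar>f x\<bar> powr p \<partial>lebesgue) = (\<integral>x. \<bar>f' x\<bar> powr p \<partial>lborel)"
proof -
  have f [measurable]: "f \<in> borel_measurable lebesgue" and i: "integrable lebesgue (\<lambda>x. \<bar>f x\<bar> powr p)"
    using assms by (auto simp: Lp_space_def)
  obtain f' where f' [measurable]: "f' \<in> borel_measurable borel" and ae: "AE x in lborel. f x = f' x"
    by (rule lebesgue_borel_rep[OF f])
  have ae': "AE x in lborel. \<bar>f x\<bar> powr p = \<bar>f' x\<bar> powr p" using ae by eventually_elim simp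
  show thesis
    using integral_lebesgue_lborel[OF _ _ ae'] i by (intro that[OF f' ae]) auto
qed

text \<open>Borel representatives of the iterates and of their second weak derivatives are fed into
  \<open>bessel_representation\<close>; absolute values then give an inequality with a nonnegative
  density.\<close>

lemma admissible_representation:
  fixes u :: "real ^ 'n \<Rightarrow> real"
  assumes u: "u \<in> admissible m" and m: "m = 2 * Suc j" "m < CARD('n)"
  defines "p \<equiv> real CARD('n) / real m"
  obtains f u' where "f \<in> borel_measurable borel" "\<And>y. f y \<ge> 0" "(\<integral>\<^sup>+y. ennreal (f y powr p) \<partial>lborel) \<le> 1"
    "u' \<in> borel_measurable borel" "\<And>x. u' x \<ge> 0" "AE x in lborel. \<bar>u x\<bar> = u' x"
    "AE x in lborel. ennreal (u' x) \<le> (\<integral>\<^sup>+y. ennreal (bessel j (x - y) * f y) \<partial>lborel)"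
proof -
  have p: "p \<ge> 1" using m by (simp add: p_def)
  define G where "G i = (neg_laplacian_plus_id ^^ i) u" for i
  have us: "u \<in> sobolev_space m p" and norm: "Lp_norm p (G (Suc j)) \<le> 1"
    using u m(1) by (auto simp: admissible_def p_def G_def)
  have G: "G i \<in> sobolev_space (2 * (Suc j - i)) p" if "i \<le> Suc j" for i
    using that
  proof (induction i)
    case 0
    then show ?case using us m(1) by (simp add: G_def)
  next
    case (Suc i)
    have "2 * (Suc j - i) = 2 * (Suc j - Suc i) + 2" using Suc.prems by simp
    then have "G i \<in> sobolev_space (2 * (Suc j - Suc i) + 2) p" using Suc by simp
    from neg_laplacian_sobolev[OF this p] show ?case by (simp add: G_def)
  qed
  have GL: "G i \<in> Lp_space p" if "i \<le> Suc j" for i using G[OF that] by (simp add: sobolev_space_def)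
  define W where "W i b = weak_deriv [b, b] (G i)" for i b
  have W: "has_weak_deriv [b, b] (G i) (W i b)" "W i b \<in> Lp_space p" if "i < Suc j" "b \<in> Basis" for i b
    unfolding W_def using that by (auto intro!: weak_deriv_sobolev[OF G[of i]])
  define R where "R F f \<longleftrightarrow> f \<in> borel_measurable borel \<and> (AE x in lborel. F x = f x) \<and>
    integrable lborel (\<lambda>x. \<bar>f x\<bar> powr p) \<and> (\<integral>x. \<bar>F x\<bar> powr p \<partial>lebesgue) = (\<integral>x. \<bar>f x\<bar> powr p \<partial>lborel)"
    for F f :: "real ^ 'n \<Rightarrow> real"
  \<comment> \<open>A choice function, because representatives are wanted for two families of
    functions at once.\<close>
  define rp where "rp F = (SOME f. R F f)" for F
  have rp: "R F (rp F)" if F: "F \<in> Lp_space p" for F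
  proof -
    have "\<exists>f. R F f" by (rule Lp_space_rep[OF F]) (unfold R_def, blast)
    then show ?thesis unfolding rp_def by (rule someI_ex)
  qed
  define g where "g i = rp (G i)" for i
  define v where "v i b = rp (W i b)" for i b
  have g: "g i \<in> borel_measurable borel" "AE x in lborel. G i x = g i x" "integrable lborel (\<lambda>x. \<bar>g i x\<bar> powr p)"
    "(\<integral>x. \<bar>G i x\<bar> powr p \<partial>lebesgue) = (\<integral>x. \<bar>g i x\<bar> powr p \<partial>lborel)" if "i \<le> Suc j" for i
    using rp[OF GL[OF that]] by (simp_all only: R_def g_def)
  have v: "v i b \<in> borel_measurable borel" "AE x in lborel. W i b x = v i b x" "integrable lborel (\<lambda>x. \<bar>v i b x\<bar> powr p)"
    if "i < Suc j" "b \<in> Basis" for i b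
    using rp[OF W(2)[OF that]] by (simp_all only: R_def v_def)
  have weak: "(\<integral>x. g i x * iter_partial [b, b] \<psi> x \<partial>lborel) = (\<integral>x. v i b x * \<psi> x \<partial>lborel)"
    if "i < Suc j" "b \<in> Basis" "\<psi> \<in> test_functions" for i b \<psi>
  proof -
    have it: "iter_partial [b, b] \<psi> \<in> test_functions" using that by (intro test_functions_iter_partial) auto
    have lb: "(\<integral>x. F x * \<eta> x \<partial>lebesgue) = (\<integral>x. F' x * \<eta> x \<partial>lborel)"
      if "F \<in> Lp_space p" "F' \<in> borel_measurable borel" "AE x in lborel. F x = F' x" "\<eta> \<in> test_functions" for F F' \<eta> :: "real ^ 'n \<Rightarrow> real"
    proof (rule integral_lebesgue_lborel(1))
      note [measurable] = test_function_borel[OF that(4)] that(2)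
      have [measurable]: "\<eta> \<in> borel_measurable lebesgue" by (rule measurable_completion) simp
      have [measurable]: "F \<in> borel_measurable lebesgue" using that(1) by (simp add: Lp_space_def)
      show "(\<lambda>x. F x * \<eta> x) \<in> borel_measurable lebesgue" by measurable
      show "(\<lambda>x. F' x * \<eta> x) \<in> borel_measurable borel" by measurable
      show "AE x in lborel. F x * \<eta> x = F' x * \<eta> x" using that(3) by eventually_elim simp
    qed
    have "(\<integral>x. G i x * iter_partial [b, b] \<psi> x \<partial>lebesgue) = (-1) ^ length [b, b] * (\<integral>x. W i b x * \<psi> x \<partial>lebesgue)"
      by (rule W(1)[OF that(1,2), unfolded has_weak_deriv_def, THEN conjunct2, THEN conjunct2, rule_format, OF that(3)])
    moreover have "(\<integral>x. G i x * iter_partial [b, b] \<psi> x \<partial>lebesgue) = (\<integral>x. g i x * iter_partial [b, b] \<psi> x \<partial>lborel)"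
      using that by (intro lb GL g it) auto
    moreover have "(\<integral>x. W i b x * \<psi> x \<partial>lebesgue) = (\<integral>x. v i b x * \<psi> x \<partial>lborel)"
      using that by (intro lb W v) auto
    ultimately show ?thesis by (simp del: iter_partial.simps)
  qed
  have step: "AE x in lborel. g (Suc i) x = g i x - (\<Sum>b\<in>Basis. v i b x)" if "i < Suc j" for i
  proof -
    have "AE x in lborel. \<forall>b\<in>Basis. W i b x = v i b x"
      using v(2)[OF that] by (intro AE_finite_allI) auto
    moreover have "AE x in lborel. G i x = g i x" "AE x in lborel. G (Suc i) x = g (Suc i) x"
      using g(2) that by auto
    ultimately show ?thesis
    proof eventually_elim
      case (elim x)
      have "G (Suc i) x = - (\<Sum>b\<in>Basis. W i b x) + G i x"
        by (simp add: G_def neg_laplacian_plus_id_def weak_laplacian_def W_def)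
      moreover have "(\<Sum>b\<in>Basis. W i b x) = (\<Sum>b\<in>Basis. v i b x)"
        by (rule sum.cong) (use elim in auto)
      ultimately show ?case using elim by simp
    qed
  qed
  have rep: "AE y in lborel. g 0 y = (\<integral>x. bessel j (y - x) * g (Suc j) x \<partial>lborel)"
    by (rule bessel_representation[where v = v, OF p _ g(1) g(3) v(1) v(3) weak step]) (use m in auto)
  show thesis
  proof (rule that[of "\<lambda>y. \<bar>g (Suc j) y\<bar>" "\<lambda>x. \<bar>g 0 x\<bar>"])
    have [measurable]: "g 0 \<in> borel_measurable borel" "g (Suc j) \<in> borel_measurable borel" using g(1) by auto
    show "(\<lambda>y. \<bar>g (Suc j) y\<bar>) \<in> borel_measurable borel" "(\<lambda>y. \<bar>g 0 y\<bar>) \<in> borel_measurable borel" by measurable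
    have "(\<integral>x. \<bar>g (Suc j) x\<bar> powr p \<partial>lborel) powr (1 / p) \<le> 1"
      using norm g(4)[of "Suc j"] by (simp add: Lp_norm_def)
    moreover have "1 < (\<integral>x. \<bar>g (Suc j) x\<bar> powr p \<partial>lborel) powr (1 / p)" if "1 < (\<integral>x. \<bar>g (Suc j) x\<bar> powr p \<partial>lborel)"
      using that p by (intro gr_one_powr) auto
    ultimately have "(\<integral>x. \<bar>g (Suc j) x\<bar> powr p \<partial>lborel) \<le> 1" by fastforce
    then show "(\<integral>\<^sup>+y. ennreal (\<bar>g (Suc j) y\<bar> powr p) \<partial>lborel) \<le> 1"
      using g(3)[of "Suc j"] by (subst nn_integral_eq_integral) auto
    show "AE x in lborel. \<bar>u x\<bar> = \<bar>g 0 x\<bar>" using g(2)[of 0] by (auto simp: G_def elim: eventually_mono)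
    show "AE x in lborel. ennreal \<bar>g 0 x\<bar> \<le> (\<integral>\<^sup>+y. ennreal (bessel j (x - y) * \<bar>g (Suc j) y\<bar>) \<partial>lborel)"
      using rep
    proof eventually_elim
      case (elim y)
      show ?case
      \<comment> \<open>If the product is not integrable, its Bochner integral is 0 by convention,
        hence so is \<open>g 0 y\<close>, and the inequality is trivial.\<close>
      proof (cases "integrable lborel (\<lambda>x. bessel j (y - x) * g (Suc j) x)")
        case True
        from integral_norm_bound_ennreal[OF this] show ?thesis
          using elim by (simp add: abs_mult bessel_nonneg)
      next
        case False
        then show ?thesis using elim by (simp add: not_integrable_integral_eq)
      qed
    qed
  qed auto
qed

section \<open>Boundedness up to the critical exponent\<close>

lemma sphere_area_eq: "0 < n \<Longrightarrow> sphere_area n = real n * unit_ball_vol (real n)"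
proof -
  assume n: "0 < n"
  have "Gamma (real n / 2 + 1) = real n / 2 * Gamma (real n / 2)"
    using n by (intro Gamma_plus1) (auto elim!: nonpos_Ints_cases)
  then show ?thesis unfolding sphere_area_def unit_ball_vol_def
    using n by (simp only:) (simp add: field_simps)
qed

lemma riesz_const_pos: "0 < m \<Longrightarrow> m < n \<Longrightarrow> riesz_const n m > 0"
  unfolding riesz_const_def by (intro divide_pos_pos mult_pos_pos Gamma_real_pos) auto

text \<open>The area of the unit sphere is n times the volume of the unit ball, which cancels the n
  in \<open>beta0\<close>. This identifies it with the constant \<open>b0\<close> of the potential
  estimate.\<close>

lemma beta0_eq:
  assumes "0 < m" "m < n"
  shows "beta0 n m = 1 / (unit_ball_vol (real n) * riesz_const n m powr (real n / (real n - real m)))"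
proof -
  have r: "riesz_const n m > 0" by (rule riesz_const_pos[OF assms])
  have "pi powr (real n / 2) * 2 ^ m * Gamma (real m / 2) / Gamma ((real n - real m) / 2) = inverse (riesz_const n m)"
    by (simp add: riesz_const_def)
  then have "beta0 n m = real n / sphere_area n * inverse (riesz_const n m) powr (real n / (real n - real m))"
    by (simp add: beta0_def)
  then show ?thesis using assms r by (simp add: sphere_area_eq inverse_powr divide_inverse)
qed

lemma j_idx_ge:
  assumes "0 < m" "m < n"
  shows "real (j_idx n m) \<ge> real n / real m" "j_idx n m \<ge> 2"
proof -
  have "\<exists>j. real j \<ge> real n / real m" by (rule real_arch_simple)
  then show 1: "real (j_idx n m) \<ge> real n / real m" unfolding j_idx_def by (rule LeastI_ex)
  have "real n / real m > 1" using assms by simp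
  then show "j_idx n m \<ge> 2" using 1 by linarith
qed

lemma trunc_exp_eq:
  assumes "0 < m" "m < n"
  shows "trunc_exp n m t = exp t - (\<Sum>i<j_idx n m - 1. t ^ i / fact i)"
proof -
  have "{0..j_idx n m - 2} = {..<j_idx n m - 1}" using j_idx_ge(2)[OF assms] by auto
  then show ?thesis by (simp add: trunc_exp_def)
qed

lemma trunc_exp_le_exp: "0 \<le> t \<Longrightarrow> trunc_exp n m t \<le> exp t"
  unfolding trunc_exp_def by (simp add: sum_nonneg)

text \<open>The first power left by the truncation is J = j_idx n m - 1, at least n / m - 1. For t
  proportional to |u| powr (n / (n - m)) the bound is a multiple of |u| powr (n / m), the power that
  is integrable.\<close>

lemma trunc_exp_le_powr:
  assumes mn: "0 < m" "m < n" and B: "0 \<le> B"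
  shows "\<exists>D\<ge>0. \<forall>t. 0 \<le> t \<and> t \<le> B \<longrightarrow> trunc_exp n m t \<le> D * t powr (real n / real m - 1)"
proof -
  define J where "J = j_idx n m - 1"
  have J: "real J \<ge> real n / real m - 1" "J \<ge> 1"
    using j_idx_ge[OF mn] by (auto simp: J_def of_nat_diff)
  have te: "trunc_exp n m t = exp t - (\<Sum>i<J. t ^ i / fact i)" for t
    unfolding J_def by (rule trunc_exp_eq[OF mn])
  define a where "a = real n / real m - 1"
  have a: "a > 0" using mn by (simp add: a_def)
  define D where "D = exp B / fact J * max 1 B powr (real J - a)"
  have "trunc_exp n m t \<le> D * t powr a" if t: "0 \<le> t" "t \<le> B" for t
  proof (cases "t = 0")
    case True
    \<comment> \<open>At t = 0 the term i = 0 is 0 ^ 0 = 1 and cancels exp 0; it is present because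
      J >= 1.\<close>
    have "{..<J} = insert 0 {1..<J}" using J by auto
    then have "(\<Sum>i<J. (0::real) ^ i / fact i) = 1"
      by (simp add: sum.neutral)
    then show ?thesis using True a by (simp add: te)
  next
    case False
    then have t0: "t > 0" using t by simp
    obtain s where s: "\<bar>s\<bar> \<le> \<bar>t\<bar>" "exp t = (\<Sum>i<J. t ^ i / fact i) + exp s / fact J * t ^ J"
      using Maclaurin_exp_le[of t J] by auto
    have "trunc_exp n m t = exp s / fact J * t ^ J"
      by (simp add: te s(2))
    also have "\<dots> \<le> exp B / fact J * t ^ J"
      using s(1) t by (intro mult_right_mono divide_right_mono) auto
    also have "t ^ J = t powr (real J - a) * t powr a"
      using t0 by (simp flip: powr_add powr_realpow)
    also have "exp B / fact J * (t powr (real J - a) * t powr a) \<le> exp B / fact J * (max 1 B powr (real J - a) * t powr a)"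
      using t J a_def by (intro mult_left_mono mult_right_mono powr_mono2) auto
    finally show ?thesis by (simp add: D_def mult_ac)
  qed
  moreover have "D \<ge> 0" by (simp add: D_def)
  ultimately show ?thesis unfolding a_def by blast
qed

lemma trunc_exp_ge_half:
  "\<exists>t0\<ge>0. \<forall>t\<ge>t0. trunc_exp n m t \<ge> exp t / 2"
proof -
  have "((\<lambda>t::real. \<Sum>i = 0..j_idx n m - 2. (1 / fact i) * (t ^ i / exp t)) \<longlongrightarrow> (\<Sum>i = 0..j_idx n m - 2. (1 / fact i) * 0)) at_top"
    by (intro tendsto_sum tendsto_mult_left tendsto_power_div_exp_0)
  then have "eventually (\<lambda>t::real. (\<Sum>i = 0..j_idx n m - 2. (1 / fact i) * (t ^ i / exp t)) < 1/2) at_top"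
    by (intro order_tendstoD(2)) auto
  then obtain t0 where t0: "\<And>t::real. t \<ge> t0 \<Longrightarrow> (\<Sum>i = 0..j_idx n m - 2. (1 / fact i) * (t ^ i / exp t)) < 1/2"
    by (auto simp: eventually_at_top_linorder)
  have "trunc_exp n m t \<ge> exp t / 2" if "t \<ge> max t0 0" for t
  proof -
    have "(\<Sum>i = 0..j_idx n m - 2. t ^ i / fact i) = exp t * (\<Sum>i = 0..j_idx n m - 2. (1 / fact i) * (t ^ i / exp t))"
      by (simp add: sum_distrib_left)
    also have "\<dots> \<le> exp t * (1/2)" using t0[of t] that by (intro mult_left_mono) auto
    finally show ?thesis by (simp add: trunc_exp_def)
  qed
  then show ?thesis by (intro exI[of _ "max t0 0"]) auto
qed

lemma adams_integral_upper:
  fixes \<alpha> \<beta> :: real and m :: nat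
  assumes "0 \<le> \<alpha>" "\<alpha> < real CARD('n::finite)" "0 < m" "even m" "m < CARD('n)"
    and \<beta>: "0 \<le> \<beta>" "\<beta> \<le> beta_sing \<alpha> CARD('n) m"
  shows "(SUP u \<in> (admissible m :: (real ^ 'n \<Rightarrow> real) set). adams_integral \<alpha> m \<beta> u) < \<infinity>"
proof -
  let ?n = "CARD('n)"
  obtain k where k: "m = 2 * k" using assms(4) by auto
  with assms(3) obtain j where m: "m = 2 * Suc j" by (cases k) auto
  have jn: "2 * Suc j < DIM(real ^ 'n)" using assms(5) m by simp
  interpret rd: riesz_dominated "bessel j :: real ^ 'n \<Rightarrow> real" "real m" "real ?n" "riesz_const ?n m"
  proof
    show "bessel j \<in> borel_measurable (borel :: (real ^ 'n) measure)" by measurable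
    show "0 \<le> bessel j z" for z :: "real ^ 'n" by (rule bessel_nonneg)
    show "real ?n = real DIM(real ^ 'n)" by simp
    show "bessel j z \<le> riesz_const ?n m * norm z powr (real m - real ?n)" if "z \<noteq> 0" for z :: "real ^ 'n"
      using bessel_integral_le(3)[OF that jn] m by simp
    show "(\<integral>\<^sup>+z. ennreal (bessel j (z :: real ^ 'n)) \<partial>lborel) \<le> 1" using nn_integral_bessel[OF jn] by simp
    show "0 < riesz_const ?n m" using assms by (intro riesz_const_pos) auto
    show "0 < real m" "real m < real ?n" using assms by auto
  qed
  have b0: "rd.b0 = beta0 ?n m" using assms by (simp add: rd.b0_def rd.q_def beta0_eq)
  have pq: "rd.p / rd.q = real ?n / real m - 1"
    using assms by (simp add: rd.p_def rd.q_def field_simps)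
  obtain D where D: "D \<ge> 0" "\<And>t. 0 \<le> t \<Longrightarrow> t \<le> rd.b0 \<Longrightarrow> trunc_exp ?n m t \<le> D * t powr (rd.p / rd.q)"
    using trunc_exp_le_powr[OF assms(3,5), of rd.b0] rd.b0_pos unfolding pq by (auto simp: less_imp_le)
  obtain C where C: "\<And>f u :: real ^ 'n \<Rightarrow> real. f \<in> borel_measurable borel \<Longrightarrow> (\<And>y. f y \<ge> 0) \<Longrightarrow>
      (\<integral>\<^sup>+y. ennreal (f y powr rd.p) \<partial>lborel) \<le> 1 \<Longrightarrow> u \<in> borel_measurable borel \<Longrightarrow> (\<And>x. u x \<ge> 0) \<Longrightarrow>
      (AE x in lborel. ennreal (u x) \<le> (\<integral>\<^sup>+y. ennreal (bessel j (x - y) * f y) \<partial>lborel)) \<Longrightarrow>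
     (\<integral>\<^sup>+x. ennreal (trunc_exp ?n m (\<beta> * u x powr rd.q) / norm x powr \<alpha>) \<partial>lborel) \<le> ennreal C"
  proof (rule rd.singular_adams_potential[where \<phi> = "trunc_exp ?n m" and \<alpha> = \<alpha> and \<beta> = \<beta> and D = D])
    show "\<beta> \<le> (1 - \<alpha> / real ?n) * rd.b0" using \<beta>(2) by (simp add: beta_sing_def b0)
    show "0 \<le> \<alpha>" "\<alpha> < real ?n" "0 \<le> \<beta>" "D \<ge> 0" using assms(1,2) \<beta>(1) D(1) by auto
    show "trunc_exp ?n m t \<le> exp t" if "t \<ge> 0" for t by (rule trunc_exp_le_exp[OF that])
    show "trunc_exp ?n m t \<le> D * t powr (rd.p / rd.q)" if "0 \<le> t" "t \<le> rd.b0" for t by (rule D(2)[OF that])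
  qed blast
  have "adams_integral \<alpha> m \<beta> u \<le> ennreal C" if u: "u \<in> admissible m" for u :: "real ^ 'n \<Rightarrow> real"
  proof -
    obtain f u' :: "real ^ 'n \<Rightarrow> real" where fu: "f \<in> borel_measurable borel" "\<And>y. f y \<ge> 0" "(\<integral>\<^sup>+y. ennreal (f y powr (real ?n / real m)) \<partial>lborel) \<le> 1"
      "u' \<in> borel_measurable borel" "\<And>x. u' x \<ge> 0" "AE x in lborel. \<bar>u x\<bar> = u' x"
      "AE x in lborel. ennreal (u' x) \<le> (\<integral>\<^sup>+y. ennreal (bessel j (x - y) * f y) \<partial>lborel)"
      by (rule admissible_representation[OF u m assms(5)]) blast
    note [measurable] = fu(4)
    let ?h = "\<lambda>x. ennreal (trunc_exp ?n m (\<beta> * u' x powr rd.q) / norm x powr \<alpha>)"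
    have "adams_integral \<alpha> m \<beta> u = (\<integral>\<^sup>+x. ?h x \<partial>lebesgue)"
      unfolding adams_integral_def
      using AE_completion[OF fu(6)] by (intro nn_integral_cong_AE) (auto elim!: eventually_mono simp: rd.q_def)
    also have "\<dots> = (\<integral>\<^sup>+x. ?h x \<partial>lborel)"
      by (rule nn_integral_completion)
    also have "\<dots> \<le> ennreal C"
      by (rule C[OF fu(1,2) _ fu(4,5,7)]) (use fu(3) in \<open>simp add: rd.p_def\<close>)
    finally show ?thesis .
  qed
  then have "(SUP u \<in> (admissible m :: (real ^ 'n \<Rightarrow> real) set). adams_integral \<alpha> m \<beta> u) \<le> ennreal C"
    by (rule SUP_least)
  then show ?thesis by (rule order_le_less_trans) simp
qed

section \<open>Unboundedness beyond the critical exponent\<close>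

text \<open>After the substitution \<open>s = \<epsilon> + (norm z)\<^sup>2 * \<tau>\<close> the integrand of \<open>besseleps\<close> is bounded below by
  one that depends only on an upper bound \<open>a\<close> for \<open>(norm z)\<^sup>2\<close> and \<open>\<epsilon> / (norm z)\<^sup>2\<close>.\<close>

lemma besseleps_lower:
  assumes j: "2 * Suc j < DIM('a::euclidean_space)" and \<eta>: "\<eta> > 0"
  obtains a where "a > 0"
    "\<And>z \<epsilon>. (z::'a) \<noteq> 0 \<Longrightarrow> \<epsilon> > 0 \<Longrightarrow> (norm z)\<^sup>2 \<le> a \<Longrightarrow> \<epsilon> \<le> a * (norm z)\<^sup>2 \<Longrightarrow>
      (1 - \<eta>) * (riesz_const DIM('a) (2 * Suc j) * norm z powr (real (2 * Suc j) - real DIM('a))) \<le> besseleps \<epsilon> j z"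
proof -
  let ?n = "real DIM('a)" and ?\<gamma> = "riesz_const DIM('a) (2 * Suc j)"
  have \<gamma>: "?\<gamma> > 0" using j by (intro riesz_const_pos) auto
  \<comment> \<open>The rescaled integrand in \<tau>. For a = 0 it is the Riesz integrand at a unit
    vector, with integral the Riesz constant; by dominated convergence a small a loses at most the
    factor 1 - \<eta>.\<close>
  define P where "P a s = indicator {0<..} s * (s ^ j * exp (- a * s) / fact j * ((4 * pi * (s + a)) powr (- ?n / 2) * exp (- 1 / (4 * s))))" for a s
  have P0: "P a s \<ge> 0" for a s by (simp add: P_def split: split_indicator)
  have Pm [measurable]: "P a \<in> borel_measurable borel" for a unfolding P_def[abs_def] by measurable
  obtain e :: 'a where e: "norm e = 1" using vector_choose_size[of 1] by auto
  have P00: "P 0 s = indicator {0<..} s * (s ^ j / fact j * heat s e)" for s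
    by (auto simp: P_def heat_eq e split: split_indicator)
  have nnP: "(\<integral>\<^sup>+s. ennreal (P 0 s) \<partial>lborel) = ennreal ?\<gamma>"
    unfolding P00 using riesz_kernel[of e j] e j norm_zero[where 'a = 'a] by fastforce
  have iP: "integrable lborel (P 0)"
    using nnP by (intro integrableI_nonneg) (auto simp: P0)
  have IP: "(\<integral>s. P 0 s \<partial>lborel) = ?\<gamma>"
    using nnP \<gamma> by (subst integral_eq_nn_integral) (auto simp: P0)
  have Ple: "P a s \<le> P 0 s" if "a \<ge> 0" for a s
  proof (cases "s > 0")
    case True
    have "s ^ j * exp (- a * s) / fact j \<le> s ^ j * exp (- 0 * s) / fact j"
      using True that by (intro divide_right_mono mult_left_mono) auto
    moreover have "(4 * pi * (s + a)) powr (- ?n / 2) \<le> (4 * pi * (s + 0)) powr (- ?n / 2)"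
      using True that by (intro powr_mono2') auto
    ultimately show ?thesis unfolding P_def using True that
      by (intro mult_left_mono mult_mono mult_right_mono) auto
  qed (simp add: P_def)
  have iPa: "integrable lborel (P a)" if "a \<ge> 0" for a
    by (rule Bochner_Integration.integrable_bound[OF iP]) (use Ple[OF that] P0 in auto)
  have "(\<lambda>i. \<integral>s. P (1 / (real i + 1)) s \<partial>lborel) \<longlonglongrightarrow> (\<integral>s. P 0 s \<partial>lborel)"
  proof (rule integral_dominated_convergence[OF _ _ iP])
    have elim: "(\<lambda>i. 1 / (real i + 1)) \<longlonglongrightarrow> 0" using LIMSEQ_inverse_real_of_nat by (simp add: inverse_eq_divide add.commute)
    show "AE s in lborel. (\<lambda>i. P (1 / (real i + 1)) s) \<longlonglongrightarrow> P 0 s"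
    proof (rule AE_I2)
      fix s :: real
      show "(\<lambda>i. P (1 / (real i + 1)) s) \<longlonglongrightarrow> P 0 s"
      proof (cases "s > 0")
        case True
        have "(\<lambda>i. 4 * pi * (s + 1 / (real i + 1))) \<longlonglongrightarrow> 4 * pi * (s + 0)"
          by (intro tendsto_mult_left tendsto_add tendsto_const elim)
        then have p: "(\<lambda>i. (4 * pi * (s + 1 / (real i + 1))) powr (- ?n / 2)) \<longlonglongrightarrow> (4 * pi * (s + 0)) powr (- ?n / 2)"
          using True by (intro tendsto_powr tendsto_const) auto
        have "(\<lambda>i. exp (- (1 / (real i + 1)) * s)) \<longlonglongrightarrow> exp (- 0 * s)"
          by (intro tendsto_exp tendsto_mult_right tendsto_minus elim)
        then show ?thesis unfolding P_def using p
          by (intro tendsto_mult tendsto_divide tendsto_const) auto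
      qed (simp add: P_def)
    qed
    show "AE s in lborel. norm (P (1 / (real i + 1)) s) \<le> P 0 s" for i
      using Ple[of "1 / (real i + 1)"] P0 by (auto intro!: AE_I2)
  qed measurable
  then have "eventually (\<lambda>i. (1 - \<eta>) * ?\<gamma> < (\<integral>s. P (1 / (real i + 1)) s \<partial>lborel)) sequentially"
    unfolding IP by (rule order_tendstoD(1)) (use \<gamma> \<eta> in \<open>simp add: left_diff_distrib\<close>)
  then obtain i where i: "(1 - \<eta>) * ?\<gamma> < (\<integral>s. P (1 / (real i + 1)) s \<partial>lborel)"
    using eventually_happens'[OF sequentially_bot] by blast
  define a where "a = 1 / (real i + 1)"
  have a: "a > 0" by (simp add: a_def)
  show thesis
  proof (rule that[OF a])
    fix z :: 'a and \<epsilon> :: real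
    assume z: "z \<noteq> 0" and \<epsilon>: "\<epsilon> > 0" and za: "(norm z)\<^sup>2 \<le> a" and ea: "\<epsilon> \<le> a * (norm z)\<^sup>2"
    define R where "R = (norm z)\<^sup>2"
    have R: "R > 0" using z by (simp add: R_def)
    define Q where "Q s = indicator {\<epsilon>..} s * (gamma_weight j (s - \<epsilon>) * heat s z)" for s
    have iQ: "integrable lborel Q" unfolding Q_def[abs_def]
    proof (rule integrable_ladder_Suc)
      show "\<bar>heat s z\<bar> \<le> (4 * pi * \<epsilon>) powr (- ?n / 2)" if "s \<ge> \<epsilon>" for s
      proof -
        have "heat s z \<le> (4 * pi * s) powr (- ?n / 2)" using that \<epsilon> by (intro heat_le) auto
        also have "\<dots> \<le> (4 * pi * \<epsilon>) powr (- ?n / 2)" using that \<epsilon> by (intro powr_mono2') auto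
        finally show ?thesis using heat_pos[of s z] that \<epsilon> by simp
      qed
    qed measurable
    have "besseleps \<epsilon> j z = (\<integral>s. Q s \<partial>lborel)" by (simp add: besseleps_eq Q_def)
    also have "\<dots> = R * (\<integral>\<tau>. Q (\<epsilon> + R * \<tau>) \<partial>lborel)"
      using lborel_integral_real_affine[where c = R and t = \<epsilon> and f = Q] R by simp
    finally have be: "besseleps \<epsilon> j z = R * (\<integral>\<tau>. Q (\<epsilon> + R * \<tau>) \<partial>lborel)" .
    have iQ': "integrable lborel (\<lambda>\<tau>. Q (\<epsilon> + R * \<tau>))"
      using lborel_integrable_real_affine_iff[where c = R and t = \<epsilon> and f = Q] iQ R by simp
    \<comment> \<open>The weight loses at most exp (- a * \<tau>), as norm z ^ 2 <= a; the
      normalisation of the heat kernel loses the shift from \<tau> to \<tau> + a, as \<epsilon> <= a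
      * norm z ^ 2; its exponential only gains from the later time.\<close>
    have low: "R powr (real j - ?n / 2) * P a \<tau> \<le> Q (\<epsilon> + R * \<tau>)" for \<tau>
    proof (cases "\<tau> > 0")
      case True
      let ?s = "\<epsilon> + R * \<tau>"
      have s: "?s > 0" using True R \<epsilon> by (simp add: add_pos_pos)
      have s1: "?s \<le> R * (\<tau> + a)" using ea R by (simp add: R_def algebra_simps)
      have s2: "R * \<tau> \<le> ?s" using \<epsilon> by simp
      have g: "gamma_weight j (?s - \<epsilon>) \<ge> R ^ j * (\<tau> ^ j * exp (- a * \<tau>) / fact j)"
      proof -
        have "R * \<tau> \<le> a * \<tau>" using za True by (intro mult_right_mono) (auto simp: R_def)
        then have "(R * \<tau>) ^ j * exp (- (a * \<tau>)) / fact j \<le> (R * \<tau>) ^ j * exp (- (R * \<tau>)) / fact j"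
          using True R by (intro divide_right_mono mult_left_mono) auto
        then show ?thesis by (simp add: gamma_weight_def power_mult_distrib)
      qed
      have h1: "(4 * pi * ?s) powr (- ?n / 2) \<ge> R powr (- ?n / 2) * (4 * pi * (\<tau> + a)) powr (- ?n / 2)"
      proof -
        have "(4 * pi * ?s) powr (- ?n / 2) \<ge> (R * (4 * pi * (\<tau> + a))) powr (- ?n / 2)"
          using s s1 by (intro powr_mono2') (auto simp: mult.left_commute[of R])
        then show ?thesis using R a True by (simp add: powr_mult)
      qed
      have h2: "exp (- 1 / (4 * \<tau>)) \<le> exp (- (norm z)\<^sup>2 / (4 * ?s))"
      proof -
        have "R * \<tau> / (\<tau> * ?s) \<le> ?s / (\<tau> * ?s)" using s2 True s by (intro divide_right_mono) auto
        then have "R / ?s \<le> 1 / \<tau>" using True s by simp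
        then have "R / ?s / 4 \<le> 1 / \<tau> / 4" by (rule divide_right_mono) simp
        then show ?thesis by (simp add: R_def mult.commute)
      qed
      have "heat ?s z \<ge> (R powr (- ?n / 2) * (4 * pi * (\<tau> + a)) powr (- ?n / 2)) * exp (- 1 / (4 * \<tau>))"
        unfolding heat_eq[OF s] using h1 h2 by (intro mult_mono) auto
      then have "(R ^ j * (\<tau> ^ j * exp (- a * \<tau>) / fact j)) * ((R powr (- ?n / 2) * (4 * pi * (\<tau> + a)) powr (- ?n / 2)) * exp (- 1 / (4 * \<tau>)))
          \<le> gamma_weight j (?s - \<epsilon>) * heat ?s z"
        using g True R by (intro mult_mono gamma_weight_nonneg) auto
      moreover have "R ^ j * R powr (- ?n / 2) = R powr (real j - ?n / 2)"
      proof -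
        have "real j - ?n / 2 = real j + (- ?n / 2)" by simp
        then show ?thesis by (simp only: powr_add powr_realpow[OF R])
      qed
      moreover have "(A * X) * ((B * Y) * Z) = (A * B) * (X * (Y * Z))" for A B X Y Z :: real by simp
      ultimately have "R powr (real j - ?n / 2) * (\<tau> ^ j * exp (- a * \<tau>) / fact j * ((4 * pi * (\<tau> + a)) powr (- ?n / 2) * exp (- 1 / (4 * \<tau>))))
          \<le> gamma_weight j (?s - \<epsilon>) * heat ?s z"
        by (simp only:)
      then show ?thesis using True R by (simp add: P_def Q_def)
    next
      case False
      have "Q (\<epsilon> + R * \<tau>) \<ge> 0" unfolding Q_def by (rule shifted_weight_le(1)[OF \<epsilon>])
      then show ?thesis using False by (simp add: P_def)
    qed
    have "R powr (real j - ?n / 2) * (\<integral>\<tau>. P a \<tau> \<partial>lborel) \<le> (\<integral>\<tau>. Q (\<epsilon> + R * \<tau>) \<partial>lborel)"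
      using integral_mono[OF integrable_mult_right[OF iPa[of a], of "R powr (real j - ?n / 2)"] iQ' low] a by simp
    moreover have "(1 - \<eta>) * ?\<gamma> \<le> (\<integral>\<tau>. P a \<tau> \<partial>lborel)" using i by (simp add: a_def)
    ultimately have "R powr (real j - ?n / 2) * ((1 - \<eta>) * ?\<gamma>) \<le> (\<integral>\<tau>. Q (\<epsilon> + R * \<tau>) \<partial>lborel)"
      by (meson mult_left_mono order_trans powr_ge_zero)
    then have "R * (R powr (real j - ?n / 2) * ((1 - \<eta>) * ?\<gamma>)) \<le> besseleps \<epsilon> j z"
      unfolding be using R by (intro mult_left_mono) auto
    moreover have "R * R powr (real j - ?n / 2) = norm z powr (real (2 * Suc j) - ?n)"
    proof -
      have R2: "R = norm z powr 2" using z by (simp add: R_def powr_numeral)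
      have "R * R powr (real j - ?n / 2) = R powr (1 + (real j - ?n / 2))" using R by (simp only: powr_add) simp
      also have "\<dots> = norm z powr (real (2 * Suc j) - ?n)"
        unfolding R2 powr_powr by (rule arg_cong[where f = "(powr) (norm z)"]) (simp add: algebra_simps)
      finally show ?thesis .
    qed
    moreover have "R * (X * (A * B)) = A * (B * (R * X))" for X A B :: real by simp
    ultimately show "(1 - \<eta>) * (?\<gamma> * norm z powr (real (2 * Suc j) - ?n)) \<le> besseleps \<epsilon> j z"
      by (simp only:)
  qed
qed

section \<open>Heat mixtures as admissible functions\<close>

lemma borel_Lp_space:
  assumes [measurable]: "f \<in> borel_measurable borel" and "integrable lborel (\<lambda>x. \<bar>f x\<bar> powr p)"
  shows "f \<in> Lp_space p"
proof -
  have "integrable lebesgue (\<lambda>x. \<bar>f x\<bar> powr p)"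
    by (rule iffD2[OF integrable_completion]) (use assms in auto)
  then show ?thesis by (simp add: Lp_space_def borel_imp_lebesgue assms)
qed

context heat_mixture
begin

lemma mix_Lp_space: "p \<ge> 1 \<Longrightarrow> mix N e \<in> Lp_space p"
  by (intro borel_Lp_space mix_measurable mix_Lp)

lemma mix_has_weak_deriv:
  assumes "set bs \<subseteq> Basis"
  shows "has_weak_deriv bs (mix N e) (mix N (add_order bs e))"
  unfolding has_weak_deriv_def
proof (intro conjI ballI)
  show "locally_integrable (mix N e)" "locally_integrable (mix N (add_order bs e))"
    by (rule Lp_space_locally_integrable[OF mix_Lp_space[of 1]]; simp)+
  fix \<psi> :: "'a \<Rightarrow> real" assume \<psi>: "\<psi> \<in> test_functions"
  have it: "iter_partial bs \<psi> \<in> test_functions" by (rule test_functions_iter_partial[OF \<psi> assms])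
  note [measurable] = test_function_borel[OF \<psi>] test_function_borel[OF it]
  have "(\<integral>x. mix N e x * iter_partial bs \<psi> x \<partial>lebesgue) = (\<integral>x. mix N e x * iter_partial bs \<psi> x \<partial>lborel)"
    by (rule integral_completion) measurable
  moreover have "(\<integral>x. mix N (add_order bs e) x * \<psi> x \<partial>lebesgue) = (\<integral>x. mix N (add_order bs e) x * \<psi> x \<partial>lborel)"
    by (rule integral_completion) measurable
  ultimately show "(\<integral>x. mix N e x * iter_partial bs \<psi> x \<partial>lebesgue) =
      (-1) ^ length bs * (\<integral>x. mix N (add_order bs e) x * \<psi> x \<partial>lebesgue)"
    using mix_by_parts[OF \<psi> assms] by simp
qed

lemma mix_sobolev: "p \<ge> 1 \<Longrightarrow> mix N e \<in> sobolev_space k p"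
  unfolding sobolev_space_def using mix_Lp_space mix_has_weak_deriv by blast

end

lemma has_weak_deriv_AE_cong:
  assumes d: "has_weak_deriv bs u v" and ae: "AE x in lebesgue. u x = u' x" and u': "locally_integrable u'"
    and bs: "set bs \<subseteq> Basis"
  shows "has_weak_deriv bs u' v"
  unfolding has_weak_deriv_def
proof (intro conjI ballI u')
  show "locally_integrable v" using d by (simp add: has_weak_deriv_def)
  fix \<psi> :: "'a \<Rightarrow> real" assume \<psi>: "\<psi> \<in> test_functions"
  have it: "iter_partial bs \<psi> \<in> test_functions" by (rule test_functions_iter_partial[OF \<psi> bs])
  have "(\<integral>x. u' x * iter_partial bs \<psi> x \<partial>lebesgue) = (\<integral>x. u x * iter_partial bs \<psi> x \<partial>lebesgue)"
  proof (rule integral_cong_AE)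
    show "(\<lambda>x. u' x * iter_partial bs \<psi> x) \<in> borel_measurable lebesgue"
      by (rule borel_measurable_integrable[OF locally_integrable_test[OF u' it]])
    show "(\<lambda>x. u x * iter_partial bs \<psi> x) \<in> borel_measurable lebesgue"
      by (rule borel_measurable_integrable[OF locally_integrable_test[OF _ it]]) (use d in \<open>simp add: has_weak_deriv_def\<close>)
    show "AE x in lebesgue. u' x * iter_partial bs \<psi> x = u x * iter_partial bs \<psi> x"
      using ae by eventually_elim simp
  qed
  then show "(\<integral>x. u' x * iter_partial bs \<psi> x \<partial>lebesgue) = (-1) ^ length bs * (\<integral>x. v x * \<psi> x \<partial>lebesgue)"
    using d \<psi> by (simp add: has_weak_deriv_def)
qed

text \<open>\<open>weak_laplacian\<close> uses some choice of weak derivatives, so the lower rung is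
  reached only almost everywhere. The hypothesis on h is an almost everywhere equality as well,
  which allows iteration.\<close>

lemma neg_laplacian_mix_ladder:
  fixes F :: "'a::euclidean_space measure"
  assumes \<epsilon>: "\<epsilon> > 0" and F: "finite_measure F" "sets F = sets borel" and p: "p \<ge> 1"
    and h: "h \<in> Lp_space p" "AE x in lebesgue. h x = mix (ladder \<epsilon> (Suc k) \<Otimes>\<^sub>M F) (\<lambda>_. 0) x"
  shows "neg_laplacian_plus_id h \<in> Lp_space p"
    "AE x in lebesgue. neg_laplacian_plus_id h x = mix (ladder \<epsilon> k \<Otimes>\<^sub>M F) (\<lambda>_. 0) x"
proof -
  let ?N = "\<lambda>k. ladder \<epsilon> k \<Otimes>\<^sub>M F"
  interpret S: heat_mixture "?N (Suc k)" \<epsilon> by (rule heat_mixture_ladder[OF \<epsilon> F])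
  interpret K: heat_mixture "?N k" \<epsilon> by (rule heat_mixture_ladder[OF \<epsilon> F])
  have hl: "locally_integrable h" by (rule Lp_space_locally_integrable[OF h(1) p])
  have w: "has_weak_deriv [b, b] h (mix (?N (Suc k)) ((\<lambda>_. 0)(b := 2)))" if b: "b \<in> Basis" for b
  proof -
    have "AE x in lebesgue. mix (?N (Suc k)) (\<lambda>_. 0) x = h x" using h(2) by eventually_elim simp
    moreover have "has_weak_deriv [b, b] (mix (?N (Suc k)) (\<lambda>_. 0)) (mix (?N (Suc k)) (add_order [b, b] (\<lambda>_. 0)))"
      by (rule S.mix_has_weak_deriv) (use b in auto)
    moreover have "add_order [b, b] (\<lambda>_. 0) = (\<lambda>_. 0)(b := 2)" by (auto simp: fun_eq_iff)
    ultimately show ?thesis using has_weak_deriv_AE_cong[OF _ _ hl, of "[b, b]"] b by auto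
  qed
  have wd: "has_weak_deriv [b, b] h (weak_deriv [b, b] h)" if "b \<in> Basis" for b
    unfolding weak_deriv_def by (rule someI[of "has_weak_deriv [b, b] h", OF w[OF that]])
  have "AE x in lebesgue. \<forall>b\<in>Basis. weak_deriv [b, b] h x = mix (?N (Suc k)) ((\<lambda>_. 0)(b := 2)) x"
    using weak_deriv_unique[OF wd w] by (intro AE_finite_allI) auto
  then show ae: "AE x in lebesgue. neg_laplacian_plus_id h x = mix (?N k) (\<lambda>_. 0) x"
    using h(2)
  proof eventually_elim
    case (elim x)
    have "(\<Sum>b\<in>Basis. weak_deriv [b, b] h x) = (\<Sum>b\<in>Basis. mix (?N (Suc k)) ((\<lambda>_. 0)(b := 2)) x)"
      by (rule sum.cong) (use elim in auto)
    then show ?case using mix_ladder_step[OF \<epsilon> F, of k x] elim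
      by (simp add: neg_laplacian_plus_id_def weak_laplacian_def del: ladder.simps)
  qed
  have [measurable]: "weak_deriv [b, b] h \<in> borel_measurable lebesgue" if "b \<in> Basis" for b
    using wd[OF that] by (auto simp: has_weak_deriv_def intro: locally_integrable_measurable)
  note [measurable] = locally_integrable_measurable[OF hl]
  have "(\<lambda>x. - (\<Sum>b\<in>Basis. weak_deriv [b, b] h x) + h x) \<in> borel_measurable lebesgue" by measurable
  then have "neg_laplacian_plus_id h \<in> borel_measurable lebesgue"
    by (simp add: neg_laplacian_plus_id_def[abs_def] weak_laplacian_def)
  moreover have "AE x in lebesgue. mix (?N k) (\<lambda>_. 0) x = neg_laplacian_plus_id h x" using ae by eventually_elim simp
  ultimately show "neg_laplacian_plus_id h \<in> Lp_space p"
    using Lp_space_AE_cong[OF K.mix_Lp_space[OF p]] by blast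
qed

lemma neg_laplacian_iterate_mix_ladder:
  fixes F :: "'a::euclidean_space measure"
  assumes \<epsilon>: "\<epsilon> > 0" and F: "finite_measure F" "sets F = sets borel" and p: "p \<ge> 1" and i: "i \<le> k"
  shows "(neg_laplacian_plus_id ^^ i) (mix (ladder \<epsilon> k \<Otimes>\<^sub>M F) (\<lambda>_. 0)) \<in> Lp_space p \<and>
    (AE x in lebesgue. (neg_laplacian_plus_id ^^ i) (mix (ladder \<epsilon> k \<Otimes>\<^sub>M F) (\<lambda>_. 0)) x = mix (ladder \<epsilon> (k - i) \<Otimes>\<^sub>M F) (\<lambda>_. 0) x)"
  using i
proof (induction i)
  case 0
  interpret heat_mixture "ladder \<epsilon> k \<Otimes>\<^sub>M F" \<epsilon> by (rule heat_mixture_ladder[OF \<epsilon> F])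
  show ?case using mix_Lp_space[OF p] by simp
next
  case (Suc i)
  have "k - i = Suc (k - Suc i)" using Suc.prems by simp
  then show ?case
    using Suc neg_laplacian_mix_ladder[OF \<epsilon> F p, of "(neg_laplacian_plus_id ^^ i) (mix (ladder \<epsilon> k \<Otimes>\<^sub>M F) (\<lambda>_. 0))" "k - Suc i"]
    by (simp del: ladder.simps)
qed

lemma mix_ladder_0:
  fixes f :: "'a::euclidean_space \<Rightarrow> real"
  assumes \<epsilon>: "\<epsilon> > 0" and f [measurable]: "f \<in> borel_measurable borel" and f0: "\<And>y. f y \<ge> 0"
    and F: "finite_measure (density lborel f)"
  shows "ennreal (mix (ladder \<epsilon> 0 \<Otimes>\<^sub>M density lborel f) (\<lambda>_. 0) x) = (\<integral>\<^sup>+y. ennreal (f y * heat \<epsilon> (x - y)) \<partial>lborel)"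
    "0 \<le> mix (ladder \<epsilon> 0 \<Otimes>\<^sub>M density lborel f) (\<lambda>_. 0) x"
proof -
  interpret F: finite_measure "density lborel (\<lambda>x. ennreal (f x))" by fact
  have mx: "mix (ladder \<epsilon> 0 \<Otimes>\<^sub>M density lborel f) (\<lambda>_. 0) x = (\<integral>y. heat \<epsilon> (x - y) \<partial>density lborel f)"
    by (subst mix_ladder[OF \<epsilon> F]) (simp, simp add: integral_return)
  show "0 \<le> mix (ladder \<epsilon> 0 \<Otimes>\<^sub>M density lborel f) (\<lambda>_. 0) x"
    unfolding mx by (intro Bochner_Integration.integral_nonneg less_imp_le heat_pos \<epsilon>)
  have "integrable (density lborel f) (\<lambda>y. heat \<epsilon> (x - y))"
    by (rule F.integrable_const_bound[where B = "(4 * pi * \<epsilon>) powr (- real DIM('a) / 2)"])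
      (use heat_le[OF \<epsilon>, where 'a = 'a] heat_pos[OF \<epsilon>, where 'a = 'a] in \<open>auto simp: abs_of_pos\<close>)
  then have "ennreal (\<integral>y. heat \<epsilon> (x - y) \<partial>density lborel f) = (\<integral>\<^sup>+y. ennreal (heat \<epsilon> (x - y)) \<partial>density lborel f)"
    by (intro nn_integral_eq_integral[symmetric]) (auto intro!: AE_I2 less_imp_le heat_pos \<epsilon>)
  also have "\<dots> = (\<integral>\<^sup>+y. ennreal (f y) * ennreal (heat \<epsilon> (x - y)) \<partial>lborel)"
    by (rule nn_integral_density) measurable
  also have "\<dots> = (\<integral>\<^sup>+y. ennreal (f y * heat \<epsilon> (x - y)) \<partial>lborel)"
    by (simp add: f0 ennreal_mult')
  finally show "ennreal (mix (ladder \<epsilon> 0 \<Otimes>\<^sub>M density lborel f) (\<lambda>_. 0) x) = (\<integral>\<^sup>+y. ennreal (f y * heat \<epsilon> (x - y)) \<partial>lborel)"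
    unfolding mx .
qed

text \<open>The heat kernel is a probability density: Jensen's inequality for each x, then
  Fubini.\<close>

lemma heat_average_Lp_le:
  fixes f :: "'a::euclidean_space \<Rightarrow> real"
  assumes \<epsilon>: "\<epsilon> > 0" and f [measurable]: "f \<in> borel_measurable borel" and f0: "\<And>y. f y \<ge> 0"
    and F: "finite_measure (density lborel f)" and p: "p \<ge> 1"
  shows "(\<integral>\<^sup>+x. ennreal (\<bar>mix (ladder \<epsilon> 0 \<Otimes>\<^sub>M density lborel f) (\<lambda>_. 0) x\<bar> powr p) \<partial>lborel) \<le> (\<integral>\<^sup>+y. ennreal (f y powr p) \<partial>lborel)"
proof -
  let ?u = "mix (ladder \<epsilon> 0 \<Otimes>\<^sub>M density lborel f) (\<lambda>_. 0)"
  note u = mix_ladder_0[OF \<epsilon> f f0 F]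
  have J: "ennreal (\<bar>?u x\<bar> powr p) \<le> (\<integral>\<^sup>+y. ennreal (heat \<epsilon> (x - y)) * ennreal (f y powr p) \<partial>lborel)" for x
  proof -
    let ?K = "density lborel (\<lambda>y. ennreal (heat \<epsilon> (x - y)))"
    have "emeasure ?K UNIV = (\<integral>\<^sup>+y. ennreal (heat \<epsilon> (x - y)) \<partial>lborel)"
      by (simp add: emeasure_density)
    also have "\<dots> = 1"
      using nn_integral_lborel_reflect[of "\<lambda>y. ennreal (heat \<epsilon> y)" x] nn_integral_heat[OF \<epsilon>, where 'a = 'a] by simp
    finally interpret K: prob_space ?K by (intro prob_spaceI) simp
    have "(\<integral>\<^sup>+y. ennreal (f y) \<partial>?K) = (\<integral>\<^sup>+y. ennreal (heat \<epsilon> (x - y)) * ennreal (f y) \<partial>lborel)"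
      by (rule nn_integral_density) measurable
    also have "\<dots> = ennreal (?u x)"
      unfolding u(1) using heat_pos[OF \<epsilon>] by (simp add: f0 less_imp_le mult.commute flip: ennreal_mult')
    finally have "ennreal (?u x powr p) \<le> (\<integral>\<^sup>+y. ennreal (f y powr p) \<partial>?K)"
      by (intro K.nn_integral_powr_Jensen u(2) p f0) auto
    also have "\<dots> = (\<integral>\<^sup>+y. ennreal (heat \<epsilon> (x - y)) * ennreal (f y powr p) \<partial>lborel)"
      by (rule nn_integral_density) measurable
    finally show ?thesis using u(2)[of x] by simp
  qed
  have "(\<integral>\<^sup>+x. ennreal (\<bar>?u x\<bar> powr p) \<partial>lborel) \<le>
      (\<integral>\<^sup>+x. \<integral>\<^sup>+y. ennreal (heat \<epsilon> (x - y)) * ennreal (f y powr p) \<partial>lborel \<partial>lborel)"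
    by (intro nn_integral_mono J)
  also have "\<dots> = (\<integral>\<^sup>+y. \<integral>\<^sup>+x. ennreal (heat \<epsilon> (x - y)) * ennreal (f y powr p) \<partial>lborel \<partial>lborel)"
    by (rule lborel_pair.Fubini') measurable
  also have "\<dots> = (\<integral>\<^sup>+y. ennreal (f y powr p) \<partial>lborel)"
  proof (intro nn_integral_cong)
    fix y :: 'a
    have "(\<integral>\<^sup>+x. ennreal (heat \<epsilon> (x - y)) * ennreal (f y powr p) \<partial>lborel) = (\<integral>\<^sup>+x. ennreal (heat \<epsilon> (x - y)) \<partial>lborel) * ennreal (f y powr p)"
      by (rule nn_integral_multc) measurable
    also have "(\<integral>\<^sup>+x. ennreal (heat \<epsilon> (x - y)) \<partial>lborel) = 1"
      using nn_integral_lborel_translate[of "\<lambda>x. ennreal (heat \<epsilon> x)" y] nn_integral_heat[OF \<epsilon>, where 'a = 'a] by simp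
    finally show "(\<integral>\<^sup>+x. ennreal (heat \<epsilon> (x - y)) * ennreal (f y powr p) \<partial>lborel) = ennreal (f y powr p)" by simp
  qed
  finally show ?thesis .
qed

text \<open>After m / 2 applications of the operator the bottom of the ladder is reached, and the
  heat average of f has p-norm at most that of f.\<close>

lemma mix_ladder_admissible:
  fixes f :: "real ^ 'n \<Rightarrow> real"
  assumes \<epsilon>: "\<epsilon> > 0" and f: "f \<in> borel_measurable borel" "\<And>y. f y \<ge> 0"
    and F: "finite_measure (density lborel f)" and m: "m = 2 * Suc j" "m < CARD('n)"
    and fp: "(\<integral>\<^sup>+y. ennreal (f y powr (real CARD('n) / real m)) \<partial>lborel) \<le> 1"
  shows "mix (ladder \<epsilon> (Suc j) \<Otimes>\<^sub>M density lborel f) (\<lambda>_. 0) \<in> admissible m"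
proof -
  define p where "p = real CARD('n) / real m"
  have p: "p \<ge> 1" using m by (simp add: p_def)
  let ?F = "density lborel (\<lambda>x. ennreal (f x))"
  have sF: "sets ?F = sets borel" by simp
  let ?u = "mix (ladder \<epsilon> (Suc j) \<Otimes>\<^sub>M ?F) (\<lambda>_. 0)" and ?U = "mix (ladder \<epsilon> 0 \<Otimes>\<^sub>M ?F) (\<lambda>_. 0)"
  interpret S: heat_mixture "ladder \<epsilon> (Suc j) \<Otimes>\<^sub>M ?F" \<epsilon> by (rule heat_mixture_ladder[OF \<epsilon> F sF])
  interpret Z: heat_mixture "ladder \<epsilon> 0 \<Otimes>\<^sub>M ?F" \<epsilon> by (rule heat_mixture_ladder[OF \<epsilon> F sF])
  have h: "(neg_laplacian_plus_id ^^ Suc j) ?u \<in> Lp_space p"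
    "AE x in lebesgue. (neg_laplacian_plus_id ^^ Suc j) ?u x = ?U x"
    using neg_laplacian_iterate_mix_ladder[OF \<epsilon> F sF p, of "Suc j" "Suc j"] by (simp_all del: ladder.simps funpow.simps)
  have U: "?U \<in> Lp_space p" by (rule Z.mix_Lp_space[OF p])
  have "(\<integral>x. \<bar>(neg_laplacian_plus_id ^^ Suc j) ?u x\<bar> powr p \<partial>lebesgue) = (\<integral>x. \<bar>?U x\<bar> powr p \<partial>lebesgue)"
  proof (rule integral_cong_AE)
    have "(neg_laplacian_plus_id ^^ Suc j) ?u \<in> borel_measurable lebesgue" "?U \<in> borel_measurable lebesgue"
      using h(1) U by (auto simp: Lp_space_def)
    then show "(\<lambda>x. \<bar>(neg_laplacian_plus_id ^^ Suc j) ?u x\<bar> powr p) \<in> borel_measurable lebesgue"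
      "(\<lambda>x. \<bar>?U x\<bar> powr p) \<in> borel_measurable lebesgue" by measurable
    show "AE x in lebesgue. \<bar>(neg_laplacian_plus_id ^^ Suc j) ?u x\<bar> powr p = \<bar>?U x\<bar> powr p"
      using h(2) by eventually_elim (simp only:)
  qed
  also have "\<dots> = (\<integral>x. \<bar>?U x\<bar> powr p \<partial>lborel)" by (rule integral_completion) measurable
  also have "\<dots> \<le> 1"
  proof -
    have "ennreal (\<integral>x. \<bar>?U x\<bar> powr p \<partial>lborel) = (\<integral>\<^sup>+x. ennreal (\<bar>?U x\<bar> powr p) \<partial>lborel)"
      by (rule nn_integral_eq_integral[OF Z.mix_Lp[OF p], symmetric]) simp
    also have "\<dots> \<le> ennreal 1"
      using heat_average_Lp_le[OF \<epsilon> f F p] fp unfolding p_def[symmetric] by simp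
    finally show ?thesis by simp
  qed
  finally have le: "(\<integral>x. \<bar>(neg_laplacian_plus_id ^^ Suc j) ?u x\<bar> powr p \<partial>lebesgue) \<le> 1" .
  have "Lp_norm p ((neg_laplacian_plus_id ^^ Suc j) ?u) \<le> 1"
    unfolding Lp_norm_def by (rule powr_le1) (use p le in \<open>simp_all del: ladder.simps funpow.simps\<close>)
  moreover have "m div 2 = Suc j" using m(1) by simp
  ultimately show ?thesis
    unfolding admissible_def p_def[symmetric] using S.mix_sobolev[OF p] by (simp del: ladder.simps funpow.simps)
qed

lemma besseleps_measurable [measurable]: "besseleps \<epsilon> j \<in> borel_measurable borel"
  unfolding besseleps_eq[abs_def] by measurable

lemma besseleps_le:
  assumes "\<epsilon> > 0"
  shows "0 \<le> besseleps \<epsilon> j (z :: 'a::euclidean_space)" "besseleps \<epsilon> j z \<le> (4 * pi * \<epsilon>) powr (- real DIM('a) / 2)"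
proof -
  interpret L: prob_space "ladder \<epsilon> (Suc j)" by (rule prob_space_ladder)
  let ?B = "(4 * pi * \<epsilon>) powr (- real DIM('a) / 2)"
  have b: "0 \<le> heat s z \<and> heat s z \<le> ?B" if "\<epsilon> \<le> s" for s
  proof -
    have "heat s z \<le> (4 * pi * s) powr (- real DIM('a) / 2)" using that assms by (intro heat_le) auto
    also have "\<dots> \<le> ?B" using that assms by (intro powr_mono2') auto
    finally show ?thesis using heat_pos[of s z] that assms by simp
  qed
  have ae: "AE s in ladder \<epsilon> (Suc j). 0 \<le> heat s z \<and> heat s z \<le> ?B"
    using ladder_ge[of \<epsilon> "Suc j"] by (rule eventually_mono) (rule b)
  show "0 \<le> besseleps \<epsilon> j z" unfolding besseleps_def
    by (rule integral_nonneg_AE) (use ae in eventually_elim, simp)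
  have m: "(\<lambda>s. heat s z) \<in> borel_measurable (ladder \<epsilon> (Suc j))" by (simp add: measurable_cong_sets[OF sets_ladder refl])
  have "integrable (ladder \<epsilon> (Suc j)) (\<lambda>s. heat s z)"
    by (rule L.integrable_const_bound[OF _ m, where B = ?B]) (use ae in eventually_elim, simp)
  then show "besseleps \<epsilon> j z \<le> ?B" unfolding besseleps_def
    by (rule L.integral_le_const) (use ae in eventually_elim, simp)
qed

lemma mix_ladder_Suc:
  fixes f :: "'a::euclidean_space \<Rightarrow> real"
  assumes \<epsilon>: "\<epsilon> > 0" and f [measurable]: "f \<in> borel_measurable borel" and f0: "\<And>y. f y \<ge> 0"
    and F: "finite_measure (density lborel f)"
  shows "mix (ladder \<epsilon> (Suc j) \<Otimes>\<^sub>M density lborel f) (\<lambda>_. 0) x = (\<integral>y. f y * besseleps \<epsilon> j (x - y) \<partial>lborel)"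
    "integrable lborel (\<lambda>y. f y * besseleps \<epsilon> j (x - y))"
proof -
  interpret F: finite_measure "density lborel (\<lambda>x. ennreal (f x))" by fact
  have "integrable (density lborel f) (\<lambda>y. besseleps \<epsilon> j (x - y))"
    by (rule F.integrable_const_bound[where B = "(4 * pi * \<epsilon>) powr (- real DIM('a) / 2)"])
      (use besseleps_le[OF \<epsilon>, where 'a = 'a] in auto)
  then show "integrable lborel (\<lambda>y. f y * besseleps \<epsilon> j (x - y))"
    by (subst (asm) integrable_density) (auto simp: f0)
  have "mix (ladder \<epsilon> (Suc j) \<Otimes>\<^sub>M density lborel f) (\<lambda>_. 0) x = (\<integral>y. besseleps \<epsilon> j (x - y) \<partial>density lborel f)"
    by (subst mix_ladder[OF \<epsilon> F]) (simp_all add: besseleps_def del: ladder.simps)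
  also have "\<dots> = (\<integral>y. f y * besseleps \<epsilon> j (x - y) \<partial>lborel)"
    by (subst integral_density) (auto simp: f0)
  finally show "mix (ladder \<epsilon> (Suc j) \<Otimes>\<^sub>M density lborel f) (\<lambda>_. 0) x = (\<integral>y. f y * besseleps \<epsilon> j (x - y) \<partial>lborel)" .
qed

text \<open>The truncated Riesz extremal: the Bessel potential of \<open>c * norm y powr (- m)\<close> on an annulus is
  almost constant inside the annulus. Smoothing it by the heat flow for a time \<open>\<epsilon>\<close> much smaller than
  the square of the inner radius makes it a Sobolev function without increasing the norm.\<close>

lemma moser_function:
  fixes \<eta> a L :: real
  assumes m: "m = 2 * Suc j" "m < CARD('n)" and \<eta>: "0 < \<eta>" "\<eta> < 1" and a: "a > 0" and L: "L > 0"
    and low: "\<And>z \<epsilon>. (z :: real ^ 'n) \<noteq> 0 \<Longrightarrow> \<epsilon> > 0 \<Longrightarrow> (norm z)\<^sup>2 \<le> a \<Longrightarrow> \<epsilon> \<le> a * (norm z)\<^sup>2 \<Longrightarrow>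
      (1 - \<eta>) * (riesz_const CARD('n) m * norm z powr (real m - real CARD('n))) \<le> besseleps \<epsilon> j z"
  defines "n \<equiv> real CARD('n)"
  obtains u :: "real ^ 'n \<Rightarrow> real" where "u \<in> admissible m"
    "\<And>x. norm x < \<eta> * (sqrt a / 2 * exp (- L)) \<Longrightarrow>
      (1 - \<eta>) * (1 + \<eta>) powr (real m - n) * riesz_const CARD('n) m * (n * unit_ball_vol n * L) powr ((n - real m) / n) \<le> u x"
proof -
  let ?\<gamma> = "riesz_const CARD('n) m"
  have mn: "0 < m" "0 < n" "real m < n" using m by (auto simp: n_def)
  have \<gamma>: "?\<gamma> > 0" using m by (intro riesz_const_pos) auto
  define V where "V = unit_ball_vol n"
  have V: "V > 0" using mn by (simp add: V_def)
  \<comment> \<open>Distances between the small ball and the annulus then stay below 2 * \<delta> =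
    sqrt a, the range of the lower bound for the kernel.\<close>
  define \<delta> where "\<delta> = sqrt a / 2"
  have \<delta>: "\<delta> > 0" using a by (simp add: \<delta>_def)
  define r where "r = \<delta> * exp (- L)"
  have r: "0 < r" "r < \<delta>" using \<delta> L by (auto simp: r_def)
  have "\<delta> / r = exp L" using \<delta> by (simp add: r_def exp_minus inverse_eq_divide)
  then have lnr: "ln (\<delta> / r) = L" by simp
  define p where "p = n / real m"
  have p: "p \<ge> 1" using mn by (simp add: p_def)
  \<comment> \<open>Normalises the p-norm of \<open>f\<close> to 1: the p-th power of norm y powr (-
    m) is norm y powr (- n), with integral n * V * L over the annulus.\<close>
  define c where "c = (n * V * L) powr (- 1 / p)"
  have c: "c > 0" using mn V L by (simp add: c_def)
  define A where "A = {y :: real ^ 'n. r \<le> norm y \<and> norm y < \<delta>}"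
  have Am [measurable]: "A \<in> sets borel" unfolding A_def by measurable
  define f where "f y = c * norm y powr (- real m) * indicator A y" for y :: "real ^ 'n"
  have fm [measurable]: "f \<in> borel_measurable borel" unfolding f_def[abs_def] by measurable
  have f0: "f y \<ge> 0" for y using c by (simp add: f_def)
  have ann: "(\<integral>\<^sup>+y. ennreal (norm (y :: real ^ 'n) powr (- n)) * indicator A y \<partial>lborel) = ennreal (n * V * L)"
    using nn_integral_norm_annulus[of r \<delta>, where 'a = "real ^ 'n"] r by (simp add: A_def n_def V_def lnr)
  have fp: "ennreal (f y powr p) = ennreal (c powr p) * (ennreal (norm y powr (- n)) * indicator A y)" for y
  proof (cases "y \<in> A")
    case True
    then have "norm y > 0" using r by (auto simp: A_def)
    then have "f y powr p = c powr p * norm y powr (- n)"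
      using True c mn by (simp add: f_def powr_mult powr_powr p_def)
    then show ?thesis using True c by (simp add: ennreal_mult)
  qed (simp add: f_def)
  have cp: "c powr p = 1 / (n * V * L)"
    unfolding c_def powr_powr using p mn V L by (simp add: powr_minus_divide)
  have "(\<integral>\<^sup>+y. ennreal (f y powr p) \<partial>lborel) = ennreal (c powr p) * ennreal (n * V * L)"
    unfolding fp by (subst nn_integral_cmult) (simp_all add: ann)
  also have "\<dots> = 1" using mn V L by (simp add: cp flip: ennreal_mult)
  finally have fp1: "(\<integral>\<^sup>+y. ennreal (f y powr p) \<partial>lborel) = 1" .
  have F: "finite_measure (density lborel f)"
  proof
    have "f y \<le> indicator (ball 0 \<delta>) y + f y powr p" for y
      using abs_le_one_plus_powr[OF p, of "f y"] f0[of y] by (cases "y \<in> A") (auto simp: A_def f_def)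
    then have "(\<integral>\<^sup>+y. ennreal (f y) \<partial>lborel) \<le> (\<integral>\<^sup>+y. indicator (ball 0 \<delta>) y + ennreal (f y powr p) \<partial>lborel)"
      by (intro nn_integral_mono) (auto simp: ennreal_leI ennreal_indicator[symmetric] simp flip: ennreal_plus)
    also have "\<dots> = emeasure lborel (ball (0 :: real ^ 'n) \<delta>) + 1"
      by (subst nn_integral_add) (auto simp: fp1 intro!: borel_measurable_indicator)
    also have "\<dots> < \<infinity>" using emeasure_bounded_finite[of "ball (0 :: real ^ 'n) \<delta>"] by simp
    finally show "emeasure (density lborel f) (space (density lborel f)) \<noteq> \<infinity>"
      by (simp add: emeasure_density)
  qed
  \<comment> \<open>Points of the annulus have distance at least (1 - \<eta>) * r from the small
    ball, so this time satisfies \<epsilon> <= a * norm (x - y) ^ 2 throughout.\<close>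
  define \<epsilon> where "\<epsilon> = a * ((1 - \<eta>) * r)\<^sup>2"
  have \<epsilon>: "\<epsilon> > 0" using a \<eta> r by (simp add: \<epsilon>_def)
  \<comment> \<open>The loss from the kernel bound and from replacing norm (x - y) by (1 + \<eta>) *
    norm y; it tends to 1 as \<eta> tends to 0.\<close>
  define \<tau> where "\<tau> = (1 - \<eta>) * (1 + \<eta>) powr (real m - n)"
  have \<tau>: "\<tau> > 0" using \<eta> by (simp add: \<tau>_def)
  show thesis
  proof (rule that)
    show "mix (ladder \<epsilon> (Suc j) \<Otimes>\<^sub>M density lborel f) (\<lambda>_. 0) \<in> admissible m"
      by (rule mix_ladder_admissible[OF \<epsilon> fm f0 F m]) (use fp1 in \<open>simp add: p_def n_def\<close>)
    fix x :: "real ^ 'n" assume x: "norm x < \<eta> * (sqrt a / 2 * exp (- L))"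
    then have x: "norm x < \<eta> * r" by (simp add: r_def \<delta>_def)
    have pt: "c * \<tau> * ?\<gamma> * (norm y powr (- n) * indicator A y) \<le> f y * besseleps \<epsilon> j (x - y)" for y
    proof (cases "y \<in> A")
      case True
      then have y: "r \<le> norm y" "norm y < \<delta>" by (auto simp: A_def)
      have "norm y - norm x \<le> norm (x - y)" using norm_triangle_ineq2[of y x] by (simp add: norm_minus_commute)
      then have z1: "(1 - \<eta>) * r \<le> norm (x - y)" using x y by (simp add: algebra_simps)
      have "\<eta> * r \<le> \<eta> * norm y" using y \<eta> by (intro mult_left_mono) auto
      then have z2: "norm (x - y) \<le> (1 + \<eta>) * norm y"
        using norm_triangle_ineq4[of x y] x by (simp add: algebra_simps)
      have "(1 - \<eta>) * r > 0" using \<eta> r by simp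
      then have z0: "norm (x - y) > 0" using z1 by linarith
      have "(1 + \<eta>) * norm y \<le> 2 * \<delta>" using \<eta> y by (intro mult_mono) auto
      then have "norm (x - y) \<le> sqrt a" using z2 by (simp add: \<delta>_def)
      then have "(norm (x - y))\<^sup>2 \<le> (sqrt a)\<^sup>2" by (intro power_mono) auto
      then have za: "(norm (x - y))\<^sup>2 \<le> a" using a by simp
      have "((1 - \<eta>) * r)\<^sup>2 \<le> (norm (x - y))\<^sup>2" using z1 \<eta> r by (intro power_mono) auto
      then have ze: "\<epsilon> \<le> a * (norm (x - y))\<^sup>2" unfolding \<epsilon>_def using a by (intro mult_left_mono) auto
      have "((1 + \<eta>) * norm y) powr (real m - n) \<le> norm (x - y) powr (real m - n)"
        using z0 z2 mn by (intro powr_mono2') auto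
      then have "(1 + \<eta>) powr (real m - n) * norm y powr (real m - n) \<le> norm (x - y) powr (real m - n)"
        using \<eta> by (simp add: powr_mult)
      then have "(1 - \<eta>) * (?\<gamma> * ((1 + \<eta>) powr (real m - n) * norm y powr (real m - n))) \<le>
          (1 - \<eta>) * (?\<gamma> * norm (x - y) powr (real m - n))"
        using \<gamma> \<eta> by (intro mult_left_mono) auto
      also have "\<dots> \<le> besseleps \<epsilon> j (x - y)"
        unfolding n_def using z0 by (intro low \<epsilon> za ze) auto
      finally have "\<tau> * ?\<gamma> * norm y powr (real m - n) \<le> besseleps \<epsilon> j (x - y)"
        by (simp add: \<tau>_def mult_ac)
      then have "c * norm y powr (- real m) * (\<tau> * ?\<gamma> * norm y powr (real m - n)) \<le> c * norm y powr (- real m) * besseleps \<epsilon> j (x - y)"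
        using c by (intro mult_left_mono) auto
      moreover have "norm y powr (- real m) * norm y powr (real m - n) = norm y powr (- n)"
        by (simp flip: powr_add)
      moreover have "C * P * (T * G * Q) = C * T * G * (P * Q)" for C P T G Q :: real by simp
      ultimately have "c * \<tau> * ?\<gamma> * norm y powr (- n) \<le> c * norm y powr (- real m) * besseleps \<epsilon> j (x - y)"
        by (simp only:)
      then show ?thesis using True by (simp add: f_def)
    qed (simp add: f_def)
    have "ennreal (c * \<tau> * ?\<gamma> * (n * V * L)) = ennreal (c * \<tau> * ?\<gamma>) * (\<integral>\<^sup>+y. ennreal (norm (y :: real ^ 'n) powr (- n)) * indicator A y \<partial>lborel)"
      unfolding ann using c \<tau> \<gamma> mn V L by (intro ennreal_mult) auto
    also have "\<dots> = (\<integral>\<^sup>+y. ennreal (c * \<tau> * ?\<gamma>) * (ennreal (norm (y :: real ^ 'n) powr (- n)) * indicator A y) \<partial>lborel)"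
      by (rule nn_integral_cmult[symmetric]) measurable
    also have "\<dots> \<le> (\<integral>\<^sup>+y. ennreal (f y * besseleps \<epsilon> j (x - y)) \<partial>lborel)"
    proof (intro nn_integral_mono)
      fix y :: "real ^ 'n"
      have "ennreal (c * \<tau> * ?\<gamma>) * (ennreal (norm y powr (- n)) * indicator A y) = ennreal (c * \<tau> * ?\<gamma> * (norm y powr (- n) * indicator A y))"
        using c \<tau> \<gamma> by (auto simp: ennreal_mult' split: split_indicator)
      also have "\<dots> \<le> ennreal (f y * besseleps \<epsilon> j (x - y))" by (intro ennreal_leI pt)
      finally show "ennreal (c * \<tau> * ?\<gamma>) * (ennreal (norm y powr (- n)) * indicator A y) \<le> ennreal (f y * besseleps \<epsilon> j (x - y))" .
    qed
    also have "\<dots> = ennreal (mix (ladder \<epsilon> (Suc j) \<Otimes>\<^sub>M density lborel f) (\<lambda>_. 0) x)"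
      unfolding mix_ladder_Suc(1)[OF \<epsilon> fm f0 F]
      by (rule nn_integral_eq_integral[OF mix_ladder_Suc(2)[OF \<epsilon> fm f0 F]]) (simp add: f0 besseleps_le[OF \<epsilon>])
    finally have "c * \<tau> * ?\<gamma> * (n * V * L) \<le> mix (ladder \<epsilon> (Suc j) \<Otimes>\<^sub>M density lborel f) (\<lambda>_. 0) x"
      unfolding mix_ladder_Suc(1)[OF \<epsilon> fm f0 F]
      by (rule ennreal_le_iff[THEN iffD1, rotated])
        (intro Bochner_Integration.integral_nonneg mult_nonneg_nonneg f0 besseleps_le[OF \<epsilon>])
    \<comment> \<open>The remaining power of L is 1 - 1/p = (n - m) / n, the reciprocal of the
      exponent in the functional, in which L therefore appears to the first power.\<close>
    moreover have "c * (n * V * L) = (n * V * L) powr ((n - real m) / n)"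
    proof -
      have W: "n * V * L > 0" using mn V L by simp
      have "c * (n * V * L) = (n * V * L) powr (- 1 / p) * (n * V * L) powr 1" unfolding c_def using W by simp
      also have "\<dots> = (n * V * L) powr (- 1 / p + 1)" by (simp only: powr_add)
      also have "- 1 / p + 1 = (n - real m) / n" using mn by (simp add: p_def field_simps)
      finally show ?thesis .
    qed
    moreover have "c * \<tau> * ?\<gamma> * (n * V * L) = \<tau> * ?\<gamma> * (c * (n * V * L))" by simp
    ultimately have "\<tau> * ?\<gamma> * (n * V * L) powr ((n - real m) / n) \<le> mix (ladder \<epsilon> (Suc j) \<Otimes>\<^sub>M density lborel f) (\<lambda>_. 0) x"
      by (simp only:)
    then show "(1 - \<eta>) * (1 + \<eta>) powr (real m - n) * ?\<gamma> * (n * unit_ball_vol n * L) powr ((n - real m) / n) \<le>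
        mix (ladder \<epsilon> (Suc j) \<Otimes>\<^sub>M density lborel f) (\<lambda>_. 0) x"
      by (simp only: \<tau>_def V_def)
  qed
qed

text \<open>On a ball of radius of order exp (- L) the truncated exponential is at least exp
  (\<kappa> \<eta> * L) / 2, while the weight has integral of order exp (- (n - \<alpha>) * L)
  there. Beyond the critical exponent the first rate wins for small \<eta>, and L is
  arbitrary.\<close>

lemma adams_integral_unbounded:
  fixes \<alpha> \<beta> M :: real
  assumes "0 \<le> \<alpha>" "\<alpha> < real CARD('n::finite)" "0 < m" "even m" "m < CARD('n)"
    and \<beta>: "\<beta> > beta_sing \<alpha> CARD('n) m"
  shows "\<exists>u \<in> (admissible m :: (real ^ 'n \<Rightarrow> real) set). adams_integral \<alpha> m \<beta> u \<ge> ennreal M"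
proof -
  let ?\<gamma> = "riesz_const CARD('n) m"
  define n where "n = real CARD('n)"
  obtain k where k: "m = 2 * k" using assms(4) by auto
  with assms(3) obtain j where m: "m = 2 * Suc j" by (cases k) auto
  have mn: "0 < real m" "0 < n" "real m < n" "\<alpha> < n" using assms by (auto simp: n_def)
  have \<gamma>: "?\<gamma> > 0" using assms by (intro riesz_const_pos) auto
  define q where "q = n / (n - real m)"
  have q: "q > 0" using mn by (simp add: q_def)
  define V where "V = unit_ball_vol n"
  have V: "V > 0" using mn by (simp add: V_def)
  have b0: "beta0 CARD('n) m = 1 / (V * ?\<gamma> powr q)"
    using beta0_eq[OF assms(3,5)] by (simp add: V_def n_def q_def)
  have b0p: "beta0 CARD('n) m > 0" unfolding b0 using V \<gamma> by simp
  have bs: "(1 - \<alpha> / n) * beta0 CARD('n) m < \<beta>" using \<beta> by (simp add: beta_sing_def n_def)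
  then have "(1 - \<alpha> / n) < \<beta> / beta0 CARD('n) m" using b0p by (simp add: field_simps)
  then have "(1 - \<alpha> / n) * n < \<beta> / beta0 CARD('n) m * n" using mn by (intro mult_strict_right_mono) auto
  then have s0: "n - \<alpha> < \<beta> / beta0 CARD('n) m * n" using mn by (simp add: left_diff_distrib)
  have "0 \<le> (1 - \<alpha> / n) * beta0 CARD('n) m" using mn b0p by (intro mult_nonneg_nonneg) auto
  then have \<beta>0: "\<beta> > 0" using bs by linarith
  \<comment> \<open>The growth rate: on the small ball \<beta> * |u| powr q will be at least
    \<kappa> \<eta> * L, and \<kappa> tends to n * \<beta> / beta0 as \<eta> tends to 0.\<close>
  define \<kappa> where "\<kappa> \<eta> = \<beta> / beta0 CARD('n) m * ((1 - \<eta>) * (1 + \<eta>) powr (real m - n)) powr q * n" for \<eta> :: real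
  have "(\<kappa> \<longlongrightarrow> \<beta> / beta0 CARD('n) m * ((1 - 0) * (1 + 0) powr (real m - n)) powr q * n) (at_right 0)"
    unfolding \<kappa>_def[abs_def] by (intro tendsto_intros) auto
  then have "(\<kappa> \<longlongrightarrow> \<beta> / beta0 CARD('n) m * n) (at_right 0)" by simp
  from order_tendstoD(1)[OF this s0] have "eventually (\<lambda>\<eta>. n - \<alpha> < \<kappa> \<eta>) (at_right 0)" .
  moreover have "eventually (\<lambda>\<eta>::real. \<eta> \<in> {0<..<1}) (at_right 0)" by (rule eventually_at_right_real) simp
  ultimately have "eventually (\<lambda>\<eta>. n - \<alpha> < \<kappa> \<eta> \<and> \<eta> \<in> {0<..<1}) (at_right 0)" by (rule eventually_conj)
  then obtain \<eta> where \<eta>: "n - \<alpha> < \<kappa> \<eta>" "0 < \<eta>" "\<eta> < 1"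
    using eventually_happens'[OF trivial_limit_at_right_real] by fastforce
  define \<theta> where "\<theta> = \<kappa> \<eta> - (n - \<alpha>)"
  have \<theta>: "\<theta> > 0" using \<eta> by (simp add: \<theta>_def)
  have \<kappa>0: "\<kappa> \<eta> > 0" using \<eta>(1) mn by linarith
  have jn: "2 * Suc j < DIM(real ^ 'n)" using assms(5) m by simp
  obtain a where a: "a > 0" "\<And>z \<epsilon>. (z :: real ^ 'n) \<noteq> 0 \<Longrightarrow> \<epsilon> > 0 \<Longrightarrow> (norm z)\<^sup>2 \<le> a \<Longrightarrow> \<epsilon> \<le> a * (norm z)\<^sup>2 \<Longrightarrow>
      (1 - \<eta>) * (riesz_const DIM(real ^ 'n) (2 * Suc j) * norm z powr (real (2 * Suc j) - real DIM(real ^ 'n))) \<le> besseleps \<epsilon> j z"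
    using besseleps_lower[OF jn \<eta>(2)] by blast
  obtain t0 where t0: "t0 \<ge> 0" "\<And>t. t \<ge> t0 \<Longrightarrow> trunc_exp CARD('n) m t \<ge> exp t / 2"
    using trunc_exp_ge_half[of "CARD('n)" m] by blast
  define \<rho> where "\<rho> = \<eta> * (sqrt a / 2)"
  have \<rho>: "\<rho> > 0" using \<eta> a by (simp add: \<rho>_def)
  define K where "K = n * V / (n - \<alpha>) * \<rho> powr (n - \<alpha>) / 2"
  have K: "K > 0" using mn V \<rho> by (simp add: K_def)
  \<comment> \<open>One summand brings the exponent beyond \<open>t0\<close>, where truncation costs
    at most a factor 2; the other makes K * \<theta> * L at least \<open>M\<close>.\<close>
  define L where "L = 1 + t0 / \<kappa> \<eta> + \<bar>M\<bar> / (K * \<theta>)"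
  have "t0 / \<kappa> \<eta> \<ge> 0" "\<bar>M\<bar> / (K * \<theta>) \<ge> 0" using t0(1) \<kappa>0 K \<theta> by auto
  then have L: "L > 0" "t0 / \<kappa> \<eta> \<le> L" "\<bar>M\<bar> / (K * \<theta>) \<le> L" by (auto simp: L_def)
  have Lt: "t0 \<le> \<kappa> \<eta> * L" using L(2) \<kappa>0 by (simp add: field_simps)
  have LM: "M \<le> K * exp (\<theta> * L)"
  proof -
    have "M \<le> K * (\<theta> * L)" using L(3) K \<theta> by (simp add: field_simps)
    also have "\<theta> * L \<le> exp (\<theta> * L)" using exp_ge_add_one_self[of "\<theta> * L"] by linarith
    then have "K * (\<theta> * L) \<le> K * exp (\<theta> * L)" using K by (intro mult_left_mono) auto
    finally show ?thesis .
  qed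
  obtain u :: "real ^ 'n \<Rightarrow> real" where u: "u \<in> admissible m"
    "\<And>x. norm x < \<eta> * (sqrt a / 2 * exp (- L)) \<Longrightarrow>
      (1 - \<eta>) * (1 + \<eta>) powr (real m - n) * ?\<gamma> * (n * V * L) powr ((n - real m) / n) \<le> u x"
  proof (rule moser_function[OF m assms(5) \<eta>(2,3) a(1) L(1)])
    show "(1 - \<eta>) * (?\<gamma> * norm z powr (real m - real CARD('n))) \<le> besseleps \<epsilon> j z"
      if "z \<noteq> 0" "\<epsilon> > 0" "(norm z)\<^sup>2 \<le> a" "\<epsilon> \<le> a * (norm z)\<^sup>2" for z :: "real ^ 'n" and \<epsilon>
      using a(2)[OF that] by (simp add: m)
  qed (simp add: n_def V_def)
  define R where "R = \<rho> * exp (- L)"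
  have R: "R > 0" using \<rho> by (simp add: R_def)
  have ge: "\<kappa> \<eta> * L \<le> \<beta> * \<bar>u x\<bar> powr q" if "norm x < R" for x
  proof -
    let ?w = "(1 - \<eta>) * (1 + \<eta>) powr (real m - n) * ?\<gamma> * (n * V * L) powr ((n - real m) / n)"
    have w: "?w \<ge> 0" using \<eta> \<gamma> by auto
    have "?w \<le> u x" by (rule u(2)) (use that in \<open>simp add: R_def \<rho>_def\<close>)
    then have "?w powr q \<le> \<bar>u x\<bar> powr q" using w q by (intro powr_mono2) auto
    moreover have "?w powr q = ((1 - \<eta>) * (1 + \<eta>) powr (real m - n)) powr q * ?\<gamma> powr q * ((n * V * L) powr ((n - real m) / n)) powr q"
      using \<eta> \<gamma> by (simp add: powr_mult)
    moreover have "((n * V * L) powr ((n - real m) / n)) powr q = n * V * L"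
      using mn V L by (simp add: powr_powr q_def)
    ultimately have "\<beta> * (((1 - \<eta>) * (1 + \<eta>) powr (real m - n)) powr q * ?\<gamma> powr q * (n * V * L)) \<le> \<beta> * \<bar>u x\<bar> powr q"
      using \<beta>0 by (intro mult_left_mono) auto
    then show ?thesis by (simp add: \<kappa>_def b0 mult_ac)
  qed
  have "ennreal M \<le> ennreal (K * exp (\<theta> * L))" by (rule ennreal_leI[OF LM])
  also have "K * exp (\<theta> * L) = exp (\<kappa> \<eta> * L) / 2 * (n * V / (n - \<alpha>) * R powr (n - \<alpha>))"
  proof -
    have "R powr (n - \<alpha>) = \<rho> powr (n - \<alpha>) * exp (- L) powr (n - \<alpha>)" using \<rho> by (simp add: R_def powr_mult)
    also have "exp (- L) powr (n - \<alpha>) = exp (- L * (n - \<alpha>))" by (simp add: powr_def mult.commute)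
    finally have Rp: "R powr (n - \<alpha>) = \<rho> powr (n - \<alpha>) * exp (- L * (n - \<alpha>))" .
    have "\<theta> * L = \<kappa> \<eta> * L + - L * (n - \<alpha>)" by (simp add: \<theta>_def algebra_simps)
    then have "exp (\<theta> * L) = exp (\<kappa> \<eta> * L) * exp (- L * (n - \<alpha>))" by (simp only: exp_add)
    moreover have "A * P / 2 * (E * F) = E / 2 * (A * (P * F))" for A P E F :: real by simp
    ultimately show ?thesis unfolding Rp K_def by (simp only:)
  qed
  also have "ennreal (exp (\<kappa> \<eta> * L) / 2 * (n * V / (n - \<alpha>) * R powr (n - \<alpha>))) =
      ennreal (exp (\<kappa> \<eta> * L) / 2) * ennreal (n * V / (n - \<alpha>) * R powr (n - \<alpha>))"
    using mn V by (intro ennreal_mult) auto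
  also have "ennreal (n * V / (n - \<alpha>) * R powr (n - \<alpha>)) =
      (\<integral>\<^sup>+x. ennreal (norm (x :: real ^ 'n) powr (- \<alpha>)) * indicator {x. norm x < R} x \<partial>lborel)"
    using nn_integral_norm_powr_ball[of "n - \<alpha>" R, where 'a = "real ^ 'n"] mn R by (simp add: n_def V_def)
  also have "ennreal (exp (\<kappa> \<eta> * L) / 2) * \<dots> =
      (\<integral>\<^sup>+x. ennreal (exp (\<kappa> \<eta> * L) / 2) * (ennreal (norm (x :: real ^ 'n) powr (- \<alpha>)) * indicator {x. norm x < R} x) \<partial>lborel)"
    by (rule nn_integral_cmult[symmetric]) measurable
  also have "\<dots> = (\<integral>\<^sup>+x. ennreal (exp (\<kappa> \<eta> * L) / 2) * (ennreal (norm (x :: real ^ 'n) powr (- \<alpha>)) * indicator {x. norm x < R} x) \<partial>lebesgue)"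
    by (rule nn_integral_completion[symmetric])
  also have "\<dots> \<le> adams_integral \<alpha> m \<beta> u"
    unfolding adams_integral_def
  proof (intro nn_integral_mono)
    fix x :: "real ^ 'n"
    let ?t = "\<beta> * \<bar>u x\<bar> powr (real CARD('n) / (real CARD('n) - real m))"
    show "ennreal (exp (\<kappa> \<eta> * L) / 2) * (ennreal (norm x powr (- \<alpha>)) * indicator {x. norm x < R} x) \<le>
        ennreal (trunc_exp CARD('n) m ?t / norm x powr \<alpha>)"
    proof (cases "norm x < R")
      case True
      have t: "\<kappa> \<eta> * L \<le> ?t" using ge[OF True] by (simp add: q_def n_def)
      have "exp (\<kappa> \<eta> * L) / 2 \<le> exp ?t / 2" using t by simp
      also have "\<dots> \<le> trunc_exp CARD('n) m ?t" using t Lt by (intro t0(2)) linarith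
      finally have "exp (\<kappa> \<eta> * L) / 2 * norm x powr (- \<alpha>) \<le> trunc_exp CARD('n) m ?t * norm x powr (- \<alpha>)"
        by (rule mult_right_mono) simp
      moreover have "T * norm x powr (- \<alpha>) = T / norm x powr \<alpha>" for T by (simp add: powr_minus divide_inverse)
      ultimately have "ennreal (exp (\<kappa> \<eta> * L) / 2 * norm x powr (- \<alpha>)) \<le> ennreal (trunc_exp CARD('n) m ?t / norm x powr \<alpha>)"
        by (intro ennreal_leI) (simp only:)
      moreover have "ennreal (exp (\<kappa> \<eta> * L) / 2 * norm x powr (- \<alpha>)) = ennreal (exp (\<kappa> \<eta> * L) / 2) * ennreal (norm x powr (- \<alpha>))"
        by (intro ennreal_mult) auto
      ultimately show ?thesis using True by simp
    qed simp
  qed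
  finally show ?thesis using u(1) by blast
qed

theorem theorem1p3:
  fixes \<alpha> :: real and m :: nat
  assumes "CARD('n::finite) \<ge> 2"
    and "0 \<le> \<alpha>" and "\<alpha> < real CARD('n)"
    and "0 < m" and "even m" and "m < CARD('n)"
  shows "(\<forall>\<beta>. 0 \<le> \<beta> \<and> \<beta> \<le> beta_sing \<alpha> CARD('n) m \<longrightarrow>
            (SUP u \<in> (admissible m :: (real ^ 'n \<Rightarrow> real) set). adams_integral \<alpha> m \<beta> u) < \<infinity>)
       \<and> (\<forall>\<beta>. \<beta> > beta_sing \<alpha> CARD('n) m \<longrightarrow>
            (SUP u \<in> (admissible m :: (real ^ 'n \<Rightarrow> real) set). adams_integral \<alpha> m \<beta> u) = \<infinity>)"
proof (intro conjI allI impI)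
  fix \<beta> :: real
  assume "0 \<le> \<beta> \<and> \<beta> \<le> beta_sing \<alpha> CARD('n) m"
  then show "(SUP u \<in> (admissible m :: (real ^ 'n \<Rightarrow> real) set). adams_integral \<alpha> m \<beta> u) < \<infinity>"
    using adams_integral_upper[OF assms(2-6)] by blast
next
  fix \<beta> :: real
  assume \<beta>: "\<beta> > beta_sing \<alpha> CARD('n) m"
  let ?S = "SUP u \<in> (admissible m :: (real ^ 'n \<Rightarrow> real) set). adams_integral \<alpha> m \<beta> u"
  have le: "ennreal M \<le> ?S" for M
    using adams_integral_unbounded[OF assms(2-6) \<beta>, of M] by (meson SUP_upper2)
  have "?S \<noteq> ennreal r" if "r \<ge> 0" for r
  proof
    assume "?S = ennreal r"
    then have "ennreal (r + 1) \<le> ennreal r" using le[of "r + 1"] by (simp only:)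
    then show False using that by simp
  qed
  then show "?S = \<infinity>" by (cases ?S) auto
qed

end
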